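(* The graph $\{(r,\tau_{\mathfrak X}(r)) : r\in\mathbb{Q}\cap[0,1]\}$ of the relative geometric twist function $\tau_{\mathfrak X}:\mathbb{Q}\cap[0,1]\to[0,1]$ of the modular torus $\mathfrak X$ is dense in $[0,1]\times[0,1]$.
   Context: The modular torus is the complete finite-area hyperbolic surface $\mathfrak X=\mathbb{H}^2/\Gamma$, where $\Gamma$ is the commutator subgroup of $\mathrm{PSL}(2,\mathbb{Z})$; it is homeomorphic to a once-punctured torus, and $\Gamma$ is free on (the classes of) $\alpha=\begin{pmatrix}2&1\\1&1\end{pmatrix}$ and $\beta=\begin{pmatrix}2&-1\\-1&1\end{pmatrix}$. Identify $H_1(\mathfrak X,\mathbb{Z})\cong\mathbb{Z}^2$ so that $[\alpha]=(1,-1)$ and $[\beta]=(0,1)$. For $\frac pq\in\mathbb{Q}$ in lowest terms with $q>0$, let $\gamma_{p/q}$ be the unique oriented simple closed geodesic on $\mathfrak X$ in the homology class $(q,p)$, and let $\ell_{\mathfrak X}(\gamma_{p/q})$ be its hyperbolic length. Relative geometric twist: the completion of $\mathfrak X\setminus\gamma_{p/q}$ is a pair of pants with two geodesic boundary components and one cusp. From each geodesic boundary component there is exactly one simple orthogeodesic to the cusp; its foot on that component is called the orthogonal projection of the cusp. This gives two points on $\gamma=\gamma_{p/q}$: $A_l$, the projection of the cusp as seen from the left side of $\gamma$, and $A_r$, the projection as seen from the right side. The absolute twist $\mathrm{tw}_{\mathfrak X}(\gamma)\in[0,\ell_{\mathfrak X}(\gamma))$ is the distance travelled from $A_l$ to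 the first arrival at $A_r$ along $\gamma$ in its positive direction (and is $0$ if $A_l=A_r$). The relative twist is $\tau_{\mathfrak X}(p/q)=\mathrm{tw}_{\mathfrak X}(\gamma_{p/q})/\ell_{\mathfrak X}(\gamma_{p/q})$. *)

theory Defs
  imports "HOL-Analysis.Analysis" "HOL-Algebra.Algebra"
begin

section \<open>The commutator subgroup of the modular group\<close>

definition SL2Z :: "(int ^ 2 ^ 2) monoid" where
  "SL2Z = \<lparr>carrier = {A. det A = 1}, mult = (**), one = mat 1\<rparr>"

text \<open>Elements of \<open>PSL2Z\<close> are the cosets \<open>{A, -A}\<close>.\<close>

definition PSL2Z :: "(int ^ 2 ^ 2) set monoid" where
  "PSL2Z = SL2Z Mod {mat 1, - mat 1}"

definition proj_class :: "int ^ 2 ^ 2 \<Rightarrow> (int ^ 2 ^ 2) set" where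
  "proj_class A = {mat 1, - mat 1} #>\<^bsub>SL2Z\<^esub> A"

definition Gam :: "(int ^ 2 ^ 2) set set" where
  "Gam = derived PSL2Z (carrier PSL2Z)"

definition gen_alpha :: "(int ^ 2 ^ 2) set" where
  "gen_alpha = proj_class (vector [vector [2, 1], vector [1, 1]])"

definition gen_beta :: "(int ^ 2 ^ 2) set" where
  "gen_beta = proj_class (vector [vector [2, -1], vector [-1, 1]])"


section \<open>The hyperbolic plane and the modular torus\<close>

definition mob :: "int ^ 2 ^ 2 \<Rightarrow> complex \<Rightarrow> complex" where
  "mob A z = (of_int (A$1$1) * z + of_int (A$1$2)) / (of_int (A$2$1) * z + of_int (A$2$2))"

text \<open>The distance of the upper half-plane model (curvature \<open>-1\<close>).\<close>

definition hyp_dist :: "complex \<Rightarrow> complex \<Rightarrow> real" where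
  "hyp_dist z w = arcosh (1 + (cmod (z - w))\<^sup>2 / (2 * Im z * Im w))"

definition geodesic_line :: "(real \<Rightarrow> complex) \<Rightarrow> bool" where
  "geodesic_line c \<longleftrightarrow>
     (\<forall>t. Im (c t) > 0) \<and> (\<forall>s t. hyp_dist (c s) (c t) = \<bar>s - t\<bar>)"

text \<open>A point of the modular torus is an orbit of \<open>Gam\<close> on the upper half-plane, and
  \<open>to_torus\<close> is the covering projection.  The complete unit speed geodesics of the modular
  torus are the curves \<open>to_torus \<circ> c\<close> with \<open>c\<close> a geodesic line; below, curves on the torus
  are always given by such a lift \<open>c\<close>.\<close>

definition to_torus :: "complex \<Rightarrow> complex set" where
  "to_torus z = {mob A z | A. A \<in> \<Union>Gam}"


section \<open>Simple closed geodesics and their homology classes\<close>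

text \<open>\<open>to_torus \<circ> c\<close>, with period \<open>L\<close>, is an oriented simple closed geodesic.  As the
  parametrization has unit speed and is injective on a period, \<open>L\<close> is its length.\<close>

definition simple_closed_geodesic :: "(real \<Rightarrow> complex) \<Rightarrow> real \<Rightarrow> bool" where
  "simple_closed_geodesic c L \<longleftrightarrow>
     geodesic_line c \<and> L > 0 \<and> (\<forall>t. to_torus (c (t + L)) = to_torus (c t)) \<and>
     inj_on (to_torus \<circ> c) {0..<L}"

text \<open>\<open>Gam\<close> acts freely on the contractible upper half-plane, so it is the fundamental group
  of the modular torus, and the first integral homology group is its abelianization.\<close>

definition H1 :: "(int ^ 2 ^ 2) set set monoid" where
  "H1 = (PSL2Z\<lparr>carrier := Gam\<rparr>) Mod (derived PSL2Z Gam)"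

definition H1_class :: "(int ^ 2 ^ 2) set \<Rightarrow> (int ^ 2 ^ 2) set set" where
  "H1_class h = derived PSL2Z Gam #>\<^bsub>PSL2Z\<^esub> h"

text \<open>The homology class of the loop \<open>to_torus \<circ> c\<close> on \<open>[0, L]\<close> is the class of the deck
  transformation carrying the lift \<open>c t\<close> to \<open>c (t + L)\<close>; \<open>v\<close> is that class under the
  identification with pairs of integers sending alpha to \<open>(1, -1)\<close> and beta to \<open>(0, 1)\<close>.\<close>

definition has_homology :: "(real \<Rightarrow> complex) \<Rightarrow> real \<Rightarrow> int \<times> int \<Rightarrow> bool" where
  "has_homology c L v \<longleftrightarrow>
     (\<exists>h\<in>Gam. (\<exists>A\<in>h. \<forall>t. c (t + L) = mob A (c t)) \<and>
       (\<exists>\<phi>\<in>iso H1 (integer_group \<times>\<times> integer_group).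
          \<phi> (H1_class gen_alpha) = (1, -1) \<and> \<phi> (H1_class gen_beta) = (0, 1) \<and>
          \<phi> (H1_class h) = v))"


section \<open>Orthogonal projections of the cusp and the twist\<close>

text \<open>The lift \<open>r\<close> of a geodesic ends at the cusp if it converges to a fixed point, finite or
  infinite, of a parabolic element of \<open>Gam\<close>.  The fixed point equation is cleared of
  denominators.\<close>

definition ends_at_cusp :: "(real \<Rightarrow> complex) \<Rightarrow> bool" where
  "ends_at_cusp r \<longleftrightarrow>
     (\<exists>A\<in>\<Union>Gam. \<bar>trace A\<bar> = 2 \<and> A \<noteq> mat 1 \<and> A \<noteq> - mat 1 \<and>
        ((A$2$1 = 0 \<and> filterlim r at_infinity at_top) \<or>
         (\<exists>x::real. of_int (A$1$1) * x + of_int (A$1$2) = x * (of_int (A$2$1) * x + of_int (A$2$2)) \<and>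
            (r \<longlongrightarrow> of_real x) at_top)))"

text \<open>\<open>c s\<close> is the foot of a simple orthogeodesic to the cusp in the surface cut along the
  closed geodesic \<open>to_torus \<circ> c\<close>.  The orthogeodesic is the ray \<open>to_torus \<circ> r\<close> on \<open>[0, \<infinity>)\<close>.
  Its initial direction is that of \<open>c\<close> rotated by \<open>u\<close>: it leaves to the left of \<open>c\<close> for
  \<open>u = \<i>\<close> and to the right for \<open>u = - \<i>\<close>.\<close>

definition cusp_foot :: "complex \<Rightarrow> (real \<Rightarrow> complex) \<Rightarrow> real \<Rightarrow> bool" where
  "cusp_foot u c s \<longleftrightarrow>
     (\<exists>r. geodesic_line r \<and> r 0 = c s \<and>
        (\<exists>v. (c has_vector_derivative v) (at s) \<and> (r has_vector_derivative (u * v)) (at 0)) \<and>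
        inj_on (to_torus \<circ> r) {0..} \<and>
        (\<forall>t>0. to_torus (r t) \<notin> range (to_torus \<circ> c)) \<and>
        ends_at_cusp r)"

definition is_twist :: "(real \<Rightarrow> complex) \<Rightarrow> real \<Rightarrow> real \<Rightarrow> bool" where
  "is_twist c L t \<longleftrightarrow>
     (\<exists>sl sr. cusp_foot \<i> c sl \<and> cusp_foot (- \<i>) c sr \<and>
        0 \<le> t \<and> t < L \<and> to_torus (c (sl + t)) = to_torus (c sr))"

text \<open>\<open>quotient_of r\<close> is the pair \<open>(p, q)\<close> with \<open>r = p / q\<close> in lowest terms and \<open>q > 0\<close>.\<close>

definition relative_twist :: "rat \<Rightarrow> real" where
  "relative_twist r = (THE x. \<exists>c L t p q.
     quotient_of r = (p, q) \<and> simple_closed_geodesic c L \<and> has_homology c L (q, p) \<and>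
     is_twist c L t \<and> x = t / L)"

end

theory Submission imports Defs
begin

text \<open>Why the theorem holds.  Write \<open>n = p + q\<close>, and let \<open>a\<close> be alpha and \<open>b\<close> the inverse of beta; both are
  positive symmetric matrices.  After a translation by 2, which normalizes the commutator subgroup and so acts
  on the torus, the simple closed geodesic of slope \<open>p / q\<close> is coded by the cyclic word in \<open>a\<close>
  and \<open>b\<close> that the rotation \<open>r \<mapsto> r + p\<close> of the integers modulo \<open>n\<close> produces: the letter is \<open>b\<close> at the
  residues below \<open>q\<close> and \<open>a\<close> at the others.  The residues are the ranks of the rotated words in the order
  of their attracting fixed points, and the repelling fixed points have the opposite order.  So the geodesics
  of the rotated words are nested; hence no two lifts cross and the geodesic is simple
  (\<open>rank_unlinked\<close>, \<open>translates_unlinked\<close>, \<open>c0_simple_closed\<close>).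

  Conversely, let a simple closed geodesic be given by a shortest word of its conjugacy class.  The intervals
  below the lifts cannot cover the real line, as none of them contains the right end of a widest one (\<open>uncovered\<close>).  So
  they avoid a corner of the tiling by ideal quadrilaterals (\<open>missing_corner\<close>), which leaves two letters,
  and the homology class tells that these are \<open>a\<close> and \<open>b\<close> (\<open>positive_word\<close>).  Now the ranks
  move by the rotation, and the word is the standard one (\<open>standard_word\<close>, \<open>standard_geodesic\<close>).

  The translation by 3 maps the lifts of the geodesic to lifts of the reversed geodesic.  A lift
  that is wider than 3 would cross its own translate; with the relation between trace and lower left entry
  (\<open>trace_A0\<close>) this implies that the lift of the top rank is a widest one (\<open>lift_width\<close>).  The
  vertical rays above the highest points of this lift and of its translate by 3 are the two orthogeodesics
  to the cusp (\<open>left_foot\<close>, \<open>right_foot\<close>), and there are no others (\<open>foot_location\<close>).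

  Let \<open>j\<close> be the inverse of \<open>p\<close> modulo \<open>n\<close>.  The length is the sum of an increasing function \<open>F\<close> over all
  ranks, and the twist is, up to a bounded error, the sum of \<open>F\<close> over the ranks that the rotation visits in its
  first \<open>j\<close> steps.  These ranks are the numbers \<open>n k / j\<close> rounded down, so they are evenly spaced, and the
  relative twist differs from \<open>j / n\<close> by at most \<open>6 / n\<close> (\<open>twist_near\<close>).  Finally, \<open>p\<close> and \<open>j\<close> are entries
  of a matrix of determinant 1 with lower left entry \<open>n\<close>, and products of such matrices with
  high powers of the translation between them bring the pair of quotients near any two given rational numbers
  (\<open>rational_point_in_closure\<close>).\<close>

section \<open>Integer matrices and words in the free generators\<close>

definition mx :: "int \<Rightarrow> int \<Rightarrow> int \<Rightarrow> int \<Rightarrow> int ^ 2 ^ 2" where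
  "mx a b c d = vector [vector [a, b], vector [c, d]]"

lemma mx_nth [simp]:
  "mx a b c d $ 1 $ 1 = a" "mx a b c d $ 1 $ 2 = b" "mx a b c d $ 2 $ 1 = c" "mx a b c d $ 2 $ 2 = d"
  by (simp_all add: mx_def)

lemma mx_eq_iff: "A = B \<longleftrightarrow> A$1$1 = B$1$1 \<and> A$1$2 = B$1$2 \<and> A$2$1 = B$2$1 \<and> A$2$2 = B$2$2"
  for A B :: "int ^ 2 ^ 2"
  by (auto simp: vec_eq_iff forall_2)

lemma mx_mult_nth [simp]:
  fixes A B :: "int ^ 2 ^ 2"
  shows "(A ** B) $ 1 $ 1 = A$1$1 * B$1$1 + A$1$2 * B$2$1" "(A ** B) $ 1 $ 2 = A$1$1 * B$1$2 + A$1$2 * B$2$2"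
    "(A ** B) $ 2 $ 1 = A$2$1 * B$1$1 + A$2$2 * B$2$1" "(A ** B) $ 2 $ 2 = A$2$1 * B$1$2 + A$2$2 * B$2$2"
  by (simp_all add: matrix_matrix_mult_def sum_2)

lemma mx_one_nth [simp]:
  "(mat 1 :: int ^ 2 ^ 2) $ 1 $ 1 = 1" "(mat 1 :: int ^ 2 ^ 2) $ 1 $ 2 = 0"
  "(mat 1 :: int ^ 2 ^ 2) $ 2 $ 1 = 0" "(mat 1 :: int ^ 2 ^ 2) $ 2 $ 2 = 1"
  by (simp_all add: mat_def)

lemma trace_2: "trace (A :: int ^ 2 ^ 2) = A$1$1 + A$2$2"
  by (simp add: trace_def sum_2)

lemma mx_mult: "mx a b c d ** mx p q r s = mx (a * p + b * r) (a * q + b * s) (c * p + d * r) (c * q + d * s)"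
  by (simp add: mx_eq_iff)

lemma mx_uminus: "- mx a b c d = mx (-a) (-b) (-c) (-d)"
  by (simp add: mx_eq_iff)

lemma mx_one: "mat 1 = mx 1 0 0 1"
  by (simp add: mx_eq_iff)

lemma det_mx: "det (mx a b c d) = a * d - b * c"
  by (simp add: det_2)

lemma mx_exhaust: obtains a b c d where "A = mx a b c d"
  by (metis mx_eq_iff mx_nth)

lemma mult_uminus [simp]: "(- A) ** B = - (A ** B)" "A ** (- B) = - (A ** B)" for A B :: "int ^ 2 ^ 2"
  by (simp_all add: mx_eq_iff)

text \<open>The adjugate, which is the inverse for determinant 1.\<close>

definition adj :: "int ^ 2 ^ 2 \<Rightarrow> int ^ 2 ^ 2" where
  "adj A = mx (A$2$2) (- A$1$2) (- A$2$1) (A$1$1)"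

lemma adj_mx [simp]: "adj (mx a b c d) = mx d (-b) (-c) a"
  by (simp add: adj_def)

lemma adj_one [simp]: "adj (mat 1) = mat 1"
  by (simp add: adj_def mx_eq_iff)

lemma adj_mult: "adj (A ** B) = adj B ** adj A"
  by (simp add: adj_def mx_eq_iff algebra_simps)

lemma adj_uminus: "adj (- A) = - adj A"
  by (simp add: adj_def mx_eq_iff)

lemma adj_adj [simp]: "adj (adj A) = A"
  by (simp add: adj_def mx_eq_iff)

lemma det_adj [simp]: "det (adj A) = det A"
  by (simp add: adj_def det_2 algebra_simps)

lemma det_uminus_2 [simp]: "det (- A) = det A" for A :: "int ^ 2 ^ 2"
  by (simp add: det_2)

lemma adj_inverse:
  assumes "det A = 1"
  shows "A ** adj A = mat 1" "adj A ** A = mat 1"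
  using assms by (simp_all add: adj_def det_2 mx_eq_iff algebra_simps)

lemma adj_cancel:
  assumes "det A = 1"
  shows "A ** (adj A ** B) = B" "adj A ** (A ** B) = B"
  by (simp_all add: matrix_mul_assoc adj_inverse[OF assms])

text \<open>The letters stand for alpha, the inverse of beta, and their inverses.  The inverse of beta is
  preferred to beta because then the first two letters are positive symmetric matrices.\<close>

datatype letter = La | Lb | LA | LB

fun linv :: "letter \<Rightarrow> letter" where
  "linv La = LA" | "linv LA = La" | "linv Lb = LB" | "linv LB = Lb"

fun lm :: "letter \<Rightarrow> int ^ 2 ^ 2" where
  "lm La = mx 2 1 1 1" | "lm Lb = mx 1 1 1 2" | "lm LA = mx 1 (-1) (-1) 2" | "lm LB = mx 2 (-1) (-1) 1"

fun ea :: "letter \<Rightarrow> int" where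
  "ea La = 1" | "ea LA = -1" | "ea _ = 0"

fun eb :: "letter \<Rightarrow> int" where
  "eb Lb = 1" | "eb LB = -1" | "eb _ = 0"

definition ev :: "letter list \<Rightarrow> int ^ 2 ^ 2" where
  "ev ws = foldr (\<lambda>l A. lm l ** A) ws (mat 1)"

definition exa :: "letter list \<Rightarrow> int" where "exa ws = sum_list (map ea ws)"
definition exb :: "letter list \<Rightarrow> int" where "exb ws = sum_list (map eb ws)"

definition winv :: "letter list \<Rightarrow> letter list" where "winv ws = rev (map linv ws)"

lemma linv_linv [simp]: "linv (linv l) = l"
  by (cases l) auto

lemma linv_eq_iff [simp]: "linv l = linv l' \<longleftrightarrow> l = l'"
  by (metis linv_linv)

lemma linv_neq [simp]: "linv l \<noteq> l" "l \<noteq> linv l"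
  by (cases l; simp)+

lemma lm_linv: "lm (linv l) = adj (lm l)"
  by (cases l) auto

lemma ea_linv [simp]: "ea (linv l) = - ea l" and eb_linv [simp]: "eb (linv l) = - eb l"
  by (cases l; simp)+

lemma det_lm [simp]: "det (lm l) = 1"
  by (cases l) (auto simp: det_mx)

lemma ev_Nil [simp]: "ev [] = mat 1" and ev_Cons [simp]: "ev (l # ws) = lm l ** ev ws"
  by (simp_all add: ev_def)

lemma ev_append: "ev (us @ ws) = ev us ** ev ws"
  by (induction us) (auto simp: matrix_mul_assoc)

lemma ex_simps [simp]:
  "exa [] = 0" "exb [] = 0" "exa (l # ws) = ea l + exa ws" "exb (l # ws) = eb l + exb ws"
  "exa (us @ ws) = exa us + exa ws" "exb (us @ ws) = exb us + exb ws"
  by (simp_all add: exa_def exb_def)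

lemma det_ev [simp]: "det (ev ws) = 1"
  by (induction ws) (auto simp: det_mul)

lemma winv_simps [simp]: "winv [] = []" "winv (l # ws) = winv ws @ [linv l]" "winv (us @ ws) = winv ws @ winv us"
  by (simp_all add: winv_def)

lemma ev_winv: "ev (winv ws) = adj (ev ws)"
  by (induction ws) (auto simp: ev_append adj_mult lm_linv)

lemma ex_winv [simp]: "exa (winv ws) = - exa ws" "exb (winv ws) = - exb ws"
  by (induction ws) auto

definition Tm :: "int \<Rightarrow> int ^ 2 ^ 2" where "Tm k = mx 1 k 0 1"
definition Sm :: "int ^ 2 ^ 2" where "Sm = mx 0 (-1) 1 0"

lemma det_Tm [simp]: "det (Tm k) = 1" and det_Sm [simp]: "det Sm = 1"
  by (simp_all add: Tm_def Sm_def det_mx)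

lemma Tm_mult: "Tm i ** Tm j = Tm (i + j)"
  by (simp add: Tm_def mx_mult add.commute)

lemma Tm_0 [simp]: "Tm 0 = mat 1"
  by (simp add: Tm_def mx_one)

lemma adj_Tm [simp]: "adj (Tm k) = Tm (- k)"
  by (simp add: Tm_def)

text \<open>Conjugation by the translation by 1 and by its inverse, as substitutions on words.\<close>

fun sbl :: "letter \<Rightarrow> letter list" where
  "sbl La = [Lb]" | "sbl LA = [LB]" | "sbl Lb = [LA, Lb]" | "sbl LB = [LB, La]"

fun sbr :: "letter \<Rightarrow> letter list" where
  "sbr La = [La, LB]" | "sbr LA = [Lb, LA]" | "sbr Lb = [La]" | "sbr LB = [LA]"

lemma ev_sbl: "ev ws ** Tm 1 = Tm 1 ** ev (concat (map sbl ws))"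
proof (induction ws)
  case (Cons l ws)
  have "lm l ** Tm 1 = Tm 1 ** ev (sbl l)"
    by (cases l) (auto simp: Tm_def mx_mult mx_one)
  then have "lm l ** (Tm 1 ** ev (concat (map sbl ws))) = Tm 1 ** ev (sbl l) ** ev (concat (map sbl ws))"
    by (simp add: matrix_mul_assoc)
  then show ?case
    using Cons by (simp add: ev_append matrix_mul_assoc[symmetric])
qed auto

lemma ev_sbr: "ev ws ** Tm (-1) = Tm (-1) ** ev (concat (map sbr ws))"
proof (induction ws)
  case (Cons l ws)
  have "lm l ** Tm (-1) = Tm (-1) ** ev (sbr l)"
    by (cases l) (auto simp: Tm_def mx_mult mx_one)
  then have "lm l ** (Tm (-1) ** ev (concat (map sbr ws))) = Tm (-1) ** ev (sbr l) ** ev (concat (map sbr ws))"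
    by (simp add: matrix_mul_assoc)
  then show ?case
    using Cons by (simp add: ev_append matrix_mul_assoc[symmetric])
qed auto

lemma ex_sbl: "exa (concat (map sbl ws)) = - exb ws" "exb (concat (map sbl ws)) = exa ws + exb ws"
proof (induction ws)
  case (Cons l ws)
  { case 1 then show ?case using Cons by (cases l) auto }
  { case 2 then show ?case using Cons by (cases l) auto }
qed auto

lemma ev_Tm: "\<exists>ws'. ev ws ** Tm k = Tm k ** ev ws'"
proof -
  have pos: "\<exists>ws'. ev ws ** Tm (int n) = Tm (int n) ** ev ws'" for n ws
  proof (induction n)
    case (Suc n)
    have *: "Tm (int (Suc n)) = Tm (int n) ** Tm 1"
      by (simp add: Tm_mult add.commute)
    obtain ws' where ws': "ev ws ** Tm (int n) = Tm (int n) ** ev ws'" using Suc by blast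
    have "ev ws ** Tm (int (Suc n)) = Tm (int n) ** (ev ws' ** Tm 1)"
      by (simp only: * matrix_mul_assoc ws')
    also have "\<dots> = Tm (int (Suc n)) ** ev (concat (map sbl ws'))"
      by (simp only: * matrix_mul_assoc ev_sbl)
    finally show ?case by blast
  qed auto
  have neg: "\<exists>ws'. ev ws ** Tm (- int n) = Tm (- int n) ** ev ws'" for n ws
  proof (induction n)
    case (Suc n)
    have *: "Tm (- int (Suc n)) = Tm (- int n) ** Tm (-1)"
      by (simp add: Tm_mult algebra_simps)
    obtain ws' where ws': "ev ws ** Tm (- int n) = Tm (- int n) ** ev ws'" using Suc by blast
    have "ev ws ** Tm (- int (Suc n)) = Tm (- int n) ** (ev ws' ** Tm (-1))"
      by (simp only: * matrix_mul_assoc ws')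
    also have "\<dots> = Tm (- int (Suc n)) ** ev (concat (map sbr ws'))"
      by (simp only: * matrix_mul_assoc ev_sbr)
    finally show ?case by blast
  qed auto
  show ?thesis
    using pos[of ws "nat k"] neg[of ws "nat (- k)"] by (cases "k \<ge> 0") auto
qed

lemma ev_Tm': "\<exists>ws'. Tm k ** ev ws = ev ws' ** Tm k"
proof -
  obtain ws' where "ev ws ** Tm (- k) = Tm (- k) ** ev ws'" using ev_Tm by blast
  then have "Tm k ** (ev ws ** Tm (-k)) ** Tm k = Tm k ** (Tm (- k) ** ev ws') ** Tm k" by simp
  then have "Tm k ** ev ws = ev ws' ** Tm k"
    by (simp add: matrix_mul_assoc Tm_mult) (simp add: matrix_mul_assoc[symmetric] Tm_mult)
  then show ?thesis by blast
qed

text \<open>The translation by 3 differs from the inversion by an element of the free group.  This is why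
  the inversion, which is not in the free group, still permutes its orbits.\<close>

lemma Tm_3: "Tm 3 = - (ev [La, LB] ** Sm)"
  by (simp add: Tm_def Sm_def mx_mult mx_one mx_uminus)

lemma Tm_6: "Tm 6 = - ev [La, LB, LA, Lb]"
  by (simp add: Tm_def mx_mult mx_one mx_uminus)

lemma Sm_eq: "Sm = - (ev [Lb, LA] ** Tm 3)"
  by (simp add: Tm_def Sm_def mx_mult mx_one mx_uminus)

text \<open>The Euclidean algorithm on the first column.  Each inversion that it uses is a word times a
  translation, and translations can be moved past words to the left.\<close>

lemma SL2Z_decomp:
  assumes "det A = 1"
  shows "\<exists>k ws. A = Tm k ** ev ws \<or> A = - (Tm k ** ev ws)"
  using assms
proof (induction "nat \<bar>A$2$1\<bar>" arbitrary: A rule: less_induct)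
  case less
  obtain a b c d where A: "A = mx a b c d" by (rule mx_exhaust)
  have dt: "a * d - b * c = 1" using less.prems by (simp add: A det_mx)
  show ?case
  proof (cases "c = 0")
    case True
    then have "a * d = 1" using dt by simp
    then consider "a = 1" "d = 1" | "a = -1" "d = -1" by (metis zmult_eq_1_iff)
    then show ?thesis
    proof cases
      case 1 then have "A = Tm b ** ev []" by (simp add: A True Tm_def)
      then show ?thesis by blast
    next
      case 2 then have "A = - (Tm (-b) ** ev [])" by (simp add: A True Tm_def mx_uminus)
      then show ?thesis by blast
    qed
  next
    case False
    define q where "q = a div c"
    define r where "r = a mod c"
    have a: "a = c * q + r" by (simp add: q_def r_def)
    have r: "\<bar>r\<bar> < \<bar>c\<bar>" using False by (simp add: r_def abs_mod_less)
    define A' where "A' = mx (- c) (- d) r (b - q * d)"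
    have A': "A = - (Tm q ** (Sm ** A'))"
      by (simp add: A A'_def Tm_def Sm_def mx_mult mx_uminus a algebra_simps)
    have "det A' = 1" using dt by (simp add: A'_def det_mx a algebra_simps)
    moreover have "nat \<bar>A' $ 2 $ 1\<bar> < nat \<bar>A $ 2 $ 1\<bar>" using r False by (simp add: A A'_def)
    ultimately obtain k ws where IH: "A' = Tm k ** ev ws \<or> A' = - (Tm k ** ev ws)"
      using less.hyps by blast
    obtain vs where vs: "ev [Lb, LA] ** Tm (k + 3) = Tm (k + 3) ** ev vs" using ev_Tm by blast
    have "Sm ** (Tm k ** ev ws) = - ((ev [Lb, LA] ** (Tm 3 ** Tm k)) ** ev ws)"
      by (simp only: Sm_eq matrix_mul_assoc mult_uminus)
    also have "Tm 3 ** Tm k = Tm (k + 3)" by (simp add: Tm_mult add.commute)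
    finally have "Tm q ** (Sm ** (Tm k ** ev ws)) = - (Tm q ** (Tm (k + 3) ** ev vs ** ev ws))"
      by (simp only: vs mult_uminus)
    also have "\<dots> = - (Tm (q + (k + 3)) ** ev (vs @ ws))"
      by (simp only: ev_append matrix_mul_assoc Tm_mult)
    finally have "Tm q ** (Sm ** (Tm k ** ev ws)) = - (Tm (q + (k + 3)) ** ev (vs @ ws))" .
    then show ?thesis using IH A' by (metis minus_minus mult_uminus(2))
  qed
qed

section \<open>The commutator subgroup as the group of words\<close>

lemma SL2Z_simps [simp]:
  "carrier SL2Z = {A. det A = 1}" "mult SL2Z = (**)" "one SL2Z = mat 1"
  by (simp_all add: SL2Z_def)

lemma group_SL2Z: "group SL2Z"
proof (rule groupI)
  fix A assume "A \<in> carrier SL2Z"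
  then show "\<exists>B\<in>carrier SL2Z. B \<otimes>\<^bsub>SL2Z\<^esub> A = \<one>\<^bsub>SL2Z\<^esub>"
    by (auto intro!: exI[of _ "adj A"] simp: adj_inverse)
qed (auto simp: det_mul matrix_mul_assoc)

lemma inv_SL2Z: "det A = 1 \<Longrightarrow> inv\<^bsub>SL2Z\<^esub> A = adj A"
  by (rule group.inv_equality[OF group_SL2Z]) (auto simp: adj_inverse)

lemma normal_pm1: "{mat 1, - mat 1} \<lhd> SL2Z"
proof (rule group.normal_invI[OF group_SL2Z])
  show "subgroup {mat 1, - mat 1} SL2Z"
    by (rule group.subgroupI[OF group_SL2Z]) (auto simp: inv_SL2Z adj_uminus)
  show "x \<otimes>\<^bsub>SL2Z\<^esub> h \<otimes>\<^bsub>SL2Z\<^esub> inv\<^bsub>SL2Z\<^esub> x \<in> {mat 1, - mat 1}"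
    if "x \<in> carrier SL2Z" "h \<in> {mat 1, - mat 1}" for x h
    using that by (auto simp: inv_SL2Z adj_inverse)
qed

lemma proj_class_eq: "proj_class A = {A, - A}"
  by (simp add: proj_class_def r_coset_def) auto

lemma proj_class_eq_iff: "proj_class A = proj_class B \<longleftrightarrow> A = B \<or> A = - B"
  by (auto simp: proj_class_eq doubleton_eq_iff)

lemma group_PSL2Z: "group PSL2Z"
  unfolding PSL2Z_def by (rule normal.factorgroup_is_group[OF normal_pm1])

lemma carrier_PSL2Z: "carrier PSL2Z = {proj_class A | A. det A = 1}"
  by (auto simp: PSL2Z_def FactGroup_def RCOSETS_def proj_class_def)

lemma proj_class_in: "det A = 1 \<Longrightarrow> proj_class A \<in> carrier PSL2Z"
  by (auto simp: carrier_PSL2Z)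

lemma mult_PSL2Z: "det A = 1 \<Longrightarrow> det B = 1 \<Longrightarrow> proj_class A \<otimes>\<^bsub>PSL2Z\<^esub> proj_class B = proj_class (A ** B)"
  using normal.rcos_sum[OF normal_pm1, of A B] by (simp add: PSL2Z_def FactGroup_def proj_class_def)

lemma one_PSL2Z: "\<one>\<^bsub>PSL2Z\<^esub> = proj_class (mat 1)"
  by (auto simp: PSL2Z_def FactGroup_def proj_class_eq)

lemma inv_PSL2Z: "det A = 1 \<Longrightarrow> inv\<^bsub>PSL2Z\<^esub> proj_class A = proj_class (adj A)"
  by (rule group.inv_equality[OF group_PSL2Z]) (auto simp: mult_PSL2Z one_PSL2Z adj_inverse proj_class_in)

lemma word_classes_subgroup: "subgroup (range (\<lambda>ws. proj_class (ev ws))) PSL2Z"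
proof (rule group.subgroupI[OF group_PSL2Z])
  show "inv\<^bsub>PSL2Z\<^esub> a \<in> range (\<lambda>ws. proj_class (ev ws))" if "a \<in> range (\<lambda>ws. proj_class (ev ws))" for a
  proof -
    from that obtain ws where "a = proj_class (ev ws)" by blast
    then have "inv\<^bsub>PSL2Z\<^esub> a = proj_class (ev (winv ws))" by (simp add: inv_PSL2Z ev_winv)
    then show ?thesis by blast
  qed
  show "a \<otimes>\<^bsub>PSL2Z\<^esub> b \<in> range (\<lambda>ws. proj_class (ev ws))"
    if ab: "a \<in> range (\<lambda>ws. proj_class (ev ws))" "b \<in> range (\<lambda>ws. proj_class (ev ws))" for a b
  proof -
    from ab obtain us ws where "a = proj_class (ev us)" "b = proj_class (ev ws)" by blast
    then have "a \<otimes>\<^bsub>PSL2Z\<^esub> b = proj_class (ev (us @ ws))" by (simp add: mult_PSL2Z ev_append)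
    then show ?thesis by blast
  qed
qed (auto simp: proj_class_in)

lemma Tm_ev_comm:
  "\<exists>ws. (Tm i ** ev us) ** (Tm j ** ev vs) ** adj (Tm i ** ev us) ** adj (Tm j ** ev vs) = ev ws"
proof -
  obtain u' where u': "ev us ** Tm j = Tm j ** ev u'" using ev_Tm by blast
  obtain w' where w': "ev (u' @ vs @ winv us) ** Tm (- i) = Tm (- i) ** ev w'" using ev_Tm by blast
  obtain x where x: "Tm j ** ev (w' @ winv vs) = ev x ** Tm j" using ev_Tm' by blast
  have "(Tm i ** ev us) ** (Tm j ** ev vs) ** adj (Tm i ** ev us) ** adj (Tm j ** ev vs)
    = Tm i ** ((ev us ** Tm j) ** ev vs ** adj (ev us)) ** Tm (- i) ** adj (ev vs) ** Tm (- j)"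
    by (simp add: adj_mult matrix_mul_assoc)
  also have "\<dots> = Tm i ** Tm j ** (ev (u' @ vs @ winv us) ** Tm (- i)) ** adj (ev vs) ** Tm (- j)"
    by (simp only: u' ev_append ev_winv matrix_mul_assoc)
  also have "\<dots> = Tm i ** Tm j ** (Tm (- i) ** ev w') ** adj (ev vs) ** Tm (- j)"
    by (simp only: w')
  also have "\<dots> = (Tm i ** Tm j ** Tm (- i)) ** ev (w' @ winv vs) ** Tm (- j)"
    by (simp only: ev_append ev_winv matrix_mul_assoc)
  also have "Tm i ** Tm j ** Tm (- i) = Tm j" by (simp add: Tm_mult)
  also have "Tm j ** ev (w' @ winv vs) ** Tm (- j) = ev x ** (Tm j ** Tm (- j))"
    by (simp only: x matrix_mul_assoc)
  also have "\<dots> = ev x" by (simp add: Tm_mult)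
  finally show ?thesis by blast
qed

text \<open>The projective modular group modulo the words is generated by the translation by 1, hence is
  abelian, and each of the two positive letters is a commutator of an elliptic with a parabolic.\<close>

lemma Gam_eq: "Gam = range (\<lambda>ws. proj_class (ev ws))"
proof
  let ?N = "range (\<lambda>ws. proj_class (ev ws))"
  have "derived_set PSL2Z (carrier PSL2Z) \<subseteq> ?N"
  proof clarify
    fix h1 h2 assume "h1 \<in> carrier PSL2Z" "h2 \<in> carrier PSL2Z"
    then obtain A B where AB: "det A = 1" "det B = 1" "h1 = proj_class A" "h2 = proj_class B"
      by (auto simp: carrier_PSL2Z)
    obtain i us where us: "A = Tm i ** ev us \<or> A = - (Tm i ** ev us)" using SL2Z_decomp[OF AB(1)] by blast
    obtain j vs where vs: "B = Tm j ** ev vs \<or> B = - (Tm j ** ev vs)" using SL2Z_decomp[OF AB(2)] by blast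
    have h1: "h1 = proj_class (Tm i ** ev us)" using us AB(3) by (auto simp: proj_class_eq)
    have h2: "h2 = proj_class (Tm j ** ev vs)" using vs AB(4) by (auto simp: proj_class_eq)
    have "h1 \<otimes>\<^bsub>PSL2Z\<^esub> h2 \<otimes>\<^bsub>PSL2Z\<^esub> inv\<^bsub>PSL2Z\<^esub> h1 \<otimes>\<^bsub>PSL2Z\<^esub> inv\<^bsub>PSL2Z\<^esub> h2
      = proj_class ((Tm i ** ev us) ** (Tm j ** ev vs) ** adj (Tm i ** ev us) ** adj (Tm j ** ev vs))"
      by (simp add: h1 h2 inv_PSL2Z mult_PSL2Z det_mul)
    then show "h1 \<otimes>\<^bsub>PSL2Z\<^esub> h2 \<otimes>\<^bsub>PSL2Z\<^esub> inv\<^bsub>PSL2Z\<^esub> h1 \<otimes>\<^bsub>PSL2Z\<^esub> inv\<^bsub>PSL2Z\<^esub> h2 \<in> ?N"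
      using Tm_ev_comm[of i us j vs] by auto
  qed
  then show "Gam \<subseteq> ?N"
    unfolding Gam_def derived_def by (rule group.generate_subgroup_incl[OF group_PSL2Z _ word_classes_subgroup])
next
  interpret PSL2Z: group PSL2Z by (rule group_PSL2Z)
  have sub: "subgroup Gam PSL2Z"
    unfolding Gam_def by (rule PSL2Z.derived_is_subgroup) simp
  have comm: "proj_class (A ** B ** adj A ** adj B) \<in> Gam" if "det A = 1" "det B = 1" for A B
  proof -
    have "proj_class (A ** B ** adj A ** adj B) =
        proj_class A \<otimes>\<^bsub>PSL2Z\<^esub> proj_class B \<otimes>\<^bsub>PSL2Z\<^esub> inv\<^bsub>PSL2Z\<^esub> proj_class A \<otimes>\<^bsub>PSL2Z\<^esub> inv\<^bsub>PSL2Z\<^esub> proj_class B"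
      using that by (simp add: inv_PSL2Z mult_PSL2Z det_mul)
    then have "proj_class (A ** B ** adj A ** adj B) \<in> derived_set PSL2Z (carrier PSL2Z)"
      using proj_class_in[OF that(1)] proj_class_in[OF that(2)] by blast
    then show ?thesis
      unfolding Gam_def derived_def by (rule generate.incl)
  qed
  have a: "proj_class (lm La) \<in> Gam"
    using comm[OF det_Tm det_Sm, of 1] by (simp add: Tm_def Sm_def mx_mult)
  have b: "proj_class (lm Lb) \<in> Gam"
    using comm[OF det_Sm det_Tm, of "-1"] by (simp add: Tm_def Sm_def mx_mult)
  have l: "proj_class (lm l) \<in> Gam" for l
  proof (cases l)
    case LA
    then show ?thesis
      using subgroup.m_inv_closed[OF sub a] inv_PSL2Z[of "lm La"] by (simp add: det_mx)
  next
    case LB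
    then show ?thesis
      using subgroup.m_inv_closed[OF sub b] inv_PSL2Z[of "lm Lb"] by (simp add: det_mx)
  qed (use a b in auto)
  show "range (\<lambda>ws. proj_class (ev ws)) \<subseteq> Gam"
  proof clarify
    fix ws show "proj_class (ev ws) \<in> Gam"
    proof (induction ws)
      case Nil then show ?case using subgroup.one_closed[OF sub] by (simp add: one_PSL2Z)
    next
      case (Cons l ws)
      then show ?case using subgroup.m_closed[OF sub l Cons, of l] by (simp add: mult_PSL2Z)
    qed
  qed
qed

lemma Union_Gam: "A \<in> \<Union>Gam \<longleftrightarrow> (\<exists>ws. A = ev ws \<or> A = - ev ws)"
  by (auto simp: Gam_eq proj_class_eq)

section \<open>Ping-pong on the irrational numbers\<close>

text \<open>The denominator is kept separate because it is the cocycle from which lengths are computed.\<close>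

definition den :: "int ^ 2 ^ 2 \<Rightarrow> real \<Rightarrow> real" where
  "den A x = of_int (A$2$1) * x + of_int (A$2$2)"

definition rm :: "int ^ 2 ^ 2 \<Rightarrow> real \<Rightarrow> real" where
  "rm A x = (of_int (A$1$1) * x + of_int (A$1$2)) / den A x"

lemma irrational_linear: "x \<notin> \<rat> \<Longrightarrow> of_int c * x + of_int d = (0::real) \<Longrightarrow> c = 0 \<and> d = 0"
proof (rule ccontr)
  assume x: "x \<notin> \<rat>" and e: "of_int c * x + of_int d = (0::real)" and n: "\<not> (c = 0 \<and> d = 0)"
  then have c: "c \<noteq> 0" by auto
  then have "x = - of_int d / of_int c" using e by (simp add: field_simps)
  then show False using x by auto
qed

lemma den_nz: assumes "x \<notin> \<rat>" "det A = 1" shows "den A x \<noteq> 0"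
  using irrational_linear[OF assms(1), of "A$2$1" "A$2$2"] assms(2) by (auto simp: den_def det_2)

lemma rm_one [simp]: "rm (mat 1) x = x" and den_one [simp]: "den (mat 1) x = 1"
  by (simp_all add: rm_def den_def)

lemma rm_uminus [simp]: "rm (- A) x = rm A x" and den_uminus [simp]: "den (- A) x = - den A x"
proof -
  show d: "den (- A) x = - den A x" by (simp add: den_def)
  have "of_int ((- A)$1$1) * x + of_int ((- A)$1$2) = - (of_int (A$1$1) * x + of_int (A$1$2))" by simp
  then show "rm (- A) x = rm A x" unfolding rm_def d by (simp add: divide_simps)
qed

lemma den_mult: "x \<notin> \<rat> \<Longrightarrow> det B = 1 \<Longrightarrow> den (A ** B) x = den A (rm B x) * den B x"
  using den_nz[of x B] by (simp add: rm_def den_def field_simps)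

lemma rm_mult: "x \<notin> \<rat> \<Longrightarrow> det B = 1 \<Longrightarrow> rm (A ** B) x = rm A (rm B x)"
proof -
  assume x: "x \<notin> \<rat>" "det B = 1"
  have "rm A (rm B x) = ((of_int (A$1$1) * rm B x + of_int (A$1$2)) * den B x) / (den A (rm B x) * den B x)"
    using den_nz[OF x] by (simp add: rm_def)
  also have "(of_int (A$1$1) * rm B x + of_int (A$1$2)) * den B x =
      of_int ((A ** B)$1$1) * x + of_int ((A ** B)$1$2)"
    using den_nz[OF x] by (simp add: rm_def den_def field_simps)
  finally show ?thesis unfolding den_mult[OF x, symmetric] rm_def[of "A ** B"] by (rule sym)
qed

lemma rm_adj: "x \<notin> \<rat> \<Longrightarrow> det A = 1 \<Longrightarrow> rm (adj A) (rm A x) = x"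
  by (simp add: rm_mult[symmetric] adj_inverse)

lemma rm_irr:
  assumes "x \<notin> \<rat>" "det A = 1" shows "rm A x \<notin> \<rat>"
proof
  assume "rm A x \<in> \<rat>"
  then have "rm (adj A) (rm A x) \<in> \<rat>" unfolding rm_def[of "adj A"] den_def[of "adj A"] by simp
  then show False using assms by (simp add: rm_adj)
qed

lemma rm_adj': "x \<notin> \<rat> \<Longrightarrow> det A = 1 \<Longrightarrow> rm A (rm (adj A) x) = x"
  using rm_adj[of x "adj A"] by simp

lemma rm_diff:
  assumes "x \<notin> \<rat>" "y \<notin> \<rat>" "det A = 1"
  shows "rm A y - rm A x = (y - x) / (den A x * den A y)"
proof -
  have d: "(of_int (A$1$1) :: real) * of_int (A$2$2) - of_int (A$1$2) * of_int (A$2$1) = 1"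
  proof -
    have "real_of_int (A$1$1 * A$2$2 - A$1$2 * A$2$1) = real_of_int 1"
      using assms(3) by (simp only: det_2)
    then show ?thesis by simp
  qed
  have "rm A y - rm A x = ((of_int (A$1$1) * y + of_int (A$1$2)) * den A x - (of_int (A$1$1) * x + of_int (A$1$2)) * den A y) / (den A x * den A y)"
    using den_nz[OF assms(1,3)] den_nz[OF assms(2,3)] by (simp add: rm_def field_simps)
  also have "(of_int (A$1$1) * y + of_int (A$1$2)) * den A x - (of_int (A$1$1) * x + of_int (A$1$2)) * den A y
      = (of_int (A$1$1) * of_int (A$2$2) - of_int (A$1$2) * of_int (A$2$1)) * (y - x)"
    by (simp add: den_def algebra_simps)
  finally show ?thesis by (simp add: d)
qed

lemma rm_inj: "x \<notin> \<rat> \<Longrightarrow> y \<notin> \<rat> \<Longrightarrow> det A = 1 \<Longrightarrow> rm A x = rm A y \<Longrightarrow> x = y"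
  by (metis rm_adj)

lemma rm_Tm [simp]: "rm (Tm k) x = x + of_int k" and den_Tm [simp]: "den (Tm k) x = 1"
  by (simp_all add: rm_def den_def Tm_def)

lemma rm_Sm [simp]: "rm Sm x = - 1 / x" and den_Sm [simp]: "den Sm x = x"
  by (simp_all add: rm_def den_def Sm_def)

text \<open>The ideal quadrilateral with vertices \<open>-1, 0, 1, \<infinity>\<close> is a fundamental domain.
  \<open>lt x\<close> is the letter whose matrix carries the quadrilateral across the side that cuts off \<open>x\<close>.\<close>

definition lt :: "real \<Rightarrow> letter" where
  "lt x = (if x > 1 then La else if x > 0 then Lb else if x > -1 then LA else LB)"

lemma irr_ne: "x \<notin> \<rat> \<Longrightarrow> x \<noteq> 0 \<and> x \<noteq> 1 \<and> x \<noteq> -1"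
  by auto

lemma lt_eq_iff:
  "x \<notin> \<rat> \<Longrightarrow> lt x = La \<longleftrightarrow> x > 1" "x \<notin> \<rat> \<Longrightarrow> lt x = Lb \<longleftrightarrow> 0 < x \<and> x < 1"
  "x \<notin> \<rat> \<Longrightarrow> lt x = LA \<longleftrightarrow> -1 < x \<and> x < 0" "x \<notin> \<rat> \<Longrightarrow> lt x = LB \<longleftrightarrow> x < -1"
  using irr_ne[of x] by (auto simp: lt_def)

lemma rm_letters:
  "rm (lm La) x = (2 * x + 1) / (x + 1)" "rm (lm Lb) x = (x + 1) / (x + 2)"
  "rm (lm LA) x = (x - 1) / (2 - x)" "rm (lm LB) x = (2 * x - 1) / (1 - x)"
  by (simp_all add: rm_def den_def algebra_simps)

lemma ping_pong:
  assumes x: "x \<notin> \<rat>" and l: "lt x \<noteq> linv l"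
  shows "lt (rm (lm l) x) = l"
proof -
  have y: "rm (lm l) x \<notin> \<rat>" using x by (simp add: rm_irr)
  have "2 \<in> (\<rat> :: real set)" by simp
  then have ne: "x \<noteq> 0" "x \<noteq> 1" "x \<noteq> -1" "x \<noteq> 2" "x \<noteq> -2" using x by auto
  show ?thesis
  proof (cases l)
    case La
    then have "x < -1 \<or> x > 0" using l x ne by (auto simp: lt_eq_iff)
    then have "rm (lm l) x > 1" by (auto simp: La rm_letters field_simps simp del: lm.simps)
    then show ?thesis using y La by (simp add: lt_eq_iff del: lm.simps)
  next
    case Lb
    then have "x > -1" using l x ne by (auto simp: lt_eq_iff)
    then have "rm (lm l) x > 0 \<and> rm (lm l) x < 1" by (auto simp: Lb rm_letters field_simps simp del: lm.simps)
    then show ?thesis using y Lb by (simp add: lt_eq_iff del: lm.simps)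
  next
    case LA
    then have "x < 1" using l x ne by (auto simp: lt_eq_iff)
    then have "rm (lm l) x > -1 \<and> rm (lm l) x < 0" by (auto simp: LA rm_letters field_simps simp del: lm.simps)
    then show ?thesis using y LA by (simp add: lt_eq_iff del: lm.simps)
  next
    case LB
    then have "x < 0 \<or> x > 1" using l x ne by (auto simp: lt_eq_iff)
    then have "rm (lm l) x < -1" by (auto simp: LB rm_letters field_simps simp del: lm.simps)
    then show ?thesis using y LB by (simp add: lt_eq_iff del: lm.simps)
  qed
qed

fun reduced :: "letter list \<Rightarrow> bool" where
  "reduced (l # l' # ws) \<longleftrightarrow> l' \<noteq> linv l \<and> reduced (l' # ws)"
| "reduced _ \<longleftrightarrow> True"

lemma reduced_tl: "reduced (l # ws) \<Longrightarrow> reduced ws"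
  by (cases ws) auto

text \<open>In a reduced word the letter that a step produces never blocks the next step.\<close>

lemma ping_pong_word:
  assumes "reduced ws" "ws \<noteq> []" "x \<notin> \<rat>" "lt x \<noteq> linv (last ws)"
  shows "lt (rm (ev ws) x) = hd ws"
  using assms
proof (induction ws)
  case (Cons l ws)
  show ?case
  proof (cases ws)
    case Nil
    then show ?thesis using Cons.prems by (simp add: ping_pong)
  next
    case (Cons l' us)
    have "lt (rm (ev ws) x) = hd ws"
      using Cons.IH Cons.prems Cons by (auto intro: reduced_tl)
    then have "lt (rm (ev ws) x) \<noteq> linv l" using Cons.prems Cons by auto
    then have "lt (rm (lm l) (rm (ev ws) x)) = l"
      using Cons.prems(3) by (intro ping_pong) (auto simp: rm_irr)
    then show ?thesis using Cons.prems(3) by (simp add: rm_mult)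
  qed
qed simp

lemma ex_irr_between: "a < b \<Longrightarrow> \<exists>x. x \<notin> \<rat> \<and> a < x \<and> x < (b :: real)"
proof (rule ccontr)
  assume ab: "a < b" and "\<not> (\<exists>x. x \<notin> \<rat> \<and> a < x \<and> x < b)"
  then have "{a<..<b} \<subseteq> \<rat>" by auto
  then show False using uncountable_open_interval[of a b] ab countable_rat countable_subset by blast
qed

lemma ex_irr_lt: "\<exists>x. x \<notin> \<rat> \<and> lt x = l"
proof -
  have *: "\<exists>x. x \<notin> \<rat> \<and> real_of_int k < x \<and> x < real_of_int k + 1" for k
    by (rule ex_irr_between) simp
  show ?thesis
    using *[of 1] *[of 0] *[of "-1"] *[of "-2"] by (cases l) (fastforce simp: lt_def)+
qed

text \<open>A nonempty reduced word moves some irrational number to an interval of another letter.\<close>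

lemma reduced_ev_neq:
  assumes "reduced ws" "ws \<noteq> []"
  shows "ev ws \<noteq> mat 1" "ev ws \<noteq> - mat 1"
proof -
  have "\<exists>l. l \<noteq> hd ws \<and> l \<noteq> linv (last ws)"
  proof -
    have "\<exists>l. l \<noteq> a \<and> l \<noteq> b" for a b :: letter
    proof -
      have "La \<noteq> a \<and> La \<noteq> b \<or> Lb \<noteq> a \<and> Lb \<noteq> b \<or> LA \<noteq> a \<and> LA \<noteq> b"
        by (cases a; cases b) simp_all
      then show ?thesis by blast
    qed
    then show ?thesis .
  qed
  then obtain l x where "l \<noteq> hd ws" "l \<noteq> linv (last ws)" "x \<notin> \<rat>" "lt x = l"
    using ex_irr_lt by blast
  then have *: "rm (ev ws) x \<noteq> x" using ping_pong_word[OF assms, of x] by auto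
  show "ev ws \<noteq> mat 1" "ev ws \<noteq> - mat 1" using * by auto
qed

text \<open>Cancelling inverse neighbours changes neither the matrix nor the exponent sums.\<close>

lemma ex_reduced:
  "\<exists>us. reduced us \<and> ev us = ev ws \<and> exa us = exa ws \<and> exb us = exb ws \<and> length us \<le> length ws"
proof (induction ws)
  case (Cons l ws)
  then obtain us where us: "reduced us" "ev us = ev ws" "exa us = exa ws" "exb us = exb ws" "length us \<le> length ws"
    by blast
  show ?case
  proof (cases "us \<noteq> [] \<and> hd us = linv l")
    case True
    then obtain vs where vs: "us = linv l # vs" by (cases us) auto
    have "ev vs = lm l ** ev us" by (simp add: vs lm_linv adj_cancel)
    then show ?thesis using us vs by (intro exI[of _ vs]) (auto intro: reduced_tl)
  next
    case False
    then show ?thesis using us by (intro exI[of _ "l # us"]) (cases us; auto)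
  qed
qed auto

text \<open>Ping-pong shows that the letters generate freely, so the exponent sums of a word depend
  only on its class.\<close>

lemma ev_one_ex: "ev ws = mat 1 \<or> ev ws = - mat 1 \<Longrightarrow> exa ws = 0 \<and> exb ws = 0"
  using ex_reduced[of ws] reduced_ev_neq by fastforce

lemma ev_eq_ex:
  assumes "ev us = ev ws \<or> ev us = - ev ws"
  shows "exa us = exa ws \<and> exb us = exb ws"
proof -
  have "ev (us @ winv ws) = mat 1 \<or> ev (us @ winv ws) = - mat 1"
    using assms by (auto simp: ev_append ev_winv adj_inverse)
  from ev_one_ex[OF this] show ?thesis by simp
qed

section \<open>First homology\<close>

lemma subgroup_Gam: "subgroup Gam PSL2Z"
  unfolding Gam_eq by (rule word_classes_subgroup)

abbreviation GG where "GG \<equiv> PSL2Z\<lparr>carrier := Gam\<rparr>"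
abbreviation DG where "DG \<equiv> derived PSL2Z Gam"

lemma group_GG: "group GG"
  using subgroup.subgroup_is_group[OF subgroup_Gam group_PSL2Z] .

lemma DG_eq: "DG = derived GG (carrier GG)"
  using group.derived_consistent[OF group_PSL2Z _ subgroup_Gam, of Gam] by simp

lemma normal_DG: "DG \<lhd> GG"
  unfolding DG_eq by (rule group.derived_self_is_normal[OF group_GG])

lemma comm_H1: "comm_group H1"
  unfolding H1_def DG_eq by (rule group.derived_quot_is_comm_group[OF group_GG])

definition wcl :: "letter list \<Rightarrow> (int ^ 2 ^ 2) set set" where
  "wcl ws = H1_class (proj_class (ev ws))"

lemma mult_Gam: "proj_class (ev us) \<otimes>\<^bsub>PSL2Z\<^esub> proj_class (ev ws) = proj_class (ev (us @ ws))"
  by (simp add: mult_PSL2Z ev_append)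

lemma in_Gam: "proj_class (ev ws) \<in> Gam"
  by (simp add: Gam_eq)

lemma H1_class_eq: "H1_class h = DG #>\<^bsub>GG\<^esub> h"
  by (simp add: H1_class_def r_coset_def)

lemma carrier_H1: "carrier H1 = range wcl"
  by (auto simp: H1_def FactGroup_def RCOSETS_def wcl_def H1_class_eq Gam_eq)

lemma wcl_append: "wcl us \<otimes>\<^bsub>H1\<^esub> wcl ws = wcl (us @ ws)"
  using normal.rcos_sum[OF normal_DG, of "proj_class (ev us)" "proj_class (ev ws)"]
  by (simp add: H1_def FactGroup_def wcl_def H1_class_eq in_Gam mult_Gam)

lemma wcl_Nil: "wcl [] = \<one>\<^bsub>H1\<^esub>"
  using group.coset_mult_one[OF group_GG normal_imp_subgroup[OF normal_DG, THEN subgroup.subset]] one_PSL2Z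
  by (simp add: H1_def FactGroup_def wcl_def H1_class_eq)

lemma wcl_linv: "wcl [linv l] = inv\<^bsub>H1\<^esub> wcl [l]"
proof -
  interpret comm_group H1 by (rule comm_H1)
  have "wcl [linv l] \<otimes>\<^bsub>H1\<^esub> wcl [l] = wcl []"
    unfolding wcl_append by (simp add: wcl_def lm_linv adj_inverse)
  then show ?thesis by (intro inv_equality[symmetric]) (auto simp: wcl_Nil carrier_H1)
qed

lemma wcl_pow: "wcl ws = wcl [La] [^]\<^bsub>H1\<^esub> exa ws \<otimes>\<^bsub>H1\<^esub> wcl [Lb] [^]\<^bsub>H1\<^esub> exb ws"
proof (induction ws)
  interpret comm_group H1 by (rule comm_H1)
  have [simp]: "wcl us \<in> carrier H1" for us by (simp add: carrier_H1)
  {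
    case Nil then show ?case by (simp add: wcl_Nil)
  next
    case (Cons l ws)
    have l: "wcl [l] = wcl [La] [^]\<^bsub>H1\<^esub> ea l \<otimes>\<^bsub>H1\<^esub> wcl [Lb] [^]\<^bsub>H1\<^esub> eb l"
      using wcl_linv[of La] wcl_linv[of Lb] by (cases l) (auto simp: int_pow_neg int_pow_1)
    have "wcl (l # ws) = wcl [l] \<otimes>\<^bsub>H1\<^esub> wcl ws" using wcl_append[of "[l]" ws] by simp
    also have "\<dots> = wcl [La] [^]\<^bsub>H1\<^esub> exa (l # ws) \<otimes>\<^bsub>H1\<^esub> wcl [Lb] [^]\<^bsub>H1\<^esub> exb (l # ws)"
      unfolding l Cons by (simp add: int_pow_mult m_ac)
    finally show ?case .
  }
qed

abbreviation ZZ where "ZZ \<equiv> integer_group \<times>\<times> integer_group"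

lemma group_ZZ: "group ZZ"
  by (intro DirProd_group) auto

text \<open>The vector of exponent sums in the coordinates of the homology: the second letter stands for
  the inverse of beta, and alpha has the vector \<open>(1, - 1)\<close>.\<close>

definition hom_vec :: "letter list \<Rightarrow> int \<times> int" where
  "hom_vec ws = (exa ws, - exa ws - exb ws)"

text \<open>An isomorphism with the prescribed values is determined on all words, as the letters generate.\<close>

lemma hom_H1_word:
  assumes "\<phi> \<in> iso H1 ZZ" "\<phi> (H1_class gen_alpha) = (1, -1)" "\<phi> (H1_class gen_beta) = (0, 1)"
  shows "\<phi> (wcl ws) = hom_vec ws"
proof (induction ws)
  interpret group_hom H1 ZZ \<phi>
    using assms(1) comm_H1 group_ZZ by (auto simp: group_hom_def group_hom_axioms_def iso_def comm_group_def)
  have [simp]: "wcl us \<in> carrier H1" for us by (simp add: carrier_H1)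
  have ap: "\<phi> (wcl (us @ vs)) = (fst (\<phi> (wcl us)) + fst (\<phi> (wcl vs)), snd (\<phi> (wcl us)) + snd (\<phi> (wcl vs)))" for us vs
    using hom_mult[of "wcl us" "wcl vs"] by (simp add: wcl_append mult_DirProd')
  have nil: "\<phi> (wcl []) = (0, 0)" by (simp add: wcl_Nil)
  have a: "\<phi> (wcl [La]) = (1, -1)" using assms(2) by (simp add: gen_alpha_def wcl_def mx_def)
  have b: "\<phi> (wcl [LB]) = (0, 1)" using assms(3) by (simp add: gen_beta_def wcl_def mx_def)
  have i: "wcl ([linv l] @ [l]) = wcl []" for l
    by (simp add: wcl_def lm_linv adj_inverse)
  have A: "\<phi> (wcl [LA]) = (-1, 1)" using ap[of "[LA]" "[La]"] i[of La] nil a by (cases "\<phi> (wcl [LA])") auto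
  have B: "\<phi> (wcl [Lb]) = (0, -1)" using ap[of "[Lb]" "[LB]"] i[of LB] nil b by (cases "\<phi> (wcl [Lb])") auto
  {
    case Nil then show ?case by (simp add: nil hom_vec_def)
  next
    case (Cons l ws)
    then show ?case using ap[of "[l]" ws] a b A B by (cases l) (auto simp: hom_vec_def)
  }
qed

text \<open>Independent of the chosen word, since equal classes have equal exponent sums.\<close>

definition abel :: "(int ^ 2 ^ 2) set \<Rightarrow> int \<times> int" where
  "abel h = hom_vec (SOME ws. h = proj_class (ev ws))"

lemma abel_word: "abel (proj_class (ev ws)) = hom_vec ws"
proof -
  have "proj_class (ev ws) = proj_class (ev (SOME us. proj_class (ev ws) = proj_class (ev us)))"
    by (rule someI[of _ ws]) simp
  then have "ev ws = ev (SOME us. proj_class (ev ws) = proj_class (ev us)) \<or> ev ws = - ev (SOME us. proj_class (ev ws) = proj_class (ev us))"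
    by (simp only: proj_class_eq_iff)
  from ev_eq_ex[OF this] show ?thesis by (simp add: abel_def hom_vec_def)
qed

text \<open>The exponent sums are a surjective homomorphism, and a word with exponent sums zero is trivial in
  the abelianization.\<close>

lemma ex_hom_H1:
  "\<exists>\<phi>\<in>iso H1 ZZ. \<phi> (H1_class gen_alpha) = (1, -1) \<and> \<phi> (H1_class gen_beta) = (0, 1)"
proof -
  interpret A: group_hom GG ZZ abel
  proof (intro group_hom.intro group_hom_axioms.intro group_GG group_ZZ homI)
    fix x y assume "x \<in> carrier GG" "y \<in> carrier GG"
    then obtain us ws where "x = proj_class (ev us)" "y = proj_class (ev ws)" by (auto simp: Gam_eq)
    then show "abel (x \<otimes>\<^bsub>GG\<^esub> y) = abel x \<otimes>\<^bsub>ZZ\<^esub> abel y"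
      by (simp add: mult_Gam abel_word hom_vec_def)
  qed auto
  interpret Q: comm_group H1 by (rule comm_H1)
  have D1: "DG \<subseteq> kernel GG ZZ abel"
  proof -
    have "derived_set GG (carrier GG) \<subseteq> kernel GG ZZ abel"
    proof clarify
      fix x y assume xy: "x \<in> carrier GG" "y \<in> carrier GG"
      have "abel (x \<otimes>\<^bsub>GG\<^esub> y \<otimes>\<^bsub>GG\<^esub> inv\<^bsub>GG\<^esub> x \<otimes>\<^bsub>GG\<^esub> inv\<^bsub>GG\<^esub> y)
          = abel x \<otimes>\<^bsub>ZZ\<^esub> abel y \<otimes>\<^bsub>ZZ\<^esub> inv\<^bsub>ZZ\<^esub> abel x \<otimes>\<^bsub>ZZ\<^esub> inv\<^bsub>ZZ\<^esub> abel y"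
        using xy by (simp only: A.hom_mult A.hom_inv A.G.m_closed A.G.inv_closed)
      also have "\<dots> = \<one>\<^bsub>ZZ\<^esub>"
        by (cases "abel x"; cases "abel y") (simp add: inv_DirProd)
      finally show "x \<otimes>\<^bsub>GG\<^esub> y \<otimes>\<^bsub>GG\<^esub> inv\<^bsub>GG\<^esub> x \<otimes>\<^bsub>GG\<^esub> inv\<^bsub>GG\<^esub> y \<in> kernel GG ZZ abel"
        using xy by (simp only: kernel_def mem_Collect_eq A.G.m_closed A.G.inv_closed)
    qed
    then show ?thesis
      unfolding DG_eq by (subst derived_def) (intro A.G.generate_subgroup_incl A.subgroup_kernel)
  qed
  have D2: "kernel GG ZZ abel \<subseteq> DG"
  proof
    fix h assume h: "h \<in> kernel GG ZZ abel"
    then obtain ws where ws: "h = proj_class (ev ws)" by (auto simp: kernel_def Gam_eq)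
    then have "exa ws = 0" "exb ws = 0" using h by (auto simp: kernel_def abel_word hom_vec_def)
    then have "wcl ws = \<one>\<^bsub>H1\<^esub>" by (subst wcl_pow) simp
    then have "DG #>\<^bsub>GG\<^esub> h = DG" by (simp add: wcl_def ws H1_class_eq H1_def FactGroup_def)
    moreover have "h \<in> carrier GG" by (simp add: ws in_Gam)
    ultimately show "h \<in> DG"
      using A.G.coset_join1[of DG h] normal_imp_subgroup[OF normal_DG] subgroup.subset by blast
  qed
  have ker: "kernel GG ZZ abel = DG" using D1 D2 by blast
  have surj: "abel ` carrier GG = carrier ZZ"
  proof -
    have "\<exists>ws. hom_vec ws = (i, j)" for i j
    proof -
      have p: "exa (replicate n La) = int n" "exb (replicate n La) = 0" "exa (replicate n LA) = - int n" "exb (replicate n LA) = 0"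
        "exa (replicate n Lb) = 0" "exb (replicate n Lb) = int n" "exa (replicate n LB) = 0" "exb (replicate n LB) = - int n" for n
        by (induction n) auto
      obtain us where us: "exa us = i" "exb us = 0"
        using p(1,2)[of "nat i"] p(3,4)[of "nat (- i)"] by (cases "i \<ge> 0") auto
      obtain vs where vs: "exa vs = 0" "exb vs = - i - j"
        using p(5,6)[of "nat (- i - j)"] p(7,8)[of "nat (i + j)"] by (cases "- i - j \<ge> 0") auto
      show ?thesis by (rule exI[of _ "us @ vs"]) (simp add: hom_vec_def us vs)
    qed
    have "(i, j) \<in> abel ` carrier GG" for i j
    proof -
      obtain ws where "hom_vec ws = (i, j)" using \<open>\<And>i j. \<exists>ws. hom_vec ws = (i, j)\<close> by blast
      then have "(i, j) = abel (proj_class (ev ws))" by (simp add: abel_word)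
      then show ?thesis by (rule image_eqI) (simp add: in_Gam)
    qed
    then show ?thesis by auto
  qed
  let ?\<phi> = "\<lambda>K. the_elem (abel ` K)"
  have iso: "?\<phi> \<in> iso H1 ZZ"
    using A.FactGroup_iso_set[OF surj] unfolding ker H1_def .
  have val: "?\<phi> (wcl ws) = hom_vec ws" for ws
  proof -
    have "abel ` (DG #>\<^bsub>GG\<^esub> proj_class (ev ws)) = {hom_vec ws}"
    proof -
      have "abel (d \<otimes>\<^bsub>GG\<^esub> proj_class (ev ws)) = hom_vec ws" if "d \<in> DG" for d
      proof -
        have "d \<in> carrier GG" "abel d = (0, 0)" using that ker by (auto simp: kernel_def)
        then show ?thesis
          using A.hom_mult[of d "proj_class (ev ws)"] in_Gam[of ws] by (simp add: abel_word hom_vec_def)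
      qed
      moreover have "\<one>\<^bsub>GG\<^esub> \<in> DG" by (rule subgroup.one_closed[OF normal_imp_subgroup[OF normal_DG]])
      moreover have "DG #>\<^bsub>GG\<^esub> proj_class (ev ws) = (\<lambda>d. d \<otimes>\<^bsub>GG\<^esub> proj_class (ev ws)) ` DG"
        unfolding r_coset_def by blast
      ultimately have "abel ` (DG #>\<^bsub>GG\<^esub> proj_class (ev ws)) = (\<lambda>d. hom_vec ws) ` DG"
        by (simp only: image_image) (rule image_cong, simp_all)
      also have "\<dots> = {hom_vec ws}" using \<open>\<one>\<^bsub>GG\<^esub> \<in> DG\<close> by blast
      finally show ?thesis .
    qed
    then show ?thesis by (simp add: wcl_def H1_class_eq)
  qed
  show ?thesis
    using val[of "[La]"] val[of "[LB]"]
    by (intro bexI[OF _ iso]) (simp add: wcl_def gen_alpha_def gen_beta_def mx_def hom_vec_def)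
qed

lemma mob_uminus [simp]: "mob (- A) z = mob A z"
proof -
  have 1: "of_int ((- A)$1$1) * z + of_int ((- A)$1$2) = - (of_int (A$1$1) * z + of_int (A$1$2))"
   and 2: "of_int ((- A)$2$1) * z + of_int ((- A)$2$2) = - (of_int (A$2$1) * z + of_int (A$2$2))"
    by simp_all
  show ?thesis unfolding mob_def 1 2 by (rule minus_divide_divide)
qed

text \<open>From here on a homology class is a pair of exponent sums.\<close>

lemma has_homology_iff:
  "has_homology c L v \<longleftrightarrow> (\<exists>ws. (\<forall>t. c (t + L) = mob (ev ws) (c t)) \<and> hom_vec ws = v)"
proof
  assume "has_homology c L v"
  then obtain h A \<phi> where h: "h \<in> Gam" "A \<in> h" "\<forall>t. c (t + L) = mob A (c t)"
    and \<phi>: "\<phi> \<in> iso H1 ZZ" "\<phi> (H1_class gen_alpha) = (1, -1)" "\<phi> (H1_class gen_beta) = (0, 1)" "\<phi> (H1_class h) = v"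
    unfolding has_homology_def by blast
  obtain ws where ws: "h = proj_class (ev ws)" using h(1) by (auto simp: Gam_eq)
  have "\<forall>t. c (t + L) = mob (ev ws) (c t)" using h(2,3) ws by (auto simp: proj_class_eq)
  moreover have "hom_vec ws = v" using hom_H1_word[OF \<phi>(1-3), of ws] \<phi>(4) by (simp add: wcl_def ws)
  ultimately show "\<exists>ws. (\<forall>t. c (t + L) = mob (ev ws) (c t)) \<and> hom_vec ws = v" by blast
next
  assume "\<exists>ws. (\<forall>t. c (t + L) = mob (ev ws) (c t)) \<and> hom_vec ws = v"
  then obtain ws where ws: "\<forall>t. c (t + L) = mob (ev ws) (c t)" "hom_vec ws = v" by blast
  obtain \<phi> where \<phi>: "\<phi> \<in> iso H1 ZZ" "\<phi> (H1_class gen_alpha) = (1, -1)" "\<phi> (H1_class gen_beta) = (0, 1)"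
    using ex_hom_H1 by blast
  have "\<phi> (H1_class (proj_class (ev ws))) = v" using hom_H1_word[OF \<phi>, of ws] ws(2) by (simp add: wcl_def)
  moreover have "ev ws \<in> proj_class (ev ws)" by (simp add: proj_class_eq)
  ultimately show "has_homology c L v"
    unfolding has_homology_def using ws(1) \<phi> in_Gam by blast
qed

section \<open>Geodesics of the upper half-plane\<close>

text \<open>Real coefficients are needed to move an arbitrary pair of points to the imaginary axis.\<close>

definition rmob :: "real \<Rightarrow> real \<Rightarrow> real \<Rightarrow> real \<Rightarrow> complex \<Rightarrow> complex" where
  "rmob p q r s z = (of_real p * z + of_real q) / (of_real r * z + of_real s)"

lemma rmob_den_nz:
  assumes "p * s - q * r = 1" "Im z > 0"
  shows "of_real r * z + of_real s \<noteq> 0"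
proof
  assume e: "of_real r * z + of_real s = 0"
  then have "Im (of_real r * z + of_real s) = 0" by (simp only: zero_complex.sel)
  then have "r = 0" using assms(2) by simp
  moreover from this e have "s = 0" by simp
  ultimately show False using assms(1) by simp
qed

lemma rmob_diff:
  assumes "p * s - q * r = 1" "Im z > 0" "Im w > 0"
  shows "rmob p q r s z - rmob p q r s w = (z - w) / ((of_real r * z + of_real s) * (of_real r * w + of_real s))"
proof -
  let ?dz = "of_real r * z + of_real s" and ?dw = "of_real r * w + of_real s"
  have nz: "?dz \<noteq> 0" "?dw \<noteq> 0" using rmob_den_nz[OF assms(1)] assms(2,3) by auto
  have "rmob p q r s z - rmob p q r s w =
     ((of_real p * z + of_real q) * ?dw - (of_real p * w + of_real q) * ?dz) / (?dz * ?dw)"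
    unfolding rmob_def by (rule diff_frac_eq[OF nz])
  also have "(of_real p * z + of_real q) * ?dw - (of_real p * w + of_real q) * ?dz = of_real (p * s - q * r) * (z - w)"
    by (simp add: algebra_simps)
  finally show ?thesis by (simp add: assms(1))
qed

lemma Im_rmob:
  assumes "p * s - q * r = 1" "Im z > 0"
  shows "Im (rmob p q r s z) = Im z / (cmod (of_real r * z + of_real s))\<^sup>2"
proof -
  have "Im (rmob p q r s z) = ((p * Im z) * (r * Re z + s) - (p * Re z + q) * (r * Im z)) / (cmod (of_real r * z + of_real s))\<^sup>2"
    by (simp add: rmob_def Im_divide cmod_power2)
  also have "(p * Im z) * (r * Re z + s) - (p * Re z + q) * (r * Im z) = (p * s - q * r) * Im z"
    by (simp add: algebra_simps)
  finally show ?thesis by (simp add: assms(1))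
qed

lemma Im_rmob_pos: "p * s - q * r = 1 \<Longrightarrow> Im z > 0 \<Longrightarrow> Im (rmob p q r s z) > 0"
  using rmob_den_nz[of p s q r z] by (simp add: Im_rmob)

lemma rmob_comp:
  assumes "p * s - q * r = 1" "Im z > 0"
  shows "rmob a b c d (rmob p q r s z) = rmob (a * p + b * r) (a * q + b * s) (c * p + d * r) (c * q + d * s) z"
proof -
  let ?dz = "of_real r * z + of_real s"
  have nz: "?dz \<noteq> 0" using rmob_den_nz[OF assms] .
  have num: "rmob p q r s z * ?dz = of_real p * z + of_real q" using nz by (simp add: rmob_def)
  have "rmob a b c d (rmob p q r s z) =
     ((of_real a * rmob p q r s z + of_real b) * ?dz) / ((of_real c * rmob p q r s z + of_real d) * ?dz)"
    using nz by (simp add: rmob_def[of a])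
  also have "(of_real a * rmob p q r s z + of_real b) * ?dz = of_real (a * p + b * r) * z + of_real (a * q + b * s)"
    by (simp only: distrib_right[of _ _ "of_real r * z + of_real s"] mult.assoc num) (simp add: algebra_simps)
  also have "(of_real c * rmob p q r s z + of_real d) * ?dz = of_real (c * p + d * r) * z + of_real (c * q + d * s)"
    by (simp only: distrib_right[of _ _ "of_real r * z + of_real s"] mult.assoc num) (simp add: algebra_simps)
  finally show ?thesis by (simp add: rmob_def[of "a * p + b * r"])
qed

lemma rmob_comp_ex:
  assumes "a * d - b * c = 1" "p * s - q * r = 1"
  shows "\<exists>p' q' r' s'. p' * s' - q' * r' = 1 \<and> (\<forall>z. Im z > 0 \<longrightarrow> rmob a b c d (rmob p q r s z) = rmob p' q' r' s' z)"
proof -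
  have "(a * p + b * r) * (c * q + d * s) - (a * q + b * s) * (c * p + d * r) = (a * d - b * c) * (p * s - q * r)"
    by (simp add: algebra_simps)
  then have "(a * p + b * r) * (c * q + d * s) - (a * q + b * s) * (c * p + d * r) = 1" using assms by simp
  then show ?thesis using rmob_comp[OF assms(2), of _ a b c d] by blast
qed

lemma rmob_inverse:
  assumes "p * s - q * r = 1" "Im z > 0"
  shows "rmob s (- q) (- r) p (rmob p q r s z) = z"
proof -
  have e: "s * p + - q * r = 1" "s * q + - q * s = 0" "- r * p + p * r = 0" "- r * q + p * s = 1"
    using assms(1) by (simp_all add: algebra_simps)
  show ?thesis unfolding rmob_comp[OF assms] e by (simp add: rmob_def)
qed

lemma hyp_dist_rmob:
  assumes "p * s - q * r = 1" "Im z > 0" "Im w > 0"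
  shows "hyp_dist (rmob p q r s z) (rmob p q r s w) = hyp_dist z w"
proof -
  let ?dz = "of_real r * z + of_real s" and ?dw = "of_real r * w + of_real s"
  have nz: "?dz \<noteq> 0" "?dw \<noteq> 0" using rmob_den_nz[OF assms(1)] assms(2,3) by auto
  have "(cmod (rmob p q r s z - rmob p q r s w))\<^sup>2 / (2 * Im (rmob p q r s z) * Im (rmob p q r s w))
     = (cmod (z - w))\<^sup>2 / (2 * Im z * Im w)"
    unfolding rmob_diff[OF assms] Im_rmob[OF assms(1,2)] Im_rmob[OF assms(1,3)]
    using nz by (simp add: norm_divide norm_mult power_divide power_mult_distrib)
  then show ?thesis by (simp add: hyp_dist_def)
qed

lemma hyp_dist_eq_iff:
  assumes "Im z > 0" "Im w > 0"
  shows "hyp_dist z w = \<bar>t\<bar> \<longleftrightarrow> 1 + (cmod (z - w))\<^sup>2 / (2 * Im z * Im w) = cosh t"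
proof -
  have ge: "1 + (cmod (z - w))\<^sup>2 / (2 * Im z * Im w) \<ge> 1" using assms by simp
  show ?thesis
  proof
    assume "hyp_dist z w = \<bar>t\<bar>"
    then have "cosh (arcosh (1 + (cmod (z - w))\<^sup>2 / (2 * Im z * Im w))) = cosh \<bar>t\<bar>" by (simp add: hyp_dist_def)
    then show "1 + (cmod (z - w))\<^sup>2 / (2 * Im z * Im w) = cosh t"
      using ge by (simp add: cosh_arcosh_real)
  next
    assume "1 + (cmod (z - w))\<^sup>2 / (2 * Im z * Im w) = cosh t"
    then have "hyp_dist z w = arcosh (cosh \<bar>t\<bar>)" by (simp add: hyp_dist_def)
    then show "hyp_dist z w = \<bar>t\<bar>" by (simp add: arcosh_cosh_real del: cosh_real_abs)
  qed
qed

lemma cosh_exp: "cosh (s - t) = (exp s / exp t + exp t / exp s) / (2::real)"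
  by (simp add: cosh_def exp_diff)

lemma hyp_dist_imag:
  "hyp_dist (\<i> * of_real (exp s)) (\<i> * of_real (exp t)) = \<bar>s - t\<bar>"
proof -
  have "(cmod (\<i> * of_real (exp s) - \<i> * of_real (exp t)))\<^sup>2 = (exp s - exp t)\<^sup>2"
    by (simp add: cmod_power2)
  moreover have "1 + (exp s - exp t)\<^sup>2 / (2 * exp s * exp t) = cosh (s - t)"
    unfolding cosh_exp by (simp add: field_simps power2_eq_square)
  ultimately show ?thesis by (subst hyp_dist_eq_iff) auto
qed

text \<open>Distances to two points of the imaginary axis determine a point on it.\<close>

lemma geodesic_imag:
  assumes g: "geodesic_line c" and c0: "c 0 = \<i>" and c1: "c 1 = \<i> * of_real (exp 1)"
  shows "c t = \<i> * of_real (exp t)"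
proof -
  define u v where "u = Re (c t)" and "v = Im (c t)"
  have v: "v > 0" using g by (auto simp: geodesic_line_def v_def)
  have d0: "hyp_dist (c t) (c 0) = \<bar>t\<bar>" "hyp_dist (c t) (c 1) = \<bar>t - 1\<bar>" using g by (auto simp: geodesic_line_def)
  have 0: "1 + (u\<^sup>2 + (v - 1)\<^sup>2) / (2 * v) = cosh (t - 0)"
    using hyp_dist_eq_iff[of "c t" "c 0" t] d0(1) v by (simp add: c0 cmod_power2 u_def v_def)
  have 1: "1 + (u\<^sup>2 + (v - exp 1)\<^sup>2) / (2 * v * exp 1) = cosh (t - 1)"
    using hyp_dist_eq_iff[of "c t" "c 1" "t - 1"] d0(2) v by (simp add: c1 cmod_power2 u_def v_def)
  define E where "E = exp t"
  define e where "e = exp (1::real)"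
  have E: "E > 0" by (simp add: E_def)
  have e: "e > 1" by (simp add: e_def)
  have 2: "(u\<^sup>2 + v\<^sup>2 + 1) * E = v * (E\<^sup>2 + 1)"
    using 0 v E unfolding cosh_exp by (simp add: E_def[symmetric] field_simps power2_eq_square)
  have 3: "(u\<^sup>2 + v\<^sup>2 + e\<^sup>2) * E = v * (E\<^sup>2 + e\<^sup>2)"
  proof -
    have "1 + (u\<^sup>2 + (v - e)\<^sup>2) / (2 * v * e) = (E / e + e / E) / 2"
      using 1 unfolding cosh_exp by (simp add: E_def e_def)
    moreover have "1 + (u\<^sup>2 + (v - e)\<^sup>2) / (2 * v * e) = (u\<^sup>2 + v\<^sup>2 + e\<^sup>2) / (2 * v * e)"
      using v e by (simp add: field_simps power2_eq_square)
    moreover have "(E / e + e / E) / 2 = (E\<^sup>2 + e\<^sup>2) / (2 * E * e)"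
      using E e by (simp add: field_simps power2_eq_square)
    ultimately have "(u\<^sup>2 + v\<^sup>2 + e\<^sup>2) / (2 * v * e) = (E\<^sup>2 + e\<^sup>2) / (2 * E * e)" by simp
    then have "(u\<^sup>2 + v\<^sup>2 + e\<^sup>2) * (2 * E * e) = (E\<^sup>2 + e\<^sup>2) * (2 * v * e)"
      using v e E by (simp add: frac_eq_eq)
    then have "2 * e * ((u\<^sup>2 + v\<^sup>2 + e\<^sup>2) * E) = 2 * e * (v * (E\<^sup>2 + e\<^sup>2))" by (simp add: algebra_simps)
    then show ?thesis using e by simp
  qed
  have "(e\<^sup>2 - 1) * E = (e\<^sup>2 - 1) * v" using 2 3 by (simp add: algebra_simps)
  moreover have "e\<^sup>2 - 1 \<noteq> 0" using e by (simp add: power2_eq_1_iff)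
  ultimately have vE: "v = E" by simp
  then have "u\<^sup>2 * E = 0" using 2 by (simp add: algebra_simps power2_eq_square)
  then have "u = 0" using E by simp
  then show ?thesis using vE by (simp add: complex_eq_iff u_def v_def E_def)
qed

lemma rmob_to_imag:
  assumes "Im z > 0" "Im w > 0" "hyp_dist z w = 1"
  shows "\<exists>p q r s. p * s - q * r = 1 \<and> rmob p q r s z = \<i> \<and> rmob p q r s w = \<i> * of_real (exp 1)"
proof -
  define k where "k = sqrt (Im z)"
  have k: "k > 0" "k * k = Im z" using assms(1) by (simp_all add: k_def)
  define A where "A = rmob (1 / k) (- Re z / k) 0 k"
  have A1: "1 / k * k - - Re z / k * 0 = 1" using k by simp
  have Az: "A z = \<i>"
  proof -
    have "A z = (z - of_real (Re z)) / (of_real k * of_real k)"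
      using k(1) by (simp add: A_def rmob_def field_simps)
    also have "\<dots> = (z - of_real (Re z)) / of_real (Im z)" by (simp only: of_real_mult[symmetric] k(2))
    also have "z - of_real (Re z) = \<i> * of_real (Im z)" by (simp add: complex_eq_iff)
    finally show ?thesis using assms(1) by simp
  qed
  define w' where "w' = A w"
  have w': "Im w' > 0" using Im_rmob_pos[OF A1 assms(2)] by (simp add: w'_def A_def)
  define a b where "a = (cmod w')\<^sup>2 - 1" and "b = 2 * Re w'"
  have ex: "\<exists>\<phi>. b * cos (2 * \<phi>) = a * sin (2 * \<phi>)"
  proof (cases "a = 0 \<and> b = 0")
    case False
    then have R: "a\<^sup>2 + b\<^sup>2 > 0" by (simp add: sum_power2_gt_zero_iff)
    have "(a / sqrt (a\<^sup>2 + b\<^sup>2))\<^sup>2 + (b / sqrt (a\<^sup>2 + b\<^sup>2))\<^sup>2 = 1"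
      using R False by (simp add: power_divide add_divide_distrib[symmetric])
    from sincos_total_2pi[OF this] obtain \<psi> where "a / sqrt (a\<^sup>2 + b\<^sup>2) = cos \<psi>" "b / sqrt (a\<^sup>2 + b\<^sup>2) = sin \<psi>" by metis
    then have "b * cos \<psi> = a * sin \<psi>" by (metis mult.commute times_divide_eq_right)
    then show ?thesis by (intro exI[of _ "\<psi> / 2"]) simp
  qed auto
  then obtain \<phi> where \<phi>: "b * cos (2 * \<phi>) = a * sin (2 * \<phi>)" by blast
  define cc ss where "cc = cos \<phi>" and "ss = sin \<phi>"
  have cs: "cc * cc - ss * (- ss) = 1" by (simp add: cc_def ss_def)
  define B where "B = rmob cc ss (- ss) cc"
  have Bi: "B \<i> = \<i>"
  proof -
    have "of_real (- ss) * \<i> + of_real cc \<noteq> 0" using rmob_den_nz[OF cs, of \<i>] by simp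
    then show ?thesis unfolding B_def rmob_def by (simp add: divide_eq_eq algebra_simps)
  qed
  define w'' where "w'' = B w'"
  have w'': "Im w'' > 0" using Im_rmob_pos[OF cs w'] by (simp add: w''_def B_def)
  have "Re w'' = 0"
  proof -
    have a': "a = (Re w')\<^sup>2 + (Im w')\<^sup>2 - 1" by (simp add: a_def cmod_power2)
    have "(cc * Re w' + ss) * (cc - ss * Re w') - (cc * Im w') * (ss * Im w') =
        b / 2 * (cc * cc - ss * ss) - a / 2 * (2 * ss * cc)"
      unfolding a' b_def by (simp add: field_simps power2_eq_square)
    also have "\<dots> = (b * cos (2 * \<phi>) - a * sin (2 * \<phi>)) / 2"
      unfolding cos_double sin_double cc_def ss_def by (simp add: power2_eq_square field_simps)
    also have "\<dots> = 0" using \<phi> by simp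
    finally show ?thesis by (simp add: w''_def B_def rmob_def Re_divide algebra_simps)
  qed
  then have w''_eq: "w'' = \<i> * of_real (Im w'')" by (simp add: complex_eq_iff)
  have dA: "hyp_dist \<i> w' = 1"
    using hyp_dist_rmob[OF A1 assms(1,2)] Az assms(3) by (simp add: w'_def A_def)
  have "hyp_dist \<i> w'' = 1"
    using hyp_dist_rmob[OF cs _ w', of \<i>] Bi dA by (simp add: w''_def B_def)
  then have "hyp_dist (\<i> * of_real (exp 0)) (\<i> * of_real (exp (ln (Im w'')))) = 1"
    using w'' w''_eq by simp
  then have "\<bar>0 - ln (Im w'')\<bar> = 1" by (simp only: hyp_dist_imag)
  then have "ln (Im w'') = 1 \<or> ln (Im w'') = -1" by linarith
  then have "Im w'' = exp 1 \<or> Im w'' = exp (-1)" using w'' by (metis exp_ln)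
  then show ?thesis
  proof
    assume "Im w'' = exp 1"
    then have "rmob cc ss (- ss) cc (rmob (1 / k) (- Re z / k) 0 k w) = \<i> * of_real (exp 1)"
      using w''_eq by (simp add: w''_def B_def w'_def A_def)
    moreover have "rmob cc ss (- ss) cc (rmob (1 / k) (- Re z / k) 0 k z) = \<i>"
      using Az Bi by (simp add: A_def B_def)
    ultimately show ?thesis
      using rmob_comp_ex[OF cs A1] assms(1,2) by metis
  next
    assume e: "Im w'' = exp (-1)"
    have cs': "(- ss) * (- ss) - cc * (- cc) = 1" using cs by simp
    have S: "rmob (- ss) cc (- cc) (- ss) v = - 1 / rmob cc ss (- ss) cc v" for v
    proof -
      have "of_real (- cc) * v + of_real (- ss) = - (of_real cc * v + of_real ss)" by simp
      then show ?thesis unfolding rmob_def by (simp only: minus_divide_right[symmetric]) (simp add: minus_divide_left)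
    qed
    have "rmob (- ss) cc (- cc) (- ss) (rmob (1 / k) (- Re z / k) 0 k w) = - 1 / w''"
      unfolding S by (simp add: w''_def B_def w'_def A_def)
    also have "\<dots> = \<i> * of_real (exp 1)"
      by (subst w''_eq) (simp add: e exp_minus field_simps)
    finally have 1: "rmob (- ss) cc (- cc) (- ss) (rmob (1 / k) (- Re z / k) 0 k w) = \<i> * of_real (exp 1)" .
    have 2: "rmob (- ss) cc (- cc) (- ss) (rmob (1 / k) (- Re z / k) 0 k z) = \<i>"
      unfolding S using Az Bi by (simp add: A_def B_def)
    show ?thesis
      using 1 2 rmob_comp_ex[OF cs' A1] assms(1,2) by metis
  qed
qed

lemma geodesic_line_rmob:
  assumes "p * s - q * r = 1"
  shows "geodesic_line (\<lambda>t. rmob p q r s (\<i> * of_real (exp t)))"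
  unfolding geodesic_line_def
  using Im_rmob_pos[OF assms] hyp_dist_rmob[OF assms] hyp_dist_imag by simp

text \<open>An isometry takes the points at times 0 and 1 to the imaginary axis, and these two points determine the line.\<close>

lemma geodesic_line_iff:
  "geodesic_line c \<longleftrightarrow> (\<exists>p q r s. p * s - q * r = 1 \<and> (\<forall>t. c t = rmob p q r s (\<i> * of_real (exp t))))"
proof
  assume g: "geodesic_line c"
  then have Im: "Im (c t) > 0" for t by (simp add: geodesic_line_def)
  have "hyp_dist (c 0) (c 1) = \<bar>0 - 1\<bar>" using g unfolding geodesic_line_def by blast
  then have "hyp_dist (c 0) (c 1) = 1" by simp
  from rmob_to_imag[OF Im Im this] obtain p q r s where
    d: "p * s - q * r = 1" and "rmob p q r s (c 0) = \<i>" "rmob p q r s (c 1) = \<i> * of_real (exp 1)" by blast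
  moreover have "geodesic_line (\<lambda>t. rmob p q r s (c t))"
    using g Im_rmob_pos[OF d] hyp_dist_rmob[OF d] by (simp add: geodesic_line_def)
  ultimately have *: "rmob p q r s (c t) = \<i> * of_real (exp t)" for t
    using geodesic_imag[of "\<lambda>t. rmob p q r s (c t)"] by blast
  have "c t = rmob s (- q) (- r) p (\<i> * of_real (exp t))" for t
    using rmob_inverse[OF d Im, of t] * by simp
  moreover have "s * p - - q * - r = 1" using d by (simp add: algebra_simps)
  ultimately show "\<exists>p q r s. p * s - q * r = 1 \<and> (\<forall>t. c t = rmob p q r s (\<i> * of_real (exp t)))" by blast
next
  assume "\<exists>p q r s. p * s - q * r = 1 \<and> (\<forall>t. c t = rmob p q r s (\<i> * of_real (exp t)))"
  then obtain p q r s where "p * s - q * r = 1" "c = (\<lambda>t. rmob p q r s (\<i> * of_real (exp t)))" by blast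
  then show "geodesic_line c" using geodesic_line_rmob by blast
qed

text \<open>If \<open>x\<close> is a quadratic irrational, the other root of its integral equation is determined.\<close>

lemma conjugate_unique:
  assumes x: "x \<notin> \<rat>" and c: "c \<noteq> 0" "c' \<noteq> 0"
    and 1: "of_int c * (x + y) = real_of_int s" "of_int c * (x * y) = - real_of_int b"
    and 2: "of_int c' * (x + z) = real_of_int s'" "of_int c' * (x * z) = - real_of_int b'"
  shows "y = z"
proof -
  have q1: "of_int c * x\<^sup>2 = real_of_int s * x + of_int b"
    unfolding 1(1)[symmetric] using 1(2) by (simp add: power2_eq_square algebra_simps)
  have q2: "of_int c' * x\<^sup>2 = real_of_int s' * x + of_int b'"
    unfolding 2(1)[symmetric] using 2(2) by (simp add: power2_eq_square algebra_simps)
  have "of_int c' * (of_int c * x\<^sup>2) = of_int c * (of_int c' * x\<^sup>2)" by simp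
  then have "of_int (c' * s - c * s') * x + of_int (c' * b - c * b') = (0::real)"
    unfolding q1 q2 by (simp add: algebra_simps)
  from irrational_linear[OF x this] have "c' * s = c * s'" by simp
  then have "real_of_int c' * of_int s = of_int c * of_int s'" by (metis of_int_mult)
  then have "of_int c' * (of_int c * (x + y)) = of_int c * (of_int c' * (x + z))" unfolding 1(1) 2(1) .
  then show ?thesis using c by simp
qed

text \<open>The point \<open>gpt x y s\<close> runs through the geodesic from \<open>x\<close> to \<open>y\<close> as \<open>s\<close> runs through the
  numbers with the sign of \<open>y - x\<close>, and \<open>ln \<bar>s\<bar>\<close> is an arc length parameter.  A Moebius
  transformation multiplies \<open>s\<close> by the quotient of its denominators at the two endpoints.\<close>

definition gpt :: "real \<Rightarrow> real \<Rightarrow> real \<Rightarrow> complex" where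
  "gpt x y s = (of_real x + \<i> * of_real (s * y)) / (1 + \<i> * of_real s)"

lemma gpt_den_nz: "1 + \<i> * of_real s \<noteq> 0"
  by (simp add: complex_eq_iff)

lemma Re_gpt: "Re (gpt x y s) = (x + s\<^sup>2 * y) / (1 + s\<^sup>2)"
  by (simp add: gpt_def Re_divide power2_eq_square algebra_simps)

lemma Im_gpt: "Im (gpt x y s) = s * (y - x) / (1 + s\<^sup>2)"
  by (simp add: gpt_def Im_divide power2_eq_square algebra_simps)

lemma Im_gpt_pos: "s * (y - x) > 0 \<Longrightarrow> Im (gpt x y s) > 0"
  by (simp add: Im_gpt add_pos_nonneg)

lemma gpt_circle: "(Re (gpt x y s) - x) * (y - Re (gpt x y s)) = (Im (gpt x y s))\<^sup>2"
proof -
  have p: "1 + s\<^sup>2 > 0" by (simp add: add_pos_nonneg)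
  have "Re (gpt x y s) - x = s\<^sup>2 * (y - x) / (1 + s\<^sup>2)" "y - Re (gpt x y s) = (y - x) / (1 + s\<^sup>2)"
    using p by (simp_all add: Re_gpt field_simps)
  then show ?thesis by (simp add: Im_gpt power2_eq_square)
qed

lemma gpt_inj:
  assumes "gpt x y s = gpt x y s'" "x \<noteq> y" shows "s = s'"
proof -
  have "(of_real x + \<i> * of_real (s * y)) * (1 + \<i> * of_real s') = (of_real x + \<i> * of_real (s' * y)) * (1 + \<i> * of_real s)"
    using assms(1) gpt_den_nz by (simp add: gpt_def frac_eq_eq)
  then have "Im ((of_real x + \<i> * of_real (s * y)) * (1 + \<i> * of_real s')) = Im ((of_real x + \<i> * of_real (s' * y)) * (1 + \<i> * of_real s))"
    by simp
  then have "(s - s') * (y - x) = 0" by (simp add: algebra_simps)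
  then show ?thesis using assms(2) by simp
qed

lemma gpt_ex:
  assumes "v > 0" "(u - x) * (y - u) = v\<^sup>2"
  shows "\<exists>s. s * (y - x) > 0 \<and> gpt x y s = Complex u v"
proof -
  have yu: "y \<noteq> u" "u \<noteq> x" using assms by auto
  define s where "s = v / (y - u)"
  have s2: "s\<^sup>2 = (u - x) / (y - u)"
    using assms(2) yu by (simp add: s_def power_divide assms(2)[symmetric]) (simp add: power2_eq_square)
  have e: "1 + s\<^sup>2 = (y - x) / (y - u)" using yu by (simp add: s2 field_simps)
  have "(u - x) * (y - u) > 0" using assms by simp
  then have yx: "(y - x) / (y - u) > 0"
    by (auto simp: zero_less_mult_iff zero_less_divide_iff)
  then have yx': "y - x \<noteq> 0" by auto
  have "s * (y - x) = v * ((y - x) / (y - u))" by (simp add: s_def)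
  then have 1: "s * (y - x) > 0" using mult_pos_pos[OF assms(1) yx] by (simp only:)
  have "x + s\<^sup>2 * y = u * (1 + s\<^sup>2)" using yu by (simp add: s2 field_simps)
  then have "Re (gpt x y s) = u" using add_pos_nonneg[of 1 "s\<^sup>2"] by (simp add: Re_gpt)
  moreover have "Im (gpt x y s) = v" unfolding Im_gpt e using yu yx' by (simp add: s_def)
  ultimately show ?thesis using 1 by (intro exI[of _ s]) (simp add: complex_eq_iff)
qed

lemma gpt_flip: assumes "s \<noteq> 0" shows "gpt x y s = gpt y x (- 1 / s)"
proof -
  have "gpt y x (- 1 / s) = (of_real y + \<i> * of_real (- x / s)) * (\<i> * of_real s) / ((1 + \<i> * of_real (- 1 / s)) * (\<i> * of_real s))"
    using assms by (simp add: gpt_def)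
  also have "(of_real y + \<i> * of_real (- x / s)) * (\<i> * of_real s) = of_real x + \<i> * of_real (s * y)"
    using assms by (simp add: complex_eq_iff)
  also have "(1 + \<i> * of_real (- 1 / s)) * (\<i> * of_real s) = 1 + \<i> * of_real s"
    using assms by (simp add: complex_eq_iff)
  finally show ?thesis by (simp add: gpt_def)
qed

lemma gpt_top: "gpt x y 1 = Complex ((x + y) / 2) ((y - x) / 2)"
  by (simp add: complex_eq_iff Re_gpt Im_gpt)

lemma mob_eq_rmob: "mob A z = rmob (of_int (A$1$1)) (of_int (A$1$2)) (of_int (A$2$1)) (of_int (A$2$2)) z"
  by (simp add: mob_def rmob_def)

lemma det_real: "det (A :: int ^ 2 ^ 2) = 1 \<Longrightarrow> real_of_int (A$1$1) * real_of_int (A$2$2) - real_of_int (A$1$2) * real_of_int (A$2$1) = 1"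
proof -
  assume "det (A :: int ^ 2 ^ 2) = 1"
  then have "real_of_int (A$1$1 * A$2$2 - A$1$2 * A$2$1) = real_of_int 1"
    by (simp only: det_2)
  then show ?thesis by simp
qed

lemma Im_mob_pos: "det A = 1 \<Longrightarrow> Im z > 0 \<Longrightarrow> Im (mob A z) > 0"
  unfolding mob_eq_rmob by (rule Im_rmob_pos[OF det_real])

lemma mob_mult: "det B = 1 \<Longrightarrow> Im z > 0 \<Longrightarrow> mob (A ** B) z = mob A (mob B z)"
  unfolding mob_eq_rmob by (subst rmob_comp[OF det_real]) simp_all

lemma mob_one [simp]: "mob (mat 1) z = z"
  by (simp add: mob_def)

lemma mob_adj: "det A = 1 \<Longrightarrow> Im z > 0 \<Longrightarrow> mob (adj A) (mob A z) = z"
  by (simp add: mob_mult[symmetric] adj_inverse)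

lemma mob_Tm [simp]: "mob (Tm k) z = z + of_int k"
  by (simp add: mob_def Tm_def)

lemma mob_gpt:
  assumes "den A x \<noteq> 0" "den A y \<noteq> 0"
  shows "mob A (gpt x y s) = gpt (rm A x) (rm A y) (s * den A y / den A x)"
proof -
  let ?n = "1 + \<i> * of_real s" and ?dx = "of_real (den A x) :: complex" and ?dy = "of_real (den A y) :: complex"
  let ?a = "of_int (A$1$1) :: complex" and ?b = "of_int (A$1$2) :: complex"
  let ?c = "of_int (A$2$1) :: complex" and ?d = "of_int (A$2$2) :: complex"
  have nz: "?n \<noteq> 0" by (rule gpt_den_nz)
  have d: "?dx \<noteq> 0" "?dy \<noteq> 0" using assms by auto
  have g: "gpt x y s * ?n = of_real x + \<i> * of_real s * of_real y" using nz by (simp add: gpt_def)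
  have dx: "?dx = ?c * of_real x + ?d" and dy: "?dy = ?c * of_real y + ?d" by (simp_all add: den_def)
  have "mob A (gpt x y s) = ((?a * gpt x y s + ?b) * ?n) / ((?c * gpt x y s + ?d) * ?n)"
    using nz by (simp add: mob_def)
  also have "(?a * gpt x y s + ?b) * ?n = (?a * of_real x + ?b) + \<i> * of_real s * (?a * of_real y + ?b)"
    by (simp only: distrib_right[of _ _ ?n] mult.assoc g) (simp add: algebra_simps)
  also have "(?c * gpt x y s + ?d) * ?n = ?dx + \<i> * of_real s * ?dy"
    by (simp only: distrib_right[of _ _ ?n] mult.assoc g dx dy) (simp add: algebra_simps)
  also have "?a * of_real x + ?b = of_real (rm A x) * ?dx"
    using assms(1) by (simp add: rm_def)
  also have "?a * of_real y + ?b = of_real (rm A y) * ?dy"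
    using assms(2) by (simp add: rm_def)
  also have "(of_real (rm A x) * ?dx + \<i> * of_real s * (of_real (rm A y) * ?dy)) / (?dx + \<i> * of_real s * ?dy)
      = gpt (rm A x) (rm A y) (s * den A y / den A x)"
  proof -
    have m1: "of_real (rm A x) * ?dx + \<i> * of_real s * (of_real (rm A y) * ?dy)
        = (of_real (rm A x) + \<i> * of_real (s * den A y / den A x * rm A y)) * ?dx"
      using d by (simp add: field_simps)
    have m2: "?dx + \<i> * of_real s * ?dy = (1 + \<i> * of_real (s * den A y / den A x)) * ?dx"
      using d by (simp add: field_simps)
    show ?thesis
      unfolding m1 m2 gpt_def by (rule nonzero_mult_divide_mult_cancel_right[OF d(1)])
  qed
  finally show ?thesis .
qed

lemma gpt_sign:
  assumes "x \<notin> \<rat>" "y \<notin> \<rat>" "det A = 1" "s * (y - x) > 0"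
  shows "s * den A y / den A x * (rm A y - rm A x) > 0"
proof -
  have d: "den A x \<noteq> 0" "den A y \<noteq> 0" using den_nz assms by auto
  have "s * den A y / den A x * (rm A y - rm A x) = s * (y - x) / (den A x)\<^sup>2"
    unfolding rm_diff[OF assms(1-3)] using d by (simp add: field_simps power2_eq_square)
  then show ?thesis using assms(4) d by simp
qed

lemma geodesic_cases:
  assumes "geodesic_line c"
  obtains (semicircle) x y k where "k * (y - x) > 0" "\<And>t. c t = gpt x y (k * exp t)"
  | (up) u k where "k > 0" "\<And>t. c t = Complex u (k * exp t)"
  | (down) u k where "k > 0" "\<And>t. c t = Complex u (k * exp (- t))"
proof -
  obtain p q r s where d: "p * s - q * r = 1" and c: "\<And>t. c t = rmob p q r s (\<i> * of_real (exp t))"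
    using assms geodesic_line_iff by blast
  consider "r = 0" | "s = 0" | "r \<noteq> 0" "s \<noteq> 0" by blast
  then show thesis
  proof cases
    case 1
    then have s: "p * s = 1" "s \<noteq> 0" using d by auto
    then have p: "p = 1 / s" by (simp add: field_simps)
    have "c t = Complex (q / s) ((1 / s\<^sup>2) * exp t)" for t
      using s by (simp add: c rmob_def 1 p complex_eq_iff Re_divide Im_divide power2_eq_square)
    then show thesis using up[of "1 / s\<^sup>2" "q / s"] s by simp
  next
    case 2
    then have r: "q * r = - 1" "r \<noteq> 0" using d by auto
    then have q: "q = - 1 / r" by (simp add: field_simps)
    have "c t = Complex (p / r) ((1 / r\<^sup>2) * exp (- t))" for t
      using r by (simp add: c rmob_def 2 q complex_eq_iff Re_divide Im_divide power2_eq_square exp_minus field_simps)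
    then show thesis using down[of "1 / r\<^sup>2" "p / r"] r by simp
  next
    case 3
    have e: "p / r - q / s = 1 / (r * s)"
    proof -
      have "p / r - q / s = (p * s - q * r) / (r * s)" using 3 by (simp add: field_simps)
      then show ?thesis by (simp add: d)
    qed
    have "r / s * (p / r - q / s) > 0" unfolding e using 3 by (simp add: field_simps) (simp add: power2_eq_square[symmetric])
    moreover have "c t = gpt (q / s) (p / r) (r / s * exp t)" for t
    proof -
      have n: "of_real r * (\<i> * of_real (exp t)) + of_real s \<noteq> 0"
        using rmob_den_nz[OF d, of "\<i> * of_real (exp t)"] by simp
      have "gpt (q / s) (p / r) (r / s * exp t) = (of_real s * (of_real (q / s) + \<i> * of_real (r / s * exp t * (p / r)))) / (of_real s * (1 + \<i> * of_real (r / s * exp t)))"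
        using 3 by (simp add: gpt_def)
      also have "of_real s * (of_real (q / s) + \<i> * of_real (r / s * exp t * (p / r))) = of_real p * (\<i> * of_real (exp t)) + of_real q"
        using 3 by (simp add: field_simps)
      also have "of_real s * (1 + \<i> * of_real (r / s * exp t)) = of_real r * (\<i> * of_real (exp t)) + of_real s"
        using 3 by (simp add: field_simps)
      finally show ?thesis by (simp add: c rmob_def)
    qed
    ultimately show thesis using semicircle by blast
  qed
qed

lemma geodesic_gpt:
  assumes "k * (y - x) > 0" shows "geodesic_line (\<lambda>t. gpt x y (k * exp t))"
proof -
  define K where "K = sqrt (k * (y - x))"
  have K: "K > 0" "K * K = k * (y - x)" using assms real_sqrt_gt_zero[OF assms] by (simp_all add: K_def)
  define s where "s = 1 / K"
  have s: "s > 0" "s * s * (k * (y - x)) = 1"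
    using K(1) by (simp_all add: s_def K(2)[symmetric])
  have "(y * k * s) * s - (x * s) * (k * s) = 1" using s by (simp add: algebra_simps)
  moreover have "gpt x y (k * exp t) = rmob (y * k * s) (x * s) (k * s) s (\<i> * of_real (exp t))" for t
  proof -
    have "rmob (y * k * s) (x * s) (k * s) s (\<i> * of_real (exp t)) =
       (of_real s * (of_real x + \<i> * of_real (k * exp t * y))) / (of_real s * (1 + \<i> * of_real (k * exp t)))"
      by (simp add: rmob_def algebra_simps)
    also have "\<dots> = gpt x y (k * exp t)" using s(1) by (simp add: gpt_def)
    finally show ?thesis by simp
  qed
  ultimately show ?thesis using geodesic_line_iff by blast
qed

lemma geodesic_vertical:
  assumes "k > 0" shows "geodesic_line (\<lambda>t. Complex u (k * exp t))"
proof -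
  define s where "s = 1 / sqrt k"
  have s: "s > 0" "s * s * k = 1" using assms by (simp_all add: s_def)
  have "(k * s) * s - (u * s) * 0 = 1" using s by (simp add: algebra_simps)
  moreover have "Complex u (k * exp t) = rmob (k * s) (u * s) 0 s (\<i> * of_real (exp t))" for t
    using s(1) by (simp add: rmob_def complex_eq_iff Re_divide Im_divide power2_eq_square)
  ultimately show ?thesis using geodesic_line_iff by blast
qed

lemma gpt_tendsto_top:
  assumes "k \<noteq> 0" shows "((\<lambda>t. gpt x y (k * exp t)) \<longlongrightarrow> of_real y) at_top"
proof -
  have "norm (gpt x y (k * exp t) - of_real y) \<le> \<bar>x - y\<bar> / \<bar>k\<bar> * exp (- t)" for t
  proof -
    let ?s = "k * exp t"
    have s: "?s \<noteq> 0" using assms by simp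
    have "gpt x y ?s - of_real y = of_real (x - y) / (1 + \<i> * of_real ?s)"
      using gpt_den_nz[of ?s] by (simp add: gpt_def field_simps)
    then have "norm (gpt x y ?s - of_real y) = \<bar>x - y\<bar> / norm (1 + \<i> * of_real ?s)"
      by (simp add: norm_divide del: of_real_mult of_real_diff)
    also have "\<dots> \<le> \<bar>x - y\<bar> / \<bar>?s\<bar>"
    proof (rule divide_left_mono)
      show "\<bar>?s\<bar> \<le> norm (1 + \<i> * of_real ?s)"
        using abs_Im_le_cmod[of "1 + \<i> * of_real ?s"] by simp
      show "0 < norm (1 + \<i> * of_real ?s) * \<bar>?s\<bar>" using s gpt_den_nz[of ?s] by (simp del: of_real_mult)
    qed simp
    also have "\<dots> = \<bar>x - y\<bar> / \<bar>k\<bar> * exp (- t)"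
      by (simp add: abs_mult exp_minus field_simps)
    finally show ?thesis .
  qed
  moreover have "((\<lambda>t. \<bar>x - y\<bar> / \<bar>k\<bar> * exp (- t :: real)) \<longlongrightarrow> 0) at_top"
    by (intro tendsto_mult_right_zero filterlim_compose[OF exp_at_bot] filterlim_uminus_at_bot_at_top)
  ultimately have "((\<lambda>t. gpt x y (k * exp t) - of_real y) \<longlongrightarrow> 0) at_top"
    by (rule Lim_null_comparison[OF always_eventually[rule_format]])
  then show ?thesis by (simp add: LIM_zero_iff)
qed

lemma gpt_unique:
  assumes "k * (y - x) > 0" "k' * (y' - x') > 0" "\<And>t. gpt x y (k * exp t) = gpt x' y' (k' * exp t)"
  shows "x = x'" "y = y'" "k = k'"
proof -
  have k: "k \<noteq> 0" "k' \<noteq> 0" using assms(1,2) by auto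
  have "((\<lambda>t. gpt x y (k * exp t)) \<longlongrightarrow> of_real y') at_top"
    using gpt_tendsto_top[OF k(2)] assms(3) by simp
  then have "(of_real y :: complex) = of_real y'"
    using gpt_tendsto_top[OF k(1)] tendsto_unique[OF trivial_limit_at_top_linorder] by blast
  then show y: "y = y'" by simp
  have f: "gpt y x (- 1 / k * exp t) = gpt x y (k * exp (- t))" if "k \<noteq> 0" for x y k t
    using gpt_flip[of "k * exp (- t)" x y] that by (simp add: exp_minus field_simps)
  have "((\<lambda>t. gpt y x (- 1 / k * exp t)) \<longlongrightarrow> of_real x') at_top"
    using gpt_tendsto_top[of "- 1 / k'" y' x'] k assms(3) by (simp only: f[OF k(1)] f[OF k(2)]) simp
  then have "(of_real x :: complex) = of_real x'"
    using tendsto_unique[OF trivial_limit_at_top_linorder gpt_tendsto_top[of "- 1 / k" y x]] k by simp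
  then show x: "x = x'" by simp
  have "x \<noteq> y" using assms(1) by auto
  then show "k = k'" using gpt_inj[of x y k k'] assms(3)[of 0] x y by simp
qed

lemma gpt_has_vector_derivative:
  "((\<lambda>t. gpt x y (k * exp t)) has_vector_derivative
     \<i> * of_real (k * exp t * (y - x)) / (1 + \<i> * of_real (k * exp t))\<^sup>2) (at t)"
proof -
  let ?n = "\<lambda>t. 1 + \<i> * of_real (k * exp t)"
  have nz: "?n t \<noteq> 0" for t by (rule gpt_den_nz)
  have e: "((\<lambda>t. of_real (k * exp t) :: complex) has_vector_derivative of_real (k * exp t)) (at t)"
    by (rule has_vector_derivative_of_real) (auto intro!: derivative_eq_intros)
  have "gpt x y (k * exp t) = of_real y + of_real (x - y) * inverse (?n t)" for t
    using nz[of t] by (simp add: gpt_def field_simps)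
  moreover have "((\<lambda>t. of_real y + of_real (x - y) * inverse (?n t)) has_vector_derivative
     \<i> * of_real (k * exp t * (y - x)) / (?n t)\<^sup>2) (at t)"
  proof -
    have n: "(?n has_vector_derivative \<i> * of_real (k * exp t)) (at t)"
      by (auto intro!: derivative_eq_intros e)
    have i: "(inverse has_field_derivative - (inverse (?n t))\<^sup>2) (at (?n t))"
      using DERIV_inverse[OF nz[of t], of UNIV] by (simp add: power2_eq_square power_Suc numeral_2_eq_2)
    have "((inverse \<circ> ?n) has_vector_derivative \<i> * of_real (k * exp t) * (- (inverse (?n t))\<^sup>2)) (at t)"
      by (rule field_vector_diff_chain_at[OF n i])
    then have "((\<lambda>t. inverse (?n t)) has_vector_derivative \<i> * of_real (k * exp t) * (- (inverse (?n t))\<^sup>2)) (at t)"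
      by (simp add: o_def)
    then have "((\<lambda>t. of_real y + of_real (x - y) * inverse (?n t)) has_vector_derivative
        of_real (x - y) * (\<i> * of_real (k * exp t) * (- (inverse (?n t))\<^sup>2))) (at t)"
      by (auto intro!: derivative_eq_intros)
    then show ?thesis
      by (simp add: divide_inverse power_inverse algebra_simps)
  qed
  ultimately show ?thesis by simp
qed

section \<open>Linked pairs of endpoints\<close>

text \<open>The pairs separate each other on the circle of real numbers and infinity; the sign of the product
  is that of a cross ratio.\<close>

definition linked :: "real \<Rightarrow> real \<Rightarrow> real \<Rightarrow> real \<Rightarrow> bool" where
  "linked x y x' y' \<longleftrightarrow> (x' - x) * (x' - y) * ((y' - x) * (y' - y)) < 0"

lemma linked_sym: "linked x y x' y' \<longleftrightarrow> linked x' y' x y"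
  by (simp add: linked_def algebra_simps)

lemma linked_swap: "linked y x x' y' \<longleftrightarrow> linked x y x' y'" "linked x y y' x' \<longleftrightarrow> linked x y x' y'"
  by (simp_all add: linked_def algebra_simps)

lemma linked_rm:
  assumes "x \<notin> \<rat>" "y \<notin> \<rat>" "x' \<notin> \<rat>" "y' \<notin> \<rat>" "det A = 1"
  shows "linked (rm A x) (rm A y) (rm A x') (rm A y') \<longleftrightarrow> linked x y x' y'"
proof -
  let ?D = "den A x * den A y * den A x' * den A y'"
  have nz: "?D \<noteq> 0" using den_nz assms by simp
  have "(rm A x' - rm A x) * (rm A x' - rm A y) * ((rm A y' - rm A x) * (rm A y' - rm A y))
     = (x' - x) * (x' - y) * ((y' - x) * (y' - y)) / ?D\<^sup>2"
    unfolding rm_diff[OF assms(1,3,5)] rm_diff[OF assms(2,3,5)] rm_diff[OF assms(1,4,5)] rm_diff[OF assms(2,4,5)]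
    by (simp add: power2_eq_square ac_simps)
  then show ?thesis using nz by (simp add: linked_def divide_less_0_iff)
qed

text \<open>Two semicircles meet in at most one point, and there their endpoints alternate.\<close>

lemma meet_linked:
  assumes "s * (y - x) > 0" "s' * (y' - x') > 0" "gpt x y s = gpt x' y' s'"
  shows "linked x y x' y' \<or> (x = x' \<and> y = y') \<or> (x = y' \<and> y = x')"
proof -
  define u v where "u = Re (gpt x y s)" and "v = Im (gpt x y s)"
  have v: "v > 0" using Im_gpt_pos[OF assms(1)] by (simp add: v_def)
  have 1: "(u - x) * (y - u) = v\<^sup>2" "(u - x') * (y' - u) = v\<^sup>2"
    using gpt_circle[of x y s] gpt_circle[of x' y' s'] assms(3) by (simp_all add: u_def v_def)
  have xy: "x * y = u * (x + y) - u\<^sup>2 - v\<^sup>2" "x' * y' = u * (x' + y') - u\<^sup>2 - v\<^sup>2"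
    using 1 by (simp_all add: algebra_simps power2_eq_square)
  have "(x' - x) * (x' - y) * ((y' - x) * (y' - y)) = - v\<^sup>2 * (x' + y' - x - y)\<^sup>2"
  proof -
    have "(x' - x) * (x' - y) * ((y' - x) * (y' - y)) =
        (x' * y')\<^sup>2 - (x + y) * (x' + y') * (x' * y') + (x * y) * ((x' + y')\<^sup>2 - 2 * (x' * y')) + (x + y)\<^sup>2 * (x' * y') - (x + y) * (x * y) * (x' + y') + (x * y)\<^sup>2"
      by (simp add: algebra_simps power2_eq_square)
    also have "\<dots> = - v\<^sup>2 * ((x' + y') - (x + y))\<^sup>2"
      unfolding xy by (simp add: algebra_simps power2_eq_square)
    finally show ?thesis by (simp add: algebra_simps)
  qed
  then have "linked x y x' y' \<or> x' + y' - x - y = 0"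
    using v by (auto simp: linked_def)
  moreover have "(x = x' \<and> y = y') \<or> (x = y' \<and> y = x')" if "x' + y' - x - y = 0"
  proof -
    have "x' + y' = x + y" using that by simp
    then have "x * y = x' * y'" by (simp add: xy)
    moreover have "(x' - x) * (x' - y) = x' * x' - x' * (x + y) + x * y" by (simp add: algebra_simps)
    ultimately have "(x' - x) * (x' - y) = x' * x' - x' * (x' + y') + x' * y'" using \<open>x' + y' = x + y\<close> by simp
    then have "(x' - x) * (x' - y) = 0" by (simp add: algebra_simps)
    then show ?thesis using \<open>x' + y' = x + y\<close> by auto
  qed
  ultimately show ?thesis by blast
qed

lemma linked_meet:
  assumes "linked x y x' y'"
  shows "\<exists>s s'. s * (y - x) > 0 \<and> s' * (y' - x') > 0 \<and> gpt x y s = gpt x' y' s'"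
proof -
  define d where "d = x + y - x' - y'"
  define N where "N = x * y - x' * y'"
  define u where "u = N / d"
  define w where "w = (u - x) * (y - u)"
  have id: "(x' - x) * (x' - y) * ((y' - x) * (y' - y)) = N\<^sup>2 - (x + y) * d * N + x * y * d\<^sup>2"
    by (simp add: d_def N_def algebra_simps power2_eq_square)
  have d0: "d \<noteq> 0"
  proof
    assume "d = 0"
    then have "(x' - x) * (x' - y) * ((y' - x) * (y' - y)) = N\<^sup>2" using id by simp
    then show False using assms by (simp add: linked_def)
  qed
  have ud: "u * d = N" using d0 by (simp add: u_def)
  have "w * d\<^sup>2 = - ((u * d)\<^sup>2 - (x + y) * d * (u * d) + x * y * d\<^sup>2)"
    by (simp add: w_def algebra_simps power2_eq_square)
  then have "w * d\<^sup>2 > 0" using assms id by (simp add: ud linked_def)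
  then have w: "w > 0" by (simp add: zero_less_mult_iff)
  have w': "w = (u - x') * (y' - u)"
  proof -
    have "(u - x) * (y - u) - (u - x') * (y' - u) = u * d - N"
      by (simp add: d_def N_def algebra_simps)
    then show ?thesis by (simp add: w_def ud)
  qed
  define v where "v = sqrt w"
  have v: "v > 0" "v\<^sup>2 = w" using w by (simp_all add: v_def)
  obtain s where s: "s * (y - x) > 0" "gpt x y s = Complex u v" using gpt_ex[OF v(1), of u x y] v(2) w_def by auto
  obtain s' where s': "s' * (y' - x') > 0" "gpt x' y' s' = Complex u v" using gpt_ex[OF v(1), of u x' y'] v(2) w' by auto
  show ?thesis using s s' by metis
qed

section \<open>Points of the torus\<close>

lemma to_torus_word: "to_torus z = {mob (ev ws) z | ws. True}"
  unfolding to_torus_def using Union_Gam by auto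

lemma to_torus_eq_iff:
  assumes "Im z > 0" "Im w > 0"
  shows "to_torus z = to_torus w \<longleftrightarrow> (\<exists>ws. w = mob (ev ws) z)"
proof
  assume "to_torus z = to_torus w"
  moreover have "w \<in> to_torus w" unfolding to_torus_word by (auto intro!: exI[of _ "[]"])
  ultimately show "\<exists>ws. w = mob (ev ws) z" unfolding to_torus_word by blast
next
  assume "\<exists>ws. w = mob (ev ws) z"
  then obtain ws where w: "w = mob (ev ws) z" by blast
  have "mob (ev us) w = mob (ev (us @ ws)) z" for us
    using assms by (simp add: w ev_append mob_mult)
  moreover have "mob (ev us) z = mob (ev (us @ winv ws)) w" for us
    using assms by (simp add: ev_append mob_mult ev_winv) (simp add: w mob_adj)
  ultimately show "to_torus z = to_torus w" unfolding to_torus_word by blast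
qed

lemma to_torus_mob: "Im z > 0 \<Longrightarrow> to_torus (mob (ev ws) z) = to_torus z"
  using to_torus_eq_iff[of z "mob (ev ws) z"] Im_mob_pos[of "ev ws" z] by auto

lemma to_torus_shift:
  assumes "Im z > 0" "Im w > 0"
  shows "to_torus (z + of_int k) = to_torus (w + of_int k) \<longleftrightarrow> to_torus z = to_torus w"
proof -
  have *: "to_torus (z + of_int k) = to_torus (w + of_int k)" if zw: "Im z > 0" "Im w > 0" "to_torus z = to_torus w" for z w k
  proof -
    obtain ws where w: "w = mob (ev ws) z" using zw to_torus_eq_iff by blast
    obtain ws' where ws': "Tm k ** ev ws = ev ws' ** Tm k" using ev_Tm' by blast
    have "w + of_int k = mob (Tm k ** ev ws) z" using zw by (simp add: mob_mult w)
    also have "\<dots> = mob (ev ws') (z + of_int k)" using zw by (simp add: ws' mob_mult)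
    finally show ?thesis using zw by (simp add: to_torus_mob)
  qed
  show ?thesis using *[of z w k] *[of "z + of_int k" "w + of_int k" "- k"] assms by auto
qed

section \<open>Fixed points of positive matrices\<close>

text \<open>The number \<open>T\<^sup>2 - 4\<close> lies strictly between the squares of the consecutive integers \<open>\<bar>T\<bar> - 1\<close> and \<open>\<bar>T\<bar>\<close>.\<close>

lemma sqrt_disc_irrational:
  fixes T :: int and z :: real
  assumes "\<bar>T\<bar> \<ge> 3" "z\<^sup>2 = (of_int T)\<^sup>2 - 4"
  shows "z \<notin> \<rat>"
proof
  assume "z \<in> \<rat>"
  then obtain m k :: nat where mk: "k \<noteq> 0" "\<bar>z\<bar> = real m / real k" "coprime m k" by (rule Rats_abs_nat_div_natE)
  have "(real m / real k)\<^sup>2 = (of_int T)\<^sup>2 - 4" using mk(2) assms(2) by (metis power2_abs)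
  then have "(real m)\<^sup>2 = ((of_int T)\<^sup>2 - 4) * (real k)\<^sup>2" using mk(1) by (simp add: power_divide field_simps)
  then have "real_of_int ((int m)\<^sup>2) = real_of_int ((T\<^sup>2 - 4) * (int k)\<^sup>2)" by simp
  then have e: "(int m)\<^sup>2 = (T\<^sup>2 - 4) * (int k)\<^sup>2" by (simp only: of_int_eq_iff)
  then have "(int k)\<^sup>2 dvd (int m)\<^sup>2" by simp
  then have "k dvd m" by (simp add: pow_divides_pow_iff)
  then have "k = 1" using coprime_common_divisor_nat[OF mk(3)] by simp
  then have m: "(int m)\<^sup>2 = T\<^sup>2 - 4" using e by simp
  have "(\<bar>T\<bar> - 1)\<^sup>2 < (int m)\<^sup>2" using assms(1) by (simp add: m power2_diff)
  then have 1: "\<bar>T\<bar> - 1 < int m" by (rule power2_less_imp_less) simp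
  have "(int m)\<^sup>2 < \<bar>T\<bar>\<^sup>2" by (simp add: m)
  then have "int m < \<bar>T\<bar>" by (rule power2_less_imp_less) simp
  then show False using 1 by simp
qed

lemma fixed_point_quadratic:
  assumes "den A x \<noteq> 0"
  shows "rm A x = x \<longleftrightarrow> of_int (A$2$1) * x\<^sup>2 + (of_int (A$2$2) - of_int (A$1$1)) * x - of_int (A$1$2) = (0::real)"
  using assms by (simp add: rm_def divide_eq_eq) (auto simp: den_def algebra_simps power2_eq_square)

lemma fixed_point_irrational:
  fixes A :: "int ^ 2 ^ 2"
  assumes "det A = 1" "\<bar>trace A\<bar> \<ge> 3" "A$2$1 \<noteq> 0"
    "of_int (A$2$1) * x\<^sup>2 + (of_int (A$2$2) - of_int (A$1$1)) * x - of_int (A$1$2) = (0::real)"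
  shows "x \<notin> \<rat>"
proof
  assume x: "x \<in> \<rat>"
  define z where "z = 2 * of_int (A$2$1) * x + of_int (A$2$2) - of_int (A$1$1)"
  have "z\<^sup>2 = 4 * of_int (A$2$1) * (of_int (A$2$1) * x\<^sup>2 + (of_int (A$2$2) - of_int (A$1$1)) * x - of_int (A$1$2))
      + (of_int (A$2$2) - of_int (A$1$1))\<^sup>2 + 4 * of_int (A$2$1) * of_int (A$1$2)"
    by (simp add: z_def algebra_simps power2_eq_square)
  also have "\<dots> = (of_int (trace A))\<^sup>2 - 4 * (of_int (A$1$1) * of_int (A$2$2) - of_int (A$1$2) * of_int (A$2$1))"
    unfolding assms(4) by (simp add: trace_2 algebra_simps power2_eq_square)
  finally have "z\<^sup>2 = (of_int (trace A))\<^sup>2 - 4" using det_real[OF assms(1)] by simp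
  moreover have "z \<in> \<rat>" using x by (simp add: z_def)
  ultimately show False using sqrt_disc_irrational assms(2) by blast
qed

definition posmat :: "int ^ 2 ^ 2 \<Rightarrow> bool" where
  "posmat A \<longleftrightarrow> A$1$1 > 0 \<and> A$1$2 > 0 \<and> A$2$1 > 0 \<and> A$2$2 > 0"

lemma posmat_mult: "posmat A \<Longrightarrow> posmat B \<Longrightarrow> posmat (A ** B)"
  by (simp add: posmat_def add_pos_pos)

lemma posmat_ev: "ws \<noteq> [] \<Longrightarrow> set ws \<subseteq> {La, Lb} \<Longrightarrow> posmat (ev ws)"
proof (induction ws)
  case (Cons l ws)
  then have l: "posmat (lm l)" by (auto simp: posmat_def)
  show ?case using Cons l by (cases "ws = []") (auto simp: posmat_mult)
qed simp

lemma posmat_trace: "posmat A \<Longrightarrow> det A = 1 \<Longrightarrow> trace A \<ge> 3"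
proof -
  assume A: "posmat A" "det A = 1"
  have "A$1$2 * A$2$1 > 0" using A by (simp add: posmat_def)
  then have "A$1$1 * A$2$2 \<noteq> 1" using A by (simp add: det_2)
  then have "A$1$1 \<noteq> 1 \<or> A$2$2 \<noteq> 1" by auto
  then show ?thesis using A by (auto simp: posmat_def trace_2)
qed

definition posroot :: "int ^ 2 ^ 2 \<Rightarrow> real" where
  "posroot A = (of_int (A$1$1) - of_int (A$2$2) + sqrt ((of_int (trace A))\<^sup>2 - 4)) / (2 * of_int (A$2$1))"

lemma posroot:
  assumes A: "posmat A" "det A = 1"
  shows "posroot A > 0" "posroot A \<notin> \<rat>" "rm A (posroot A) = posroot A"
    and "\<And>y. y > 0 \<Longrightarrow> rm A y = y \<Longrightarrow> y = posroot A"
proof -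
  let ?y = "posroot A" and ?a = "real_of_int (A$1$1)" and ?b = "real_of_int (A$1$2)" and ?c = "real_of_int (A$2$1)" and ?d = "real_of_int (A$2$2)"
  define D where "D = sqrt ((of_int (trace A))\<^sup>2 - 4)"
  have pos: "?a > 0" "?b > 0" "?c > 0" "?d > 0" using A by (auto simp: posmat_def)
  have dt: "?a * ?d - ?b * ?c = 1" by (rule det_real[OF A(2)])
  have T: "trace A \<ge> 3" using posmat_trace[OF A] .
  then have "real_of_int (trace A) \<ge> 3" by linarith
  then have g: "(real_of_int (trace A))\<^sup>2 \<ge> 3\<^sup>2" by (intro power_mono) auto
  then have D2: "D\<^sup>2 = (of_int (trace A))\<^sup>2 - 4" by (simp add: D_def)
  then have D2': "D\<^sup>2 = (?a - ?d)\<^sup>2 + 4 * ?b * ?c"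
    using dt by (simp add: trace_2 power2_eq_square algebra_simps)
  then have "D\<^sup>2 > (?d - ?a)\<^sup>2" using pos by (simp add: power2_commute)
  then have Dg: "D > ?d - ?a" using power2_less_imp_less[of "?d - ?a" D] g by (simp add: D_def)
  have y: "?y = (?a - ?d + D) / (2 * ?c)" by (simp add: posroot_def D_def)
  show p: "?y > 0" using Dg pos by (simp add: y)
  have q: "?c * ?y\<^sup>2 + (?d - ?a) * ?y - ?b = 0"
  proof -
    have "D = 2 * ?c * ?y - (?a - ?d)" using pos by (simp add: y field_simps)
    then have "(2 * ?c * ?y - (?a - ?d))\<^sup>2 = (?a - ?d)\<^sup>2 + 4 * ?b * ?c" using D2' by simp
    then have "4 * ?c * (?c * ?y\<^sup>2 + (?d - ?a) * ?y - ?b) = 0" by (simp add: power2_eq_square algebra_simps)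
    then show ?thesis using pos by simp
  qed
  show "?y \<notin> \<rat>" using fixed_point_irrational[OF A(2) _ _ q] T A by (auto simp: posmat_def)
  have dp: "den A x > 0" if "x > 0" for x using pos that by (simp add: den_def add_pos_pos)
  show "rm A ?y = ?y" using fixed_point_quadratic[of A ?y] q dp[OF p] by simp
  fix z assume z: "z > 0" "rm A z = z"
  then have "?c * z\<^sup>2 + (?d - ?a) * z - ?b = 0" using fixed_point_quadratic[of A z] dp[OF z(1)] by simp
  then have "z * (?c * ?y\<^sup>2 + (?d - ?a) * ?y - ?b) - ?y * (?c * z\<^sup>2 + (?d - ?a) * z - ?b) = 0" using q by simp
  then have "(?y - z) * (?c * z * ?y + ?b) = 0" by (simp add: power2_eq_square algebra_simps)
  moreover have "?c * z * ?y + ?b > 0" using pos p z by (simp add: add_pos_pos)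
  ultimately show "z = ?y" by auto
qed

section \<open>The words that code a rotation\<close>

locale rot =
  fixes p q :: int
  assumes p0: "0 \<le> p" and q0: "0 < q" and cop: "coprime p q"
begin

definition n :: int where "n = p + q"
definition ltr :: "int \<Rightarrow> letter" where "ltr r = (if r mod n < q then Lb else La)"
definition W :: "int \<Rightarrow> nat \<Rightarrow> letter list" where "W r k = map (\<lambda>i. ltr (r + int i * p)) [0..<k]"

lemma n0: "n > 0" using p0 q0 by (simp add: n_def)

lemma cop_n: "coprime p n" using cop unfolding n_def coprime_iff_gcd_eq_1 gcd_add2 .

lemma ltr_cases: "ltr r = La \<or> ltr r = Lb" by (simp add: ltr_def)

lemma ltr_mod: "r mod n = r' mod n \<Longrightarrow> ltr r = ltr r'" by (simp add: ltr_def)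

lemma ltr_Lb: "ltr r = Lb \<longleftrightarrow> r mod n < q" and ltr_La: "ltr r = La \<longleftrightarrow> r mod n \<ge> q"
  by (auto simp: ltr_def)

text \<open>The reflection maps the arc of the residues below \<open>q\<close> to itself, since \<open>- 1 - p\<close> is \<open>q - 1\<close> modulo \<open>n\<close>.\<close>

lemma ltr_reflect: "ltr (- 1 - r - p) = ltr r"
proof -
  define \<rho> where "\<rho> = r mod n"
  have \<rho>: "0 \<le> \<rho>" "\<rho> < n" using n0 by (simp_all add: \<rho>_def)
  have m: "(- 1 - r - p) mod n = (q - 1 - \<rho>) mod n"
  proof -
    have e: "- 1 - r - p = (q - 1 - r) + (-1) * n" by (simp add: n_def)
    have "(- 1 - r - p) mod n = (q - 1 - r) mod n" unfolding e by (rule mod_mult_self1)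
    then show ?thesis unfolding \<rho>_def by (simp only: mod_diff_right_eq)
  qed
  show ?thesis
  proof (cases "\<rho> < q")
    case True
    then have "(q - 1 - \<rho>) mod n = q - 1 - \<rho>" using \<rho> p0 by (intro mod_pos_pos_trivial) (auto simp: n_def)
    then show ?thesis using True \<rho> m by (simp add: ltr_def \<rho>_def)
  next
    case False
    note m
    also have "(q - 1 - \<rho>) mod n = (q - 1 - \<rho> + n) mod n" by (rule mod_add_self2[symmetric])
    also have "\<dots> = q - 1 - \<rho> + n" using \<rho> False q0 by (intro mod_pos_pos_trivial) linarith+
    finally have v: "(- 1 - r - p) mod n = q - 1 - \<rho> + n" .
    have "\<not> q - 1 - \<rho> + n < q" using \<rho>(2) by linarith
    then show ?thesis using False unfolding ltr_def v \<rho>_def[symmetric] by (simp only: if_False)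
  qed
qed

lemma W_0 [simp]: "W r 0 = []" by (simp add: W_def)

lemma W_Suc: "W r (Suc k) = ltr r # W (r + p) k"
proof -
  have "[0..<Suc k] = 0 # map Suc [0..<k]" by (simp add: upt_conv_Cons map_Suc_upt)
  then show ?thesis by (simp add: W_def algebra_simps)
qed

lemma W_Suc': "W r (Suc k) = W r k @ [ltr (r + int k * p)]" by (simp add: W_def)

lemma W_append: "W r (j + k) = W r j @ W (r + int j * p) k"
  by (induction j arbitrary: r) (auto simp: W_Suc algebra_simps)

lemma length_W [simp]: "length (W r k) = k" by (simp add: W_def)

lemma set_W: "set (W r k) \<subseteq> {La, Lb}" using ltr_cases by (auto simp: W_def)

lemma W_mod: "r mod n = r' mod n \<Longrightarrow> W r k = W r' k"
  unfolding W_def by (intro map_cong refl ltr_mod) (rule mod_add_cong[OF _ refl])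

definition M :: "int \<Rightarrow> int ^ 2 ^ 2" where "M r = ev (W r (nat n))"

lemma posmat_M: "posmat (M r)"
  unfolding M_def using n0 set_W by (intro posmat_ev) (auto simp flip: length_0_conv)

lemma det_M [simp]: "det (M r) = 1" by (simp add: M_def)

lemma M_shift: "M r ** lm (ltr r) = lm (ltr r) ** M (r + p)"
proof -
  obtain k where k: "nat n = Suc k" using n0 by (metis gr0_conv_Suc zero_less_nat_eq)
  have "ltr (r + int (Suc k) * p) = ltr r"
    using n0 by (intro ltr_mod) (simp add: k[symmetric])
  then have "ltr r # W (r + p) (nat n) = W r (nat n) @ [ltr r]"
    using W_Suc[of r "nat n"] W_Suc'[of r "nat n"] by (simp add: k)
  then have "ev (ltr r # W (r + p) (nat n)) = ev (W r (nat n) @ [ltr r])" by simp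
  then show ?thesis by (simp add: M_def ev_append)
qed

text \<open>The endpoints of the geodesic of rank \<open>r\<close>.  The inversion conjugates each of the two symmetric
  letters to its inverse, and the reflection \<open>- 1 - r\<close> reverses the rotation; this gives the
  repelling endpoint.\<close>

definition yy :: "int \<Rightarrow> real" where "yy r = posroot (M r)"
definition xx :: "int \<Rightarrow> real" where "xx r = - 1 / yy (- 1 - r)"

lemma yy_pos: "yy r > 0" and yy_irr: "yy r \<notin> \<rat>"
  using posroot[OF posmat_M det_M] by (simp_all add: yy_def)

lemma yy_mod: "r mod n = r' mod n \<Longrightarrow> yy r = yy r'"
  unfolding yy_def M_def by (drule W_mod[of _ _ "nat n"]) simp

lemma rm_pos: "l = La \<or> l = Lb \<Longrightarrow> y > 0 \<Longrightarrow> rm (lm l) y > 0"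
  by (auto simp: rm_def den_def)

lemma yy_step: "rm (lm (ltr r)) (yy (r + p)) = yy r"
proof -
  let ?z = "rm (lm (ltr r)) (yy (r + p))"
  have "rm (M r) ?z = rm (M r ** lm (ltr r)) (yy (r + p))" using yy_irr by (simp add: rm_mult)
  also have "\<dots> = rm (lm (ltr r)) (rm (M (r + p)) (yy (r + p)))" using yy_irr by (simp add: M_shift rm_mult)
  also have "rm (M (r + p)) (yy (r + p)) = yy (r + p)"
    unfolding yy_def by (rule posroot(3)[OF posmat_M det_M])
  finally have "rm (M r) ?z = ?z" .
  moreover have "?z > 0" by (rule rm_pos[OF ltr_cases yy_pos])
  ultimately show ?thesis unfolding yy_def[of r] using posroot(4)[OF posmat_M det_M] by blast
qed

lemma yy_bounds: "ltr r = La \<Longrightarrow> 1 < yy r \<and> yy r < 2" "ltr r = Lb \<Longrightarrow> 1/2 < yy r \<and> yy r < 1"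
  using yy_step[of r, symmetric] yy_pos[of "r + p"] by (auto simp: rm_letters less_divide_eq divide_less_eq simp del: lm.simps)

lemma lt_yy: "lt (yy r) = ltr r"
  using yy_bounds[of r] ltr_cases[of r] yy_irr[of r] by (auto simp: lt_eq_iff)

lemma xx_neg: "xx r < 0" using yy_pos by (simp add: xx_def)

lemma xx_irr: "xx r \<notin> \<rat>"
proof
  assume "xx r \<in> \<rat>"
  then have "- 1 / xx r \<in> \<rat>" by simp
  then show False using yy_irr by (simp add: xx_def)
qed

lemma xx_mod: "r mod n = r' mod n \<Longrightarrow> xx r = xx r'"
proof -
  assume "r mod n = r' mod n"
  then have "(- 1 - r) mod n = (- 1 - r') mod n" by (rule mod_diff_cong[OF refl])
  from yy_mod[OF this] show "xx r = xx r'" unfolding xx_def by simp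
qed

lemma inversion_letter: "l = La \<or> l = Lb \<Longrightarrow> y > 0 \<Longrightarrow> - 1 / rm (lm l) y = rm (lm (linv l)) (- 1 / y)"
proof -
  assume l: "l = La \<or> l = Lb" and y: "y > 0"
  have a: "rm (lm LA) (- 1 / y) = - (y + 1) / (2 * y + 1)"
  proof -
    have "(- 1 / y - 1) * y = - (y + 1)" "(2 - - 1 / y) * y = 2 * y + 1" using y by (simp_all add: left_diff_distrib distrib_right)
    moreover have "rm (lm LA) (- 1 / y) = ((- 1 / y - 1) * y) / ((2 - - 1 / y) * y)" using y by (simp add: rm_letters del: lm.simps)
    ultimately show ?thesis by (simp only:)
  qed
  have b: "rm (lm LB) (- 1 / y) = - (y + 2) / (y + 1)"
  proof -
    have "(2 * (- 1 / y) - 1) * y = - (y + 2)" "(1 - - 1 / y) * y = y + 1" using y by (simp_all add: left_diff_distrib distrib_right)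
    moreover have "rm (lm LB) (- 1 / y) = ((2 * (- 1 / y) - 1) * y) / ((1 - - 1 / y) * y)" using y by (simp add: rm_letters del: lm.simps)
    ultimately show ?thesis by (simp only:)
  qed
  have c: "- 1 / rm (lm La) y = - (y + 1) / (2 * y + 1)" "- 1 / rm (lm Lb) y = - (y + 2) / (y + 1)"
    unfolding rm_letters by simp_all
  from l show ?thesis
  proof
    assume "l = La" then show ?thesis using a c(1) by (simp only: linv.simps)
  next
    assume "l = Lb" then show ?thesis using b c(2) by (simp only: linv.simps)
  qed
qed

lemma xx_step: "rm (lm (ltr r)) (xx (r + p)) = xx r"
proof -
  have "yy (- 1 - r - p) = rm (lm (ltr r)) (yy (- 1 - r))"
    using yy_step[of "- 1 - r - p"] by (simp add: ltr_reflect)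
  then have "xx (r + p) = rm (lm (linv (ltr r))) (xx r)"
    using inversion_letter[OF ltr_cases yy_pos, of r "- 1 - r"] by (simp add: xx_def algebra_simps)
  then show ?thesis using xx_irr[of r] by (simp add: lm_linv rm_adj')
qed

lemma lt_xx: "lt (xx r) = linv (ltr (r - p))"
proof -
  have "ltr (- 1 - r) = ltr (r - p)" using ltr_reflect[of "r - p"] by simp
  then show ?thesis
    using yy_bounds[of "- 1 - r"] ltr_cases[of "r - p"] xx_irr[of r] yy_pos[of "- 1 - r"]
    by (auto simp: lt_eq_iff xx_def field_simps)
qed

lemma ranks_reach: "\<exists>k. (r + int k * p) mod n = s mod n"
proof -
  obtain u v where uv: "u * p + v * n = 1" using cop_n by (metis bezout_int coprime_imp_gcd_eq_1)
  define k where "k = nat ((u * (s - r)) mod n)"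
  have k: "int k = (u * (s - r)) mod n" using n0 by (simp add: k_def)
  have "(r + int k * p) mod n = (r + (u * (s - r)) * p) mod n"
    unfolding k by (metis mod_mult_left_eq mod_add_right_eq)
  also have "r + (u * (s - r)) * p = s + (- v * (s - r)) * n"
  proof -
    have up: "u * p = 1 - v * n" using uv by simp
    have "u * (s - r) * p = (u * p) * (s - r)" by simp
    then have "u * (s - r) * p = (1 - v * n) * (s - r)" by (simp only: up)
    then show ?thesis by (simp add: algebra_simps)
  qed
  also have "\<dots> mod n = s mod n" by (rule mod_mult_self1)
  finally show ?thesis by blast
qed

text \<open>As long as the letters agree, the rotation keeps the difference of two ranks, and they differ
  before the larger rank passes the top.\<close>

lemma yy_mono:
  assumes "0 \<le> r" "r < r'" "r' < n"
  shows "yy r < yy r'"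
proof -
  have main: "yy r < yy r'" if "0 \<le> r" "r < r'" "r' < n" "(r + int k * p) mod n = n - 1" for k r r'
    using that
  proof (induction k arbitrary: r r')
    case 0
    then show ?case by simp
  next
    case (Suc k)
    have m: "r mod n = r" "r' mod n = r'" using Suc.prems by auto
    have rec: "yy r < yy r'" if l: "ltr r = ltr r'" and s: "0 \<le> r + s" "r' + s < n" "(r + s) mod n = (r + p) mod n" "(r' + s) mod n = (r' + p) mod n" for s
    proof -
      have "(r + s + int k * p) mod n = (r + p + int k * p) mod n" using s(3) by (rule mod_add_cong) simp
      also have "\<dots> = n - 1" using Suc.prems by (simp add: algebra_simps)
      finally have "yy (r + s) < yy (r' + s)" using Suc.IH[of "r + s" "r' + s"] Suc.prems s by simp
      then have lt: "yy (r + p) < yy (r' + p)" using yy_mod s(3,4) by metis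
      have "yy r' - yy r = (yy (r' + p) - yy (r + p)) / (den (lm (ltr r)) (yy (r + p)) * den (lm (ltr r)) (yy (r' + p)))"
        using yy_step[of r] yy_step[of r'] rm_diff[OF yy_irr[of "r + p"] yy_irr[of "r' + p"] det_lm[of "ltr r"]] l by simp
      moreover have "den (lm (ltr r)) (yy t) > 0" for t
        using ltr_cases[of r] yy_pos[of t] by (auto simp: den_def add_pos_pos)
      ultimately have "yy r' - yy r > 0" using lt by simp
      then show ?thesis by simp
    qed
    show ?case
    proof (cases "ltr r = ltr r'")
      case False
      then have "r < q" "q \<le> r'" using Suc.prems(2) unfolding ltr_def m by (auto split: if_splits)
      then have "ltr r = Lb" "ltr r' = La" using m by (auto simp: ltr_Lb ltr_La)
      then show ?thesis using yy_bounds(2)[of r] yy_bounds(1)[of r'] by simp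
    next
      case True
      show ?thesis
      proof (cases "r < q")
        case r: True
        then have "r' < q" using True m by (simp add: ltr_def split: if_splits)
        then show ?thesis using rec[of p] True Suc.prems p0 by (simp add: n_def)
      next
        case False
        have "(r - q) mod n = (r - q + n) mod n" "(r' - q) mod n = (r' - q + n) mod n" by simp_all
        then show ?thesis using rec[of "- q"] True Suc.prems q0 False by (simp add: n_def algebra_simps)
      qed
    qed
  qed
  obtain k where "(r + int k * p) mod n = (n - 1) mod n" using ranks_reach by blast
  then have "(r + int k * p) mod n = n - 1" using mod_pos_pos_trivial[of "n - 1" n] n0 by (simp only:)
  from main[OF assms this] show ?thesis .
qed

lemma xx_antimono:
  assumes "0 \<le> r" "r < r'" "r' < n"
  shows "xx r' < xx r"
proof -
  have m: "(- 1 - s) mod n = (n - 1 - s) mod n" for s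
    by (metis diff_add_eq mod_add_self1 uminus_add_conv_diff diff_conv_add_uminus add.commute minus_diff_eq)
  have "yy (n - 1 - r') < yy (n - 1 - r)" using assms by (intro yy_mono) auto
  then have "yy (- 1 - r') < yy (- 1 - r)" using yy_mod[OF m] by simp
  then show ?thesis using yy_pos[of "- 1 - r'"] yy_pos[of "- 1 - r"] by (simp add: xx_def field_simps)
qed

lemma yy_inj: "yy r = yy r' \<Longrightarrow> r mod n = r' mod n"
proof (rule ccontr)
  assume e: "yy r = yy r'" and "r mod n \<noteq> r' mod n"
  moreover have "yy (r mod n) = yy r" "yy (r' mod n) = yy r'" by (auto intro: yy_mod)
  ultimately show False using yy_mono[of "r mod n" "r' mod n"] yy_mono[of "r' mod n" "r mod n"] n0
    by (metis less_irrefl linorder_neqE_linordered_idom pos_mod_bound pos_mod_sign)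
qed

text \<open>The two endpoints move in opposite directions when the rank grows, so the geodesics are nested.\<close>

lemma rank_unlinked: "\<not> linked (xx r) (yy r) (xx r') (yy r')"
proof -
  have a: "\<not> linked (xx r) (yy r) (xx r') (yy r')" if "0 \<le> r" "r < r'" "r' < n" for r r'
    using yy_mono[OF that] xx_antimono[OF that] xx_neg[of r] xx_neg[of r'] yy_pos[of r] yy_pos[of r']
    by (simp add: linked_def not_less zero_le_mult_iff mult_le_0_iff)
  have m: "xx (r mod n) = xx r" "yy (r mod n) = yy r" for r by (auto intro: yy_mod xx_mod)
  have b: "0 \<le> r mod n" "r mod n < n" for r using n0 by auto
  consider "r mod n = r' mod n" | "r mod n < r' mod n" | "r' mod n < r mod n" by linarith
  then show ?thesis
  proof cases
    case 1 then show ?thesis using xx_mod[OF 1] by (simp add: linked_def)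
  next
    case 2 then show ?thesis using a[of "r mod n" "r' mod n"] b by (simp add: m)
  next
    case 3 then show ?thesis using a[of "r' mod n" "r mod n"] b by (simp add: m linked_sym)
  qed
qed

lemma ev_W_step: "rm (ev (W r k)) (yy (r + int k * p)) = yy r" "rm (ev (W r k)) (xx (r + int k * p)) = xx r"
proof (induction k arbitrary: r)
  case (Suc k)
  { case 1 show ?case using Suc(1)[of "r + p"] yy_step[of r] yy_irr by (simp add: W_Suc rm_mult algebra_simps) }
  { case 2 show ?case using Suc(2)[of "r + p"] xx_step[of r] xx_irr by (simp add: W_Suc rm_mult algebra_simps) }
qed auto

lemma step_back: "rm (lm (linv (ltr r))) (yy r) = yy (r + p)" "rm (lm (linv (ltr r))) (xx r) = xx (r + p)"
  using yy_step[of r] xx_step[of r] rm_adj[OF yy_irr[of "r + p"] det_lm[of "ltr r"]] rm_adj[OF xx_irr[of "r + p"] det_lm[of "ltr r"]]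
  by (simp_all add: lm_linv)

lemma step_fwd: "rm (lm (ltr (r - p))) (yy r) = yy (r - p)" "rm (lm (ltr (r - p))) (xx r) = xx (r - p)"
  using yy_step[of "r - p"] xx_step[of "r - p"] by simp_all

text \<open>A translate of one of the geodesics of the word that still separates the letters of its
  endpoints is again one of them, and the translating word runs along the axis.\<close>

lemma crossing_translate:
  assumes "reduced v" "lt (rm (ev v) (xx r)) \<noteq> lt (rm (ev v) (yy r))"
  shows "\<exists>j. ev v = adj (ev (W r j)) \<or> ev v = ev (W (r - int j * p) j)"
  using assms
proof (induction v arbitrary: r rule: rev_induct)
  case Nil
  then show ?case by (intro exI[of _ 0]) simp
next
  case (snoc l v)
  have red: "reduced v" using snoc.prems(1) by (induction v rule: reduced.induct) auto
  have ev: "ev (v @ [l]) = ev v ** lm l" by (simp add: ev_append)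
  have "lt (xx r) = linv l \<or> lt (yy r) = linv l"
  proof (rule ccontr)
    assume "\<not> ?thesis"
    then have "lt (rm (ev (v @ [l])) (xx r)) = hd (v @ [l])" "lt (rm (ev (v @ [l])) (yy r)) = hd (v @ [l])"
      using ping_pong_word[OF snoc.prems(1) _ xx_irr] ping_pong_word[OF snoc.prems(1) _ yy_irr] by auto
    then show False using snoc.prems(2) by simp
  qed
  then show ?case
  proof
    assume "lt (xx r) = linv l"
    then have l: "l = ltr (r - p)" by (simp add: lt_xx)
    have "rm (ev (v @ [l])) (xx r) = rm (ev v) (xx (r - p))" "rm (ev (v @ [l])) (yy r) = rm (ev v) (yy (r - p))"
      using xx_irr yy_irr step_fwd[of r] by (simp_all add: ev_append rm_mult l)
    then obtain j where j: "ev v = adj (ev (W (r - p) j)) \<or> ev v = ev (W (r - p - int j * p) j)"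
      using snoc.IH[OF red, of "r - p"] snoc.prems(2) by auto
    then show ?thesis
    proof
      assume a: "ev v = adj (ev (W (r - p) j))"
      show ?thesis
      proof (cases j)
        case 0
        then have "ev (v @ [l]) = ev (W (r - int 1 * p) 1)" using a by (simp add: ev_append l W_Suc)
        then show ?thesis by blast
      next
        case (Suc i)
        then have "ev (v @ [l]) = adj (ev (W r i))"
          using a by (simp add: ev_append l W_Suc adj_mult matrix_mul_assoc[symmetric] adj_inverse)
        then show ?thesis by blast
      qed
    next
      assume a: "ev v = ev (W (r - p - int j * p) j)"
      have "ev (v @ [l]) = ev (W (r - int (Suc j) * p) (Suc j))"
        unfolding W_Suc' ev_append using a by (simp add: ev_append l algebra_simps)
      then show ?thesis by blast
    qed
  next
    assume "lt (yy r) = linv l"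
    then have l: "l = linv (ltr r)" by (metis linv_linv lt_yy)
    have "rm (ev (v @ [l])) (xx r) = rm (ev v) (xx (r + p))" "rm (ev (v @ [l])) (yy r) = rm (ev v) (yy (r + p))"
      using xx_irr yy_irr step_back[of r] by (simp_all add: ev_append rm_mult l)
    then obtain j where j: "ev v = adj (ev (W (r + p) j)) \<or> ev v = ev (W (r + p - int j * p) j)"
      using snoc.IH[OF red, of "r + p"] snoc.prems(2) by auto
    then show ?thesis
    proof
      assume a: "ev v = adj (ev (W (r + p) j))"
      have "ev (v @ [l]) = adj (ev (W r (Suc j)))"
        using a by (simp add: ev_append l W_Suc adj_mult lm_linv)
      then show ?thesis by blast
    next
      assume a: "ev v = ev (W (r + p - int j * p) j)"
      show ?thesis
      proof (cases j)
        case 0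
        then have "ev (v @ [l]) = adj (ev (W r 1))" using a by (simp add: ev_append l W_Suc lm_linv)
        then show ?thesis by blast
      next
        case (Suc i)
        have "ev v = ev (W (r - int i * p) i) ** lm (ltr r)"
          using a unfolding Suc W_Suc' ev_append by (simp add: algebra_simps)
        then have "ev (v @ [l]) = ev (W (r - int i * p) i)"
          by (simp add: ev_append l lm_linv matrix_mul_assoc[symmetric] adj_inverse)
        then show ?thesis by blast
      qed
    qed
  qed
qed

lemma word_image_rank:
  assumes "ev v = adj (ev (W r j)) \<or> ev v = ev (W (r - int j * p) j)"
  shows "\<exists>r'. rm (ev v) (xx r) = xx r' \<and> rm (ev v) (yy r) = yy r'"
  using assms
proof
  assume "ev v = adj (ev (W r j))"
  then have "rm (ev v) (xx r) = xx (r + int j * p)" "rm (ev v) (yy r) = yy (r + int j * p)"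
    using ev_W_step[of r j] rm_adj[OF xx_irr[of "r + int j * p"] det_ev[of "W r j"]] rm_adj[OF yy_irr[of "r + int j * p"] det_ev[of "W r j"]] by auto
  then show ?thesis by blast
next
  assume "ev v = ev (W (r - int j * p) j)"
  then have "rm (ev v) (xx r) = xx (r - int j * p)" "rm (ev v) (yy r) = yy (r - int j * p)"
    using ev_W_step[of "r - int j * p" j] by auto
  then show ?thesis by blast
qed

lemma lt_xx_yy: "lt (xx r) \<noteq> lt (yy r)"
  using ltr_cases[of "r - p"] ltr_cases[of r] by (auto simp: lt_xx lt_yy)

lemma lt_interval:
  assumes "lt x' = l" "lt y' = l" "lt x \<noteq> l" "lt y \<noteq> l" "x \<notin> \<rat>" "y \<notin> \<rat>" "x' \<notin> \<rat>" "y' \<notin> \<rat>"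
  shows "\<not> linked x y x' y'"
proof -
  have s: "(x' - z) * (y' - z) > 0" if "lt z \<noteq> l" "z \<notin> \<rat>" for z
    using assms(1,2,7,8) that by (cases l) (auto simp: lt_eq_iff zero_less_mult_iff)
  have e: "(x' - x) * (x' - y) * ((y' - x) * (y' - y)) = ((x' - x) * (y' - x)) * ((x' - y) * (y' - y))"
    by (simp only: mult.assoc mult.left_commute)
  show ?thesis
    unfolding linked_def e using mult_pos_pos[OF s[OF assms(3,5)] s[OF assms(4,6)]] by (rule less_not_sym)
qed

text \<open>Induction on the translating word.  If the translate has both ends in the interval of the first
  letter, a geodesic that crosses it must enter that interval; then the letter can be removed
  from the word, and the rank of the other geodesic moves by one step of the rotation.\<close>

lemma translates_unlinked_reduced:
  assumes "reduced v"
  shows "\<not> linked (xx r) (yy r) (rm (ev v) (xx r')) (rm (ev v) (yy r'))"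
  using assms
proof (induction v arbitrary: r)
  case Nil
  then show ?case by (simp add: rank_unlinked)
next
  case (Cons l v)
  let ?x = "rm (ev (l # v)) (xx r')" and ?y = "rm (ev (l # v)) (yy r')"
  have irr: "?x \<notin> \<rat>" "?y \<notin> \<rat>" using rm_irr[OF xx_irr det_ev] rm_irr[OF yy_irr det_ev] by blast+
  show ?case
  proof (cases "lt ?x = lt ?y")
    case False
    then obtain j where "ev (l # v) = adj (ev (W r' j)) \<or> ev (l # v) = ev (W (r' - int j * p) j)"
      using crossing_translate[OF Cons.prems] by blast
    from word_image_rank[OF this] show ?thesis by (auto simp: rank_unlinked)
  next
    case True
    have "lt (xx r') \<noteq> linv (last (l # v)) \<or> lt (yy r') \<noteq> linv (last (l # v))" using lt_xx_yy[of r'] by auto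
    then have l: "lt ?x = l" "lt ?y = l"
      using True ping_pong_word[OF Cons.prems, of "xx r'"] ping_pong_word[OF Cons.prems, of "yy r'"] xx_irr yy_irr by auto
    have red: "reduced v" using Cons.prems by (rule reduced_tl)
    have conj: "linked (xx r) (yy r) ?x ?y \<longleftrightarrow>
      linked (rm (lm (linv l)) (xx r)) (rm (lm (linv l)) (yy r)) (rm (ev v) (xx r')) (rm (ev v) (yy r'))"
    proof -
      have "rm (lm (linv l)) ?x = rm (ev v) (xx r')" "rm (lm (linv l)) ?y = rm (ev v) (yy r')"
        using xx_irr yy_irr by (simp_all add: rm_mult lm_linv rm_irr rm_adj)
      then show ?thesis
        using linked_rm[OF xx_irr yy_irr irr, of "lm (linv l)" r r] by simp
    qed
    show ?thesis
    proof (cases "lt (xx r) = l \<or> lt (yy r) = l")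
      case False
      then show ?thesis using lt_interval[OF l] xx_irr yy_irr irr by blast
    next
      case True
      then show ?thesis
      proof
        assume "lt (yy r) = l"
        then have "l = ltr r" by (simp add: lt_yy)
        then show ?thesis unfolding conj using Cons.IH[OF red, of "r + p"] step_back[of r] by simp
      next
        assume "lt (xx r) = l"
        then have "linv l = ltr (r - p)" by (metis linv_linv lt_xx)
        then show ?thesis unfolding conj using Cons.IH[OF red, of "r - p"] step_fwd[of r] by simp
      qed
    qed
  qed
qed

lemma translates_unlinked:
  "\<not> linked (xx r) (yy r) (rm (ev v) (xx r')) (rm (ev v) (yy r'))"
  using ex_reduced[of v] translates_unlinked_reduced by metis

text \<open>A translate whose endpoints are those of a rank is again the geodesic of a rank, with positive attracting and
  negative repelling endpoint.\<close>

lemma no_swap: "\<not> (rm (ev v) (xx r) = yy r' \<and> rm (ev v) (yy r) = xx r')"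
proof
  assume e: "rm (ev v) (xx r) = yy r' \<and> rm (ev v) (yy r) = xx r'"
  obtain u where u: "reduced u" "ev u = ev v" using ex_reduced by blast
  then have "lt (rm (ev u) (xx r)) \<noteq> lt (rm (ev u) (yy r))" using e lt_xx_yy[of r'] by auto
  then obtain r'' where "rm (ev u) (xx r) = xx r''"
    using crossing_translate[OF u(1)] word_image_rank by blast
  then have "yy r' = xx r''" using e u by simp
  then show False using xx_neg[of r''] yy_pos[of r'] by simp
qed

lemma ev_W_period: "ev (W r (k * nat n)) = (((**) (M r)) ^^ k) (mat 1)"
proof (induction k)
  case (Suc k)
  have "W (r + int (nat n) * p) (k * nat n) = W r (k * nat n)" using n0 by (intro W_mod) simp
  then have "W r (Suc k * nat n) = W r (nat n) @ W r (k * nat n)" by (simp add: W_append)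
  then show ?case using Suc by (simp add: ev_append M_def)
qed simp

text \<open>A word that fixes the geodesic runs along its axis, and it returns to the same rank only after
  whole periods.\<close>

lemma fixing_word:
  assumes "rm (ev v) (xx r) = xx r'" "rm (ev v) (yy r) = yy r'" "r mod n = r' mod n"
  shows "\<exists>k. ev v = ev (W r (k * nat n)) \<or> ev v = adj (ev (W r (k * nat n)))"
proof -
  obtain u where u: "reduced u" "ev u = ev v" using ex_reduced by blast
  then have "lt (rm (ev u) (xx r)) \<noteq> lt (rm (ev u) (yy r))" using assms lt_xx_yy[of r'] by auto
  then obtain j where j: "ev v = adj (ev (W r j)) \<or> ev v = ev (W (r - int j * p) j)"
    using crossing_translate[OF u(1)] u(2) by metis
  have "n dvd int j"
  proof -
    from j have "yy (r + int j * p) = yy r \<or> yy (r - int j * p) = yy r"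
    proof
      assume "ev v = adj (ev (W r j))"
      then have "rm (ev v) (yy r) = yy (r + int j * p)"
        using ev_W_step(1)[of r j] rm_adj[OF yy_irr[of "r + int j * p"] det_ev[of "W r j"]] by simp
      then show ?thesis using assms yy_mod by metis
    next
      assume "ev v = ev (W (r - int j * p) j)"
      then have "rm (ev v) (yy r) = yy (r - int j * p)" using ev_W_step(1)[of "r - int j * p" j] by simp
      then show ?thesis using assms yy_mod by metis
    qed
    then have "(r + int j * p) mod n = r mod n \<or> (r - int j * p) mod n = r mod n" using yy_inj by blast
    then have "n dvd int j * p" by (auto simp: mod_eq_dvd_iff)
    then show ?thesis using cop_n by (metis coprime_commute coprime_dvd_mult_left_iff)
  qed
  then obtain k where k: "int j = n * k" by auto
  then have "k \<ge> 0" using n0 by (metis linorder_not_less mult_pos_neg of_nat_less_0_iff)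
  then have jk: "j = nat k * nat n" using k n0 by (metis mult.commute nat_int nat_mult_distrib)
  have "(r - int j * p) mod n = r mod n" unfolding k by (metis mod_mult_self4 mult.assoc mult_minus_right diff_conv_add_uminus mod_mult_self2)
  then have "W (r - int j * p) j = W r j" by (rule W_mod)
  then show ?thesis using j jk by metis
qed

end

section \<open>The standard geodesic\<close>

text \<open>The standard lift is that of rank \<open>- 1\<close>, which is the top rank \<open>n - 1\<close>.  As the denominator at the
  attracting end is \<open>lam\<close>, the translation length is \<open>2 ln lam\<close>.\<close>

lemma ev_rev: "set ws \<subseteq> {La, Lb} \<Longrightarrow> ev (rev ws) = transpose (ev ws)"
proof (induction ws)
  case Nil then show ?case by (simp add: transpose_mat)
next
  case (Cons l ws)
  have "transpose (lm l) = lm l" using Cons.prems by (auto simp: mx_eq_iff transpose_def)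
  then show ?case using Cons by (simp add: ev_append matrix_transpose_mul)
qed

lemma filterlim_vertical:
  assumes "k > 0" shows "filterlim (\<lambda>t. Complex u (k * exp t)) at_infinity at_top"
  unfolding filterlim_at_infinity_conv_norm_at_top
proof -
  have "filterlim (\<lambda>t. k * exp t) at_top at_top"
    by (rule filterlim_tendsto_pos_mult_at_top[OF tendsto_const assms exp_at_top])
  moreover have "k * exp t \<le> norm (Complex u (k * exp t))" for t
    using abs_Im_le_cmod[of "Complex u (k * exp t)"] by (simp add: abs_le_iff)
  ultimately show "filterlim (\<lambda>t. norm (Complex u (k * exp t))) at_top at_top"
    by (rule filterlim_at_top_mono[OF _ always_eventually[rule_format]])
qed

lemma square_sum_bound: "(u - x) * (y - u) \<le> (y - x)\<^sup>2 / (4 :: real)"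
proof -
  have "(y - x)\<^sup>2 / 4 - (u - x) * (y - u) = (u - (x + y) / 2)\<^sup>2" by (simp add: power2_eq_square field_simps)
  then show ?thesis by (metis diff_ge_0_iff_ge zero_le_power2)
qed

context rot
begin

definition x0 :: real where "x0 = xx (- 1)"
definition y0 :: real where "y0 = yy (- 1)"
definition A0 :: "int ^ 2 ^ 2" where "A0 = M (- 1)"
definition m0 :: int where "m0 = A0 $ 2 $ 1"
definition lam :: real where "lam = den A0 y0"
definition L0 :: real where "L0 = 2 * ln lam"
definition c0 :: "real \<Rightarrow> complex" where "c0 t = gpt x0 y0 (exp t)"

lemma xy0: "x0 < 0" "0 < y0" "x0 \<notin> \<rat>" "y0 \<notin> \<rat>"
  using xx_neg yy_pos xx_irr yy_irr by (simp_all add: x0_def y0_def)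

lemma det_A0 [simp]: "det A0 = 1" by (simp add: A0_def)

lemma m0_pos: "m0 > 0" using posmat_M[of "-1"] by (simp add: m0_def A0_def posmat_def)

lemma rm_M: "rm (M r) (xx r) = xx r" "rm (M r) (yy r) = yy r"
proof -
  have "(r + int (nat n) * p) mod n = r mod n" using n0 by simp
  then show "rm (M r) (xx r) = xx r" "rm (M r) (yy r) = yy r"
    using ev_W_step[of r "nat n"] xx_mod[of "r + int (nat n) * p" r] yy_mod[of "r + int (nat n) * p" r] by (simp_all add: M_def)
qed

lemma A0_fix: "rm A0 x0 = x0" "rm A0 y0 = y0"
  using rm_M by (simp_all add: A0_def x0_def y0_def)

lemma lam_pos: "lam > 1" and den_A0_x0: "den A0 x0 = 1 / lam"
proof -
  have nz: "den A0 x0 \<noteq> 0" "den A0 y0 \<noteq> 0" using den_nz xy0 by simp_all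
  have "y0 - x0 = (y0 - x0) / (den A0 x0 * den A0 y0)"
    using rm_diff[OF xy0(3,4) det_A0] by (simp add: A0_fix)
  then have "(y0 - x0) * (den A0 x0 * den A0 y0) = y0 - x0" using nz by (simp add: eq_divide_eq)
  then have "(y0 - x0) * (den A0 x0 * den A0 y0 - 1) = 0" by (simp add: algebra_simps)
  then have 1: "den A0 x0 * den A0 y0 = 1" using xy0 by simp
  have pos: "den A0 y0 > 0" using posmat_M[of "-1"] xy0 by (simp add: den_def A0_def posmat_def add_pos_pos)
  have "den A0 y0 - den A0 x0 = of_int m0 * (y0 - x0)" by (simp add: den_def m0_def algebra_simps)
  also have "\<dots> > 0" using m0_pos xy0 by simp
  finally have "den A0 x0 < den A0 y0" by simp
  then have "1 < den A0 y0 * den A0 y0" using 1 mult_strict_right_mono[OF _ pos] by metis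
  then show "lam > 1" using pos by (metis lam_def less_le_not_le linorder_not_less mult_le_one order_less_imp_le)
  show "den A0 x0 = 1 / lam" using 1 nz by (simp add: lam_def field_simps)
qed

lemma L0_pos: "L0 > 0" using lam_pos by (simp add: L0_def)

text \<open>The word of the top rank is \<open>a w b\<close> with a palindrome \<open>w\<close>.  The palindrome is a symmetric matrix,
  and this makes the trace three times the lower left entry (the Markov number of the geodesic).\<close>

lemma trace_A0: "trace A0 = 3 * m0"
proof (cases "p = 0")
  case True
  then have "q = 1" using cop q0 by simp
  then have n1: "n = 1" using True unfolding n_def by simp
  have "(- 1) mod n = 0" unfolding n1 by simp
  then have "ltr (- 1) = Lb" unfolding ltr_Lb using q0 by simp
  moreover have "W (- 1) (nat n) = [ltr (- 1)]" unfolding n1 by (simp add: W_Suc)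
  ultimately have "A0 = lm Lb" unfolding A0_def M_def by simp
  then show ?thesis by (simp add: m0_def trace_2)
next
  case False
  then have p: "p > 0" using p0 by simp
  then obtain N where N: "nat n = Suc (Suc N)"
  proof -
    have "nat n = Suc (Suc (nat (n - 2)))" using p q0 by (simp add: n_def)
    then show ?thesis using that by blast
  qed
  have nN: "n = int N + 2" using N n0 by linarith
  define w where "w = W (p - 1) N"
  have first: "ltr (- 1) = La"
  proof -
    have "(- 1) mod n = (n - 1) mod n" by (metis mod_add_self1 uminus_add_conv_diff add.commute diff_conv_add_uminus)
    also have "\<dots> = n - 1" using n0 by (intro mod_pos_pos_trivial) auto
    finally show ?thesis using p by (simp add: ltr_La n_def)
  qed
  have last: "ltr (p - 1 + int N * p) = Lb"
  proof -
    have e: "p - 1 + int N * p = - 1 - 0 - p + p * n" by (simp add: nN algebra_simps)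
    have "ltr (p - 1 + int N * p) = ltr (- 1 - 0 - p)" unfolding e by (intro ltr_mod) (rule mod_mult_self1)
    also have "\<dots> = ltr 0" by (rule ltr_reflect)
    finally show ?thesis using q0 by (simp add: ltr_def)
  qed
  have W: "W (- 1) (nat n) = La # w @ [Lb]"
    unfolding N using W_Suc[of "-1" "Suc N"] W_Suc'[of "p - 1" N] first last by (simp add: w_def add.commute)
  have "rev w = w"
  proof (rule nth_equalityI)
    fix i assume "i < length (rev w)"
    then have i: "i < N" by (simp add: w_def)
    then have "rev w ! i = ltr (p - 1 + int (N - Suc i) * p)" by (simp add: rev_nth w_def W_def)
    also have "p - 1 + int (N - Suc i) * p = - 1 - (int i + 1) * p - p + n * p"
      using i by (simp add: nN of_nat_diff algebra_simps)
    also have "ltr (- 1 - (int i + 1) * p - p + n * p) = ltr (- 1 - (int i + 1) * p - p)"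
      by (intro ltr_mod) simp
    also have "\<dots> = ltr ((int i + 1) * p)" by (rule ltr_reflect)
    also have "\<dots> = ltr ((int i + 1) * p - 1)"
    proof -
      define \<rho> where "\<rho> = ((int i + 1) * p) mod n"
      have \<rho>: "0 \<le> \<rho>" "\<rho> < n" using n0 by (simp_all add: \<rho>_def)
      have ndvd: "\<not> n dvd j * p" if "0 < j" "j < n" for j
        using that cop_n by (metis coprime_commute coprime_dvd_mult_left_iff zdvd_not_zless)
      have "\<rho> \<noteq> 0" using ndvd[of "int i + 1"] i nN by (auto simp: \<rho>_def mod_eq_0_iff_dvd)
      moreover have "\<rho> \<noteq> q"
      proof
        assume "\<rho> = q"
        then have "((int i + 1) * p + p) mod n = (q + p) mod n" unfolding \<rho>_def by (metis mod_add_left_eq)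
        then have "(int i + 2) * p mod n = 0" by (simp add: n_def algebra_simps)
        then show False using ndvd[of "int i + 2"] i nN by (simp add: mod_eq_0_iff_dvd)
      qed
      moreover have "((int i + 1) * p - 1) mod n = (\<rho> - 1) mod n" unfolding \<rho>_def by (simp only: mod_diff_left_eq)
      ultimately have "((int i + 1) * p - 1) mod n = \<rho> - 1" "\<rho> \<noteq> q" using \<rho> mod_pos_pos_trivial[of "\<rho> - 1" n] by simp_all
      then show ?thesis unfolding ltr_def \<rho>_def[symmetric] by simp
    qed
    also have "\<dots> = w ! i" using i by (simp add: w_def W_def algebra_simps)
    finally show "rev w ! i = w ! i" .
  qed simp
  then have "transpose (ev w) = ev w" using ev_rev[OF set_W, of "p - 1" N] unfolding w_def by (simp only:)
  then have "transpose (ev w) $ 2 $ 1 = ev w $ 2 $ 1" by (simp only:)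
  then have sym: "ev w $ 1 $ 2 = ev w $ 2 $ 1" by (simp add: transpose_def)
  have "A0 = lm La ** (ev w ** lm Lb)" unfolding A0_def M_def W by (simp add: ev_append)
  then show ?thesis by (simp add: m0_def trace_2 sym)
qed

lemma sum_x0_y0: "x0 + y0 = of_int (A0$1$1 - A0$2$2) / of_int m0"
  and width0: "(y0 - x0)\<^sup>2 = 9 - 4 / (of_int m0)\<^sup>2"
proof -
  have nz: "den A0 x0 \<noteq> 0" "den A0 y0 \<noteq> 0" using den_nz xy0 by simp_all
  have q: "of_int m0 * x0\<^sup>2 + (of_int (A0$2$2) - of_int (A0$1$1)) * x0 - of_int (A0$1$2) = (0::real)"
    "of_int m0 * y0\<^sup>2 + (of_int (A0$2$2) - of_int (A0$1$1)) * y0 - of_int (A0$1$2) = (0::real)"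
    using fixed_point_quadratic[OF nz(1)] fixed_point_quadratic[OF nz(2)] A0_fix by (simp_all add: m0_def)
  then have "(y0 - x0) * (of_int m0 * (x0 + y0) - (of_int (A0$1$1) - of_int (A0$2$2))) = 0"
    by (simp add: power2_eq_square algebra_simps)
  then have s: "of_int m0 * (x0 + y0) = of_int (A0$1$1) - of_int (A0$2$2)" using xy0 by simp
  then show "x0 + y0 = of_int (A0$1$1 - A0$2$2) / of_int m0" using m0_pos by (simp add: field_simps)
  have "of_int m0 * (x0 * y0) = x0 * (of_int m0 * (x0 + y0)) - of_int m0 * x0\<^sup>2"
    by (simp add: power2_eq_square algebra_simps)
  also have "\<dots> = - of_int (A0$1$2)" unfolding s using q(1) by (simp add: algebra_simps)
  finally have pr: "of_int m0 * (x0 * y0) = - of_int (A0$1$2)" .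
  have "(of_int m0)\<^sup>2 * (y0 - x0)\<^sup>2 = (of_int m0 * (x0 + y0))\<^sup>2 - 4 * of_int m0 * (of_int m0 * (x0 * y0))"
    by (simp add: power2_eq_square algebra_simps)
  also have "\<dots> = (of_int (A0$1$1) - of_int (A0$2$2))\<^sup>2 + 4 * of_int m0 * of_int (A0$1$2)"
    unfolding s pr by simp
  also have "\<dots> = (of_int (trace A0))\<^sup>2 - 4 * (of_int (A0$1$1) * of_int (A0$2$2) - of_int (A0$1$2) * of_int (A0$2$1))"
    by (simp add: trace_2 m0_def power2_eq_square algebra_simps)
  also have "\<dots> = 9 * (of_int m0)\<^sup>2 - 4" by (simp add: det_real[OF det_A0] trace_A0 power2_eq_square)
  finally show "(y0 - x0)\<^sup>2 = 9 - 4 / (of_int m0)\<^sup>2" using m0_pos by (simp add: field_simps)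
qed

text \<open>The lifts of the closed geodesic, as ordered pairs of endpoints.\<close>

definition lift :: "real \<Rightarrow> real \<Rightarrow> bool" where
  "lift x y \<longleftrightarrow> (\<exists>v. x = rm (ev v) x0 \<and> y = rm (ev v) y0)"

lemma lift_0: "lift x0 y0" unfolding lift_def by (rule exI[of _ "[]"]) simp

lemma lift_word: "lift x y \<Longrightarrow> lift (rm (ev v) x) (rm (ev v) y)"
proof -
  assume "lift x y"
  then obtain u where "x = rm (ev u) x0" "y = rm (ev u) y0" by (auto simp: lift_def)
  then have "rm (ev v) x = rm (ev (v @ u)) x0" "rm (ev v) y = rm (ev (v @ u)) y0"
    using xy0 by (simp_all add: ev_append rm_mult)
  then show ?thesis unfolding lift_def by blast
qed

lemma lift_irr: assumes "lift x y" shows "x \<notin> \<rat>" "y \<notin> \<rat>"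
  using assms rm_irr[OF xy0(3) det_ev] rm_irr[OF xy0(4) det_ev] by (auto simp: lift_def)

lemma lift_ne: "lift x y \<Longrightarrow> x \<noteq> y"
  using rm_inj[OF xy0(3,4) det_ev] xy0 by (fastforce simp: lift_def)

lemma lift_rank: "lift (xx r) (yy r)"
proof -
  obtain k where k: "(- 1 + int k * p) mod n = r mod n" using ranks_reach by blast
  have "rm (ev (W (- 1) k)) (xx r) = x0" "rm (ev (W (- 1) k)) (yy r) = y0"
    using ev_W_step[of "-1" k] xx_mod[OF k] yy_mod[OF k] by (simp_all add: x0_def y0_def)
  then have "rm (ev (winv (W (- 1) k))) x0 = xx r" "rm (ev (winv (W (- 1) k))) y0 = yy r"
    using rm_adj[OF xx_irr[of r] det_ev[of "W (-1) k"]] rm_adj[OF yy_irr[of r] det_ev[of "W (-1) k"]] by (simp_all add: ev_winv)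
  then show ?thesis unfolding lift_def by (intro exI[of _ "winv (W (- 1) k)"]) simp
qed

lemma lift_unlinked: assumes "lift x y" "lift x' y'" shows "\<not> linked x y x' y'"
proof -
  obtain u v where u: "x = rm (ev u) x0" "y = rm (ev u) y0" and v: "x' = rm (ev v) x0" "y' = rm (ev v) y0"
    using assms by (auto simp: lift_def)
  have "\<not> linked x0 y0 (rm (ev (winv u @ v)) x0) (rm (ev (winv u @ v)) y0)"
    using translates_unlinked[of "-1" "winv u @ v" "-1"] by (simp add: x0_def y0_def)
  moreover have "rm (ev (winv u)) x = x0" "rm (ev (winv u)) y = y0" using xy0 by (simp_all add: u ev_winv rm_adj)
  moreover have "rm (ev (winv u @ v)) x0 = rm (ev (winv u)) x'" "rm (ev (winv u @ v)) y0 = rm (ev (winv u)) y'"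
    using xy0 by (simp_all add: v ev_append rm_mult)
  ultimately have "\<not> linked (rm (ev (winv u)) x) (rm (ev (winv u)) y) (rm (ev (winv u)) x') (rm (ev (winv u)) y')" by simp
  then show ?thesis using linked_rm[OF lift_irr[OF assms(1)] lift_irr[OF assms(2)] det_ev] by blast
qed

lemma lift_no_swap: "lift x y \<Longrightarrow> \<not> lift y x"
proof
  assume "lift x y" "lift y x"
  then obtain u v where u: "x = rm (ev u) x0" "y = rm (ev u) y0" and v: "y = rm (ev v) x0" "x = rm (ev v) y0"
    unfolding lift_def by blast
  have "rm (ev (winv u @ v)) x0 = y0" "rm (ev (winv u @ v)) y0 = x0"
    using xy0 u v by (metis ev_append ev_winv rm_mult rm_adj det_ev)+
  then show False using no_swap[of "winv u @ v" "-1" "-1"] by (simp add: x0_def y0_def)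
qed

lemma inversion_0: "rm Sm x0 = yy 0" "rm Sm y0 = xx 0"
  by (simp_all add: x0_def y0_def xx_def)

text \<open>The translation by 3 is the inversion followed by a word, and the inversion reverses the
  geodesic of rank \<open>r\<close> into that of rank \<open>- 1 - r\<close>.\<close>

lemma lift_shift3: assumes "lift x y" shows "lift (y + 3) (x + 3)"
proof -
  obtain v where v: "x = rm (ev v) x0" "y = rm (ev v) y0" using assms by (auto simp: lift_def)
  obtain v' where v': "Tm 3 ** ev v = ev v' ** Tm 3" using ev_Tm' by blast
  have *: "z + 3 = rm (ev (v' @ [La, LB])) (rm Sm w)" if "z = rm (ev v) w" "w \<notin> \<rat>" for z w
  proof -
    have sw: "rm Sm w \<notin> \<rat>" using that(2) by (intro rm_irr) auto
    have "z + 3 = rm (Tm 3) (rm (ev v) w)" by (simp add: that)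
    also have "\<dots> = rm (ev v' ** Tm 3) w" by (simp only: v'[symmetric] rm_mult[OF that(2) det_ev])
    also have "\<dots> = rm (ev v' ** (ev [La, LB] ** Sm)) w" by (simp only: Tm_3 mult_uminus rm_uminus)
    also have "\<dots> = rm (ev v' ** ev [La, LB]) (rm Sm w)"
      by (simp only: matrix_mul_assoc rm_mult[OF that(2) det_Sm])
    finally show ?thesis by (simp only: ev_append)
  qed
  have "lift (rm (ev (v' @ [La, LB])) (xx 0)) (rm (ev (v' @ [La, LB])) (yy 0))"
    by (rule lift_word[OF lift_rank])
  then show ?thesis using *[OF v(1) xy0(3)] *[OF v(2) xy0(4)] by (simp only: inversion_0)
qed

lemma lift_shift6: assumes "lift x y" shows "lift (x + 6 * of_int k) (y + 6 * of_int k)"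
proof -
  have s: "lift (x + 6) (y + 6)" if "lift x y" for x y
    using lift_shift3[OF lift_shift3[OF that]] by (simp add: add.assoc)
  have d: "lift (x - 6) (y - 6)" if "lift x y" for x y
  proof -
    have "rm (Tm (- 6)) z = rm (ev (winv [La, LB, LA, Lb])) z" for z
    proof -
      have "Tm (- 6) = adj (Tm 6)" by simp
      also have "\<dots> = - ev (winv [La, LB, LA, Lb])" by (simp only: Tm_6 adj_uminus ev_winv)
      finally show ?thesis by simp
    qed
    then show ?thesis using lift_word[OF that, of "winv [La, LB, LA, Lb]"] by (simp add: rm_Tm)
  qed
  have pos: "lift (x + 6 * real j) (y + 6 * real j)" for j
  proof (induction j)
    case (Suc j) from s[OF this] show ?case by (simp add: algebra_simps)
  qed (simp add: assms)
  have neg: "lift (x - 6 * real j) (y - 6 * real j)" for j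
  proof (induction j)
    case (Suc j) from d[OF this] show ?case by (simp add: algebra_simps)
  qed (simp add: assms)
  show ?thesis
  proof (cases "k \<ge> 0")
    case True then show ?thesis using pos[of "nat k"] by simp
  next
    case False then show ?thesis using neg[of "nat (- k)"] by simp
  qed
qed

lemma lift_matrix:
  assumes "lift x y"
  shows "\<exists>N :: int ^ 2 ^ 2. det N = 1 \<and> trace N = 3 * m0 \<and> N$2$1 \<noteq> 0 \<and>
    of_int (N$2$1) * (x + y) = real_of_int (N$1$1 - N$2$2) \<and> of_int (N$2$1) * (x * y) = - real_of_int (N$1$2)"
proof -
  obtain v where v: "x = rm (ev v) x0" "y = rm (ev v) y0" using assms by (auto simp: lift_def)
  define N where "N = ev v ** A0 ** adj (ev v)"
  have d: "det N = 1" by (simp add: N_def det_mul)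
  have "trace N = trace (adj (ev v) ** (ev v ** A0))" unfolding N_def by (simp add: trace_2 algebra_simps)
  then have t: "trace N = 3 * m0" by (simp add: adj_cancel trace_A0)
  have Nv: "N ** ev v = ev v ** A0" by (simp add: N_def matrix_mul_assoc[symmetric] adj_inverse)
  have f: "rm N x = x" "rm N y = y"
    using xy0 A0_fix by (simp_all add: v rm_mult[symmetric] Nv) (simp_all add: rm_mult)
  have nz: "den N x \<noteq> 0" "den N y \<noteq> 0" using den_nz lift_irr[OF assms] d by auto
  have q: "of_int (N$2$1) * x\<^sup>2 + (of_int (N$2$2) - of_int (N$1$1)) * x - of_int (N$1$2) = (0::real)"
    "of_int (N$2$1) * y\<^sup>2 + (of_int (N$2$2) - of_int (N$1$1)) * y - of_int (N$1$2) = (0::real)"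
    using fixed_point_quadratic[OF nz(1)] fixed_point_quadratic[OF nz(2)] f by simp_all
  then have "(y - x) * (of_int (N$2$1) * (x + y) - (of_int (N$1$1) - of_int (N$2$2))) = 0"
    by (simp add: power2_eq_square algebra_simps)
  then have s: "of_int (N$2$1) * (x + y) = real_of_int (N$1$1) - of_int (N$2$2)" using lift_ne[OF assms] by simp
  have "of_int (N$2$1) * (x * y) = x * (of_int (N$2$1) * (x + y)) - of_int (N$2$1) * x\<^sup>2"
    by (simp add: power2_eq_square algebra_simps)
  also have "\<dots> = - of_int (N$1$2)" unfolding s using q(1) by (simp add: algebra_simps)
  finally have pr: "of_int (N$2$1) * (x * y) = - real_of_int (N$1$2)" .
  have "N$2$1 \<noteq> 0"
  proof
    assume z: "N$2$1 = 0"
    then have "N$1$1 * N$2$2 = 1" using d by (simp add: det_2)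
    then have "trace N = 2 \<or> trace N = -2" by (auto simp: trace_2 zmult_eq_1_iff)
    then show False using t by presburger
  qed
  then show ?thesis using d t s pr by (intro exI[of _ N]) simp
qed

lemma lift_same_start:
  assumes "lift x y" "lift x z" shows "y = z"
  using lift_matrix[OF assms(1)] lift_matrix[OF assms(2)] conjugate_unique[OF lift_irr(1)[OF assms(1)]] by blast

lemma lift_same_cross: assumes "lift x y" shows "\<not> lift y z"
proof
  assume a: "lift y z"
  obtain N :: "int ^ 2 ^ 2" where N: "N$2$1 \<noteq> 0" "of_int (N$2$1) * (x + y) = real_of_int (N$1$1 - N$2$2)" "of_int (N$2$1) * (x * y) = - real_of_int (N$1$2)"
    using lift_matrix[OF assms] by blast
  obtain K :: "int ^ 2 ^ 2" where K: "K$2$1 \<noteq> 0" "of_int (K$2$1) * (y + z) = real_of_int (K$1$1 - K$2$2)" "of_int (K$2$1) * (y * z) = - real_of_int (K$1$2)"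
    using lift_matrix[OF a] by blast
  have "x = z" using conjugate_unique[OF lift_irr(2)[OF assms] N(1) K(1)] N(2,3) K(2,3) by (metis add.commute mult.commute)
  then show False using a assms lift_no_swap by blast
qed

text \<open>A semicircle wider than 3 would cross its translate by 3.  Hence the lower left entries of the
  conjugates are at least the Markov number in absolute value, and the standard lift is a widest one.\<close>

lemma lift_width: assumes "lift x y" shows "(y - x)\<^sup>2 \<le> (y0 - x0)\<^sup>2"
proof -
  have "\<not> linked x y (y + 3) (x + 3)" using lift_unlinked[OF assms lift_shift3[OF assms]] .
  moreover have "(y + 3 - x) * (y + 3 - y) * ((x + 3 - x) * (x + 3 - y)) = 9 * (9 - (y - x)\<^sup>2)"
    by (simp add: power2_eq_square algebra_simps)
  ultimately have w: "(y - x)\<^sup>2 \<le> 9" by (simp add: linked_def)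
  obtain N :: "int ^ 2 ^ 2" where N: "det N = 1" "trace N = 3 * m0" "N$2$1 \<noteq> 0"
    "of_int (N$2$1) * (x + y) = real_of_int (N$1$1 - N$2$2)" "of_int (N$2$1) * (x * y) = - real_of_int (N$1$2)"
    using lift_matrix[OF assms] by blast
  let ?c = "real_of_int (N$2$1)"
  have "?c\<^sup>2 * (y - x)\<^sup>2 = (?c * (x + y))\<^sup>2 - 4 * ?c * (?c * (x * y))"
    by (simp add: power2_eq_square algebra_simps)
  also have "\<dots> = (real_of_int (N$1$1 - N$2$2))\<^sup>2 + 4 * ?c * of_int (N$1$2)" unfolding N(4,5) by simp
  also have "\<dots> = (of_int (trace N))\<^sup>2 - 4 * (of_int (N$1$1) * of_int (N$2$2) - of_int (N$1$2) * of_int (N$2$1))"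
    by (simp add: trace_2 power2_eq_square algebra_simps)
  also have "\<dots> = 9 * (of_int m0)\<^sup>2 - 4" by (simp add: det_real[OF N(1)] N(2) power2_eq_square)
  finally have e: "?c\<^sup>2 * (y - x)\<^sup>2 = 9 * (of_int m0)\<^sup>2 - 4" .
  have "9 * (of_int m0)\<^sup>2 - 4 \<le> ?c\<^sup>2 * 9" unfolding e[symmetric] using w by (intro mult_left_mono) auto
  then have "real_of_int (9 * m0\<^sup>2 - 4) \<le> real_of_int (9 * (N$2$1)\<^sup>2)" by simp
  then have i: "9 * m0\<^sup>2 - 4 \<le> 9 * (N$2$1)\<^sup>2" by (simp only: of_int_le_iff)
  have "m0\<^sup>2 \<le> (N$2$1)\<^sup>2" using i by linarith
  then have mc: "(of_int m0)\<^sup>2 \<le> ?c\<^sup>2" by (metis of_int_le_iff of_int_power)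
  have "(y - x)\<^sup>2 = 9 * ((of_int m0)\<^sup>2 / ?c\<^sup>2) - 4 / ?c\<^sup>2" using e N(3) by (simp add: field_simps)
  have "(of_int m0)\<^sup>2 * (y - x)\<^sup>2 \<le> ?c\<^sup>2 * (y - x)\<^sup>2" using mc by (intro mult_right_mono) auto
  also have "\<dots> = (of_int m0)\<^sup>2 * (y0 - x0)\<^sup>2" unfolding e width0 using m0_pos by (simp add: field_simps)
  finally show ?thesis using m0_pos by simp
qed

lemma c0_geodesic: "geodesic_line c0"
  using geodesic_gpt[of 1 y0 x0] xy0 by (simp add: c0_def[abs_def])

lemma Im_c0: "Im (c0 t) > 0"
  unfolding c0_def using xy0 by (intro Im_gpt_pos) simp

lemma c0_inj: "c0 s = c0 t \<Longrightarrow> s = t"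
  unfolding c0_def using gpt_inj[of x0 y0 "exp s" "exp t"] xy0 by simp

lemma mob_A0_c0: "mob A0 (c0 t) = c0 (t + L0)"
proof -
  have "mob A0 (c0 t) = gpt x0 y0 (exp t * lam / (1 / lam))"
    unfolding c0_def using mob_gpt[of A0 x0 y0 "exp t"] den_nz[OF xy0(3) det_A0] den_nz[OF xy0(4) det_A0]
    by (simp add: A0_fix den_A0_x0 lam_def)
  also have "exp t * lam / (1 / lam) = exp (t + L0)"
    using lam_pos by (simp add: exp_add L0_def exp_double power2_eq_square)
  finally show ?thesis by (simp add: c0_def)
qed

lemma mob_power_c0: "mob (ev (W (- 1) (k * nat n))) (c0 t) = c0 (t + of_nat k * L0)"
proof (induction k arbitrary: t)
  case (Suc k)
  have "ev (W (- 1) (Suc k * nat n)) = A0 ** ev (W (- 1) (k * nat n))"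
    unfolding ev_W_period by (simp add: A0_def)
  then show ?case using Suc Im_c0 by (simp add: mob_mult mob_A0_c0 algebra_simps)
qed simp

lemma mob_power_c0': "mob (adj (ev (W (- 1) (k * nat n)))) (c0 t) = c0 (t - of_nat k * L0)"
  using mob_power_c0[of k "t - of_nat k * L0"] mob_adj[OF det_ev Im_c0] by (metis diff_add_cancel)

lemma mob_c0: "mob (ev v) (c0 t) = gpt (rm (ev v) x0) (rm (ev v) y0) (exp t * den (ev v) y0 / den (ev v) x0)"
  "exp t * den (ev v) y0 / den (ev v) x0 * (rm (ev v) y0 - rm (ev v) x0) > 0"
proof -
  show "mob (ev v) (c0 t) = gpt (rm (ev v) x0) (rm (ev v) y0) (exp t * den (ev v) y0 / den (ev v) x0)"
    unfolding c0_def by (rule mob_gpt) (use den_nz xy0 in auto)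
  show "exp t * den (ev v) y0 / den (ev v) x0 * (rm (ev v) y0 - rm (ev v) x0) > 0"
    by (rule gpt_sign[OF xy0(3,4) det_ev]) (use xy0 in simp)
qed

lemma stabilizer_c0:
  assumes "rm (ev v) x0 = x0" "rm (ev v) y0 = y0"
  shows "\<exists>k::int. \<forall>t. mob (ev v) (c0 t) = c0 (t + of_int k * L0)"
proof -
  obtain k where "ev v = ev (W (- 1) (k * nat n)) \<or> ev v = adj (ev (W (- 1) (k * nat n)))"
    using fixing_word[of v "-1" "-1"] assms by (auto simp: x0_def y0_def)
  then show ?thesis
  proof
    assume "ev v = ev (W (- 1) (k * nat n))"
    then show ?thesis by (intro exI[of _ "int k"]) (simp add: mob_power_c0)
  next
    assume "ev v = adj (ev (W (- 1) (k * nat n)))"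
    then show ?thesis by (intro exI[of _ "- int k"]) (simp add: mob_power_c0')
  qed
qed

text \<open>Lifts do not cross, so points of the lift that agree on the torus are related by its stabilizer.\<close>

lemma torus_c0_eq:
  assumes "to_torus (c0 s) = to_torus (c0 t)" shows "\<exists>k::int. t = s + of_int k * L0"
proof -
  obtain v where v: "c0 t = mob (ev v) (c0 s)" using assms Im_c0 to_torus_eq_iff by blast
  have e: "gpt x0 y0 (exp t) = gpt (rm (ev v) x0) (rm (ev v) y0) (exp s * den (ev v) y0 / den (ev v) x0)"
    using trans[OF v mob_c0(1)[of v s]] unfolding c0_def[of t] .
  have "exp t * (y0 - x0) > 0" using xy0 by simp
  from meet_linked[OF this mob_c0(2)[of s v] e]
  have "linked x0 y0 (rm (ev v) x0) (rm (ev v) y0) \<or> (x0 = rm (ev v) x0 \<and> y0 = rm (ev v) y0) \<or> (x0 = rm (ev v) y0 \<and> y0 = rm (ev v) x0)" .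
  moreover have l: "lift (rm (ev v) x0) (rm (ev v) y0)" by (rule lift_word[OF lift_0])
  ultimately have "rm (ev v) x0 = x0" "rm (ev v) y0 = y0"
    using lift_unlinked[OF lift_0 l] lift_no_swap[OF lift_0] l by metis+
  from stabilizer_c0[OF this] show ?thesis using v c0_inj by metis
qed

lemma c0_simple_closed: "simple_closed_geodesic c0 L0"
proof -
  have "to_torus (c0 (t + L0)) = to_torus (c0 t)" for t
    using to_torus_mob[OF Im_c0, of "W (-1) (nat n)" t] mob_A0_c0[of t] by (simp add: A0_def M_def)
  moreover have "inj_on (to_torus \<circ> c0) {0..<L0}"
  proof (rule inj_onI)
    fix s t assume st: "s \<in> {0..<L0}" "t \<in> {0..<L0}" "(to_torus \<circ> c0) s = (to_torus \<circ> c0) t"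
    have "to_torus (c0 s) = to_torus (c0 t)" using st(3) by simp
    then obtain k :: int where k: "t = s + of_int k * L0" using torus_c0_eq by blast
    have "\<bar>of_int k * L0\<bar> < 1 * L0" using st k by auto
    then have "\<bar>real_of_int k\<bar> * L0 < 1 * L0" using L0_pos by (simp add: abs_mult)
    then have "\<bar>real_of_int k\<bar> < 1" using L0_pos by simp
    then have "real_of_int \<bar>k\<bar> < real_of_int 1" by simp
    then have "\<bar>k\<bar> < 1" by (simp only: of_int_less_iff)
    then show "s = t" using k by simp
  qed
  ultimately show ?thesis using c0_geodesic L0_pos by (simp add: simple_closed_geodesic_def)
qed

section \<open>The feet of the standard geodesic\<close>

definition u0 :: real where "u0 = (x0 + y0) / 2"
definition \<rho>0 :: real where "\<rho>0 = (y0 - x0) / 2"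
definition r0 :: "real \<Rightarrow> complex" where "r0 t = Complex u0 (\<rho>0 * exp t)"

lemma rho0_pos: "\<rho>0 > 0" using xy0 by (simp add: \<rho>0_def)

lemma Im_r0: "Im (r0 t) > 0" using rho0_pos by (simp add: r0_def)

lemma r0_0: "r0 0 = c0 0" by (simp add: r0_def c0_def gpt_top u0_def \<rho>0_def)

lemma c0_deriv: "(c0 has_vector_derivative of_real \<rho>0) (at 0)"
proof -
  have "(c0 has_vector_derivative \<i> * of_real (1 * exp 0 * (y0 - x0)) / (1 + \<i> * of_real (1 * exp 0))\<^sup>2) (at 0)"
    using gpt_has_vector_derivative[of x0 y0 1 0] by (simp add: c0_def[abs_def])
  moreover have "(1 + \<i>)\<^sup>2 = 2 * \<i>" by (simp add: power2_eq_square algebra_simps)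
  ultimately show ?thesis by (simp add: \<rho>0_def)
qed

lemma r0_deriv: "(r0 has_vector_derivative \<i> * of_real \<rho>0) (at 0)"
proof -
  have "(r0 = (\<lambda>t. of_real u0 + \<i> * of_real (\<rho>0 * exp t)))" by (auto simp: r0_def complex_eq_iff)
  moreover have "((\<lambda>t. of_real (\<rho>0 * exp t) :: complex) has_vector_derivative of_real (\<rho>0 * exp 0)) (at 0)"
    by (rule has_vector_derivative_of_real) (auto intro!: derivative_eq_intros)
  then have "((\<lambda>t. of_real u0 + \<i> * of_real (\<rho>0 * exp t)) has_vector_derivative \<i> * of_real (\<rho>0 * exp 0)) (at 0)"
    by (auto intro!: derivative_eq_intros)
  ultimately show ?thesis by simp
qed

text \<open>The vertical ray lies above all lifts, since it starts at the highest point of a widest one.\<close>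

lemma r0_disjoint: assumes "t > 0" shows "to_torus (r0 t) \<noteq> to_torus (c0 s)"
proof
  assume "to_torus (r0 t) = to_torus (c0 s)"
  from this[symmetric] obtain v where v: "r0 t = mob (ev v) (c0 s)" using to_torus_eq_iff[OF Im_c0 Im_r0] by blast
  let ?x = "rm (ev v) x0" and ?y = "rm (ev v) y0"
  have l: "lift ?x ?y" by (rule lift_word[OF lift_0])
  have "(Re (r0 t) - ?x) * (?y - Re (r0 t)) = (Im (r0 t))\<^sup>2" unfolding v mob_c0(1) by (rule gpt_circle)
  then have "(\<rho>0 * exp t)\<^sup>2 \<le> (?y - ?x)\<^sup>2 / 4" using square_sum_bound[of u0 ?x ?y] by (simp add: r0_def)
  also have "\<dots> \<le> \<rho>0\<^sup>2" using lift_width[OF l] by (simp add: \<rho>0_def power_divide)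
  finally have "\<rho>0 * exp t \<le> \<rho>0" using power2_le_imp_le[OF _ less_imp_le[OF rho0_pos]] by blast
  then show False using assms rho0_pos by simp
qed

text \<open>The foot is a highest point of the closed geodesic, so its perpendicular is a shortest connection
  to the cusp and cannot meet itself.\<close>

lemma r0_lower:
  assumes "mob (ev v) (r0 s) = r0 t" "s \<ge> 0" shows "t \<le> s"
proof (rule ccontr)
  assume ts: "\<not> t \<le> s"
  let ?c = "real_of_int (ev v $ 2 $ 1)" and ?d = "real_of_int (ev v $ 2 $ 2)"
  have Im: "Im (mob (ev v) z) = Im z / ((?c * Re z + ?d)\<^sup>2 + ?c\<^sup>2 * (Im z)\<^sup>2)" if "Im z > 0" for z
    unfolding mob_eq_rmob using Im_rmob[OF det_real[OF det_ev[of v]] that] by (simp add: cmod_power2 power_mult_distrib)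
  define K where "K z = (?c * Re z + ?d)\<^sup>2 + ?c\<^sup>2 * (Im z)\<^sup>2" for z
  have "\<rho>0 * exp t = \<rho>0 * exp s / K (r0 s)" using Im[OF Im_r0, of s] assms(1) by (simp add: K_def r0_def)
  moreover have "\<rho>0 * exp t > \<rho>0 * exp s" using ts rho0_pos by simp
  moreover have Kp: "K z > 0" if "Im z > 0" for z
  proof -
    have "K z = (cmod (of_real ?c * z + of_real ?d))\<^sup>2" by (simp add: K_def cmod_power2 power_mult_distrib)
    then show ?thesis using rmob_den_nz[OF det_real[OF det_ev[of v]] that] by simp
  qed
  ultimately have "\<rho>0 * exp s < \<rho>0 * exp s / K (r0 s)" by simp
  then have "(\<rho>0 * exp s) * K (r0 s) < (\<rho>0 * exp s) * 1" using Kp[OF Im_r0, of s] by (simp add: less_divide_eq)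
  then have K1: "K (r0 s) < 1"
    by (simp only: mult_less_cancel_left_pos[OF mult_pos_pos[OF rho0_pos exp_gt_zero]])
  have "K (c0 0) \<le> K (r0 s)"
  proof -
    have "\<rho>0 * 1 \<le> \<rho>0 * exp s" using rho0_pos assms(2) by (intro mult_left_mono) auto
    then have "\<rho>0\<^sup>2 \<le> (\<rho>0 * exp s)\<^sup>2" using rho0_pos by (intro power_mono) auto
    then show ?thesis unfolding r0_0[symmetric] K_def by (simp add: r0_def mult_left_mono)
  qed
  then have K2: "K (c0 0) < 1" using K1 by simp
  have Kpos: "K (c0 0) > 0" by (rule Kp[OF Im_c0])
  have "Im (mob (ev v) (c0 0)) = \<rho>0 / K (c0 0)" using Im[OF Im_r0, of 0] unfolding K_def r0_0[symmetric] by (simp add: r0_def)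
  also have "\<dots> > \<rho>0" using K2 Kpos rho0_pos by (simp add: field_simps)
  finally have hi: "Im (mob (ev v) (c0 0)) > \<rho>0" .
  let ?x = "rm (ev v) x0" and ?y = "rm (ev v) y0"
  have l: "lift ?x ?y" by (rule lift_word[OF lift_0])
  have "(Im (mob (ev v) (c0 0)))\<^sup>2 \<le> (?y - ?x)\<^sup>2 / 4"
    unfolding mob_c0(1) gpt_circle[symmetric] by (rule square_sum_bound)
  also have "\<dots> \<le> \<rho>0\<^sup>2" using lift_width[OF l] by (simp add: \<rho>0_def power_divide)
  finally have "Im (mob (ev v) (c0 0)) \<le> \<rho>0" using power2_le_imp_le[OF _ less_imp_le[OF rho0_pos]] by blast
  then show False using hi by simp
qed

lemma r0_torus_inj: assumes "to_torus (r0 s) = to_torus (r0 t)" "s \<ge> 0" "t \<ge> 0" shows "s = t"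
proof -
  obtain v where v: "r0 t = mob (ev v) (r0 s)" using to_torus_eq_iff[OF Im_r0 Im_r0] assms(1) by blast
  obtain w where w: "r0 s = mob (ev w) (r0 t)" using to_torus_eq_iff[OF Im_r0 Im_r0] assms(1)[symmetric] by blast
  show ?thesis using r0_lower[OF v[symmetric] assms(2)] r0_lower[OF w[symmetric] assms(3)] by linarith
qed

lemma r0_geodesic: "geodesic_line r0"
  using geodesic_vertical[OF rho0_pos, of u0] by (simp add: r0_def[abs_def])

lemma Tm6_in: "Tm 6 \<in> \<Union>Gam"
  unfolding Union_Gam by (rule exI, rule disjI2, rule Tm_6)

lemma left_foot: "cusp_foot \<i> c0 0"
proof -
  have "ends_at_cusp r0"
    unfolding ends_at_cusp_def
    by (rule bexI[OF _ Tm6_in]) (use filterlim_vertical[OF rho0_pos, of u0] in \<open>auto simp: trace_2 Tm_def mx_eq_iff r0_def[abs_def]\<close>)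
  moreover have "inj_on (to_torus \<circ> r0) {0..}" by (auto intro!: inj_onI r0_torus_inj)
  ultimately show ?thesis
    unfolding cusp_foot_def using r0_geodesic r0_0 c0_deriv r0_deriv r0_disjoint
    by (intro exI[of _ r0] conjI) (auto intro!: exI[of _ "of_real \<rho>0"])
qed

end

lemma mob_has_derivative:
  assumes "det A = 1" "Im z > 0"
  shows "\<exists>w. (mob A has_field_derivative w) (at z)"
proof -
  have nz: "of_int (A$2$1) * z + of_int (A$2$2) \<noteq> 0"
    using rmob_den_nz[OF det_real[OF assms(1)] assms(2)] by simp
  show ?thesis
    unfolding mob_def[abs_def] by (rule exI) (rule derivative_eq_intros refl nz)+
qed

lemma mob_sub:
  assumes "det A = 1" "A$2$1 \<noteq> 0" "Im z > 0"
  shows "mob A z = of_int (A$1$1) / of_int (A$2$1) - 1 / (of_int (A$2$1) * (of_int (A$2$1) * z + of_int (A$2$2)))"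
proof -
  let ?n = "of_int (A$2$1) * z + of_int (A$2$2)" and ?a = "of_int (A$1$1) :: complex" and ?b = "of_int (A$1$2) :: complex" and ?c = "of_int (A$2$1) :: complex" and ?d = "of_int (A$2$2) :: complex"
  have nz: "?n \<noteq> 0" "?c \<noteq> 0"
    using rmob_den_nz[OF det_real[OF assms(1)] assms(3)] assms(2) by simp_all
  have dt: "?a * ?d - ?b * ?c = 1"
  proof -
    have "of_int (A$1$1 * A$2$2 - A$1$2 * A$2$1) = (of_int 1 :: complex)" using assms(1) by (simp only: det_2)
    then show ?thesis by simp
  qed
  have "?a / ?c - 1 / (?c * ?n) = (?a * ?n - 1) / (?c * ?n)" using nz by (simp add: diff_divide_distrib)
  also have "?a * ?n - 1 = ?c * (?a * z + ?b)" unfolding dt[symmetric] by (simp add: algebra_simps)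
  also have "?c * (?a * z + ?b) / (?c * ?n) = mob A z" using nz by (simp add: mob_def)
  finally show ?thesis by simp
qed

lemma rm_sub:
  assumes "det A = 1" "A$2$1 \<noteq> 0" "den A z \<noteq> 0"
  shows "rm A z = of_int (A$1$1) / of_int (A$2$1) - 1 / (of_int (A$2$1) * den A z)"
proof -
  let ?a = "real_of_int (A$1$1)" and ?b = "real_of_int (A$1$2)" and ?c = "real_of_int (A$2$1)" and ?d = "real_of_int (A$2$2)"
  have dt: "?a * ?d - ?b * ?c = 1" by (rule det_real[OF assms(1)])
  have "?a / ?c - 1 / (?c * den A z) = (?a * den A z - 1) / (?c * den A z)" using assms(2,3) by (simp add: diff_divide_distrib)
  also have "?a * den A z - 1 = ?c * (?a * z + ?b)" unfolding dt[symmetric] by (simp add: den_def algebra_simps)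
  also have "?c * (?a * z + ?b) / (?c * den A z) = rm A z" using assms(2) by (simp add: rm_def)
  finally show ?thesis by simp
qed

text \<open>A semicircle that fits into the gap between two neighbouring translates by 3 of the standard
  semicircle, in the coordinate \<open>e\<close> that measures the distance from the centre of the gap.
  The stabilizer of the neighbour acts by \<open>e \<mapsto> 3 - \<mu> / e\<close>.  As it moves the small
  semicircle off itself, it carries some point of the vertical ray above it to another point of
  the ray.\<close>

lemma gap_core:
  fixes a b \<delta> \<mu> :: real
  assumes "0 < a" "a < b" "b < \<delta>" "\<delta> < 3 / 2" "\<mu> = \<delta> * (3 - \<delta>)"
    and unl: "\<not> linked a b (3 - \<mu> / a) (3 - \<mu> / b)"
  shows "\<exists>\<eta>. \<eta> \<ge> (b - a) / 2 \<and> ((a + b) / 2)\<^sup>2 + \<eta>\<^sup>2 = \<mu> * ((a + b) / 2) / (3 - (a + b) / 2)"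
proof -
  define \<epsilon> \<rho> where "\<epsilon> = (a + b) / 2" and "\<rho> = (b - a) / 2"
  have ab: "a = \<epsilon> - \<rho>" "b = \<epsilon> + \<rho>" by (simp_all add: \<epsilon>_def \<rho>_def field_simps)
  have \<rho>: "0 < \<rho>" "\<rho> < \<epsilon>" "\<epsilon> < 3 / 2" using assms by (simp_all add: \<epsilon>_def \<rho>_def)
  have down: "3 - \<mu> / e < e" if "0 < e" "e < \<delta>" for e
  proof -
    have "\<mu> - e * (3 - e) = (\<delta> - e) * (3 - \<delta> - e)" by (simp add: assms(5) algebra_simps)
    moreover have "(\<delta> - e) * (3 - \<delta> - e) > 0" using that assms(4) by (intro mult_pos_pos) auto
    ultimately have "e * (3 - e) < \<mu>" by simp
    then have "3 - e < \<mu> / e" using that by (simp add: less_divide_eq mult.commute)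
    then show ?thesis by simp
  qed
  have \<mu>0: "\<mu> > 0" using assms by simp
  have "3 - \<mu> / a < 3 - \<mu> / b" using assms \<mu>0 by (simp add: frac_less2 divide_strict_left_mono)
  then have "3 - \<mu> / b \<le> a"
  proof (rule_tac ccontr)
    assume "\<not> 3 - \<mu> / b \<le> a"
    then have 1: "3 - \<mu> / b - a > 0" by simp
    have 2: "3 - \<mu> / b - b < 0" "3 - \<mu> / a - a < 0" "3 - \<mu> / a - b < 0"
      using down[of a] down[of b] assms by simp_all
    have "(3 - \<mu> / a - a) * (3 - \<mu> / a - b) > 0" "(3 - \<mu> / b - a) * (3 - \<mu> / b - b) < 0"
      using 1 2 by (simp_all add: mult_neg_neg mult_pos_neg)
    then have "(3 - \<mu> / a - a) * (3 - \<mu> / a - b) * ((3 - \<mu> / b - a) * (3 - \<mu> / b - b)) < 0"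
      by (rule mult_pos_neg)
    then show False using unl unfolding linked_def by blast
  qed
  then have "(3 - a) * b \<le> \<mu>" using assms by (simp add: le_divide_eq) (simp add: field_simps)
  then have m: "(3 - \<epsilon> + \<rho>) * (\<epsilon> + \<rho>) \<le> \<mu>" by (simp add: ab algebra_simps)
  define H where "H = \<mu> * \<epsilon> / (3 - \<epsilon>) - \<epsilon>\<^sup>2"
  have H: "H \<ge> \<rho>\<^sup>2"
  proof -
    have "(3 - \<epsilon>) * H = \<mu> * \<epsilon> - \<epsilon>\<^sup>2 * (3 - \<epsilon>)" using \<rho> by (simp add: H_def field_simps)
    also have "\<dots> \<ge> (3 - \<epsilon> + \<rho>) * (\<epsilon> + \<rho>) * \<epsilon> - \<epsilon>\<^sup>2 * (3 - \<epsilon>)"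
      using mult_right_mono[OF m, of \<epsilon>] \<rho> by simp
    also have "(3 - \<epsilon> + \<rho>) * (\<epsilon> + \<rho>) * \<epsilon> - \<epsilon>\<^sup>2 * (3 - \<epsilon>) = (3 - \<epsilon>) * \<rho>\<^sup>2 + ((3 - \<epsilon>) * \<rho> * (\<epsilon> - \<rho>) + \<epsilon> * \<rho> * (\<epsilon> + \<rho>))"
      by (simp add: power2_eq_square algebra_simps)
    also have "\<dots> \<ge> (3 - \<epsilon>) * \<rho>\<^sup>2" using \<rho> by simp
    finally have "(3 - \<epsilon>) * \<rho>\<^sup>2 \<le> (3 - \<epsilon>) * H" .
    then show ?thesis using \<rho> by simp
  qed
  have "sqrt H \<ge> \<rho>" using H by (rule real_le_rsqrt)
  moreover have "\<epsilon>\<^sup>2 + (sqrt H)\<^sup>2 = \<mu> * \<epsilon> / (3 - \<epsilon>)"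
  proof -
    have "H \<ge> 0" using H by (rule order_trans[OF zero_le_power2])
    then show ?thesis by (simp add: H_def)
  qed
  ultimately show ?thesis unfolding \<epsilon>_def[symmetric] \<rho>_def[symmetric] by blast
qed

text \<open>Every rational number is carried to infinity by an element of the group, since the translations
  represent all its cosets in the modular group.\<close>

lemma word_to_infinity:
  assumes "x \<in> \<rat>"
  shows "\<exists>ws. ev ws $ 2 $ 1 \<noteq> 0 \<and> of_int (ev ws $ 2 $ 1) * x + of_int (ev ws $ 2 $ 2) = (0 :: real)"
proof -
  obtain P Q :: int where PQ: "Q > 0" "coprime P Q" "x = of_int P / of_int Q"
    using assms by (rule Rats_cases')
  obtain u v where uv: "u * P + v * Q = 1" using PQ(2) by (metis bezout_int coprime_imp_gcd_eq_1)
  define N where "N = mx (- u) (- v) Q (- P)"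
  have "det N = 1" using uv by (simp add: N_def det_mx)
  then obtain k ws where kw: "N = Tm k ** ev ws \<or> N = - (Tm k ** ev ws)" using SL2Z_decomp by blast
  have "(Tm k ** ev ws) $ 2 $ 1 = ev ws $ 2 $ 1" "(Tm k ** ev ws) $ 2 $ 2 = ev ws $ 2 $ 2" by (simp_all add: Tm_def)
  then have "ev ws $ 2 $ 1 = Q \<and> ev ws $ 2 $ 2 = - P \<or> ev ws $ 2 $ 1 = - Q \<and> ev ws $ 2 $ 2 = P"
    using kw by (auto simp: N_def mx_eq_iff)
  then show ?thesis using PQ by (intro exI[of _ ws]) auto
qed

lemma cusp_to_infinity:
  assumes "ends_at_cusp r" "\<And>t. Im (r t) > 0"
  shows "\<exists>ws. filterlim (\<lambda>t. mob (ev ws) (r t)) at_infinity at_top"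
proof -
  obtain A where A: "A \<in> \<Union>Gam" "\<bar>trace A\<bar> = 2" "A \<noteq> mat 1" "A \<noteq> - mat 1"
    and lim: "(A$2$1 = 0 \<and> filterlim r at_infinity at_top) \<or>
         (\<exists>x::real. of_int (A$1$1) * x + of_int (A$1$2) = x * (of_int (A$2$1) * x + of_int (A$2$2)) \<and> (r \<longlongrightarrow> of_real x) at_top)"
    using assms(1) unfolding ends_at_cusp_def by blast
  have dA: "det A = 1" using A(1) unfolding Union_Gam by auto
  from lim show ?thesis
  proof
    assume "A$2$1 = 0 \<and> filterlim r at_infinity at_top"
    then show ?thesis by (intro exI[of _ "[]"]) simp
  next
    assume "\<exists>x::real. of_int (A$1$1) * x + of_int (A$1$2) = x * (of_int (A$2$1) * x + of_int (A$2$2)) \<and> (r \<longlongrightarrow> of_real x) at_top"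
    then obtain x :: real where x: "of_int (A$1$1) * x + of_int (A$1$2) = x * (of_int (A$2$1) * x + of_int (A$2$2))" "(r \<longlongrightarrow> of_real x) at_top" by blast
    have tr: "(trace A)\<^sup>2 = 4" using A(2) by (metis power2_abs power2_eq_square mult_2 numeral_Bit0 numeral_One one_add_one)
    have "x \<in> \<rat>"
    proof (cases "A$2$1 = 0")
      case True
      then have "A$1$1 * A$2$2 = 1" using dA by (simp add: det_2)
      then have "A$1$1 = A$2$2 \<and> (A$1$1 = 1 \<or> A$1$1 = -1)" by (auto simp: zmult_eq_1_iff)
      then show ?thesis using x(1) True A(3,4) by (auto simp: mx_eq_iff)
    next
      case False
      let ?c = "real_of_int (A$2$1)" and ?s = "real_of_int (A$1$1) - of_int (A$2$2)"
      have "(2 * ?c * x - ?s)\<^sup>2 = 4 * ?c * (x * (?c * x + of_int (A$2$2)) - of_int (A$1$1) * x - of_int (A$1$2)) + (of_int (trace A))\<^sup>2 - 4 * (of_int (A$1$1) * of_int (A$2$2) - of_int (A$1$2) * of_int (A$2$1))"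
        by (simp add: trace_2 power2_eq_square algebra_simps)
      also have "\<dots> = 0"
        unfolding det_real[OF dA] x(1)[symmetric] using tr by (simp flip: of_int_power)
      finally have "x = ?s / (2 * ?c)" using False by (simp add: field_simps)
      then show ?thesis by simp
    qed
    then obtain ws where ws: "ev ws $ 2 $ 1 \<noteq> 0" "of_int (ev ws $ 2 $ 1) * x + of_int (ev ws $ 2 $ 2) = (0 :: real)"
      using word_to_infinity by blast
    let ?a = "of_int (ev ws $ 1 $ 1) :: complex" and ?b = "of_int (ev ws $ 1 $ 2) :: complex"
      and ?c = "of_int (ev ws $ 2 $ 1) :: complex" and ?d = "of_int (ev ws $ 2 $ 2) :: complex"
    have l1: "((\<lambda>t. ?a * r t + ?b) \<longlongrightarrow> ?a * of_real x + ?b) at_top" by (intro tendsto_intros x(2))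
    have l2: "?a * of_real x + ?b \<noteq> 0"
    proof
      assume "?a * of_real x + ?b = 0"
      then have "of_real (of_int (ev ws $ 1 $ 1) * x + of_int (ev ws $ 1 $ 2)) = (0 :: complex)" by simp
      then have "of_int (ev ws $ 1 $ 1) * x + of_int (ev ws $ 1 $ 2) = 0" by (simp only: of_real_eq_0_iff)
      then have "of_int (ev ws $ 2 $ 2) * (of_int (ev ws $ 1 $ 1) * x + of_int (ev ws $ 1 $ 2)) - of_int (ev ws $ 1 $ 2) * (of_int (ev ws $ 2 $ 1) * x + of_int (ev ws $ 2 $ 2)) = 0"
        unfolding ws(2) by simp
      then have "(of_int (ev ws $ 1 $ 1) * of_int (ev ws $ 2 $ 2) - of_int (ev ws $ 1 $ 2) * of_int (ev ws $ 2 $ 1)) * x = 0"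
        by (simp add: algebra_simps)
      then have "x = 0" by (simp add: det_real)
      then show False using ws(2) \<open>of_int (ev ws $ 1 $ 1) * x + of_int (ev ws $ 1 $ 2) = 0\<close> det_real[OF det_ev[of ws]] by simp
    qed
    have l3: "filterlim (\<lambda>t. ?c * r t + ?d) (at 0) at_top"
    proof (rule filterlim_atI)
      have "((\<lambda>t. ?c * r t + ?d) \<longlongrightarrow> ?c * of_real x + ?d) at_top" by (intro tendsto_intros x(2))
      moreover have "?c * of_real x + ?d = of_real (of_int (ev ws $ 2 $ 1) * x + of_int (ev ws $ 2 $ 2))" by simp
      ultimately show "((\<lambda>t. ?c * r t + ?d) \<longlongrightarrow> 0) at_top" by (simp only: ws(2) of_real_0)
      show "\<forall>\<^sub>F t in at_top. ?c * r t + ?d \<noteq> 0"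
        using rmob_den_nz[OF det_real[OF det_ev[of ws]] assms(2)] by (simp add: always_eventually)
    qed
    have "filterlim (\<lambda>t. (?a * r t + ?b) * inverse (?c * r t + ?d)) at_infinity at_top"
      by (rule tendsto_mult_filterlim_at_infinity[OF l1 l2 filterlim_compose[OF filterlim_inverse_at_infinity l3]])
    then show ?thesis unfolding mob_def divide_inverse by blast
  qed
qed

lemma not_at_infinity: "(f \<longlongrightarrow> l) F \<Longrightarrow> F \<noteq> bot \<Longrightarrow> \<not> filterlim f at_infinity F" for f :: "'b \<Rightarrow> complex"
  using not_tendsto_and_filterlim_at_infinity by blast

lemma geodesic_to_infinity:
  assumes "geodesic_line r" "filterlim r at_infinity at_top"
  shows "\<exists>u k. k > 0 \<and> (\<forall>t. r t = Complex u (k * exp t))"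
  using assms(1)
proof (cases rule: geodesic_cases)
  case (semicircle x y k)
  then have "k \<noteq> 0" by auto
  have "r = (\<lambda>t. gpt x y (k * exp t))" using semicircle(2) by blast
  then have "(r \<longlongrightarrow> of_real y) at_top" using gpt_tendsto_top[OF \<open>k \<noteq> 0\<close>, of x y] by simp
  then show ?thesis using assms(2) not_at_infinity[of r _ at_top] by simp
next
  case (up u k)
  then show ?thesis by blast
next
  case (down u k)
  have e: "((\<lambda>t. exp (- t :: real)) \<longlongrightarrow> 0) at_top"
    by (rule filterlim_compose[OF exp_at_bot filterlim_uminus_at_bot_at_top])
  have "((\<lambda>t. Complex u (k * exp (- t))) \<longlongrightarrow> Complex u (k * 0)) at_top"
    by (intro tendsto_Complex tendsto_const tendsto_mult e)
  moreover have "r = (\<lambda>t. Complex u (k * exp (- t)))" using down(2) by blast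
  ultimately have "(r \<longlongrightarrow> Complex u (k * 0)) at_top" by simp
  then show ?thesis using assms(2) not_at_infinity[of r _ at_top] by simp
qed

lemma geodesic_mob: "det A = 1 \<Longrightarrow> geodesic_line r \<Longrightarrow> geodesic_line (\<lambda>t. mob A (r t))"
  unfolding geodesic_line_def mob_eq_rmob using Im_rmob_pos[OF det_real] hyp_dist_rmob[OF det_real] by simp

text \<open>A perpendicular to a geodesic that runs to the cusp, moved to the cusp at infinity: the vertical
  ray over the top of a lift.\<close>

lemma vertical_perpendicular:
  assumes "\<theta> * (y - x) > 0" "\<i> * of_real (\<theta> * (y - x)) / (1 + \<i> * of_real \<theta>)\<^sup>2 = of_real k"
  shows "k = (y - x) / 2 \<and> gpt x y \<theta> = Complex ((x + y) / 2) \<bar>k\<bar>"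
proof -
  have nz: "1 + \<i> * of_real \<theta> \<noteq> 0" by (rule gpt_den_nz)
  have "\<i> * of_real (\<theta> * (y - x)) = of_real k * (1 + \<i> * of_real \<theta>)\<^sup>2"
    using assms(2) nz by (simp add: divide_eq_eq)
  then have "Re (\<i> * of_real (\<theta> * (y - x))) = Re (of_real k * (1 + \<i> * of_real \<theta>)\<^sup>2)"
    and im: "Im (\<i> * of_real (\<theta> * (y - x))) = Im (of_real k * (1 + \<i> * of_real \<theta>)\<^sup>2)" by simp_all
  then have re: "k * (1 - \<theta>\<^sup>2) = 0" by (simp add: power2_eq_square)
  from im have im': "\<theta> * (y - x) = 2 * k * \<theta>" by (simp add: power2_eq_square) (auto simp: mult.commute)
  have th: "\<theta> \<noteq> 0" using assms(1) by auto
  have "\<theta> * (y - x) = \<theta> * (2 * k)" using im' by (simp only: mult.commute mult.left_commute)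
  then have "y - x = 2 * k" by (simp only: mult_left_cancel[OF th])
  then have k: "k = (y - x) / 2" by simp
  then have "k \<noteq> 0" using assms(1) by auto
  then have "\<theta>\<^sup>2 = 1" using re by simp
  then have "Re (gpt x y \<theta>) = (x + y) / 2" "Im (gpt x y \<theta>) = \<theta> * k" using k by (simp_all add: Re_gpt Im_gpt)
  moreover have "\<theta> * k = \<bar>k\<bar>"
  proof -
    have "\<theta> * k = \<theta> * (y - x) / 2" unfolding k by simp
    then have "\<theta> * k > 0" using assms(1) by linarith
    moreover have "\<bar>\<theta>\<bar> = 1" using \<open>\<theta>\<^sup>2 = 1\<close> by (simp add: power2_eq_1_iff) auto
    ultimately show ?thesis by (metis abs_mult abs_of_pos mult_1)
  qed
  ultimately show ?thesis using k by (simp add: complex_eq_iff)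
qed

context rot
begin

subsection \<open>The right foot\<close>

text \<open>The number of steps of the rotation from the top rank \<open>- 1\<close> to the bottom rank \<open>0\<close>, which is the inverse
  of \<open>p\<close> modulo \<open>n\<close>.\<close>

definition jj :: nat where "jj = (LEAST k. (- 1 + int k * p) mod n = 0)"

lemma jj: "(- 1 + int jj * p) mod n = 0"
proof -
  obtain k where "(- 1 + int k * p) mod n = 0 mod n" using ranks_reach by blast
  then have "(- 1 + int k * p) mod n = 0" by simp
  then show ?thesis unfolding jj_def by (rule LeastI)
qed

text \<open>The word \<open>hh\<close> carries the geodesic of rank 0, the reversed image of the standard lift under the inversion, back to
  the standard lift.  So \<open>EE\<close> reverses the standard lift, and \<open>D0\<close> is the parameter to which it moves the top.\<close>

definition hh :: "int ^ 2 ^ 2" where "hh = ev (W (- 1) jj)"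
definition EE :: "int ^ 2 ^ 2" where "EE = hh ** Sm"
definition dh :: real where "dh = den hh (yy 0)"
definition D0 :: real where "D0 = 2 * ln (- x0 * dh)"

lemma det_hh [simp]: "det hh = 1" by (simp add: hh_def)
lemma det_EE [simp]: "det EE = 1" by (simp add: EE_def det_mul)

lemma hh_ends: "rm hh (xx 0) = x0" "rm hh (yy 0) = y0"
proof -
  have "(- 1 + int jj * p) mod n = 0 mod n" using jj by simp
  then show "rm hh (xx 0) = x0" "rm hh (yy 0) = y0"
    using ev_W_step[of "-1" jj] xx_mod yy_mod unfolding hh_def x0_def y0_def by metis+
qed

lemma hh_22: "hh $ 2 $ 2 > 0" and dh_pos: "dh > 0"
proof -
  have "hh $ 2 $ 2 > 0 \<and> hh $ 2 $ 1 \<ge> 0"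
  proof (cases "jj = 0")
    case True then show ?thesis by (simp add: hh_def)
  next
    case False
    then have "posmat hh" unfolding hh_def using set_W by (intro posmat_ev) (auto simp flip: length_0_conv)
    then show ?thesis by (simp add: posmat_def)
  qed
  then show "hh $ 2 $ 2 > 0" "dh > 0" using yy_pos[of 0] by (auto simp: dh_def den_def add_nonneg_pos)
qed

lemma EE_ends: "rm EE x0 = y0" "rm EE y0 = x0"
  using xy0 hh_ends inversion_0 by (simp_all add: EE_def rm_mult)

lemma xx_0: "xx 0 = - 1 / y0" and yy_0: "yy 0 = - 1 / x0"
  using inversion_0 by simp_all

lemma EE_den: "den EE x0 = dh * x0" "den EE y0 = - 1 / (x0 * dh)"
proof -
  show "den EE x0 = dh * x0" using xy0 inversion_0 by (simp add: EE_def den_mult dh_def)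
  have nz: "den hh (xx 0) \<noteq> 0" "dh \<noteq> 0" using den_nz xx_irr dh_pos by simp_all
  have "y0 - x0 = (yy 0 - xx 0) / (den hh (xx 0) * dh)"
    using rm_diff[OF xx_irr[of 0] yy_irr[of 0] det_hh] by (simp add: hh_ends dh_def)
  then have "(y0 - x0) * (den hh (xx 0) * dh) = yy 0 - xx 0" using nz by (simp add: eq_divide_eq)
  also have "\<dots> = (y0 - x0) * (- 1 / (x0 * y0))" using xy0 unfolding xx_0 yy_0 by (simp add: field_simps)
  finally have "den hh (xx 0) * dh = - 1 / (x0 * y0)" using xy0 by (simp only: mult_cancel_left) auto
  then have "den hh (xx 0) * y0 = - 1 / (x0 * dh)" using nz xy0 by (simp add: field_simps)
  moreover have "den EE y0 = den hh (xx 0) * y0" using xy0 inversion_0 by (simp add: EE_def den_mult)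
  ultimately show "den EE y0 = - 1 / (x0 * dh)" by simp
qed

lemma mob_EE_c0: "mob EE (c0 t) = c0 (D0 - t)"
proof -
  have nz: "den EE x0 \<noteq> 0" "den EE y0 \<noteq> 0" using den_nz xy0 by simp_all
  have pos: "- x0 * dh > 0" using xy0 dh_pos by (simp add: mult_neg_pos)
  have ex: "exp D0 = (x0 * dh)\<^sup>2"
    using pos by (simp add: D0_def exp_double power_mult_distrib)
  have "mob EE (c0 t) = gpt y0 x0 (exp t * den EE y0 / den EE x0)"
    unfolding c0_def by (simp add: mob_gpt[OF nz] EE_ends)
  also have "exp t * den EE y0 / den EE x0 = - exp t / exp D0"
    unfolding EE_den ex using xy0 dh_pos by (simp add: field_simps power2_eq_square)
  also have "gpt y0 x0 (- exp t / exp D0) = gpt x0 y0 (- 1 / (- exp t / exp D0))"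
    by (rule gpt_flip) simp
  also have "- 1 / (- exp t / exp D0) = exp (D0 - t)" by (simp add: exp_diff)
  finally show ?thesis by (simp add: c0_def)
qed

text \<open>The inversion and the translation by 3 agree up to sign and an element of the group.\<close>

lemma torus_EE: assumes "Im z > 0" shows "to_torus (mob EE z) = to_torus (z + 3)"
proof -
  have I: "Im (mob Sm z) > 0" using Im_mob_pos[OF det_Sm assms] .
  have "z + 3 = mob (Tm 3) z" by simp
  also have "\<dots> = mob (ev [La, LB]) (mob Sm z)" unfolding Tm_3 by (simp only: mob_uminus mob_mult[OF det_Sm assms])
  finally have "to_torus (z + 3) = to_torus (mob Sm z)" by (simp only: to_torus_mob[OF I])
  moreover have "mob EE z = mob hh (mob Sm z)" unfolding EE_def by (rule mob_mult[OF det_Sm assms])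
  ultimately show ?thesis unfolding hh_def by (simp only: to_torus_mob[OF I])
qed

text \<open>The image under \<open>EE\<close> of the ray at the left foot.  Since \<open>EE\<close> preserves the orientation of the plane
  but reverses the lift, the ray now leaves on the right.\<close>

lemma right_foot: "cusp_foot (- \<i>) c0 D0"
proof -
  define r1 where "r1 t = mob EE (r0 t)" for t
  have E21: "EE $ 2 $ 1 > 0" using hh_22 by (simp add: EE_def Sm_def)
  have geo: "geodesic_line r1" unfolding r1_def[abs_def] by (rule geodesic_mob[OF det_EE r0_geodesic])
  have r10: "r1 0 = c0 D0" by (simp add: r1_def r0_0 mob_EE_c0)
  obtain w where w: "(mob EE has_field_derivative w) (at (c0 0))" using mob_has_derivative[OF det_EE Im_c0] by blast
  have d1: "(r1 has_vector_derivative (\<i> * of_real \<rho>0) * w) (at 0)"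
    using field_vector_diff_chain_at[OF r0_deriv, of "mob EE" w] w by (simp add: r0_0 o_def r1_def[abs_def])
  have "((mob EE \<circ> c0) has_vector_derivative of_real \<rho>0 * w) (at 0)"
    by (rule field_vector_diff_chain_at[OF c0_deriv w])
  then have "((\<lambda>t. c0 (D0 - t)) has_vector_derivative of_real \<rho>0 * w) (at (D0 - D0))"
    by (simp add: o_def mob_EE_c0)
  moreover have "((\<lambda>t. D0 - t) has_vector_derivative - 1) (at D0)" by (auto intro!: derivative_eq_intros)
  ultimately have "(((\<lambda>t. c0 (D0 - t)) \<circ> (\<lambda>t. D0 - t)) has_vector_derivative (- 1) *\<^sub>R (of_real \<rho>0 * w)) (at D0)"
    using vector_diff_chain_at by blast
  then have d0: "(c0 has_vector_derivative - (of_real \<rho>0 * w)) (at D0)" by (simp add: o_def)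
  have tor: "to_torus (r1 t) = to_torus (r0 t + of_int 3)" for t
    unfolding r1_def using torus_EE[OF Im_r0] by simp
  have inj: "inj_on (to_torus \<circ> r1) {0..}"
    by (intro inj_onI) (simp add: tor to_torus_shift[OF Im_r0 Im_r0] r0_torus_inj del: of_int_numeral)
  have dis: "to_torus (r1 t) \<notin> range (to_torus \<circ> c0)" if "t > 0" for t
  proof
    assume "to_torus (r1 t) \<in> range (to_torus \<circ> c0)"
    then obtain s where "to_torus (r1 t) = to_torus (c0 s)" by auto
    also have "c0 s = mob EE (c0 (D0 - s))" by (simp add: mob_EE_c0)
    also have "to_torus \<dots> = to_torus (c0 (D0 - s) + of_int 3)" using torus_EE[OF Im_c0] by simp
    finally have "to_torus (r0 t) = to_torus (c0 (D0 - s))"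
      unfolding tor using to_torus_shift[OF Im_r0 Im_c0] by blast
    then show False using r0_disjoint[OF that] by blast
  qed
  have cusp: "ends_at_cusp r1"
  proof -
    define P where "P = EE ** Tm 6 ** adj EE"
    have "P \<in> \<Union>Gam"
    proof -
      have S: "Sm ** (Tm 6 ** adj Sm) = ev [Lb, LA] ** (Tm 6 ** adj (ev [Lb, LA]))"
        by (simp add: Sm_def Tm_def mx_mult mx_one)
      have "P = hh ** (Sm ** (Tm 6 ** adj Sm)) ** adj hh" by (simp add: P_def EE_def adj_mult matrix_mul_assoc)
      also have "\<dots> = hh ** (ev [Lb, LA] ** (Tm 6 ** adj (ev [Lb, LA]))) ** adj hh" by (simp only: S)
      also have "\<dots> = - ev (W (- 1) jj @ [Lb, LA] @ [La, LB, LA, Lb] @ winv [Lb, LA] @ winv (W (- 1) jj))"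
        unfolding Tm_6 hh_def by (simp only: ev_append ev_winv mult_uminus matrix_mul_assoc)
      finally show ?thesis unfolding Union_Gam by blast
    qed
    have Pe: "P $ 1 $ 1 = 1 - 6 * (EE$1$1 * EE$2$1)" "P $ 1 $ 2 = 6 * (EE$1$1 * EE$1$1)"
      "P $ 2 $ 1 = - 6 * (EE$2$1 * EE$2$1)" "P $ 2 $ 2 = 1 + 6 * (EE$1$1 * EE$2$1)"
      using det_EE by (simp_all add: P_def Tm_def adj_def det_2 algebra_simps)
    have tr: "\<bar>trace P\<bar> = 2" unfolding trace_2 Pe by simp
    have ne: "P \<noteq> mat 1" "P \<noteq> - mat 1" using E21 by (auto simp: mx_eq_iff Pe)
    have lim: "(r1 \<longlongrightarrow> of_real (of_int (EE$1$1) / of_int (EE$2$1))) at_top"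
    proof -
      let ?c = "real_of_int (EE$2$1)" and ?d = "real_of_int (EE$2$2)"
      have rt: "r1 t = of_real (of_int (EE$1$1) / ?c) - (1 / of_real ?c) / Complex (?c * u0 + ?d) ((?c * \<rho>0) * exp t)" for t
      proof -
        have "of_int (EE$2$1) * r0 t + of_int (EE$2$2) = Complex (?c * u0 + ?d) ((?c * \<rho>0) * exp t)"
          by (simp add: complex_eq_iff r0_def)
        then show ?thesis unfolding r1_def using mob_sub[OF det_EE _ Im_r0, of t] E21 by simp
      qed
      have "((\<lambda>t. (1 / of_real ?c) / Complex (?c * u0 + ?d) ((?c * \<rho>0) * exp t)) \<longlongrightarrow> 0) at_top"
        using E21 rho0_pos by (intro tendsto_divide_0[OF tendsto_const] filterlim_vertical) simp
      then have "((\<lambda>t. of_real (of_int (EE$1$1) / ?c) - (1 / of_real ?c) / Complex (?c * u0 + ?d) ((?c * \<rho>0) * exp t)) \<longlongrightarrow> of_real (of_int (EE$1$1) / ?c) - 0) at_top"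
        by (intro tendsto_diff tendsto_const)
      moreover have "r1 = (\<lambda>t. of_real (of_int (EE$1$1) / ?c) - (1 / of_real ?c) / Complex (?c * u0 + ?d) ((?c * \<rho>0) * exp t))"
        using rt by blast
      ultimately show ?thesis by simp
    qed
    have fx: "of_int (P$1$1) * z + of_int (P$1$2) = z * (of_int (P$2$1) * z + of_int (P$2$2))" if "z = real_of_int (EE$1$1) / of_int (EE$2$1)" for z
      using E21 unfolding that Pe by (simp add: field_simps)
    show ?thesis
      unfolding ends_at_cusp_def
      by (rule bexI[OF _ \<open>P \<in> \<Union>Gam\<close>])
        (intro conjI disjI2 exI[of _ "real_of_int (EE$1$1) / of_int (EE$2$1)"] tr ne lim fx[OF refl])
  qed
  have "- \<i> * - (of_real \<rho>0 * w) = (\<i> * of_real \<rho>0) * w" by simp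
  then have "(r1 has_vector_derivative - \<i> * - (of_real \<rho>0 * w)) (at 0)" using d1 by (simp only:)
  then have "\<exists>v. (c0 has_vector_derivative v) (at D0) \<and> (r1 has_vector_derivative - \<i> * v) (at 0)"
    using d0 by blast
  then show ?thesis
    unfolding cusp_foot_def using geo r10 inj dis cusp by blast
qed

end

section \<open>Uniqueness of the feet\<close>

lemma ev_conj_Tm: "\<exists>ws'. Tm k ** ev ws ** Tm (- k) = ev ws'"
proof -
  obtain ws' where "Tm k ** ev ws = ev ws' ** Tm k" using ev_Tm' by blast
  then have "Tm k ** ev ws ** Tm (- k) = ev ws' ** (Tm k ** Tm (- k))" by (simp only: matrix_mul_assoc)
  then show ?thesis by (auto simp: Tm_mult)
qed

lemma linked_affine:
  assumes "\<sigma>\<^sup>2 = (1 :: real)"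
  shows "linked (C - \<sigma> * x) (C - \<sigma> * y) (C - \<sigma> * x') (C - \<sigma> * y') \<longleftrightarrow> linked x y x' y'"
proof -
  have *: "(C - \<sigma> * a - (C - \<sigma> * b)) * (C - \<sigma> * a - (C - \<sigma> * d)) = (a - b) * (a - d)" for a b d
  proof -
    have "(C - \<sigma> * a - (C - \<sigma> * b)) * (C - \<sigma> * a - (C - \<sigma> * d)) = \<sigma>\<^sup>2 * ((a - b) * (a - d))"
      by (simp add: power2_eq_square algebra_simps)
    then show ?thesis by (simp add: assms)
  qed
  show ?thesis unfolding linked_def * ..
qed

context rot
begin

text \<open>The location of a foot does not depend on the orientation of the lift.\<close>

definition ulift :: "real \<Rightarrow> real \<Rightarrow> bool" where "ulift x y \<longleftrightarrow> lift x y \<or> lift y x"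

lemma ulift_sym: "ulift x y \<longleftrightarrow> ulift y x" by (auto simp: ulift_def)

lemma ulift_word: "ulift x y \<Longrightarrow> ulift (rm (ev v) x) (rm (ev v) y)"
  by (auto simp: ulift_def lift_word)

lemma ulift_unlinked: "ulift x y \<Longrightarrow> ulift x' y' \<Longrightarrow> \<not> linked x y x' y'"
  unfolding ulift_def using lift_unlinked linked_swap by metis

lemma ulift_width: assumes "ulift x y" shows "\<bar>y - x\<bar> \<le> y0 - x0"
proof -
  have "(y - x)\<^sup>2 \<le> (y0 - x0)\<^sup>2" using assms lift_width[of x y] lift_width[of y x] by (auto simp: ulift_def power2_commute)
  then show ?thesis using xy0 by (simp add: abs_le_square_iff[symmetric])
qed

lemma ulift_irr: "ulift x y \<Longrightarrow> x \<notin> \<rat> \<and> y \<notin> \<rat>"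
  using lift_irr by (auto simp: ulift_def)

lemma ulift_unique: "ulift x y \<Longrightarrow> ulift x z \<Longrightarrow> y = z"
proof -
  have end_unique: "y = z" if "lift y x" "lift z x" for x y z
    using lift_same_start[OF lift_shift3[OF that(1)] lift_shift3[OF that(2)]] by simp
  assume "ulift x y" "ulift x z"
  then consider "lift x y" "lift x z" | "lift x y" "lift z x" | "lift y x" "lift x z" | "lift y x" "lift z x"
    by (auto simp: ulift_def)
  then show "y = z"
    using lift_same_start lift_same_cross end_unique by cases blast+
qed

lemma lift_shift_even: "even i \<Longrightarrow> lift (x0 + 3 * of_int i) (y0 + 3 * of_int i)"
  using lift_shift6[OF lift_0, of "i div 2"] by (auto elim!: evenE)

lemma lift_shift_odd: "odd i \<Longrightarrow> lift (y0 + 3 * of_int i) (x0 + 3 * of_int i)"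
proof -
  assume "odd i"
  then obtain j where j: "i = 2 * j + 1" by (rule oddE)
  show ?thesis using lift_shift3[OF lift_shift_even[of "2 * j"]] by (simp add: j algebra_simps)
qed

lemma ulift_shift: "ulift (x0 + 3 * of_int i) (y0 + 3 * of_int i)"
  unfolding ulift_def using lift_shift_even[of i] lift_shift_odd[of i] by blast

lemma ulift_meets_c0:
  assumes "ulift x y" "s * (y - x) > 0" shows "to_torus (gpt x y s) \<in> range (to_torus \<circ> c0)"
proof -
  have main: "to_torus (gpt x y s) \<in> range (to_torus \<circ> c0)" if l: "lift x y" and s: "s * (y - x) > 0" for x y s
  proof -
    obtain v where v: "x = rm (ev v) x0" "y = rm (ev v) y0" using l by (auto simp: lift_def)
    have d: "den (ev v) x0 \<noteq> 0" "den (ev v) y0 \<noteq> 0" using den_nz xy0 by simp_all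
    have yx: "y - x = (y0 - x0) / (den (ev v) x0 * den (ev v) y0)" unfolding v using rm_diff[OF xy0(3,4) det_ev] .
    define s' where "s' = s * den (ev v) x0 / den (ev v) y0"
    have "s' * (y0 - x0) = s * (y - x) * (den (ev v) x0)\<^sup>2" using d by (simp add: s'_def yx field_simps power2_eq_square)
    then have "s' * (y0 - x0) > 0" using s d by simp
    then have s': "s' > 0" using xy0 by (simp add: zero_less_mult_iff)
    have "mob (ev v) (c0 (ln s')) = gpt x y s"
      unfolding mob_c0(1) v[symmetric] using s' d by (simp add: s'_def)
    then have "to_torus (gpt x y s) = to_torus (c0 (ln s'))" using to_torus_mob[OF Im_c0] by metis
    then show ?thesis by simp
  qed
  show ?thesis
  proof (cases "lift x y")
    case True then show ?thesis using main assms by blast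
  next
    case False
    then have l: "lift y x" using assms by (simp add: ulift_def)
    have "s \<noteq> 0" using assms by auto
    moreover have "- 1 / s * (x - y) > 0"
    proof -
      have "- 1 / s * (x - y) = s * (y - x) / s\<^sup>2" using \<open>s \<noteq> 0\<close> by (simp add: field_simps power2_eq_square)
      then show ?thesis using assms(2) \<open>s \<noteq> 0\<close> by simp
    qed
    ultimately show ?thesis using main[OF l, of "- 1 / s"] gpt_flip[of s x y] by simp
  qed
qed

text \<open>The elements of the group that fix the two semicircles adjacent to a gap act near the centre of
  the gap by the formula used in the gap lemma.\<close>

lemma gap_word:
  assumes "\<sigma> = 1 \<or> \<sigma> = - 1" "C = (y0 + x0 + 3) / 2 + 3 * of_int i" "\<mu> = 1 / (of_int m0)\<^sup>2"
  shows "\<exists>v. (\<forall>z. z \<notin> \<rat> \<longrightarrow> rm (ev v) z = C - 3 * \<sigma> + \<mu> / (C - z)) \<and>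
    (\<forall>z. Im z > 0 \<longrightarrow> mob (ev v) z = of_real (C - 3 * \<sigma>) + of_real \<mu> / (of_real C - z))"
proof -
  let ?a = "real_of_int (A0$1$1)" and ?d = "real_of_int (A0$2$2)" and ?m = "real_of_int m0"
  have m: "?m > 0" using m0_pos by simp
  have ad: "?a + ?d = 3 * ?m" using trace_A0 by (simp add: trace_2 flip: of_int_add)
  have C: "C = ?a / ?m + 3 * of_int i"
  proof -
    have "y0 + x0 = (?a - ?d) / ?m" using sum_x0_y0 by simp
    also have "\<dots> = (2 * ?a - 3 * ?m) / ?m" using ad by simp
    also have "\<dots> = 2 * (?a / ?m) - 3" using m by (simp add: field_simps)
    finally show ?thesis by (simp add: assms(2))
  qed
  have dm: "?d / ?m = 3 - ?a / ?m"
  proof -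
    have "?d = 3 * ?m - ?a" using ad by simp
    then show ?thesis using m by (simp add: field_simps)
  qed
  define k where "k = (if \<sigma> = 1 then 3 * i else 3 * (i + 1))"
  define B where "B = (if \<sigma> = 1 then adj A0 else A0)"
  have det_B: "det B = 1" by (simp add: B_def)
  have "\<exists>ws. B = ev ws"
    unfolding B_def A0_def M_def by (auto simp flip: ev_winv)
  then obtain v where v: "Tm k ** B ** Tm (- k) = ev v" using ev_conj_Tm by blast
  have B21: "B$2$1 \<noteq> 0" using m0_pos by (simp add: B_def adj_def m0_def)
  have Bc: "of_int (B$2$1) = (if \<sigma> = 1 then - ?m else ?m)" "of_int (B$1$1) = (if \<sigma> = 1 then ?d else ?a)"
    "of_int (B$2$2) = (if \<sigma> = 1 then ?a else ?d)" by (simp_all add: B_def adj_def m0_def)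
  have mC1: "?m * C = ?a + 3 * of_int i * ?m" using m by (simp add: C field_simps)
  then have mC2: "?m * C = 3 * ?m - ?d + 3 * of_int i * ?m" using ad by simp
  have c1: "of_int k + of_int (B$1$1) / of_int (B$2$1) = C - 3 * \<sigma>"
    using assms(1) dm by (auto simp: Bc k_def C minus_divide_right[symmetric])
  have "rm (ev v) z = C - 3 * \<sigma> + \<mu> / (C - z)" if z: "z \<notin> \<rat>" for z
  proof -
    have z': "z - of_int k \<notin> \<rat>"
    proof
      assume "z - of_int k \<in> \<rat>"
      then have "z - of_int k + of_int k \<in> \<rat>" by (intro Rats_add) auto
      then show False using z by simp
    qed
    have "rm (ev v) z = of_int k + rm B (z - of_int k)"
      unfolding v[symmetric] using z z' det_B
      by (simp add: rm_mult rm_irr)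
    also have "rm B (z - of_int k) = of_int (B$1$1) / of_int (B$2$1) - 1 / (of_int (B$2$1) * den B (z - of_int k))"
      by (rule rm_sub[OF det_B B21 den_nz[OF z' det_B]])
    also have "den B (z - of_int k) = (if \<sigma> = 1 then ?m * (C - z) else ?m * (z - C))"
    proof (cases "\<sigma> = 1")
      case True
      have "?m * (C - z) = ?m * C - ?m * z" by (simp add: algebra_simps)
      then show ?thesis using True unfolding mC1 by (simp add: den_def Bc k_def algebra_simps)
    next
      case False
      have "?m * (z - C) = ?m * z - ?m * C" by (simp add: algebra_simps)
      then show ?thesis using False unfolding mC2 by (simp add: den_def Bc k_def algebra_simps)
    qed
    finally have e: "rm (ev v) z = of_int k + (of_int (B$1$1) / of_int (B$2$1) - 1 / (of_int (B$2$1) * (if \<sigma> = 1 then ?m * (C - z) else ?m * (z - C))))" .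
    have c2: "- (1 / (of_int (B$2$1) * (if \<sigma> = 1 then ?m * (C - z) else ?m * (z - C)))) = \<mu> / (C - z)"
    proof (cases "\<sigma> = 1")
      case True
      then show ?thesis by (simp add: Bc assms(3) power2_eq_square)
    next
      case False
      then have "of_int (B$2$1) * (?m * (z - C)) = - (?m\<^sup>2 * (C - z))"
        by (simp add: Bc power2_eq_square algebra_simps)
      then show ?thesis using False by (simp add: assms(3))
    qed
    show ?thesis unfolding e c1[symmetric] c2[symmetric] by simp
  qed
  moreover have "mob (ev v) z = of_real (C - 3 * \<sigma>) + of_real \<mu> / (of_real C - z)" if z: "Im z > 0" for z
  proof -
    let ?z = "z - of_int k"
    have z': "Im ?z > 0" using z by simp
    have "mob (ev v) z = of_int k + mob B ?z"
      unfolding v[symmetric] using z z' det_B by (simp add: mob_mult Im_mob_pos)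
    also have "mob B ?z = of_int (B$1$1) / of_int (B$2$1) - 1 / (of_int (B$2$1) * (of_int (B$2$1) * ?z + of_int (B$2$2)))"
      by (rule mob_sub[OF det_B B21 z'])
    also have "of_int (B$2$1) * ?z + of_int (B$2$2) = (if \<sigma> = 1 then of_real ?m * (of_real C - z) else of_real ?m * (z - of_real C))"
    proof -
      have "(of_int (B$2$1) :: complex) = of_real (of_int (B$2$1))" "(of_int (B$2$2) :: complex) = of_real (of_int (B$2$2))" by simp_all
      moreover have "of_real (of_int (B$2$1)) * ?z + of_real (of_int (B$2$2)) = (if \<sigma> = 1 then of_real ?m * (of_real C - z) else of_real ?m * (z - of_real C))"
      proof (cases "\<sigma> = 1")
        case True
        have "(of_real ?m :: complex) * of_real C = of_real (?a + 3 * of_int i * ?m)" by (simp only: of_real_mult[symmetric] mC1)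
        then show ?thesis using True by (simp add: Bc k_def algebra_simps)
      next
        case False
        have "(of_real ?m :: complex) * of_real C = of_real (3 * ?m - ?d + 3 * of_int i * ?m)" by (simp only: of_real_mult[symmetric] mC2)
        then show ?thesis using False by (simp add: Bc k_def algebra_simps)
      qed
      ultimately show ?thesis by simp
    qed
    finally have e: "mob (ev v) z = of_int k + (of_int (B$1$1) / of_int (B$2$1) - 1 / (of_int (B$2$1) * (if \<sigma> = 1 then of_real ?m * (of_real C - z) else of_real ?m * (z - of_real C))))" .
    have c1': "(of_int k :: complex) + of_int (B$1$1) / of_int (B$2$1) = of_real (C - 3 * \<sigma>)"
      unfolding c1[symmetric] by simp
    have c2: "- (1 / (of_int (B$2$1) * (if \<sigma> = 1 then of_real ?m * (of_real C - z) else of_real ?m * (z - of_real C)))) = of_real \<mu> / (of_real C - z)"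
    proof (cases "\<sigma> = 1")
      case True
      have "(of_int (B$2$1) :: complex) = - of_real ?m" using True by (simp add: B_def adj_def m0_def)
      then show ?thesis using True by (simp add: assms(3) power2_eq_square)
    next
      case False
      have b: "(of_int (B$2$1) :: complex) = of_real ?m" using False by (simp add: B_def m0_def)
      have "z - of_real C = - (of_real C - z)" by simp
      then have "of_int (B$2$1) * (of_real ?m * (z - of_real C)) = - (of_real (?m\<^sup>2) * (of_real C - z))"
        by (simp add: b power2_eq_square algebra_simps)
      then show ?thesis using False by (simp add: assms(3))
    qed
    show ?thesis unfolding e c1'[symmetric] c2[symmetric] by simp
  qed
  ultimately show ?thesis by blast
qed

text \<open>A lift whose vertical ray is embedded and avoids the geodesic is a translate by a multiple of 3 of
  the standard one.  A lift under a translate has a ray that runs into that translate.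
  A lift in a gap between two translates, on one side of the centre, has a ray that meets itself on
  the torus, by the gap lemma; a lift over the centre would have an image that is too wide.\<close>

lemma foot_location:
  assumes l: "ulift lo hi" and lh: "lo < hi"
    and inj: "\<And>s t. s \<ge> (hi - lo) / 2 \<Longrightarrow> t \<ge> (hi - lo) / 2 \<Longrightarrow> to_torus (Complex ((lo + hi) / 2) s) = to_torus (Complex ((lo + hi) / 2) t) \<Longrightarrow> s = t"
    and dis: "\<And>s. s > (hi - lo) / 2 \<Longrightarrow> to_torus (Complex ((lo + hi) / 2) s) \<notin> range (to_torus \<circ> c0)"
  shows "\<exists>i::int. lo = x0 + 3 * of_int i \<and> hi = y0 + 3 * of_int i"
proof -
  define u \<rho> where "u = (lo + hi) / 2" and "\<rho> = (hi - lo) / 2"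
  have lo: "lo = u - \<rho>" and hi: "hi = u + \<rho>" by (simp_all add: u_def \<rho>_def field_simps)
  have \<rho>: "\<rho> > 0" using lh by (simp add: \<rho>_def)
  define i where "i = \<lceil>(lo - x0) / 3\<rceil> - 1"
  have i1: "x0 + 3 * of_int i < lo" "lo \<le> x0 + 3 * of_int i + 3"
  proof -
    have c: "of_int \<lceil>(lo - x0) / 3\<rceil> - 1 < (lo - x0) / 3" "(lo - x0) / 3 \<le> of_int \<lceil>(lo - x0) / 3\<rceil>"
      using ceiling_correct[of "(lo - x0) / 3"] by auto
    have i: "real_of_int i = of_int \<lceil>(lo - x0) / 3\<rceil> - 1" by (simp add: i_def)
    have "real_of_int i < (lo - x0) / 3" "(lo - x0) / 3 \<le> real_of_int i + 1" using c unfolding i by simp_all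
    then show "x0 + 3 * of_int i < lo" "lo \<le> x0 + 3 * of_int i + 3" by (simp_all add: field_simps)
  qed
  define X0 Y0 where "X0 = x0 + 3 * of_int i" and "Y0 = y0 + 3 * of_int i"
  have S: "ulift X0 Y0" unfolding X0_def Y0_def by (rule ulift_shift)
  have S': "ulift (X0 + 3) (Y0 + 3)" using ulift_shift[of "i + 1"] by (simp add: X0_def Y0_def algebra_simps)
  have w: "Y0 - X0 = y0 - x0" by (simp add: X0_def Y0_def)
  have w3: "0 < y0 - x0" "y0 - x0 < 3"
  proof -
    show "0 < y0 - x0" using xy0 by simp
    have "(y0 - x0)\<^sup>2 < 3\<^sup>2" using m0_pos by (simp add: width0)
    then show "y0 - x0 < 3" by (rule power2_less_imp_less) simp
  qed
  have wid: "hi - lo \<le> y0 - x0" using ulift_width[OF l] by simp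
  have inside: False if "X0 < lo" "hi \<le> Y0"
  proof -
    have pr: "(u - X0) * (Y0 - u) > \<rho>\<^sup>2"
    proof -
      have "(u - X0) > \<rho>" "Y0 - u \<ge> \<rho>" using that by (simp_all add: lo hi)
      then have "\<rho> * \<rho> < (u - X0) * (Y0 - u)" using \<rho> by (intro mult_less_le_imp_less) auto
      then show ?thesis by (simp add: power2_eq_square)
    qed
    define \<eta> where "\<eta> = sqrt ((u - X0) * (Y0 - u))"
    have \<eta>: "\<eta> > \<rho>" unfolding \<eta>_def using pr \<rho> by (intro real_less_rsqrt) auto
    have "\<eta>\<^sup>2 = (u - X0) * (Y0 - u)" using pr \<rho> unfolding \<eta>_def by (intro real_sqrt_pow2) (smt (verit) zero_le_power2)
    then obtain s where "s * (Y0 - X0) > 0" "gpt X0 Y0 s = Complex u \<eta>"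
      using gpt_ex[of \<eta> u X0 Y0] \<eta> \<rho> by auto
    then have "to_torus (Complex u \<eta>) \<in> range (to_torus \<circ> c0)" using ulift_meets_c0[OF S] by metis
    then show False using dis[of \<eta>] \<eta> by (simp add: u_def \<rho>_def)
  qed
  have lX: "X0 < lo" "lo \<le> X0 + 3" using i1 by (simp_all add: X0_def)
  show ?thesis
  proof (cases "lo < Y0")
    case True
    have "hi \<le> Y0"
    proof (rule ccontr)
      assume "\<not> hi \<le> Y0"
      then have "(lo - X0) * (lo - Y0) < 0" "(hi - X0) * (hi - Y0) > 0"
        using True lX lh by (auto intro: mult_pos_neg mult_pos_pos)
      then have "linked X0 Y0 lo hi" unfolding linked_def by (rule mult_neg_pos)
      then show False using ulift_unlinked[OF S l] by simp
    qed
    then show ?thesis using inside lX by blast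
  next
    case False
    have "lo \<noteq> Y0"
    proof
      assume "lo = Y0"
      then have "hi = X0" using ulift_unique[of Y0 hi X0] l S ulift_sym by blast
      then show False using lX lh by simp
    qed
    then have lY: "Y0 < lo" using False by simp
    show ?thesis
    proof (cases "lo = X0 + 3")
      case True
      then have "hi = Y0 + 3" using ulift_unique[of lo hi "Y0 + 3"] l S' by simp
      then show ?thesis using True by (intro exI[of _ "i + 1"]) (simp add: X0_def Y0_def)
    next
      case ne: False
      then have lX3: "lo < X0 + 3" using lX by simp
      have hX3: "hi < X0 + 3"
      proof -
        have "hi \<noteq> X0 + 3"
        proof
          assume "hi = X0 + 3"
          then have "lo = Y0 + 3" using ulift_unique[of hi lo "Y0 + 3"] l S' ulift_sym by blast
          then show False using lX3 w w3 by simp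
        qed
        moreover have "\<not> hi > X0 + 3"
        proof
          assume h: "hi > X0 + 3"
          have "hi < Y0 + 3" using wid lX3 w by simp
          then have "(hi - (X0 + 3)) * (hi - (Y0 + 3)) < 0" "(lo - (X0 + 3)) * (lo - (Y0 + 3)) > 0"
            using h lX3 w w3 by (auto intro: mult_pos_neg mult_neg_neg)
          then have "linked (X0 + 3) (Y0 + 3) lo hi" unfolding linked_def using mult_pos_neg by blast
          then show False using ulift_unlinked[OF S' l] by simp
        qed
        ultimately show ?thesis by simp
      qed
      \<comment> \<open>The gap has the centre \<open>C\<close> and half the width \<open>\<delta>\<close>.\<close>
      define C \<delta> \<mu> where "C = (y0 + x0 + 3) / 2 + 3 * of_int i" and "\<delta> = (3 - (y0 - x0)) / 2" and "\<mu> = 1 / (real_of_int m0)\<^sup>2"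
      have YC: "Y0 = C - \<delta>" and XC: "X0 = C + \<delta> - 3" by (simp_all add: C_def \<delta>_def X0_def Y0_def field_simps)
      have \<delta>: "0 < \<delta>" "\<delta> < 3 / 2" using w3 by (simp_all add: \<delta>_def)
      have \<mu>: "\<mu> = \<delta> * (3 - \<delta>)"
      proof -
        have "\<delta> * (3 - \<delta>) = (9 - (y0 - x0)\<^sup>2) / 4" by (simp add: \<delta>_def power2_eq_square field_simps)
        then show ?thesis by (simp add: width0 \<mu>_def)
      qed
      have Crat: "C \<in> \<rat>"
        unfolding C_def using sum_x0_y0 by (simp add: add.commute)
      then have Cne: "C \<noteq> lo" "C \<noteq> hi" using ulift_irr[OF l] by auto
      have gap: False if \<sigma>: "\<sigma> = 1 \<or> \<sigma> = - 1" and ab: "0 < a" "a < b" "b < \<delta>"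
        and pts: "{lo, hi} = {C - \<sigma> * a, C - \<sigma> * b}" for \<sigma> a b
      proof -
        have s2: "\<sigma>\<^sup>2 = 1" using \<sigma> by auto
        obtain v where v: "\<And>z. z \<notin> \<rat> \<Longrightarrow> rm (ev v) z = C - 3 * \<sigma> + \<mu> / (C - z)"
          "\<And>z. Im z > 0 \<Longrightarrow> mob (ev v) z = of_real (C - 3 * \<sigma>) + of_real \<mu> / (of_real C - z)"
          using gap_word[OF \<sigma> C_def \<mu>_def] by blast
        have l': "ulift (C - \<sigma> * a) (C - \<sigma> * b)" using pts l ulift_sym by (auto simp: doubleton_eq_iff)
        have im: "rm (ev v) (C - \<sigma> * e) = C - \<sigma> * (3 - \<mu> / e)" if "C - \<sigma> * e \<notin> \<rat>" for e
          using v(1)[OF that] \<sigma> by auto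
        have "\<not> linked (C - \<sigma> * a) (C - \<sigma> * b) (C - \<sigma> * (3 - \<mu> / a)) (C - \<sigma> * (3 - \<mu> / b))"
          using ulift_unlinked[OF l' ulift_word[OF l', of v]] ulift_irr[OF l'] im by simp
        then have "\<not> linked a b (3 - \<mu> / a) (3 - \<mu> / b)" unfolding linked_affine[OF s2] .
        from gap_core[OF ab \<delta>(2) \<mu> this] obtain \<eta> where
          \<eta>: "\<eta> \<ge> (b - a) / 2" "((a + b) / 2)\<^sup>2 + \<eta>\<^sup>2 = \<mu> * ((a + b) / 2) / (3 - (a + b) / 2)" by blast
        define \<epsilon> where "\<epsilon> = (a + b) / 2"
        have \<epsilon>: "0 < \<epsilon>" "\<epsilon> < 3 / 2" using ab \<delta> by (simp_all add: \<epsilon>_def)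
        have u: "u = C - \<sigma> * \<epsilon>" and r: "\<rho> = (b - a) / 2"
        proof -
          have "lo + hi = (C - \<sigma> * a) + (C - \<sigma> * b)" using pts by (auto simp: doubleton_eq_iff)
          then show "u = C - \<sigma> * \<epsilon>" by (simp add: u_def \<epsilon>_def field_simps)
          have "hi - lo = b - a" using pts lh \<sigma> ab by (auto simp: doubleton_eq_iff)
          then show "\<rho> = (b - a) / 2" by (simp add: \<rho>_def)
        qed
        have \<eta>0: "\<eta> > 0" using \<eta>(1) ab by simp
        have \<mu>0: "\<mu> > 0" using \<mu> \<delta> by simp
        define K where "K = \<epsilon>\<^sup>2 + \<eta>\<^sup>2"
        have K: "K > 0" "\<mu> / K = (3 - \<epsilon>) / \<epsilon>"
        proof -
          show "K > 0" using \<epsilon> by (simp add: K_def add_pos_nonneg)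
          have "K = \<mu> * \<epsilon> / (3 - \<epsilon>)" using \<eta>(2) by (simp add: K_def \<epsilon>_def)
          then show "\<mu> / K = (3 - \<epsilon>) / \<epsilon>" using \<epsilon> \<mu>0 by simp
        qed
        have "mob (ev v) (Complex u \<eta>) = of_real (C - 3 * \<sigma>) + of_real \<mu> / (of_real C - Complex u \<eta>)"
          using v(2)[of "Complex u \<eta>"] \<eta>0 by simp
        also have "of_real C - Complex u \<eta> = Complex (\<sigma> * \<epsilon>) (- \<eta>)" by (simp add: complex_eq_iff u)
        also have "of_real \<mu> / Complex (\<sigma> * \<epsilon>) (- \<eta>) = Complex (\<mu> / K * (\<sigma> * \<epsilon>)) (\<mu> / K * \<eta>)"
          using s2 by (simp add: complex_eq_iff Re_divide Im_divide K_def power_mult_distrib)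
        also have "of_real (C - 3 * \<sigma>) + Complex (\<mu> / K * (\<sigma> * \<epsilon>)) (\<mu> / K * \<eta>) = Complex u ((3 - \<epsilon>) / \<epsilon> * \<eta>)"
        proof -
          have k1: "(3 - \<epsilon>) / \<epsilon> * (\<sigma> * \<epsilon>) = \<sigma> * (3 - \<epsilon>)" using \<epsilon> by simp
          show ?thesis unfolding K(2) k1 by (simp add: complex_eq_iff u algebra_simps)
        qed
        \<comment> \<open>Both points are on the ray above the lift, and they are distinct.\<close>
        finally have e: "mob (ev v) (Complex u \<eta>) = Complex u ((3 - \<epsilon>) / \<epsilon> * \<eta>)" .
        have g: "(3 - \<epsilon>) / \<epsilon> > 1" using \<epsilon> by (simp add: field_simps)
        then have big: "(3 - \<epsilon>) / \<epsilon> * \<eta> > \<eta>" using mult_strict_right_mono[OF g \<eta>0] by (simp only: mult_1)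
        have "to_torus (Complex u ((3 - \<epsilon>) / \<epsilon> * \<eta>)) = to_torus (Complex u \<eta>)"
          unfolding e[symmetric] using \<eta>0 by (intro to_torus_mob) simp
        then have tor: "to_torus (Complex ((lo + hi) / 2) ((3 - \<epsilon>) / \<epsilon> * \<eta>)) = to_torus (Complex ((lo + hi) / 2) \<eta>)"
          unfolding u_def .
        have ge: "\<eta> \<ge> (hi - lo) / 2" using \<eta>(1) unfolding r[symmetric] \<rho>_def .
        then have ge': "(3 - \<epsilon>) / \<epsilon> * \<eta> \<ge> (hi - lo) / 2" using big by linarith
        have "(3 - \<epsilon>) / \<epsilon> * \<eta> = \<eta>" by (rule inj[OF ge' ge tor])
        then show False using big by simp
      qed
      consider "hi < C" | "lo < C" "C < hi" | "C < lo" using Cne by linarith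
      then show ?thesis
      proof cases
        case 1
        have False by (rule gap[of 1 "C - hi" "C - lo"]) (use 1 lh lY YC in auto)
        then show ?thesis ..
      next
        case 3
        have False by (rule gap[of "-1" "lo - C" "hi - C"]) (use 3 lh hX3 XC in auto)
        then show ?thesis ..
      next
        case 2
        obtain v where v: "\<And>z. z \<notin> \<rat> \<Longrightarrow> rm (ev v) z = C - 3 + \<mu> / (C - z)"
          using gap_word[OF _ C_def \<mu>_def, of 1] by auto
        have \<mu>': "\<mu> / e > 3 - \<delta>" if "0 < e" "e < \<delta>" for e
        proof -
          have "(3 - \<delta>) * e < (3 - \<delta>) * \<delta>" using that \<delta> by (intro mult_strict_left_mono) auto
          then show ?thesis using that by (simp add: \<mu> less_divide_eq mult.commute)
        qed
        have "\<mu> / (C - lo) > 3 - \<delta>" using 2 lY YC by (intro \<mu>') auto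
        moreover have "\<mu> / (hi - C) > 3 - \<delta>" using 2 hX3 XC by (intro \<mu>') auto
        moreover have "\<mu> / (C - hi) = - (\<mu> / (hi - C))" by (metis minus_diff_eq minus_divide_right)
        ultimately have "rm (ev v) lo - rm (ev v) hi > 6 - 2 * \<delta>" using v ulift_irr[OF l] by simp
        moreover have "6 - 2 * \<delta> = 3 + (y0 - x0)" by (simp add: \<delta>_def field_simps)
        then have "6 - 2 * \<delta> > y0 - x0" by simp
        ultimately show ?thesis using ulift_width[OF ulift_word[OF l, of v]] by simp
      qed
    qed
  qed
qed

end

section \<open>The twist of the standard geodesic\<close>

lemma to_torus_6: "Im z > 0 \<Longrightarrow> to_torus (z + of_int (6 * k)) = to_torus z"
proof -
  have s: "to_torus (z + 6) = to_torus z" if "Im z > 0" for z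
  proof -
    have "z + 6 = mob (Tm 6) z" by simp
    also have "\<dots> = mob (ev [La, LB, LA, Lb]) z" unfolding Tm_6 by (rule mob_uminus)
    finally show ?thesis by (simp only: to_torus_mob[OF that])
  qed
  have p: "to_torus (z + of_nat (6 * j)) = to_torus z" if "Im z > 0" for j z
  proof (induction j)
    case (Suc j)
    have "z + of_nat (6 * Suc j) = (z + of_nat (6 * j)) + 6" by simp
    then show ?case using s[of "z + of_nat (6 * j)"] that Suc by (simp only:) simp
  qed simp
  assume z: "Im z > 0"
  show ?thesis
  proof (cases "k \<ge> 0")
    case True
    then show ?thesis using p[OF z, of "nat k"] by (simp add: of_nat_mult)
  next
    case False
    have "Im (z + of_int (6 * k)) > 0" using z by simp
    from p[OF this, of "nat (- k)"] False show ?thesis by simp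
  qed
qed

context rot
begin

text \<open>Some element of the group carries the cusp at which the perpendicular ends to infinity, and the
  perpendicular becomes the vertical ray over the top of a lift.\<close>

lemma foot_extract:
  assumes foot: "cusp_foot u c s" and u: "u = of_real \<sigma> * \<i>" "\<sigma> = 1 \<or> \<sigma> = - 1"
    and c: "\<And>t. c t = mob (ev g) (c0 (t + t0))"
  shows "\<exists>x y. lift x y \<and> \<sigma> * (y - x) > 0 \<and>
    to_torus (c s) = to_torus (Complex ((x + y) / 2) (\<bar>y - x\<bar> / 2)) \<and>
    (\<forall>s t. s \<ge> \<bar>y - x\<bar> / 2 \<longrightarrow> t \<ge> \<bar>y - x\<bar> / 2 \<longrightarrow> to_torus (Complex ((x + y) / 2) s) = to_torus (Complex ((x + y) / 2) t) \<longrightarrow> s = t) \<and>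
    (\<forall>s > \<bar>y - x\<bar> / 2. to_torus (Complex ((x + y) / 2) s) \<notin> range (to_torus \<circ> c0))"
proof -
  obtain r v where r: "geodesic_line r" "r 0 = c s" "(c has_vector_derivative v) (at s)" "(r has_vector_derivative (u * v)) (at 0)"
    "inj_on (to_torus \<circ> r) {0..}" "\<forall>t>0. to_torus (r t) \<notin> range (to_torus \<circ> c)" "ends_at_cusp r"
    using foot unfolding cusp_foot_def by blast
  have Imr: "Im (r t) > 0" for t using r(1) by (simp add: geodesic_line_def)
  have Imc: "Im (c t) > 0" for t using Im_mob_pos[OF det_ev Im_c0] by (simp add: c)
  obtain N where N: "filterlim (\<lambda>t. mob (ev N) (r t)) at_infinity at_top"
    using cusp_to_infinity[OF r(7) Imr] by blast
  obtain a k where k: "k > 0" and ray: "\<And>t. mob (ev N) (r t) = Complex a (k * exp t)"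
    using geodesic_to_infinity[OF geodesic_mob[OF det_ev r(1)] N] by blast
  define h where "h = N @ g"
  have Nc: "mob (ev N) (c t) = mob (ev h) (c0 (t + t0))" for t
    using Im_c0 by (simp add: c h_def ev_append mob_mult)
  define x y where "x = rm (ev h) x0" and "y = rm (ev h) y0"
  have l: "lift x y" unfolding x_def y_def by (rule lift_word[OF lift_0])
  define K where "K = exp t0 * den (ev h) y0 / den (ev h) x0"
  have Ncg: "mob (ev N) (c t) = gpt x y (K * exp t)" for t
    unfolding Nc mob_c0(1) x_def y_def K_def by (simp add: exp_add algebra_simps)
  have Kp: "K * exp s * (y - x) > 0"
    using mob_c0(2)[of "s + t0" h] by (simp add: x_def y_def K_def exp_add algebra_simps)
  obtain w where w: "\<And>f v. f s = c s \<Longrightarrow> (f has_vector_derivative v) (at s) \<Longrightarrow> ((\<lambda>t. mob (ev N) (f t)) has_vector_derivative v * w) (at s)"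
    and w0: "\<And>f v. f 0 = c s \<Longrightarrow> (f has_vector_derivative v) (at 0) \<Longrightarrow> ((\<lambda>t. mob (ev N) (f t)) has_vector_derivative v * w) (at 0)"
  proof -
    obtain w where w: "(mob (ev N) has_field_derivative w) (at (c s))" using mob_has_derivative[OF det_ev Imc] by blast
    have "((\<lambda>t. mob (ev N) (f t)) has_vector_derivative v * w) (at s')" if "f s' = c s" "(f has_vector_derivative v) (at s')" for f v s'
      using field_vector_diff_chain_at[OF that(2), of "mob (ev N)" w] w that(1) by (simp add: o_def)
    then show thesis using that by blast
  qed
  have dr: "((\<lambda>t. Complex a (k * exp t)) has_vector_derivative u * v * w) (at 0)"
    using w0[OF r(2,4)] by (simp add: ray)
  have "((\<lambda>t. of_real (k * exp t) :: complex) has_vector_derivative of_real (k * exp 0)) (at 0)"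
    by (rule has_vector_derivative_of_real) (auto intro!: derivative_eq_intros)
  then have "((\<lambda>t. of_real a + \<i> * of_real (k * exp t)) has_vector_derivative \<i> * of_real (k * exp 0)) (at 0)"
    by (auto intro!: derivative_eq_intros)
  moreover have "(\<lambda>t. of_real a + \<i> * of_real (k * exp t)) = (\<lambda>t. Complex a (k * exp t))" by (auto simp: complex_eq_iff)
  ultimately have "((\<lambda>t. Complex a (k * exp t)) has_vector_derivative \<i> * of_real k) (at 0)" by simp
  then have uvw: "u * v * w = \<i> * of_real k" using vector_derivative_unique_at[OF dr] by blast
  have vw: "v * w = of_real (\<sigma> * k)"
  proof -
    have "\<i> * (of_real \<sigma> * (v * w)) = \<i> * of_real k" using uvw by (simp add: u(1) ac_simps)
    then have "of_real \<sigma> * (v * w) = of_real k" by (simp only: mult_left_cancel[OF complex_i_not_zero])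
    then have "of_real \<sigma> * (of_real \<sigma> * (v * w)) = of_real \<sigma> * of_real k" by (simp only:)
    moreover have "of_real \<sigma> * of_real \<sigma> = (1 :: complex)" using u(2) by auto
    ultimately show ?thesis by (simp only: mult.assoc[symmetric] mult_1 of_real_mult)
  qed
  have "((\<lambda>t. mob (ev N) (c t)) has_vector_derivative v * w) (at s)" by (rule w[OF refl r(3)])
  then have dc: "((\<lambda>t. gpt x y (K * exp t)) has_vector_derivative v * w) (at s)" by (simp add: Ncg)
  have "\<i> * of_real (K * exp s * (y - x)) / (1 + \<i> * of_real (K * exp s))\<^sup>2 = of_real (\<sigma> * k)"
    using vector_derivative_unique_at[OF dc gpt_has_vector_derivative] vw by simp
  from vertical_perpendicular[OF Kp this]
  have sk: "\<sigma> * k = (y - x) / 2" and top: "gpt x y (K * exp s) = Complex ((x + y) / 2) \<bar>\<sigma> * k\<bar>" by auto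
  have kk: "k = \<bar>y - x\<bar> / 2" "\<bar>\<sigma> * k\<bar> = k" "\<sigma> * (y - x) > 0"
    using sk u(2) k by auto
  have start: "Complex a k = Complex ((x + y) / 2) k"
    using ray[of 0] r(2) Ncg[of s] top kk(2) by simp
  then have a: "a = (x + y) / 2" by simp
  have tor: "to_torus (Complex a (k * exp t)) = to_torus (r t)" for t
    using to_torus_mob[OF Imr, of N t] by (simp add: ray)
  have rng: "range (to_torus \<circ> c0) = range (to_torus \<circ> c)"
  proof -
    have "(to_torus \<circ> c) t = (to_torus \<circ> c0) (t + t0)" for t using to_torus_mob[OF Im_c0] by (simp add: c)
    then show ?thesis by (auto simp: image_iff) (metis diff_add_cancel)
  qed
  have par: "z = k * exp (ln (z / k))" "ln (z / k) \<ge> 0" if "z \<ge> k" for z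
    using k that by (simp_all add: ln_ge_zero)
  have inj: "s1 = s2" if "s1 \<ge> k" "s2 \<ge> k" "to_torus (Complex a s1) = to_torus (Complex a s2)" for s1 s2
  proof -
    have "to_torus (r (ln (s1 / k))) = to_torus (r (ln (s2 / k)))"
      unfolding tor[symmetric] using par(1)[OF that(1)] par(1)[OF that(2)] that(3) by simp
    then have "ln (s1 / k) = ln (s2 / k)"
      using inj_onD[OF r(5), of "ln (s1 / k)" "ln (s2 / k)"] par(2)[OF that(1)] par(2)[OF that(2)] by simp
    then show ?thesis using par(1)[OF that(1)] par(1)[OF that(2)] by metis
  qed
  have dis: "to_torus (Complex a s1) \<notin> range (to_torus \<circ> c0)" if "s1 > k" for s1
  proof -
    have "ln (s1 / k) > 0" using that k by simp
    then have "to_torus (r (ln (s1 / k))) \<notin> range (to_torus \<circ> c0)" unfolding rng using r(6) by blast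
    then show ?thesis unfolding tor[symmetric] using par(1)[of s1] that by simp
  qed
  have "to_torus (c s) = to_torus (Complex a k)" using tor[of 0] r(2) by simp
  then show ?thesis
    using l kk(3) inj dis unfolding a kk(1) by blast
qed

text \<open>The parity of the translation by multiples of 3 decides the orientation of the lift, hence the side of
  the foot.\<close>

lemma foot_unique:
  assumes foot: "cusp_foot u c s" and u: "u = of_real \<sigma> * \<i>" "\<sigma> = 1 \<or> \<sigma> = - 1"
    and c: "\<And>t. c t = mob (ev g) (c0 (t + t0))"
  shows "to_torus (c s) = to_torus (c0 (if \<sigma> = 1 then 0 else D0))"
proof -
  obtain x y where l: "lift x y" and sg: "\<sigma> * (y - x) > 0"
    and top: "to_torus (c s) = to_torus (Complex ((x + y) / 2) (\<bar>y - x\<bar> / 2))"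
    and inj: "\<And>s t. s \<ge> \<bar>y - x\<bar> / 2 \<Longrightarrow> t \<ge> \<bar>y - x\<bar> / 2 \<Longrightarrow> to_torus (Complex ((x + y) / 2) s) = to_torus (Complex ((x + y) / 2) t) \<Longrightarrow> s = t"
    and dis: "\<And>s. s > \<bar>y - x\<bar> / 2 \<Longrightarrow> to_torus (Complex ((x + y) / 2) s) \<notin> range (to_torus \<circ> c0)"
    using foot_extract[OF assms] by blast
  define lo hi where "lo = min x y" and "hi = max x y"
  have lh: "lo + hi = x + y" "hi - lo = \<bar>y - x\<bar>" "ulift lo hi" "lo < hi"
    using l lift_ne[OF l] by (auto simp: lo_def hi_def min_def max_def ulift_def)
  obtain i :: int where i: "lo = x0 + 3 * of_int i" "hi = y0 + 3 * of_int i"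
    using foot_location[OF lh(3,4)] inj dis unfolding lh(1,2) by blast
  have "Complex ((x + y) / 2) (\<bar>y - x\<bar> / 2) = c0 0 + of_int (3 * i)"
    unfolding lh(1,2)[symmetric] i r0_0[symmetric] by (simp add: r0_def u0_def \<rho>0_def complex_eq_iff)
  then have t: "to_torus (c s) = to_torus (c0 0 + of_int (3 * i))" using top by simp
  show ?thesis
  proof (cases "\<sigma> = 1")
    case True
    then have "lift lo hi" using l sg by (simp add: lo_def hi_def min_def max_def)
    then have "even i" using lift_shift_odd[of i] lift_no_swap i by blast
    then obtain j where "i = 2 * j" by (rule evenE)
    then have e: "(of_int (3 * i) :: complex) = of_int (6 * j)" by simp
    show ?thesis using t to_torus_6[OF Im_c0, of 0 j] unfolding if_P[OF True] e by (rule trans)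
  next
    case False
    then have "lift hi lo" using l sg u(2) by (auto simp: lo_def hi_def min_def max_def)
    then have "odd i" using lift_shift_even[of i] lift_no_swap i by blast
    then obtain j where "i = 2 * j + 1" by (rule oddE)
    then have e: "c0 0 + of_int (3 * i) = (c0 0 + 3) + of_int (6 * j)" by simp
    have "Im (c0 0 + 3) > 0" using Im_c0[of 0] by simp
    then have "to_torus (c s) = to_torus (c0 0 + 3)" using trans[OF t[unfolded e] to_torus_6[of "c0 0 + 3" j]] by blast
    also have "\<dots> = to_torus (mob EE (c0 0))" using torus_EE[OF Im_c0] by simp
    also have "\<dots> = to_torus (c0 D0)" by (simp add: mob_EE_c0)
    finally show ?thesis using False by simp
  qed
qed

definition tw0 :: real where "tw0 = D0 - L0 * of_int \<lfloor>D0 / L0\<rfloor>"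

lemma tw0_bounds: "0 \<le> tw0" "tw0 < L0"
proof -
  have "of_int \<lfloor>D0 / L0\<rfloor> \<le> D0 / L0" by (rule of_int_floor_le)
  then have "of_int \<lfloor>D0 / L0\<rfloor> * L0 \<le> D0" by (simp only: pos_le_divide_eq[OF L0_pos])
  then show "0 \<le> tw0" by (simp add: tw0_def mult.commute)
  have "D0 / L0 < of_int \<lfloor>D0 / L0\<rfloor> + 1" by (rule floor_correct[THEN conjunct2, simplified])
  then have "D0 < (of_int \<lfloor>D0 / L0\<rfloor> + 1) * L0" by (simp only: pos_divide_less_eq[OF L0_pos])
  then show "tw0 < L0" by (simp add: tw0_def algebra_simps)
qed

lemma torus_c0_period: "to_torus (c0 (t + of_int k * L0)) = to_torus (c0 t)"
proof -
  have p: "to_torus (c0 (t + of_nat j * L0)) = to_torus (c0 t)" for j t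
    using mob_power_c0[of j t] to_torus_mob[OF Im_c0] by metis
  show ?thesis
  proof (cases "k \<ge> 0")
    case True then show ?thesis using p[of t "nat k"] by simp
  next
    case False then show ?thesis using p[of "t + of_int k * L0" "nat (- k)"] by simp
  qed
qed

lemma twist_unique:
  assumes "is_twist c L0 t" and c: "\<And>t. c t = mob (ev g) (c0 (t + t0))"
  shows "t = tw0"
proof -
  obtain sl sr where f: "cusp_foot \<i> c sl" "cusp_foot (- \<i>) c sr" and t: "0 \<le> t" "t < L0"
    and e: "to_torus (c (sl + t)) = to_torus (c sr)" using assms(1) unfolding is_twist_def by blast
  have tc: "to_torus (c s) = to_torus (c0 (s + t0))" for s using to_torus_mob[OF Im_c0] by (simp add: c)
  have "to_torus (c0 (sl + t0)) = to_torus (c0 0)"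
    using foot_unique[OF f(1) _ _ c, of 1] by (simp add: tc)
  then obtain k :: int where k: "0 = sl + t0 + of_int k * L0" using torus_c0_eq by blast
  have "to_torus (c sr) = to_torus (c0 D0)"
    using foot_unique[OF f(2) _ _ c, of "-1"] by simp
  then have "to_torus (c0 (sl + t + t0)) = to_torus (c0 D0)" using e by (simp add: tc)
  then obtain j :: int where j: "D0 = sl + t + t0 + of_int j * L0" using torus_c0_eq by blast
  define i where "i = j - k"
  have i: "D0 = t + of_int i * L0" using j k by (simp add: i_def algebra_simps)
  have "D0 / L0 = t / L0 + of_int i" using i L0_pos by (simp add: field_simps)
  moreover have "0 \<le> t / L0" "t / L0 < 1" using t L0_pos by simp_all
  ultimately have "\<lfloor>D0 / L0\<rfloor> = i" by linarith
  then show ?thesis using i by (simp add: tw0_def)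
qed

lemma twist_exists: "is_twist c0 L0 tw0"
  unfolding is_twist_def
proof (intro exI conjI)
  show "cusp_foot \<i> c0 0" by (rule left_foot)
  show "cusp_foot (- \<i>) c0 D0" by (rule right_foot)
  show "0 \<le> tw0" "tw0 < L0" by (rule tw0_bounds)+
  have "0 + tw0 = D0 + of_int (- \<lfloor>D0 / L0\<rfloor>) * L0" by (simp add: tw0_def)
  then show "to_torus (c0 (0 + tw0)) = to_torus (c0 D0)" using torus_c0_period by (simp only:)
qed

end

section \<open>Invariance under the integer translations\<close>

text \<open>The translations normalize the group and act on the torus by isometries.\<close>

lemma hyp_dist_shift: "hyp_dist (z + of_int k) (w + of_int k) = hyp_dist z w"
  by (simp add: hyp_dist_def)

lemma geodesic_line_shift: "geodesic_line c \<Longrightarrow> geodesic_line (\<lambda>t. c t + of_int k)"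
  by (simp add: geodesic_line_def hyp_dist_shift)

lemma ends_at_cusp_shift: assumes "ends_at_cusp r" shows "ends_at_cusp (\<lambda>t. r t + of_int k)"
proof -
  obtain A where A: "A \<in> \<Union>Gam" "\<bar>trace A\<bar> = 2" "A \<noteq> mat 1" "A \<noteq> - mat 1"
    and lim: "(A$2$1 = 0 \<and> filterlim r at_infinity at_top) \<or>
         (\<exists>x::real. of_int (A$1$1) * x + of_int (A$1$2) = x * (of_int (A$2$1) * x + of_int (A$2$2)) \<and> (r \<longlongrightarrow> of_real x) at_top)"
    using assms unfolding ends_at_cusp_def by blast
  define B where "B = Tm k ** A ** Tm (- k)"
  have B: "B$1$1 = A$1$1 + k * A$2$1" "B$1$2 = A$1$2 + k * A$2$2 - k * (A$1$1 + k * A$2$1)"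
    "B$2$1 = A$2$1" "B$2$2 = A$2$2 - k * A$2$1"
    by (simp_all add: B_def Tm_def algebra_simps)
  obtain ws where "A = ev ws \<or> A = - ev ws" using A(1) unfolding Union_Gam by blast
  moreover obtain ws' where "Tm k ** ev ws ** Tm (- k) = ev ws'" using ev_conj_Tm by blast
  ultimately have "B = ev ws' \<or> B = - ev ws'" unfolding B_def by auto
  then have Bin: "B \<in> \<Union>Gam" unfolding Union_Gam by blast
  have tr: "\<bar>trace B\<bar> = 2" using A(2) by (simp add: trace_2 B)
  have "A = Tm (- k) ** B ** Tm k"
  proof -
    have "Tm (- k) ** B ** Tm k = (Tm (- k) ** Tm k) ** A ** (Tm (- k) ** Tm k)" by (simp only: B_def matrix_mul_assoc)
    then show ?thesis by (simp add: Tm_mult)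
  qed
  then have ne: "B \<noteq> mat 1" "B \<noteq> - mat 1" using A(3,4) by (auto simp: Tm_mult)
  have "(B$2$1 = 0 \<and> filterlim (\<lambda>t. r t + of_int k) at_infinity at_top) \<or>
         (\<exists>x::real. of_int (B$1$1) * x + of_int (B$1$2) = x * (of_int (B$2$1) * x + of_int (B$2$2)) \<and> ((\<lambda>t. r t + of_int k) \<longlongrightarrow> of_real x) at_top)"
    using lim
  proof
    assume a: "A$2$1 = 0 \<and> filterlim r at_infinity at_top"
    then have "filterlim (\<lambda>t. r t + of_int k) at_infinity at_top"
      using tendsto_add_filterlim_at_infinity'[OF _ tendsto_const] by blast
    then show ?thesis using a B by simp
  next
    assume "\<exists>x::real. of_int (A$1$1) * x + of_int (A$1$2) = x * (of_int (A$2$1) * x + of_int (A$2$2)) \<and> (r \<longlongrightarrow> of_real x) at_top"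
    then obtain x :: real where x: "of_int (A$1$1) * x + of_int (A$1$2) = x * (of_int (A$2$1) * x + of_int (A$2$2))" "(r \<longlongrightarrow> of_real x) at_top" by blast
    have "((\<lambda>t. r t + of_int k) \<longlongrightarrow> of_real (x + of_int k)) at_top"
      using tendsto_add[OF x(2) tendsto_const, of "of_int k"] by simp
    moreover have "of_int (B$1$1) * (x + of_int k) + of_int (B$1$2) = (x + of_int k) * (of_int (B$2$1) * (x + of_int k) + of_int (B$2$2))"
      unfolding B using x(1) by (simp add: algebra_simps)
    ultimately show ?thesis by blast
  qed
  then show ?thesis unfolding ends_at_cusp_def using Bin tr ne by blast
qed

lemma cusp_foot_shift:
  assumes "cusp_foot u c s" "\<And>t. Im (c t) > 0" shows "cusp_foot u (\<lambda>t. c t + of_int k) s"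
proof -
  obtain r v where r: "geodesic_line r" "r 0 = c s" "(c has_vector_derivative v) (at s)" "(r has_vector_derivative (u * v)) (at 0)"
    "inj_on (to_torus \<circ> r) {0..}" "\<forall>t>0. to_torus (r t) \<notin> range (to_torus \<circ> c)" "ends_at_cusp r"
    using assms(1) unfolding cusp_foot_def by blast
  have Imr: "Im (r t) > 0" for t using r(1) by (simp add: geodesic_line_def)
  have "((\<lambda>t. c t + of_int k) has_vector_derivative v) (at s)" "((\<lambda>t. r t + of_int k) has_vector_derivative (u * v)) (at 0)"
    using r(3,4) by (auto intro!: derivative_eq_intros)
  moreover have "inj_on (to_torus \<circ> (\<lambda>t. r t + of_int k)) {0..}"
    using r(5) by (auto simp: inj_on_def to_torus_shift[OF Imr Imr])
  moreover have "\<forall>t>0. to_torus (r t + of_int k) \<notin> range (to_torus \<circ> (\<lambda>t. c t + of_int k))"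
    using r(6) by (auto simp: to_torus_shift[OF Imr assms(2)])
  ultimately show ?thesis
    unfolding cusp_foot_def using geodesic_line_shift[OF r(1)] r(2) ends_at_cusp_shift[OF r(7)]
    by (intro exI[of _ "\<lambda>t. r t + of_int k"]) auto
qed

lemma is_twist_shift:
  assumes "is_twist c L t" "\<And>t. Im (c t) > 0" shows "is_twist (\<lambda>t. c t + of_int k) L t"
proof -
  obtain sl sr where "cusp_foot \<i> c sl" "cusp_foot (- \<i>) c sr" "0 \<le> t" "t < L" "to_torus (c (sl + t)) = to_torus (c sr)"
    using assms(1) unfolding is_twist_def by blast
  moreover from this have "cusp_foot \<i> (\<lambda>t. c t + of_int k) sl" "cusp_foot (- \<i>) (\<lambda>t. c t + of_int k) sr"
    using cusp_foot_shift[of _ c _ k] assms(2) by blast+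
  ultimately show ?thesis
    unfolding is_twist_def using to_torus_shift[OF assms(2) assms(2)] by blast
qed

lemma simple_closed_geodesic_shift:
  assumes "simple_closed_geodesic c L" shows "simple_closed_geodesic (\<lambda>t. c t + of_int k) L"
proof -
  have I: "Im (c t) > 0" for t using assms by (simp add: simple_closed_geodesic_def geodesic_line_def)
  show ?thesis
    using assms geodesic_line_shift[of c k] unfolding simple_closed_geodesic_def
    by (auto simp: inj_on_def to_torus_shift[OF I I])
qed

section \<open>Simple closed geodesics and cyclic words\<close>

lemma not_reduced_shorter:
  assumes "\<not> reduced ws" shows "\<exists>us. ev us = ev ws \<and> length us < length ws"
  using assms
proof (induction ws)
  case (Cons l ws)
  show ?case
  proof (cases "reduced ws")
    case False
    then obtain us where "ev us = ev ws" "length us < length ws" using Cons.IH by blast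
    then show ?thesis by (intro exI[of _ "l # us"]) simp
  next
    case True
    then obtain l' vs where ws: "ws = l' # vs" "l' = linv l" using Cons.prems by (cases ws) auto
    then have "ev vs = ev (l # ws)" by (simp add: lm_linv matrix_mul_assoc adj_inverse)
    then show ?thesis using ws by (intro exI[of _ vs]) simp
  qed
qed simp

lemma reduced_append:
  "reduced us \<Longrightarrow> reduced vs \<Longrightarrow> us \<noteq> [] \<Longrightarrow> vs \<noteq> [] \<Longrightarrow> hd vs \<noteq> linv (last us) \<Longrightarrow> reduced (us @ vs)"
proof (induction us)
  case (Cons l us)
  show ?case
  proof (cases us)
    case Nil then show ?thesis using Cons.prems by (cases vs) auto
  next
    case (Cons l' us')
    then have "reduced (us @ vs)" using Cons.IH Cons.prems reduced_tl[of l us] by simp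
    then show ?thesis using Cons Cons.prems by simp
  qed
qed simp

text \<open>A shortest word of a conjugacy class is cyclically reduced, as otherwise a cancellation would
  shorten it or one of its rotations.\<close>

lemma shortest_word:
  assumes min: "\<forall>h vs. ev vs = ev h ** ev us ** adj (ev h) \<longrightarrow> length us \<le> length vs"
  shows "reduced us" "us \<noteq> [] \<Longrightarrow> hd us \<noteq> linv (last us)"
proof -
  have same: "length us \<le> length vs" if "ev vs = ev us" for vs
    using min[rule_format, of vs "[]"] that by simp
  show "reduced us" using not_reduced_shorter[of us] same by (meson linorder_not_less)
  show "hd us \<noteq> linv (last us)" if ne: "us \<noteq> []"
  proof
    assume h: "hd us = linv (last us)"
    obtain l vs where us: "us = vs @ [l]" using ne by (cases us rule: rev_cases) auto
    then have "vs \<noteq> []" using h by auto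
    then obtain vs' where vs: "vs = linv l # vs'" using h us by (cases vs) auto
    have "ev vs' = lm l ** (ev us ** lm (linv l))"
      by (simp add: us vs ev_append lm_linv matrix_mul_assoc[symmetric] adj_inverse adj_cancel)
    also have "\<dots> = ev [l] ** ev us ** adj (ev [l])"
      by (simp add: lm_linv matrix_mul_assoc)
    finally have "length us \<le> length vs'" by (rule min[rule_format])
    then show False by (simp add: us vs)
  qed
qed

lemma shortest_conjugate:
  "\<exists>g us. ev us = ev g ** ev ws ** adj (ev g) \<and>
    (\<forall>h vs. ev vs = ev h ** ev us ** adj (ev h) \<longrightarrow> length us \<le> length vs)"
proof -
  define P where "P k \<longleftrightarrow> (\<exists>g us. ev us = ev g ** ev ws ** adj (ev g) \<and> length us = k)" for k
  have "P (length ws)" unfolding P_def by (intro exI[of _ "[]"] exI[of _ ws]) simp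
  then have L: "P (LEAST k. P k)" by (rule LeastI)
  then obtain g us where gu: "ev us = ev g ** ev ws ** adj (ev g)" "length us = (LEAST k. P k)" unfolding P_def by blast
  have min: "length us \<le> length vs" if "ev vs = ev h ** ev us ** adj (ev h)" for h vs
  proof -
    have "ev vs = ev (h @ g) ** ev ws ** adj (ev (h @ g))"
      unfolding that gu(1) by (simp add: ev_append adj_mult matrix_mul_assoc)
    then show ?thesis unfolding gu(2) by (intro Least_le) (use P_def in blast)
  qed
  show ?thesis using gu(1) min by blast
qed

lemma fixed_in_half_plane:
  assumes "det B = 1" "Im z > 0" "mob B z = z"
  shows "B = mat 1 \<or> B = - mat 1 \<or> \<bar>trace B\<bar> \<le> 1"
proof -
  let ?c = "real_of_int (B$2$1)" and ?d = "real_of_int (B$2$2)" and ?a = "real_of_int (B$1$1)" and ?b = "real_of_int (B$1$2)"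
  have nz: "of_int (B$2$1) * z + of_int (B$2$2) \<noteq> 0"
    using rmob_den_nz[OF det_real[OF assms(1)] assms(2)] by simp
  have e: "of_int (B$1$1) * z + of_int (B$1$2) = z * (of_int (B$2$1) * z + of_int (B$2$2))"
    using assms(3) nz by (simp add: mob_def divide_eq_eq)
  have im: "?a * Im z = Im z * (?c * Re z + ?d) + Re z * (?c * Im z)" using arg_cong[OF e, of Im] by simp
  have re: "?a * Re z + ?b = Re z * (?c * Re z + ?d) - Im z * (?c * Im z)" using arg_cong[OF e, of Re] by simp
  have "Im z * (?a - ?d - 2 * ?c * Re z) = 0" using im by (simp add: algebra_simps)
  then have ad: "?a - ?d = 2 * ?c * Re z" using assms(2) by simp
  have b: "?b = - ?c * ((Re z)\<^sup>2 + (Im z)\<^sup>2)"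
  proof -
    have "?b = Re z * (?c * Re z) - (?a - ?d) * Re z - Im z * (?c * Im z)" using re by (simp add: algebra_simps)
    then show ?thesis unfolding ad by (simp add: algebra_simps power2_eq_square)
  qed
  show ?thesis
  proof (cases "B$2$1 = 0")
    case True
    then have "B$1$1 = B$2$2" "B$1$2 = 0" using ad b by simp_all
    moreover from this True have "B$2$2 * B$2$2 = 1" using assms(1) by (simp add: det_2)
    then have "B$2$2 = 1 \<or> B$2$2 = -1" by (auto simp: zmult_eq_1_iff)
    ultimately show ?thesis using True by (auto simp: mx_eq_iff)
  next
    case False
    have "(real_of_int (trace B))\<^sup>2 = (?a - ?d)\<^sup>2 + 4 * ?b * ?c + 4 * (?a * ?d - ?b * ?c)"
      by (simp add: trace_2 power2_eq_square algebra_simps)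
    also have "\<dots> = 4 - 4 * (?c * Im z)\<^sup>2"
      unfolding ad b using det_real[OF assms(1)] ad b by (simp add: power2_eq_square algebra_simps)
    also have "\<dots> < 2\<^sup>2" using False assms(2) by simp
    finally have "\<bar>real_of_int (trace B)\<bar> < 2" using power2_less_imp_less[of "\<bar>real_of_int (trace B)\<bar>" 2] by simp
    then show ?thesis by linarith
  qed
qed

text \<open>A matrix with a fixed point in the half plane has trace at most 1 in absolute value, hence finite order; but the
  powers of a cyclically reduced word are reduced, so they are not trivial.\<close>

lemma torsion_free:
  assumes "Im z > 0" "mob (ev ws) z = z" shows "ev ws = mat 1 \<or> ev ws = - mat 1"
proof -
  obtain g us where us1: "ev us = ev g ** ev ws ** adj (ev g)"
    and min: "\<forall>h vs. ev vs = ev h ** ev us ** adj (ev h) \<longrightarrow> length us \<le> length vs"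
    using shortest_conjugate[of ws] by blast
  note us = us1 shortest_word[OF min]
  have conj: "ev ws = adj (ev g) ** ev us ** ev g"
  proof -
    have "adj (ev g) ** ev us ** ev g = (adj (ev g) ** ev g) ** ev ws ** (adj (ev g) ** ev g)"
      unfolding us(1) by (simp only: matrix_mul_assoc)
    then show ?thesis by (simp add: adj_inverse)
  qed
  show ?thesis
  proof (cases "us = []")
    case True
    then have "ev ws = mat 1" using conj by (simp add: adj_inverse)
    then show ?thesis ..
  next
    case False
    have "mob (ev us) (mob (ev g) z) = mob (ev g ** ev ws) z"
      unfolding us(1) using assms(1) by (simp add: mob_mult Im_mob_pos mob_adj)
    then have "mob (ev us) (mob (ev g) z) = mob (ev g) z" using assms by (simp add: mob_mult)
    from fixed_in_half_plane[OF det_ev Im_mob_pos[OF det_ev assms(1)] this] show ?thesis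
    proof (elim disjE)
      assume "ev us = mat 1" then show ?thesis using reduced_ev_neq[OF us(2) False] by simp
    next
      assume "ev us = - mat 1" then show ?thesis using reduced_ev_neq[OF us(2) False] by simp
    next
      assume t: "\<bar>trace (ev us)\<bar> \<le> 1"
      have r2: "reduced (us @ us)" using reduced_append[OF us(2,2) False False us(3)[OF False]] .
      have r3: "reduced (us @ us @ us)" using reduced_append[OF us(2) r2 False] us(3) False by simp
      let ?B = "ev us"
      have dt: "?B$1$1 * ?B$2$2 - ?B$1$2 * ?B$2$1 = 1" using det_ev[of us] by (simp add: det_2)
      have sq: "?B ** ?B = mx (trace ?B * ?B$1$1 - 1) (trace ?B * ?B$1$2) (trace ?B * ?B$2$1) (trace ?B * ?B$2$2 - 1)"
        unfolding mx_eq_iff using dt by (simp add: trace_2 algebra_simps)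
      have "trace ?B = 0 \<or> trace ?B = 1 \<or> trace ?B = - 1" using t by linarith
      then have "?B ** ?B = - mat 1 \<or> ?B ** (?B ** ?B) = - mat 1 \<or> ?B ** (?B ** ?B) = mat 1"
      proof (elim disjE)
        assume "trace ?B = 0" then show ?thesis using sq by (simp add: mx_eq_iff)
      next
        assume t1: "trace ?B = 1"
        have as: "?B ** (?B ** ?B) = ?B ** ?B ** ?B" by (simp only: matrix_mul_assoc)
        have e: "?B$2$2 = 1 - ?B$1$1" using t1 by (simp add: trace_2)
        have "?B$1$2 * ?B$2$1 = ?B$1$1 * (1 - ?B$1$1) - 1" using dt unfolding e by simp
        then have "?B ** (?B ** ?B) = - mat 1" unfolding as sq t1 by (simp add: mx_eq_iff e algebra_simps)
        then show ?thesis by simp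
      next
        assume t1: "trace ?B = - 1"
        have as: "?B ** (?B ** ?B) = ?B ** ?B ** ?B" by (simp only: matrix_mul_assoc)
        have e: "?B$2$2 = - 1 - ?B$1$1" using t1 by (simp add: trace_2)
        have "?B$1$2 * ?B$2$1 = ?B$1$1 * (- 1 - ?B$1$1) - 1" using dt unfolding e by simp
        then have "?B ** (?B ** ?B) = mat 1" unfolding as sq t1 by (simp add: mx_eq_iff e algebra_simps)
        then show ?thesis by simp
      qed
      then show ?thesis using reduced_ev_neq[OF r2] reduced_ev_neq[OF r3] False by (auto simp: ev_append)
    qed
  qed
qed

lemma Im_mob_times: "det A = 1 \<Longrightarrow> A$2$1 \<noteq> 0 \<Longrightarrow> Im z > 0 \<Longrightarrow> Im (mob A z) * Im z \<le> 1"
proof -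
  assume A: "det A = 1" "A$2$1 \<noteq> 0" "Im z > 0"
  let ?c = "real_of_int (A$2$1)" and ?d = "real_of_int (A$2$2)"
  let ?D = "(?c * Re z + ?d)\<^sup>2 + (?c * Im z)\<^sup>2"
  have I: "Im (mob A z) = Im z / ?D"
    unfolding mob_eq_rmob using Im_rmob[OF det_real[OF A(1)] A(3)] by (simp add: cmod_power2)
  have "1 \<le> \<bar>A$2$1\<bar>" using A(2) by simp
  then have "1 \<le> \<bar>?c\<bar>" by linarith
  then have "1\<^sup>2 \<le> \<bar>?c\<bar>\<^sup>2" by (intro power_mono) auto
  then have "1 * (Im z)\<^sup>2 \<le> ?c\<^sup>2 * (Im z)\<^sup>2" by (intro mult_right_mono) auto
  then have "(Im z)\<^sup>2 \<le> ?D" by (simp add: power_mult_distrib add_increasing)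
  moreover have "(Im z)\<^sup>2 > 0" using A(3) by simp
  ultimately show ?thesis unfolding I by (simp add: power2_eq_square)
qed

lemma Im_mob_upper: "det A = 1 \<Longrightarrow> A$2$1 = 0 \<Longrightarrow> \<exists>j. \<forall>z. mob A z = z + of_int j"
proof -
  assume A: "det A = 1" "A$2$1 = 0"
  then have "A$1$1 * A$2$2 = 1" by (simp add: det_2)
  then consider "A$1$1 = 1" "A$2$2 = 1" | "A$1$1 = -1" "A$2$2 = -1" by (metis zmult_eq_1_iff)
  then show ?thesis
  proof cases
    case 1 then show ?thesis using A by (intro exI[of _ "A$1$2"]) (simp add: mob_def)
  next
    case 2 then show ?thesis using A by (intro exI[of _ "- A$1$2"]) (simp add: mob_def)
  qed
qed

text \<open>The endpoints of the line are fixed by \<open>A\<close>, and the quadratic equation for them shows that they are irrational.  A vertical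
  line is impossible, as an integer matrix that changes heights maps no point above height 1 to a point
  above height 1.\<close>

lemma translated_geodesic:
  assumes g: "geodesic_line c" and L: "L > 0" and A: "det A = 1" "\<And>t. c (t + L) = mob A (c t)"
  shows "\<exists>x y k. x \<notin> \<rat> \<and> y \<notin> \<rat> \<and> k * (y - x) > 0 \<and> (\<forall>t. c t = gpt x y (k * exp t)) \<and>
    rm A x = x \<and> rm A y = y \<and> den A y = exp L * den A x"
  using g
proof (cases rule: geodesic_cases)
  case (semicircle x y k)
  have k: "k \<noteq> 0" "x \<noteq> y" using semicircle(1) by auto
  have top: "(c \<longlongrightarrow> of_real y) at_top"
  proof -
    have "c = (\<lambda>t. gpt x y (k * exp t))" using semicircle(2) by blast
    then show ?thesis using gpt_tendsto_top[OF k(1), of x y] by simp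
  qed
  have bot: "((\<lambda>t. c (- t)) \<longlongrightarrow> of_real x) at_top"
  proof -
    have "c (- t) = gpt y x (- 1 / k * exp t)" for t
      using gpt_flip[of "k * exp (- t)" x y] k semicircle(2) by (simp add: exp_minus field_simps)
    then have "(\<lambda>t. c (- t)) = (\<lambda>t. gpt y x (- 1 / k * exp t))" by blast
    then show ?thesis using gpt_tendsto_top[of "- 1 / k" y x] k by simp
  qed
  have "A$2$1 \<noteq> 0"
  proof
    assume "A$2$1 = 0"
    then obtain j where j: "\<And>z. mob A z = z + of_int j" using Im_mob_upper A(1) by blast
    have "((\<lambda>t. c (t + L)) \<longlongrightarrow> of_real y) at_top"
      by (rule filterlim_compose[OF top]) (rule filterlim_tendsto_add_at_top[OF tendsto_const filterlim_ident, of L, simplified add.commute])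
    then have "((\<lambda>t. c (t + L) - c t) \<longlongrightarrow> of_real y - of_real y) at_top" by (intro tendsto_diff top)
    then have "((\<lambda>t::real. of_int j :: complex) \<longlongrightarrow> 0) at_top" by (simp add: A(2) j)
    then have "(of_int j :: complex) = 0" using tendsto_unique[OF trivial_limit_at_top_linorder tendsto_const] by blast
    then have "c (0 + L) = c 0" unfolding A(2) j by simp
    then have "gpt x y (k * exp L) = gpt x y (k * exp 0)" using semicircle(2) by simp
    then show False using gpt_inj[OF _ k(2)] k L by fastforce
  qed
  have lim_eq: "of_int (A$1$1) * w + of_int (A$1$2) = w * (of_int (A$2$1) * w + of_int (A$2$2))"
    if "(f \<longlongrightarrow> of_real w) at_top" "(f' \<longlongrightarrow> of_real w) at_top" "\<And>t. f' t = mob A (f t)" "\<And>t. Im (f t) > 0" for f f' :: "real \<Rightarrow> complex" and w :: real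
  proof -
    have e: "f' t * (of_int (A$2$1) * f t + of_int (A$2$2)) = of_int (A$1$1) * f t + of_int (A$1$2)" for t
      using rmob_den_nz[OF det_real[OF A(1)] that(4)] by (simp add: that(3) mob_def)
    have "((\<lambda>t. f' t * (of_int (A$2$1) * f t + of_int (A$2$2))) \<longlongrightarrow> of_real w * (of_int (A$2$1) * of_real w + of_int (A$2$2))) at_top"
      by (intro tendsto_intros that)
    moreover have "((\<lambda>t. of_int (A$1$1) * f t + of_int (A$1$2)) \<longlongrightarrow> of_int (A$1$1) * of_real w + of_int (A$1$2)) at_top"
      by (intro tendsto_intros that)
    ultimately have "of_real w * (of_int (A$2$1) * of_real w + of_int (A$2$2)) = (of_int (A$1$1) * of_real w + of_int (A$1$2) :: complex)"
      unfolding e using tendsto_unique[OF trivial_limit_at_top_linorder] by blast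
    then have "of_real (w * (of_int (A$2$1) * w + of_int (A$2$2))) = (of_real (of_int (A$1$1) * w + of_int (A$1$2)) :: complex)" by simp
    then show ?thesis by (simp only: of_real_eq_iff)
  qed
  have Imc: "Im (c t) > 0" for t using g by (simp add: geodesic_line_def)
  have sh: "filterlim (\<lambda>t. t + L) at_top at_top" "filterlim (\<lambda>t. t - L) at_top at_top"
    using filterlim_tendsto_add_at_top[OF tendsto_const filterlim_ident, of L] filterlim_tendsto_add_at_top[OF tendsto_const filterlim_ident, of "- L"]
    by (simp_all add: add.commute)
  have ey: "of_int (A$1$1) * y + of_int (A$1$2) = y * (of_int (A$2$1) * y + of_int (A$2$2))"
    using lim_eq[OF top filterlim_compose[OF top sh(1)]] A(2) Imc by simp
  have "c (- (t - L)) = mob A (c (- t))" for t using A(2)[of "- t"] by (simp add: algebra_simps)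
  then have ex: "of_int (A$1$1) * x + of_int (A$1$2) = x * (of_int (A$2$1) * x + of_int (A$2$2))"
    using lim_eq[OF bot filterlim_compose[OF bot sh(2)]] Imc by simp
  let ?c = "real_of_int (A$2$1)" and ?a = "real_of_int (A$1$1)" and ?d = "real_of_int (A$2$2)" and ?b = "real_of_int (A$1$2)"
  have qx: "?c * x\<^sup>2 + (?d - ?a) * x - ?b = 0" and qy: "?c * y\<^sup>2 + (?d - ?a) * y - ?b = 0"
    using ex ey by (simp_all add: power2_eq_square algebra_simps)
  have tr: "\<bar>trace A\<bar> \<ge> 3"
  proof -
    have "(y - x) * (?c * (x + y) - (?a - ?d)) = 0" using qx qy by (simp add: power2_eq_square algebra_simps)
    then have s: "?a - ?d = ?c * (x + y)" using k by simp
    have "?b = ?c * x\<^sup>2 - (?a - ?d) * x" using qx by (simp add: algebra_simps)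
    then have b: "?b = - ?c * (x * y)" unfolding s by (simp add: power2_eq_square algebra_simps)
    have "(real_of_int (trace A))\<^sup>2 = (?a - ?d)\<^sup>2 + 4 * ?b * ?c + 4 * (?a * ?d - ?b * ?c)"
      by (simp add: trace_2 power2_eq_square algebra_simps)
    also have "\<dots> = (?a - ?d)\<^sup>2 + 4 * ?b * ?c + 4" unfolding det_real[OF A(1)] by simp
    also have "\<dots> = ?c\<^sup>2 * (y - x)\<^sup>2 + 4"
      unfolding s b by (simp add: power2_eq_square algebra_simps)
    finally have "(real_of_int (trace A))\<^sup>2 > 2\<^sup>2" using \<open>A$2$1 \<noteq> 0\<close> k by simp
    then have "\<bar>real_of_int (trace A)\<bar> > 2" using power2_less_imp_less[of 2 "\<bar>real_of_int (trace A)\<bar>"] by simp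
    then show ?thesis by linarith
  qed
  have irr: "x \<notin> \<rat>" "y \<notin> \<rat>"
    using fixed_point_irrational[OF A(1) tr \<open>A$2$1 \<noteq> 0\<close>] qx qy by blast+
  have d: "den A x \<noteq> 0" "den A y \<noteq> 0" using den_nz irr A(1) by auto
  have f: "rm A x = x" "rm A y = y" using fixed_point_quadratic[OF d(1)] fixed_point_quadratic[OF d(2)] qx qy by blast+
  have "gpt x y (k * exp L) = gpt x y (k * den A y / den A x)"
    using A(2)[of 0] mob_gpt[OF d, of k] semicircle(2)[of 0] semicircle(2)[of L] f by simp
  then have "k * exp L = k * den A y / den A x" using gpt_inj[OF _ k(2)] by blast
  then have "den A y = exp L * den A x" using k d by (simp add: field_simps)
  then show ?thesis using irr semicircle f by blast
next
  case (up u k)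
  have Imc: "Im (c t) > 0" for t using g by (simp add: geodesic_line_def)
  show ?thesis
  proof (cases "A$2$1 = 0")
    case True
    then obtain j where "\<And>z. mob A z = z + of_int j" using Im_mob_upper A(1) by blast
    then have "Im (c (0 + L)) = Im (c 0)" using A(2)[of 0] by simp
    then show ?thesis using up L by simp
  next
    case False
    define t where "t = - ln k"
    have "Im (c (t + L)) * Im (c t) \<le> 1" unfolding A(2) by (rule Im_mob_times[OF A(1) False Imc])
    moreover have "Im (c t) = 1" "Im (c (t + L)) = exp L" using up by (simp_all add: t_def exp_add exp_minus exp_diff)
    ultimately show ?thesis using L by simp
  qed
next
  case (down u k)
  have Imc: "Im (c t) > 0" for t using g by (simp add: geodesic_line_def)
  show ?thesis
  proof (cases "A$2$1 = 0")
    case True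
    then obtain j where "\<And>z. mob A z = z + of_int j" using Im_mob_upper A(1) by blast
    then have "Im (c (0 + L)) = Im (c 0)" using A(2)[of 0] by simp
    then show ?thesis using down L by simp
  next
    case False
    define t where "t = ln k - 2 * L"
    have "Im (c (t + L)) * Im (c t) \<le> 1" unfolding A(2) by (rule Im_mob_times[OF A(1) False Imc])
    moreover have "Im (c t) = exp (2 * L)" "Im (c (t + L)) = exp L" using down by (simp_all add: t_def exp_diff exp_add exp_minus field_simps)
    moreover have "exp L > 1" "exp (2 * L) > 1" using L by simp_all
    ultimately show ?thesis using less_1_mult[of "exp L" "exp (2 * L)"] by simp
  qed
qed

lemma simple_period:
  assumes "simple_closed_geodesic c L" "to_torus (c s) = to_torus (c t)"
  shows "\<exists>m::int. t = s + of_int m * L"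
proof -
  have L: "L > 0" and per: "\<And>t. to_torus (c (t + L)) = to_torus (c t)" and inj: "inj_on (to_torus \<circ> c) {0..<L}"
    using assms(1) by (auto simp: simple_closed_geodesic_def)
  have pn: "to_torus (c (t + of_nat j * L)) = to_torus (c t)" for j t
  proof (induction j)
    case (Suc j)
    have "t + of_nat (Suc j) * L = (t + of_nat j * L) + L" by (simp add: algebra_simps)
    then show ?case using per[of "t + of_nat j * L"] Suc by (simp only:)
  qed simp
  have p: "to_torus (c (t + of_int j * L)) = to_torus (c t)" for j t
  proof (cases "j \<ge> 0")
    case True then show ?thesis using pn[of t "nat j"] by simp
  next
    case False then show ?thesis using pn[of "t + of_int j * L" "nat (- j)"] by simp
  qed
  define fl where "fl s = s + of_int (- \<lfloor>s / L\<rfloor>) * L" for s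
  have fl: "fl s \<in> {0..<L}" for s
  proof -
    have "of_int \<lfloor>s / L\<rfloor> \<le> s / L" by (rule of_int_floor_le)
    then have 1: "of_int \<lfloor>s / L\<rfloor> * L \<le> s" by (simp only: pos_le_divide_eq[OF L])
    have "s / L < of_int \<lfloor>s / L\<rfloor> + 1" by (rule floor_correct[THEN conjunct2, simplified])
    then have "s < (of_int \<lfloor>s / L\<rfloor> + 1) * L" by (simp only: pos_divide_less_eq[OF L])
    then show ?thesis using 1 by (simp add: fl_def algebra_simps)
  qed
  have "to_torus (c (fl s)) = to_torus (c (fl t))" unfolding fl_def p using assms(2) .
  then have "fl s = fl t" using inj_onD[OF inj _ fl fl] by simp
  then have "t = s + of_int (\<lfloor>t / L\<rfloor> - \<lfloor>s / L\<rfloor>) * L" by (simp add: fl_def algebra_simps)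
  then show ?thesis by blast
qed

text \<open>The lifts of a simple closed geodesic do not cross: at a crossing the deck transformation would
  have to be a power of the period, or have a fixed point.\<close>

lemma simple_unlinked:
  assumes sc: "simple_closed_geodesic c L" and ws: "\<And>t. c (t + L) = mob (ev ws) (c t)"
    and form: "x \<notin> \<rat>" "y \<notin> \<rat>" "k * (y - x) > 0" "\<And>t. c t = gpt x y (k * exp t)"
  shows "\<not> linked x y (rm (ev g) x) (rm (ev g) y)"
proof
  assume "linked x y (rm (ev g) x) (rm (ev g) y)"
  then obtain s s' where s: "s * (y - x) > 0" "s' * (rm (ev g) y - rm (ev g) x) > 0" "gpt x y s = gpt (rm (ev g) x) (rm (ev g) y) s'"
    using linked_meet by blast
  have d: "den (ev g) x \<noteq> 0" "den (ev g) y \<noteq> 0" using den_nz form by auto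
  have on_c: "\<exists>t. gpt x y s = c t" if "s * (y - x) > 0" for s
  proof -
    have "y - x \<noteq> 0" using form(3) by auto
    then have e: "(s * (y - x)) / (k * (y - x)) = s / k" by simp
    have sk: "s / k > 0" using divide_pos_pos[OF that form(3)] unfolding e .
    then have "k \<noteq> 0" by auto
    then have "gpt x y s = c (ln (s / k))" using sk by (simp add: form(4))
    then show ?thesis by blast
  qed
  define s'' where "s'' = s' * den (ev g) x / den (ev g) y"
  have "s'' * (y - x) = s' * (rm (ev g) y - rm (ev g) x) * (den (ev g) x)\<^sup>2"
    unfolding rm_diff[OF form(1,2) det_ev] using d by (simp add: s''_def field_simps power2_eq_square)
  then have "s'' * (y - x) > 0" using s(2) d by simp
  then obtain t2 where t2: "gpt x y s'' = c t2" using on_c by blast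
  obtain t1 where t1: "gpt x y s = c t1" using on_c[OF s(1)] by blast
  have "mob (ev g) (c t2) = gpt (rm (ev g) x) (rm (ev g) y) (s'' * den (ev g) y / den (ev g) x)"
    unfolding t2[symmetric] by (rule mob_gpt[OF d])
  also have "s'' * den (ev g) y / den (ev g) x = s'" using d by (simp add: s''_def)
  finally have e: "c t1 = mob (ev g) (c t2)" using s(3) t1 by simp
  have Imc: "Im (c t) > 0" for t using sc by (simp add: simple_closed_geodesic_def geodesic_line_def)
  have "to_torus (c t1) = to_torus (c t2)" unfolding e using to_torus_mob[OF Imc] .
  then obtain m :: int where m: "t2 = t1 + of_int m * L" using simple_period[OF sc] by blast
  have pn: "\<exists>v. \<forall>t. c (t + of_nat j * L) = mob (ev v) (c t)" for j
  proof (induction j)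
    case 0 show ?case by (rule exI[of _ "[]"]) simp
  next
    case (Suc j)
    then obtain v where v: "\<And>t. c (t + of_nat j * L) = mob (ev v) (c t)" by blast
    have "c (t + of_nat (Suc j) * L) = mob (ev (ws @ v)) (c t)" for t
    proof -
      have "t + of_nat (Suc j) * L = (t + of_nat j * L) + L" by (simp add: algebra_simps)
      then have "c (t + of_nat (Suc j) * L) = mob (ev ws) (mob (ev v) (c t))" by (simp only: ws v)
      then show ?thesis by (simp add: ev_append mob_mult Imc)
    qed
    then show ?case by blast
  qed
  have "\<exists>v. \<forall>t. c (t + of_int m * L) = mob (ev v) (c t)"
  proof (cases "m \<ge> 0")
    case True then show ?thesis using pn[of "nat m"] by simp
  next
    case False
    obtain v where v: "\<And>t. c (t + of_nat (nat (- m)) * L) = mob (ev v) (c t)" using pn by blast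
    have "c (t + of_int m * L) = mob (ev (winv v)) (c t)" for t
    proof -
      have "c t = mob (ev v) (c (t + of_int m * L))" using v[of "t + of_int m * L"] False by simp
      then show ?thesis using mob_adj[OF det_ev Imc, of v "t + of_int m * L"] by (simp add: ev_winv)
    qed
    then show ?thesis by blast
  qed
  then obtain v where v: "\<And>t. c (t + of_int m * L) = mob (ev v) (c t)" by blast
  have dv: "den (ev v) x \<noteq> 0" "den (ev v) y \<noteq> 0" using den_nz form by auto
  have "gpt x y ((k * exp (of_int m * L)) * exp t) = gpt (rm (ev v) x) (rm (ev v) y) ((k * den (ev v) y / den (ev v) x) * exp t)" for t
    using v[of t] mob_gpt[OF dv, of "k * exp t"] by (simp add: form(4) exp_add algebra_simps)
  moreover have "k * exp (of_int m * L) * (y - x) > 0" using mult_pos_pos[OF form(3) exp_gt_zero, of "of_int m * L"] by (simp add: algebra_simps)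
  moreover have "k * den (ev v) y / den (ev v) x * (rm (ev v) y - rm (ev v) x) > 0" by (rule gpt_sign[OF form(1,2) det_ev form(3)])
  ultimately have fix_v: "rm (ev v) x = x" "rm (ev v) y = y" using gpt_unique by metis+
  have "mob (ev (g @ v)) (c t1) = c t1" using e m v by (simp add: ev_append mob_mult Imc)
  from torsion_free[OF Imc this] have "rm (ev (g @ v)) x = x" "rm (ev (g @ v)) y = y" by auto
  then have "rm (ev g) x = x" "rm (ev g) y = y" using fix_v form by (simp_all add: ev_append rm_mult)
  then show False using \<open>linked x y (rm (ev g) x) (rm (ev g) y)\<close> by (simp add: linked_def)
qed

section \<open>The axis of a shortest word\<close>

lemma lt_locally_constant:
  assumes "x \<notin> \<rat>" "(f \<longlongrightarrow> x) F" shows "eventually (\<lambda>n. lt (f n) = lt x) F"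
proof -
  note o = order_tendstoD[OF assms(2)]
  have ne: "x \<noteq> 0" "x \<noteq> 1" "x \<noteq> -1" using irr_ne[OF assms(1)] by auto
  consider "x > 1" | "0 < x" "x < 1" | "-1 < x" "x < 0" | "x < -1" using ne by linarith
  then show ?thesis
  proof cases
    case 1 show ?thesis using o(1)[OF 1] by eventually_elim (use 1 in \<open>simp add: lt_def\<close>)
  next
    case 2 show ?thesis using o(1)[OF 2(1)] o(2)[OF 2(2)] by eventually_elim (use 2 in \<open>simp add: lt_def\<close>)
  next
    case 3 show ?thesis using o(1)[OF 3(1)] o(2)[OF 3(2)] by eventually_elim (use 3 in \<open>simp add: lt_def\<close>)
  next
    case 4 show ?thesis using o(2)[OF 4] by eventually_elim (use 4 in \<open>simp add: lt_def\<close>)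
  qed
qed

lemma third_letter: "\<exists>l. l \<noteq> l1 \<and> l \<noteq> (l2 :: letter)"
  by (metis letter.distinct(1,3,7))

text \<open>The iterates of any other point converge to the attracting fixed point, and from the first one on
  they lie in the interval of the first letter.\<close>

lemma attracting_letter:
  assumes red: "reduced ws" "ws \<noteq> []" "hd ws \<noteq> linv (last ws)"
    and irr: "x \<notin> \<rat>" "y \<notin> \<rat>" "x \<noteq> y" and f: "rm (ev ws) x = x" "rm (ev ws) y = y"
    and con: "\<bar>den (ev ws) x\<bar> < \<bar>den (ev ws) y\<bar>"
  shows "lt y = hd ws"
proof -
  let ?A = "ev ws"
  obtain l where l: "l \<noteq> linv (last ws)" "l \<noteq> lt x" using third_letter by blast
  obtain z0 where z0: "z0 \<notin> \<rat>" "lt z0 = l" using ex_irr_lt by blast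
  define z where "z N = (rm ?A ^^ N) z0" for N
  define \<rho> where "\<rho> = den ?A x / den ?A y"
  have dx: "den ?A x \<noteq> 0" and dy: "den ?A y \<noteq> 0" using den_nz irr by auto
  have zS: "z (Suc N) = rm ?A (z N)" for N by (simp add: z_def)
  have zi: "z N \<notin> \<rat>" for N
  proof (induction N)
    case 0 then show ?case using z0 by (simp add: z_def)
  next
    case (Suc N) then show ?case using rm_irr[OF _ det_ev] by (simp only: zS)
  qed
  have zx: "z N \<noteq> x" for N
  proof (induction N)
    case 0 then show ?case using z0 l by (auto simp: z_def)
  next
    case (Suc N)
    show ?case
    proof
      assume "z (Suc N) = x"
      then have "rm ?A (z N) = rm ?A x" using f zS by simp
      then show False using rm_inj[OF zi irr(1) det_ev] Suc by blast
    qed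
  qed
  have zl: "lt (z N) \<noteq> linv (last ws) \<and> lt (z (Suc N)) = hd ws" for N
  proof (induction N)
    case 0
    have "lt (z 0) \<noteq> linv (last ws)" using z0 l by (simp add: z_def)
    then show ?case using ping_pong_word[OF red(1,2) zi] zS by simp
  next
    case (Suc N)
    then have "lt (z (Suc N)) \<noteq> linv (last ws)" using red(3) by simp
    then show ?case using ping_pong_word[OF red(1,2) zi] zS[of "Suc N"] by (simp only: simp_thms)
  qed
  define C where "C = (z 0 - y) / (z 0 - x)"
  have u: "(z N - y) / (z N - x) = \<rho> ^ N * C" for N
  proof (induction N)
    case (Suc N)
    have dz: "den ?A (z N) \<noteq> 0" using den_nz[OF zi det_ev] .
    have 1: "z (Suc N) - y = (z N - y) / (den ?A y * den ?A (z N))"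
      using rm_diff[OF irr(2) zi det_ev, of ws N] by (simp only: zS f)
    have 2: "z (Suc N) - x = (z N - x) / (den ?A x * den ?A (z N))"
      using rm_diff[OF irr(1) zi det_ev, of ws N] by (simp only: zS f)
    have "(z (Suc N) - y) / (z (Suc N) - x) = \<rho> * ((z N - y) / (z N - x))"
      unfolding 1 2 \<rho>_def using dx dy dz by simp
    then show ?case unfolding Suc by simp
  qed (simp add: C_def)
  have "\<bar>\<rho>\<bar> < 1" unfolding \<rho>_def abs_divide using con dy by (simp add: divide_less_eq)
  then have "(\<lambda>N. \<rho> ^ N) \<longlonglongrightarrow> 0" by (intro LIMSEQ_power_zero) simp
  then have u0: "(\<lambda>N. (z N - y) / (z N - x)) \<longlonglongrightarrow> 0"
    unfolding u using tendsto_mult_left_zero by blast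
  have "z N = (y - x * ((z N - y) / (z N - x))) / (1 - (z N - y) / (z N - x))" for N
  proof -
    have nz: "z N - x \<noteq> 0" using zx by simp
    have a: "1 - (z N - y) / (z N - x) = (y - x) / (z N - x)" using nz by (simp add: field_simps)
    have b: "y - x * ((z N - y) / (z N - x)) = z N * (y - x) / (z N - x)" using nz by (simp add: field_simps)
    have yx: "y - x \<noteq> 0" using irr by simp
    show ?thesis unfolding a b using nz yx by simp
  qed
  moreover have "(\<lambda>N. (y - x * ((z N - y) / (z N - x))) / (1 - (z N - y) / (z N - x))) \<longlonglongrightarrow> (y - x * 0) / (1 - 0)"
    by (intro tendsto_intros u0) simp
  ultimately have "z \<longlonglongrightarrow> y" by simp
  from lt_locally_constant[OF irr(2) this] have "eventually (\<lambda>N. lt (z N) = lt y) sequentially" .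
  then obtain N where "\<And>k. k \<ge> N \<Longrightarrow> lt (z k) = lt y" by (auto simp: eventually_sequentially)
  from this[of "Suc N"] show ?thesis using zl[of N] by simp
qed

text \<open>The data of a simple closed geodesic after conjugation: a shortest word, its repelling
  and its attracting fixed point, and the absence of crossings.\<close>

definition axis :: "letter list \<Rightarrow> real \<Rightarrow> real \<Rightarrow> bool" where
  "axis us x y \<longleftrightarrow> us \<noteq> [] \<and> (\<forall>h vs. ev vs = ev h ** ev us ** adj (ev h) \<longrightarrow> length us \<le> length vs) \<and>
     x \<notin> \<rat> \<and> y \<notin> \<rat> \<and> x \<noteq> y \<and> rm (ev us) x = x \<and> rm (ev us) y = y \<and>
     \<bar>den (ev us) x\<bar> < \<bar>den (ev us) y\<bar> \<and> (\<forall>h. \<not> linked x y (rm (ev h) x) (rm (ev h) y))"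

lemma axisD:
  assumes "axis us x y"
  shows "us \<noteq> []" "\<forall>h vs. ev vs = ev h ** ev us ** adj (ev h) \<longrightarrow> length us \<le> length vs"
    "x \<notin> \<rat>" "y \<notin> \<rat>" "x \<noteq> y" "rm (ev us) x = x" "rm (ev us) y = y"
    "\<bar>den (ev us) x\<bar> < \<bar>den (ev us) y\<bar>" "\<And>h. \<not> linked x y (rm (ev h) x) (rm (ev h) y)"
  using assms by (simp_all add: axis_def)

lemma den_adj_fixed: "x \<notin> \<rat> \<Longrightarrow> det A = 1 \<Longrightarrow> rm A x = x \<Longrightarrow> den (adj A) x * den A x = 1"
  using den_mult[of x A "adj A"] by (simp add: adj_inverse)

lemma conj_fixed:
  assumes "x \<notin> \<rat>" "det g = 1" "det A = 1" "rm A x = x"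
  shows "rm (g ** A ** adj g) (rm g x) = rm g x" "den (g ** A ** adj g) (rm g x) = den A x"
proof -
  have i: "rm g x \<notin> \<rat>" using rm_irr assms by blast
  have b: "rm (adj g) (rm g x) = x" using rm_adj assms by blast
  show "rm (g ** A ** adj g) (rm g x) = rm g x"
    using assms i b by (simp add: rm_mult)
  have "den (adj g) (rm g x) * den g x = 1" using den_mult[OF assms(1,2), of "adj g"] assms(2) by (simp add: adj_inverse)
  moreover have "den (g ** A ** adj g) (rm g x) = den g x * den A x * den (adj g) (rm g x)"
    using assms i b by (simp add: den_mult)
  ultimately show "den (g ** A ** adj g) (rm g x) = den A x" by (simp add: algebra_simps)
qed

lemma axis_letters:
  assumes "axis us x y" shows "lt y = hd us" "lt x = linv (last us)"
proof -
  note a = axisD[OF assms]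
  show "lt y = hd us" using attracting_letter[OF shortest_word(1)[OF a(2)] a(1) shortest_word(2)[OF a(2,1)] a(3-8)] .
  have min: "\<forall>h vs. ev vs = ev h ** ev (winv us) ** adj (ev h) \<longrightarrow> length (winv us) \<le> length vs"
  proof (intro allI impI)
    fix h vs assume that: "ev vs = ev h ** ev (winv us) ** adj (ev h)"
    have "ev (winv vs) = ev h ** ev us ** adj (ev h)" unfolding ev_winv that by (simp add: adj_mult matrix_mul_assoc ev_winv)
    from a(2)[rule_format, OF this] show "length (winv us) \<le> length vs" by (simp add: winv_def)
  qed
  have ne: "winv us \<noteq> []" using a(1) by (simp add: winv_def)
  have dx: "den (adj (ev us)) x * den (ev us) x = 1" and dy: "den (adj (ev us)) y * den (ev us) y = 1"
    using den_adj_fixed a by auto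
  have nz: "den (ev us) x \<noteq> 0" "den (ev us) y \<noteq> 0" using dx dy by auto
  have e: "den (adj (ev us)) x = 1 / den (ev us) x" "den (adj (ev us)) y = 1 / den (ev us) y"
    using dx dy nz by (simp_all add: field_simps)
  have "\<bar>den (ev (winv us)) y\<bar> < \<bar>den (ev (winv us)) x\<bar>"
    unfolding ev_winv e abs_divide using a(8) nz by (simp add: frac_less2)
  moreover have "rm (ev (winv us)) x = x" "rm (ev (winv us)) y = y"
    using rm_adj[OF a(3) det_ev, of us] rm_adj[OF a(4) det_ev, of us] a(6,7) by (simp_all add: ev_winv)
  ultimately have "lt x = hd (winv us)"
    using attracting_letter[OF shortest_word(1)[OF min] ne shortest_word(2)[OF min ne] a(4,3)] a(5) by metis
  then show "lt x = linv (last us)" using a(1) by (simp add: winv_def hd_rev last_map)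
qed

lemma axis_conj:
  assumes ax: "axis us x y" and e: "ev us' = ev g ** ev us ** adj (ev g)" "length us' = length us"
  shows "axis us' (rm (ev g) x) (rm (ev g) y)"
proof -
  note a = axisD[OF ax]
  have "us' \<noteq> []" using a(1) e(2) by auto
  moreover have "length us' \<le> length vs" if "ev vs = ev h ** ev us' ** adj (ev h)" for h vs
  proof -
    have "ev vs = ev (h @ g) ** ev us ** adj (ev (h @ g))"
      unfolding that e by (simp add: ev_append adj_mult matrix_mul_assoc)
    from a(2)[rule_format, OF this] show ?thesis using e by simp
  qed
  moreover have "rm (ev g) x \<notin> \<rat>" "rm (ev g) y \<notin> \<rat>" using rm_irr a det_ev by blast+
  moreover have "rm (ev g) x \<noteq> rm (ev g) y" using rm_inj a det_ev by blast
  moreover note conj_fixed[OF a(3) det_ev det_ev a(6), of g] conj_fixed[OF a(4) det_ev det_ev a(7), of g]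
  moreover have "\<not> linked (rm (ev g) x) (rm (ev g) y) (rm (ev h) (rm (ev g) x)) (rm (ev h) (rm (ev g) y))" for h
  proof -
    have c: "rm (ev h) (rm (ev g) z) = rm (ev g) (rm (ev (winv g @ h @ g)) z)" if "z \<notin> \<rat>" for z
      using that rm_irr[OF that det_ev] rm_irr[OF rm_irr[OF that det_ev] det_ev] rm_adj'[OF _ det_ev]
      by (simp add: ev_append ev_winv rm_mult det_mul)
    show ?thesis
      unfolding c[OF a(3)] c[OF a(4)] using linked_rm[OF a(3,4) rm_irr[OF a(3) det_ev] rm_irr[OF a(4) det_ev] det_ev] a(9) by blast
  qed
  ultimately show ?thesis unfolding axis_def e(1) using a(8) by simp
qed

section \<open>Rotating the word\<close>

locale geodesic_word =
  fixes us :: "letter list" and x y :: real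
  assumes ax: "axis us x y"
begin

definition m :: nat where "m = length us"
definition fl :: "nat \<Rightarrow> letter" where "fl i = us ! (i mod m)"
definition gw :: "nat \<Rightarrow> letter list" where "gw i = winv (map fl [0..<i])"
definition Xp :: "nat \<Rightarrow> real" where "Xp i = rm (ev (gw i)) x"
definition Yp :: "nat \<Rightarrow> real" where "Yp i = rm (ev (gw i)) y"

lemmas a = axisD[OF ax]

lemma m0: "m > 0" using a(1) by (simp add: m_def)

lemma gw_Suc: "gw (Suc i) = linv (fl i) # gw i" by (simp add: gw_def)

lemma fl_period: "fl (i + m) = fl i" by (simp add: fl_def)

lemma Yp_irr: "Yp i \<notin> \<rat>" and Xp_irr: "Xp i \<notin> \<rat>"
  using rm_irr[OF a(4) det_ev] rm_irr[OF a(3) det_ev] by (simp_all add: Xp_def Yp_def)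

lemma Yp_Suc: "Yp (Suc i) = rm (lm (linv (fl i))) (Yp i)" and Xp_Suc: "Xp (Suc i) = rm (lm (linv (fl i))) (Xp i)"
  using a by (simp_all add: Xp_def Yp_def gw_Suc rm_mult)

lemma hd_rotate: "hd (rotate i us) = fl i"
  using a(1) by (simp add: hd_rotate_conv_nth fl_def m_def)

lemma last_rotate: "last (rotate (Suc i) us) = fl i"
proof -
  have ne: "rotate (Suc i) us \<noteq> []" using a(1) by simp
  have "last (rotate (Suc i) us) = rotate (Suc i) us ! (m - 1)" using ne by (subst last_conv_nth) (simp_all add: m_def)
  also have "\<dots> = us ! ((Suc i + (m - 1)) mod m)" using m0 by (subst nth_rotate) (simp_all add: m_def)
  also have "Suc i + (m - 1) = i + m" using m0 by simp
  finally show ?thesis by (simp add: fl_def)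
qed

lemma axis_rotate: "axis (rotate i us) (Xp i) (Yp i)"
proof (induction i)
  case 0
  then show ?case using ax by (simp add: Xp_def Yp_def gw_def)
next
  case (Suc i)
  define l ws where "l = fl i" and "ws = tl (rotate i us)"
  have r: "rotate i us = l # ws" using a(1) hd_rotate[of i] by (simp add: l_def ws_def) (metis list.collapse rotate_is_Nil_conv)
  have r': "rotate (Suc i) us = ws @ [l]" by (simp add: r)
  have "ev (ws @ [l]) = ev [linv l] ** ev (l # ws) ** adj (ev [linv l])"
    by (simp add: ev_append lm_linv matrix_mul_assoc adj_inverse)
  from axis_conj[OF Suc[unfolded r] this] show ?case unfolding r' by (simp add: Xp_Suc Yp_Suc l_def)
qed

lemma lt_Yp: "lt (Yp i) = fl i" and lt_Xp: "lt (Xp (Suc i)) = linv (fl i)"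
  using axis_letters[OF axis_rotate[of i]] axis_letters[OF axis_rotate[of "Suc i"]] hd_rotate last_rotate by auto

lemma fl_Suc_ne: "fl (Suc i) \<noteq> linv (fl i)"
  using shortest_word(2)[OF axisD(2)[OF axis_rotate[of "Suc i"]]] a(1) hd_rotate[of "Suc i"] last_rotate[of i] by auto

lemma Yp_period: "Yp (i + m) = Yp i"
proof -
  have "map fl [0..<m] = us" by (rule nth_equalityI) (simp_all add: fl_def m_def)
  then have "gw m = winv us" by (simp add: gw_def)
  then have "Yp m = y"
    using rm_adj[OF a(4) det_ev, of us] a(7) by (simp add: Yp_def ev_winv)
  show "Yp (i + m) = Yp i"
  proof (induction i)
    case 0 then show ?case using \<open>Yp m = y\<close> by (simp add: Yp_def gw_def)
  next
    case (Suc i) then show ?case using Yp_Suc[of "i + m"] Yp_Suc[of i] fl_period[of i] by simp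
  qed
qed

lemma fl_in: "fl i \<in> set us" using m0 by (simp add: fl_def m_def)

section \<open>A corner of the tiling that the geodesic avoids\<close>

definition orb :: "real \<Rightarrow> real \<Rightarrow> bool" where
  "orb s t \<longleftrightarrow> (\<exists>h. s = rm (ev h) x \<and> t = rm (ev h) y)"

lemma orb_word: "orb s t \<Longrightarrow> orb (rm (ev v) s) (rm (ev v) t)"
proof -
  assume "orb s t"
  then obtain h where "s = rm (ev h) x" "t = rm (ev h) y" unfolding orb_def by blast
  then have "rm (ev v) s = rm (ev (v @ h)) x" "rm (ev v) t = rm (ev (v @ h)) y" using a by (simp_all add: ev_append rm_mult)
  then show ?thesis unfolding orb_def by blast
qed

lemma orb_pts: "orb (Xp i) (Yp i)" unfolding orb_def Xp_def Yp_def by blast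

lemma orb_irr: "orb s t \<Longrightarrow> s \<notin> \<rat> \<and> t \<notin> \<rat>"
  unfolding orb_def using rm_irr[OF a(3) det_ev] rm_irr[OF a(4) det_ev] by blast

lemma orb_unlinked: assumes "orb s t" "orb s' t'" shows "\<not> linked s t s' t'"
proof -
  obtain g h where g: "s = rm (ev g) x" "t = rm (ev g) y" and h: "s' = rm (ev h) x" "t' = rm (ev h) y"
    using assms unfolding orb_def by blast
  have c: "rm (ev h) z = rm (ev g) (rm (ev (winv g @ h)) z)" if "z \<notin> \<rat>" for z
    using that rm_irr[OF that det_ev] rm_adj'[OF _ det_ev] by (simp add: ev_append ev_winv rm_mult)
  show ?thesis
    unfolding g h c[OF a(3)] c[OF a(4)] using linked_rm[OF a(3,4) rm_irr[OF a(3) det_ev] rm_irr[OF a(4) det_ev] det_ev] a(9) by blast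
qed

lemma Tm_6_word: "\<exists>v. Tm (6 * k) = ev v \<or> Tm (6 * k) = - ev v"
proof -
  have n: "\<exists>v. Tm (6 * int j) = ev v \<or> Tm (6 * int j) = - ev v" for j
  proof (induction j)
    case 0 show ?case by (intro exI[of _ "[]"]) simp
  next
    case (Suc j)
    then obtain v where v: "Tm (6 * int j) = ev v \<or> Tm (6 * int j) = - ev v" by blast
    have "Tm (6 * int (Suc j)) = Tm 6 ** Tm (6 * int j)" by (simp add: Tm_mult algebra_simps)
    also have "\<dots> = - (ev [La, LB, LA, Lb] ** Tm (6 * int j))" by (simp only: Tm_6 mult_uminus)
    finally have "Tm (6 * int (Suc j)) = ev ([La, LB, LA, Lb] @ v) \<or> Tm (6 * int (Suc j)) = - ev ([La, LB, LA, Lb] @ v)"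
      using v unfolding ev_append by (auto simp del: ev_Cons)
    then show ?case by blast
  qed
  show ?thesis
  proof (cases "k \<ge> 0")
    case True then show ?thesis using n[of "nat k"] by simp
  next
    case False
    then obtain v where v: "Tm (6 * - k) = ev v \<or> Tm (6 * - k) = - ev v" using n[of "nat (- k)"] by auto
    have "Tm (6 * k) = adj (Tm (6 * - k))" by simp
    then have "Tm (6 * k) = ev (winv v) \<or> Tm (6 * k) = - ev (winv v)"
      using v by (elim disjE) (simp_all only: ev_winv adj_uminus simp_thms)
    then show ?thesis by blast
  qed
qed

lemma orb_shift: "orb s t \<Longrightarrow> orb (s + 6 * of_int k) (t + 6 * of_int k)"
proof -
  assume o: "orb s t"
  obtain v where "Tm (6 * k) = ev v \<or> Tm (6 * k) = - ev v" using Tm_6_word by blast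
  then have "rm (ev v) z = rm (Tm (6 * k)) z" for z by (elim disjE) (simp_all only: rm_uminus)
  then have "rm (ev v) z = z + 6 * of_int k" for z by simp
  then show ?thesis using orb_word[OF o, of v] by simp
qed

text \<open>The denominators at the fixed points are invariant under conjugation.  Hence the width of a lift is
  inversely proportional to the lower left entry of its matrix, an integer, and there is a widest lift.\<close>

lemma orb_width:
  assumes "s = rm (ev h) x" "t = rm (ev h) y"
  shows "of_int ((ev h ** ev us ** adj (ev h)) $ 2 $ 1) * (t - s) = den (ev us) y - den (ev us) x"
proof -
  let ?N = "ev h ** ev us ** adj (ev h)"
  have "den ?N t - den ?N s = den (ev us) y - den (ev us) x"
    using conj_fixed(2)[OF a(3) det_ev det_ev a(6), of h] conj_fixed(2)[OF a(4) det_ev det_ev a(7), of h] assms by simp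
  then show ?thesis by (simp add: den_def algebra_simps)
qed

text \<open>A lift that covers the right end of a widest lift without crossing it would be wider.\<close>

lemma uncovered: "\<exists>w. w \<notin> \<rat> \<and> (\<forall>s t. orb s t \<longrightarrow> \<not> (s < w \<and> w < t) \<and> \<not> (t < w \<and> w < s))"
proof -
  define K where "K = den (ev us) y - den (ev us) x"
  define cc where "cc h = nat \<bar>(ev h ** ev us ** adj (ev h)) $ 2 $ 1\<bar>" for h
  have K0: "K \<noteq> 0" using a(8) by (auto simp: K_def)
  obtain h where h: "\<And>h'. cc h \<le> cc h'" using ex_has_least_nat[of "\<lambda>_. True" "[]" cc] by blast
  have wd: "of_nat (cc h') * \<bar>rm (ev h') y - rm (ev h') x\<bar> = \<bar>K\<bar>" for h'
  proof -
    have "\<bar>of_int ((ev h' ** ev us ** adj (ev h')) $ 2 $ 1) * (rm (ev h') y - rm (ev h') x)\<bar> = \<bar>K\<bar>"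
      using orb_width[OF refl refl, of h'] by (simp add: K_def)
    then show ?thesis by (simp add: abs_mult cc_def)
  qed
  define u v where "u = rm (ev h) x" and "v = rm (ev h) y"
  have uv: "orb u v" unfolding orb_def u_def v_def by blast
  \<comment> \<open>The right end of the lift, which may be the repelling or the attracting endpoint.\<close>
  define w where "w = max u v"
  have no: False if "orb s t" "min s t < w" "w < max s t" for s t
  proof -
    have "\<not> linked u v s t" using orb_unlinked[OF uv that(1)] .
    have "min s t \<le> min u v"
    proof (rule ccontr)
      assume "\<not> min s t \<le> min u v"
      then have "linked u v s t" using that(2,3)
        by (auto simp: linked_def w_def min_def max_def mult_less_0_iff zero_less_mult_iff split: if_splits)
      then show False using orb_unlinked[OF uv that(1)] by blast
    qed
    then have ltw: "\<bar>v - u\<bar> < \<bar>t - s\<bar>" using that(3) by (auto simp: w_def min_def max_def split: if_splits)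
    obtain h' where h': "s = rm (ev h') x" "t = rm (ev h') y" using \<open>orb s t\<close> unfolding orb_def by blast
    have "real (cc h) \<noteq> 0"
    proof
      assume "real (cc h) = 0"
      then have "\<bar>K\<bar> = 0" using wd[of h] by (simp only: mult_zero_left)
      then show False using K0 by simp
    qed
    then have pos: "real (cc h) > 0" by (simp only: of_nat_0_less_iff of_nat_eq_0_iff neq0_conv)
    have "\<bar>K\<bar> = real (cc h) * \<bar>v - u\<bar>" using wd[of h] by (simp add: u_def v_def)
    also have "\<dots> < real (cc h) * \<bar>t - s\<bar>" using ltw pos by simp
    also have "\<dots> \<le> real (cc h') * \<bar>t - s\<bar>" using h[of h'] by (intro mult_right_mono) auto
    also have "\<dots> = \<bar>K\<bar>" using wd[of h'] h' by simp
    finally show False by simp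
  qed
  have "w \<notin> \<rat>" using orb_irr[OF uv] by (simp add: w_def max_def)
  moreover have "\<not> (s < w \<and> w < t) \<and> \<not> (t < w \<and> w < s)" if "orb s t" for s t using no[OF that] by (auto simp: min_def max_def split: if_splits)
  ultimately show ?thesis by blast
qed

text \<open>The geodesic turns around the vertex between the intervals of the two letters.\<close>

definition corner :: "letter \<Rightarrow> letter \<Rightarrow> bool" where
  "corner l l' \<longleftrightarrow> (\<exists>i. (lt (Xp i) = l \<and> lt (Yp i) = l') \<or> (lt (Xp i) = l' \<and> lt (Yp i) = l))"

definition spans :: "real \<Rightarrow> real \<Rightarrow> bool" where
  "spans b c \<longleftrightarrow> (\<exists>s t. orb s t \<and> ((s < b \<and> c < t) \<or> (t < b \<and> c < s)))"

lemma corner_spans: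
  assumes "corner l l'" and "\<And>z. z \<notin> \<rat> \<Longrightarrow> lt z = l \<Longrightarrow> rm (ev v) z < b" and "\<And>z. z \<notin> \<rat> \<Longrightarrow> lt z = l' \<Longrightarrow> c < rm (ev v) z"
  shows "spans b c"
proof -
  obtain i where "(lt (Xp i) = l \<and> lt (Yp i) = l') \<or> (lt (Xp i) = l' \<and> lt (Yp i) = l)" using assms(1) unfolding corner_def by blast
  then show ?thesis using orb_word[OF orb_pts, of v i] assms(2,3)[OF Xp_irr, of i] assms(2,3)[OF Yp_irr, of i]
    unfolding spans_def by blast
qed

text \<open>Suitable elements of the group carry arcs around the four vertices to arcs that together cover the interval
  from \<open>-1\<close> to \<open>5\<close>.  This is a period of the parabolic stabilizer of infinity, which is generated by the
  translation by 6, so every irrational number would be covered.\<close>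

lemma missing_corner: "\<not> (corner LB La \<and> corner LA LB \<and> corner Lb LA \<and> corner La Lb)"
proof
  assume c: "corner LB La \<and> corner LA LB \<and> corner Lb LA \<and> corner La Lb"
  have s1: "spans (-1) 1" using corner_spans[of LB La "[]" "-1" 1] c by (auto simp: lt_eq_iff)
  have s2: "spans 1 2"
  proof (rule corner_spans[of LA LB "[La]"])
    show "corner LA LB" using c by blast
    show "rm (ev [La]) z < 1" if "z \<notin> \<rat>" "lt z = LA" for z
      using that by (auto simp: lt_eq_iff rm_letters field_simps simp del: lm.simps)
    show "2 < rm (ev [La]) z" if "z \<notin> \<rat>" "lt z = LB" for z
      using that by (auto simp: lt_eq_iff rm_letters field_simps simp del: lm.simps)
  qed
  have k: "rm (ev [La, LB]) z = 3 - 1 / z" if "z \<noteq> 0" for z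
    using that by (simp add: rm_def den_def field_simps mx_mult)
  have s3: "spans 2 4"
  proof (rule corner_spans[of Lb LA "[La, LB]"])
    show "corner Lb LA" using c by blast
    show "rm (ev [La, LB]) z < 2" if "z \<notin> \<rat>" "lt z = Lb" for z
    proof -
      have "0 < z" "z < 1" using that by (simp_all add: lt_eq_iff)
      then have "1 / z > 1" "z \<noteq> 0" by simp_all
      then show ?thesis using k[of z] by simp
    qed
    show "4 < rm (ev [La, LB]) z" if "z \<notin> \<rat>" "lt z = LA" for z
    proof -
      have z: "- 1 < z" "z < 0" using that by (simp_all add: lt_eq_iff)
      then have "1 / z < - 1" by (simp add: divide_less_eq)
      then show ?thesis using k[of z] z by (simp del: ev_Cons)
    qed
  qed
  have k': "rm (ev [La, LB, LA]) z = 4 - 1 / (z - 1)" if "z \<noteq> 1" for z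
    using that by (simp add: rm_def den_def field_simps mx_mult)
  have s4: "spans 4 5"
  proof (rule corner_spans[of La Lb "[La, LB, LA]"])
    show "corner La Lb" using c by blast
    show "rm (ev [La, LB, LA]) z < 4" if "z \<notin> \<rat>" "lt z = La" for z
    proof -
      have z: "z > 1" using that by (simp add: lt_eq_iff)
      then have "1 / (z - 1) > 0" by simp
      then show ?thesis using k'[of z] z by (simp del: ev_Cons)
    qed
    show "5 < rm (ev [La, LB, LA]) z" if "z \<notin> \<rat>" "lt z = Lb" for z
    proof -
      have z: "0 < z" "z < 1" using that by (simp_all add: lt_eq_iff)
      then have "1 / (z - 1) < - 1" by (simp add: divide_less_eq)
      then show ?thesis using k'[of z] z by (simp del: ev_Cons)
    qed
  qed
  obtain w where w: "w \<notin> \<rat>" "\<And>s t. orb s t \<Longrightarrow> \<not> (s < w \<and> w < t) \<and> \<not> (t < w \<and> w < s)" using uncovered by blast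
  \<comment> \<open>Translate into the interval from \<open>-1\<close> to \<open>5\<close>, which the four arcs cover.\<close>
  define k where "k = \<lfloor>(w + 1) / 6\<rfloor>"
  define w' where "w' = w - 6 * of_int k"
  have "of_int k \<le> (w + 1) / 6" "(w + 1) / 6 < of_int k + 1" unfolding k_def by linarith+
  then have r: "-1 \<le> w'" "w' < 5" by (simp_all add: w'_def)
  have nw: "\<not> (b \<le> w' \<and> w' \<le> c)" if sp: "spans b c" for b c
  proof
    assume bc: "b \<le> w' \<and> w' \<le> c"
    obtain s t where st: "orb s t" "(s < b \<and> c < t) \<or> (t < b \<and> c < s)" using sp unfolding spans_def by blast
    have "orb (s + 6 * of_int k) (t + 6 * of_int k)" using orb_shift st by blast
    from w(2)[OF this] show False using st(2) bc by (auto simp: w'_def)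
  qed
  show False using nw[OF s1] nw[OF s2] nw[OF s3] nw[OF s4] r by linarith
qed

text \<open>In a reduced word, a passage from the letters \<open>linv l\<close>, \<open>linv l'\<close> to \<open>l\<close>, \<open>l'\<close> goes around the corner.\<close>

lemma letters_split:
  assumes "\<not> corner l l'" "l' \<noteq> l" "l' \<noteq> linv l"
  shows "set us \<subseteq> {l, l'} \<or> set us \<subseteq> {linv l, linv l'}"
proof -
  have all: "k = l \<or> k = l' \<or> k = linv l \<or> k = linv l'" for k using assms(2,3) by (cases k; cases l; cases l') auto
  have step: "fl (Suc i) = linv l \<or> fl (Suc i) = linv l'" if "fl i = linv l \<or> fl i = linv l'" for i
  proof -
    have "lt (Xp (Suc i)) = l \<or> lt (Xp (Suc i)) = l'" using that lt_Xp[of i] by auto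
    moreover have "fl (Suc i) \<noteq> linv (fl i)" by (rule fl_Suc_ne)
    ultimately show ?thesis using assms(1) all[of "fl (Suc i)"] lt_Yp[of "Suc i"] lt_Xp[of i] unfolding corner_def by metis
  qed
  have later: "fl (i + j) = linv l \<or> fl (i + j) = linv l'" if "fl i = linv l \<or> fl i = linv l'" for i j
    by (induction j) (use that step in auto)
  have per: "fl (i + k * m) = fl i" for i k by (simp add: fl_def)
  show ?thesis
  proof (cases "\<exists>i. fl i = linv l \<or> fl i = linv l'")
    case True
    then obtain i where i: "fl i = linv l \<or> fl i = linv l'" by blast
    have "us ! j = linv l \<or> us ! j = linv l'" if "j < m" for j
    proof -
      have "i \<le> j + i * m" using m0 by (simp add: trans_le_add2)
      then obtain d where d: "j + i * m = i + d" using le_Suc_ex by blast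
      have "us ! j = fl (j + i * m)" using that unfolding per by (simp add: fl_def)
      then show ?thesis using later[OF i, of d] d by simp
    qed
    then have "\<forall>k\<in>set us. k = linv l \<or> k = linv l'" by (metis in_set_conv_nth m_def)
    then have "set us \<subseteq> {linv l, linv l'}" by blast
    then show ?thesis ..
  next
    case False
    have "us ! j = l \<or> us ! j = l'" if "j < m" for j
    proof -
      have "us ! j = fl j" using that by (simp add: fl_def)
      then show ?thesis using False all[of "fl j"] by auto
    qed
    then have "\<forall>k\<in>set us. k = l \<or> k = l'" by (metis in_set_conv_nth m_def)
    then have "set us \<subseteq> {l, l'}" by blast
    then show ?thesis ..
  qed
qed

lemma ex_signs: "La \<notin> set ws \<Longrightarrow> exa ws \<le> 0 \<and> (exa ws = 0 \<longrightarrow> LA \<notin> set ws)" "Lb \<notin> set ws \<Longrightarrow> exb ws \<le> 0"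
proof -
  show "La \<notin> set ws \<Longrightarrow> exa ws \<le> 0 \<and> (exa ws = 0 \<longrightarrow> LA \<notin> set ws)"
  proof (induction ws)
    case (Cons l ws) then show ?case by (cases l) auto
  qed simp
  show "Lb \<notin> set ws \<Longrightarrow> exb ws \<le> 0"
  proof (induction ws)
    case (Cons l ws) then show ?case by (cases l) auto
  qed simp
qed

text \<open>Of the four pairs of letters, only \<open>La\<close> and \<open>Lb\<close> allow these exponent sums.\<close>

lemma positive_word:
  assumes "exa us \<ge> 0" "exb us > 0" shows "set us \<subseteq> {La, Lb}"
proof -
  have "set us \<subseteq> {La, Lb} \<or> set us \<subseteq> {LA, LB} \<or> set us \<subseteq> {LA, Lb} \<or> set us \<subseteq> {La, LB}"
  proof -
    have c: "set us \<subseteq> {l, l'} \<or> set us \<subseteq> {k, k'}" if "\<not> corner l l'" "l' \<noteq> l" "l' \<noteq> linv l" "k = linv l" "k' = linv l'" for l l' k k'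
      using letters_split[of l l'] that by simp
    consider "\<not> corner LB La" | "\<not> corner LA LB" | "\<not> corner Lb LA" | "\<not> corner La Lb" using missing_corner by blast
    then show ?thesis
    proof cases
      case 1 from c[OF this, of Lb LA] show ?thesis by auto
    next
      case 2 from c[OF this, of La Lb] show ?thesis by auto
    next
      case 3 from c[OF this, of LB La] show ?thesis by auto
    next
      case 4 from c[OF this, of LA LB] show ?thesis by auto
    qed
  qed
  moreover have "Lb \<in> set us" using ex_signs(2)[of us] assms(2) by force
  ultimately have "set us \<subseteq> {La, Lb} \<or> set us \<subseteq> {LA, Lb}" by auto
  then show ?thesis
  proof
    assume s: "set us \<subseteq> {LA, Lb}"
    then have "La \<notin> set us" by auto
    then have "LA \<notin> set us" using ex_signs(1)[of us] assms(1) by simp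
    then show ?thesis using s by auto
  qed simp
qed

end

section \<open>The ranks of the rotations of the word\<close>

context geodesic_word begin

lemma orb_vieta:
  assumes "orb s t"
  shows "\<exists>(c::int) d b. c \<noteq> 0 \<and> of_int c * (s + t) = real_of_int d \<and> of_int c * (s * t) = - real_of_int b"
proof -
  obtain h where h: "s = rm (ev h) x" "t = rm (ev h) y" using assms unfolding orb_def by blast
  let ?N = "ev h ** ev us ** adj (ev h)"
  note i = orb_irr[OF assms]
  have "den (ev us) y - den (ev us) x \<noteq> 0" using a(8) by auto
  then have "of_int (?N$2$1) * (t - s) \<noteq> 0" unfolding orb_width[OF h] .
  then have c: "?N$2$1 \<noteq> 0" and st: "t - s \<noteq> 0" by (simp_all only: mult_eq_0_iff of_int_eq_0_iff) blast+
  have dn: "den ?N s \<noteq> 0" "den ?N t \<noteq> 0" using den_nz[of _ ?N] i by (simp_all add: det_mul)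
  have fx: "rm ?N s = s" "rm ?N t = t"
    unfolding h using conj_fixed(1)[OF a(3) det_ev det_ev a(6)] conj_fixed(1)[OF a(4) det_ev det_ev a(7)] by blast+
  have qs: "of_int (?N$2$1) * s\<^sup>2 + (of_int (?N$2$2) - of_int (?N$1$1)) * s - of_int (?N$1$2) = (0::real)"
    and qt: "of_int (?N$2$1) * t\<^sup>2 + (of_int (?N$2$2) - of_int (?N$1$1)) * t - of_int (?N$1$2) = (0::real)"
    using fixed_point_quadratic[OF dn(1)] fixed_point_quadratic[OF dn(2)] fx by blast+
  have "(t - s) * (of_int (?N$2$1) * (s + t) - (of_int (?N$1$1) - of_int (?N$2$2))) = 0"
    using qs qt by (simp add: power2_eq_square algebra_simps)
  then have sum: "of_int (?N$2$1) * (s + t) = real_of_int (?N$1$1 - ?N$2$2)" using st by simp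
  have "of_int (?N$2$2) - of_int (?N$1$1) = - (of_int (?N$2$1) * (s + t))" unfolding sum by simp
  from qs[unfolded this] have "of_int (?N$2$1) * (s * t) = - real_of_int (?N$1$2)"
    by (simp add: power2_eq_square algebra_simps)
  then show ?thesis using c sum by blast
qed

lemma orb_same_end: assumes "orb s t" "orb s' t" shows "s = s'"
proof -
  obtain c d b where 1: "c \<noteq> (0::int)" "of_int c * (s + t) = real_of_int d" "of_int c * (s * t) = - real_of_int b"
    using orb_vieta[OF assms(1)] by blast
  obtain c' d' b' where 2: "c' \<noteq> (0::int)" "of_int c' * (s' + t) = real_of_int d'" "of_int c' * (s' * t) = - real_of_int b'"
    using orb_vieta[OF assms(2)] by blast
  show ?thesis
    using conjugate_unique[of t c c' s d b s' d' b'] orb_irr[OF assms(1)] 1 2 by (simp add: add.commute mult.commute)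
qed

text \<open>The rank of a rotation: the number of rotations with a smaller attracting endpoint.\<close>

definition R :: "nat \<Rightarrow> int" where "R i = (\<Sum>j<m. of_bool (Yp j < Yp i))"

lemma sum_shift: "(\<Sum>j<m. f (Suc j)) = (\<Sum>j<m. f j)" if "f m = f 0" for f :: "nat \<Rightarrow> int"
  using sum.lessThan_Suc_shift[of f m] sum.lessThan_Suc[of f m] that by simp

lemma R_Suc: "R (Suc i) = (\<Sum>j<m. of_bool (Yp (Suc j) < Yp (Suc i)))"
  unfolding R_def by (rule sum_shift[symmetric]) (use Yp_period[of 0] in simp)

context
  assumes pos: "set us \<subseteq> {La, Lb}"
begin

lemma fl_cases: "fl i = La \<or> fl i = Lb" using fl_in pos by auto

lemma fl_Yp: "fl i = La \<Longrightarrow> Yp i > 1" "fl i = Lb \<Longrightarrow> 0 < Yp i \<and> Yp i < 1"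
  using lt_Yp[of i] Yp_irr[of i] lt_eq_iff by metis+

lemma Yp_pos: "Yp i > 0" using fl_cases[of i] fl_Yp[of i] by auto

lemma Xp_neg: "fl i = La \<Longrightarrow> -1 < Xp (Suc i) \<and> Xp (Suc i) < 0" "fl i = Lb \<Longrightarrow> Xp (Suc i) < -1"
  using lt_Xp[of i] Xp_irr[of "Suc i"] lt_eq_iff by simp_all

lemma Yp_back: "Yp i = rm (lm (fl i)) (Yp (Suc i))"
  unfolding Yp_Suc using rm_adj'[OF Yp_irr det_lm] by (simp add: lm_linv)

lemma same_letter: assumes "fl i = fl j" shows "Yp (Suc j) < Yp (Suc i) \<longleftrightarrow> Yp j < Yp i"
proof -
  have d: "den (lm (fl i)) (Yp (Suc k)) > 0" for k
    using fl_cases[of i] Yp_pos[of "Suc k"] by (auto simp: den_def add_pos_pos)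
  have "Yp i - Yp j = (Yp (Suc i) - Yp (Suc j)) / (den (lm (fl i)) (Yp (Suc j)) * den (lm (fl i)) (Yp (Suc i)))"
    using rm_diff[OF Yp_irr[of "Suc j"] Yp_irr[of "Suc i"] det_lm[of "fl i"]] Yp_back[of i] Yp_back[of j] assms by simp
  then have "Yp i - Yp j > 0 \<longleftrightarrow> Yp (Suc i) - Yp (Suc j) > 0"
    using mult_pos_pos[OF d[of j] d[of i]] by (simp only: pos_less_divide_eq mult_zero_left)
  then show ?thesis by simp
qed

text \<open>Going forward across different letters is decided by the repelling endpoints.\<close>

lemma cross_letters: assumes "fl i = Lb" "fl j = La" shows "Yp (Suc j) < Yp (Suc i)"
proof -
  have x: "Xp (Suc i) < Xp (Suc j)" "Xp (Suc j) < 0" using Xp_neg(2)[OF assms(1)] Xp_neg(1)[OF assms(2)] by auto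
  have "\<not> linked (Xp (Suc i)) (Yp (Suc i)) (Xp (Suc j)) (Yp (Suc j))" by (rule orb_unlinked[OF orb_pts orb_pts])
  moreover have "linked (Xp (Suc i)) (Yp (Suc i)) (Xp (Suc j)) (Yp (Suc j))" if "Yp (Suc i) < Yp (Suc j)"
    using that x Yp_pos[of "Suc i"] Yp_pos[of "Suc j"] by (auto simp: linked_def mult_less_0_iff zero_less_mult_iff)
  moreover have "Yp (Suc i) \<noteq> Yp (Suc j)"
  proof
    assume e: "Yp (Suc i) = Yp (Suc j)"
    have "Xp (Suc i) = Xp (Suc j)" using orb_same_end[OF orb_pts[of "Suc i"]] orb_pts[of "Suc j"] unfolding e by blast
    then show False using x by simp
  qed
  ultimately show ?thesis by linarith
qed

lemma fl_less: "fl i = Lb \<Longrightarrow> fl j = La \<Longrightarrow> Yp i < Yp j" using fl_Yp(2)[of i] fl_Yp(1)[of j] by simp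

lemma count_letters: "exa us = (\<Sum>j<m. of_bool (fl j = La))" "exb us = (\<Sum>j<m. of_bool (fl j = Lb))"
proof -
  have c: "exa ws = (\<Sum>j<length ws. of_bool (ws ! j = La)) \<and> exb ws = (\<Sum>j<length ws. of_bool (ws ! j = Lb))"
    if "set ws \<subseteq> {La, Lb}" for ws
    using that
  proof (induction ws)
    case (Cons l ws)
    then show ?case by (auto simp: sum.lessThan_Suc_shift simp del: sum.lessThan_Suc)
  qed simp
  show "exa us = (\<Sum>j<m. of_bool (fl j = La))" "exb us = (\<Sum>j<m. of_bool (fl j = Lb))"
    using c[OF pos] by (simp_all add: m_def fl_def)
qed

lemma length_eq: "int m = exa us + exb us"
proof -
  have "exa us + exb us = (\<Sum>j<m. of_bool (fl j = La) + of_bool (fl j = Lb))" unfolding count_letters by (rule sum.distrib[symmetric])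
  also have "\<dots> = (\<Sum>j<m. 1)" using fl_cases by (intro sum.cong) (auto simp: of_bool_def)
  finally show ?thesis by simp
qed

text \<open>Rotations with the same letter keep their order, and the two classes of letters exchange their order.\<close>

lemma R_step: "fl i = Lb \<Longrightarrow> R (Suc i) = R i + exa us" "fl i = La \<Longrightarrow> R (Suc i) = R i - exb us"
proof -
  assume i: "fl i = Lb"
  have "R (Suc i) = (\<Sum>j<m. of_bool (Yp j < Yp i) + of_bool (fl j = La))"
    unfolding R_Suc
  proof (intro sum.cong refl)
    fix j
    show "of_bool (Yp (Suc j) < Yp (Suc i)) = (of_bool (Yp j < Yp i) + of_bool (fl j = La) :: int)"
    proof (cases "fl j = La")
      case True then show ?thesis using cross_letters[OF i True] fl_less[OF i True] by simp
    next
      case False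
      then have "fl j = Lb" using fl_cases by blast
      then show ?thesis using same_letter[of i j] i False by simp
    qed
  qed
  then show "R (Suc i) = R i + exa us" by (simp add: sum.distrib R_def count_letters)
next
  assume i: "fl i = La"
  have "R (Suc i) = (\<Sum>j<m. of_bool (Yp j < Yp i) - of_bool (fl j = Lb))"
    unfolding R_Suc
  proof (intro sum.cong refl)
    fix j
    show "of_bool (Yp (Suc j) < Yp (Suc i)) = (of_bool (Yp j < Yp i) - of_bool (fl j = Lb) :: int)"
    proof (cases "fl j = Lb")
      case True then show ?thesis using cross_letters[OF True i] fl_less[OF True i] by simp
    next
      case False
      then have "fl j = La" using fl_cases by blast
      then show ?thesis using same_letter[of i j] i False by simp
    qed
  qed
  then show "R (Suc i) = R i - exb us" by (simp add: sum_subtractf R_def count_letters)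
qed

lemma R_bounds: assumes "i < m" shows "0 \<le> R i" "R i < int m" "fl i = Lb \<longleftrightarrow> R i < exb us"
proof -
  show "0 \<le> R i" unfolding R_def by (intro sum_nonneg) simp
  have one: "(\<Sum>j<m. of_bool (j = i)) = (1::int)"
    using assms sum.delta[of "{..<m}" i "\<lambda>_. 1::int"] by (simp add: of_bool_def)
  have s: "R i + 1 = (\<Sum>j<m. of_bool (Yp j < Yp i) + of_bool (j = i))" unfolding sum.distrib one R_def ..
  have "R i + 1 \<le> (\<Sum>j<m. 1)" unfolding s by (intro sum_mono) (auto simp: of_bool_def)
  then show "R i < int m" by simp
  show "fl i = Lb \<longleftrightarrow> R i < exb us"
  proof (cases "fl i = Lb")
    case True
    have "R i + 1 \<le> (\<Sum>j<m. of_bool (fl j = Lb))"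
      unfolding s
    proof (intro sum_mono)
      fix j
      show "of_bool (Yp j < Yp i) + of_bool (j = i) \<le> (of_bool (fl j = Lb) :: int)"
      proof (cases "fl j = Lb")
        case True then show ?thesis by (auto simp: of_bool_def)
      next
        case False
        then have "fl j = La" using fl_cases by blast
        then show ?thesis using fl_less[OF True, of j] \<open>fl i = Lb\<close> False by (auto simp: of_bool_def)
      qed
    qed
    then show ?thesis using True count_letters(2) by simp
  next
    case False
    then have La: "fl i = La" using fl_cases by blast
    have "exb us \<le> R i" unfolding R_def count_letters(2)
      using fl_less[OF _ La] by (intro sum_mono) (auto simp: of_bool_def)
    then show ?thesis using False by simp
  qed
qed

end

text \<open>Both steps of the rank are the addition of \<open>p\<close> modulo \<open>n\<close>, and the rank determines the letter.\<close>

lemma standard_word: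
  assumes "set us \<subseteq> {La, Lb}" and pq: "rot p q" and ex: "exa us = p" "exb us = q"
  shows "\<exists>r. us = rot.W p q r (nat (rot.n p q))"
proof -
  interpret rot p q by (rule pq)
  note pos = assms(1)
  have mn: "int m = n" using length_eq[OF pos] ex by (simp add: n_def)
  have Ri: "R i = (R 0 + int i * p) mod n" if "i < m" for i
    using that
  proof (induction i)
    case 0
    show ?case using R_bounds(1,2)[OF pos m0] mn by simp
  next
    case (Suc i)
    then have IH: "R i = (R 0 + int i * p) mod n" by simp
    have "R (Suc i) mod n = (R i + p) mod n"
    proof (cases "fl i = Lb")
      case True then show ?thesis using R_step(1)[OF pos True] ex by simp
    next
      case False
      then have "fl i = La" using fl_cases[OF pos] by blast
      then have "R i + p = R (Suc i) + n" using R_step(2)[OF pos] ex by (simp add: n_def)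
      then show ?thesis by simp
    qed
    also have "\<dots> = (R 0 + int i * p + p) mod n" unfolding IH by (simp add: mod_add_left_eq)
    also have "R 0 + int i * p + p = R 0 + int (Suc i) * p" by (simp add: algebra_simps)
    finally show ?case using R_bounds(1,2)[OF pos Suc.prems] mn by simp
  qed
  have "us = W (R 0) (nat n)"
  proof (rule nth_equalityI)
    show l: "length us = length (W (R 0) (nat n))" using mn by (simp add: m_def)
    fix i assume "i < length us"
    then have i: "i < m" by (simp add: m_def)
    then have "us ! i = fl i" by (simp add: fl_def)
    also have "fl i = (if R i < q then Lb else La)" using R_bounds(3)[OF pos i] ex fl_cases[OF pos, of i] by auto
    also have "\<dots> = ltr (R 0 + int i * p)" unfolding ltr_def Ri[OF i] ..
    also have "\<dots> = W (R 0) (nat n) ! i" using i mn[symmetric] by (simp add: W_def)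
    finally show "us ! i = W (R 0) (nat n) ! i" .
  qed
  then show ?thesis by blast
qed

end

context rot begin

lemma fixed_points_M:
  assumes "rm (M r) x = x" "rm (M r) y = y" "x \<notin> \<rat>" "y \<notin> \<rat>" "x < 0" "0 < y"
  shows "x = xx r" "y = yy r"
proof -
  show y: "y = yy r" unfolding yy_def using posroot(4)[OF posmat_M det_M assms(6,2)] .
  have fx: "rm (M r) (xx r) = xx r"
  proof -
    have "xx (r + int (nat n) * p) = xx r" using n0 by (intro xx_mod) simp
    then show ?thesis using ev_W_step(2)[of r "nat n"] by (simp add: M_def)
  qed
  let ?c = "real_of_int (M r$2$1)" and ?e = "real_of_int (M r$2$2) - of_int (M r$1$1)" and ?b = "real_of_int (M r$1$2)"
  have q: "?c * z\<^sup>2 + ?e * z - ?b = 0" if "rm (M r) z = z" "z \<notin> \<rat>" for z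
    using fixed_point_quadratic[OF den_nz[OF that(2) det_M]] that(1) by blast
  have c: "?c > 0" using posmat_M[of r] by (simp add: posmat_def)
  have d: "?c * (z + y) + ?e = 0" if "rm (M r) z = z" "z \<notin> \<rat>" "z < 0" for z
  proof -
    have "(z - y) * (?c * (z + y) + ?e) = 0" using q[OF that(1,2)] q[OF assms(2,4)] by (simp add: power2_eq_square algebra_simps)
    then show ?thesis using that assms(6) by simp
  qed
  have "?c * (x + y) = ?c * (xx r + y)" using d[OF assms(1,3,5)] d[OF fx xx_irr xx_neg] by linarith
  then show "x = xx r" using c by simp
qed

text \<open>Conjugate to a shortest word; it is a rotation of the standard word, and another word carries its axis
  to the standard lift.  The parametrizations then differ by a shift.\<close>

theorem standard_geodesic:
  assumes sc: "simple_closed_geodesic c L" and ws: "\<And>t. c (t + L) = mob (ev ws) (c t)" and ex: "exa ws = p" "exb ws = q"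
  shows "L = L0" "\<exists>g t0. \<forall>t. c t = mob (ev g) (c0 (t + t0))"
proof -
  have L: "L > 0" and gl: "geodesic_line c" using sc by (simp_all add: simple_closed_geodesic_def)
  obtain x y k where form: "x \<notin> \<rat>" "y \<notin> \<rat>" "k * (y - x) > 0" "\<And>t. c t = gpt x y (k * exp t)"
    and fx: "rm (ev ws) x = x" "rm (ev ws) y = y" "den (ev ws) y = exp L * den (ev ws) x"
    using translated_geodesic[OF gl L det_ev ws] by blast
  obtain g us where us: "ev us = ev g ** ev ws ** adj (ev g)"
    and min: "\<forall>h vs. ev vs = ev h ** ev us ** adj (ev h) \<longrightarrow> length us \<le> length vs"
    using shortest_conjugate[of ws] by blast
  have "ev us = ev (g @ ws @ winv g)" using us by (simp add: ev_append ev_winv matrix_mul_assoc)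
  then have exu: "exa us = p" "exb us = q" using ev_eq_ex[of us "g @ ws @ winv g"] ex by auto
  define x1 y1 where "x1 = rm (ev g) x" and "y1 = rm (ev g) y"
  have irr1: "x1 \<notin> \<rat>" "y1 \<notin> \<rat>" using rm_irr form det_ev by (auto simp: x1_def y1_def)
  have xy: "x \<noteq> y" using form(3) by auto
  note cx = conj_fixed[OF form(1) det_ev det_ev fx(1), of g, folded us x1_def]
  note cy = conj_fixed[OF form(2) det_ev det_ev fx(2), of g, folded us y1_def]
  have dx: "den (ev ws) x \<noteq> 0" using den_nz form(1) by auto
  have ax: "axis us x1 y1"
    unfolding axis_def
  proof (intro conjI allI)
    show "us \<noteq> []" using exu q0 by auto
    show "x1 \<noteq> y1" using rm_inj[OF form(1,2) det_ev] xy by (auto simp: x1_def y1_def)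
    have "\<bar>den (ev ws) x\<bar> * 1 < \<bar>den (ev ws) x\<bar> * exp L" using dx L by (intro mult_strict_left_mono) auto
    then show "\<bar>den (ev us) x1\<bar> < \<bar>den (ev us) y1\<bar>" unfolding cx(2) cy(2) fx(3) by (simp add: abs_mult mult.commute)
    fix h
    have e: "rm (ev h) (rm (ev g) z) = rm (ev g) (rm (ev (winv g @ h @ g)) z)" if "z \<notin> \<rat>" for z
      using that rm_irr[OF that det_ev] rm_irr[OF rm_irr[OF that det_ev] det_ev] rm_adj'[OF _ det_ev]
      by (simp add: ev_append ev_winv rm_mult det_mul)
    show "\<not> linked x1 y1 (rm (ev h) x1) (rm (ev h) y1)"
      unfolding x1_def y1_def e[OF form(1)] e[OF form(2)]
      using linked_rm[OF form(1,2) rm_irr[OF form(1) det_ev] rm_irr[OF form(2) det_ev] det_ev] simple_unlinked[OF sc ws form] by blast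
  qed (use min irr1 cx(1) cy(1) in blast)+
  interpret gwd: geodesic_word us x1 y1 by unfold_locales (rule ax)
  have pos: "set us \<subseteq> {La, Lb}" using gwd.positive_word exu p0 q0 by simp
  obtain r where r: "us = W r (nat n)" using gwd.standard_word[OF pos rot_axioms exu] by blast
  have Mr: "ev us = M r" by (simp add: r M_def)
  have "lt y1 = hd us" "lt x1 = linv (last us)" using axis_letters[OF ax] by blast+
  moreover have "hd us = La \<or> hd us = Lb" "last us = La \<or> last us = Lb"
    using subsetD[OF pos hd_in_set[OF gwd.a(1)]] subsetD[OF pos last_in_set[OF gwd.a(1)]] by simp_all
  ultimately have ll: "lt y1 = La \<or> lt y1 = Lb" "lt x1 = LA \<or> lt x1 = LB" by auto
  have "y1 > 0" using ll(1) by (elim disjE) (simp_all add: lt_eq_iff[OF irr1(2)])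
  have "x1 < 0" using ll(2) by (elim disjE) (simp_all add: lt_eq_iff[OF irr1(1)])
  then have xy1: "x1 = xx r" "y1 = yy r" using fixed_points_M[OF cx(1)[unfolded Mr] cy(1)[unfolded Mr] irr1 \<open>x1 < 0\<close> \<open>y1 > 0\<close>] by blast+
  obtain j where "(- 1 + int j * p) mod n = r mod n" using ranks_reach by blast
  then have j: "xx (- 1 + int j * p) = x1" "yy (- 1 + int j * p) = y1" using xx_mod yy_mod xy1 by metis+
  define h where "h = W (- 1) j"
  have h: "rm (ev h) x1 = x0" "rm (ev h) y1 = y0"
    using ev_W_step[of "- 1" j] unfolding j h_def x0_def y0_def by simp_all
  have per: "ev (h @ us @ winv h) = A0"
  proof -
    have "W (- 1) j @ W (- 1 + int j * p) (nat n) = W (- 1) (nat n) @ W (- 1 + int (nat n) * p) j"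
      unfolding W_append[symmetric] by (simp add: add.commute)
    moreover have "W (- 1 + int (nat n) * p) j = W (- 1) j"
    proof (rule W_mod)
      have "- 1 + int (nat n) * p = - 1 + p * n" using n0 by simp
      then show "(- 1 + int (nat n) * p) mod n = (- 1) mod n" by (simp only: mod_mult_self1)
    qed
    moreover have "W (- 1 + int j * p) (nat n) = us" unfolding r by (rule W_mod) fact
    ultimately have "ev (h @ us) = A0 ** ev h" by (simp add: h_def A0_def M_def ev_append)
    then have "ev (h @ us) ** adj (ev h) = A0 ** (ev h ** adj (ev h))" by (simp only: matrix_mul_assoc)
    then show ?thesis by (simp add: ev_append ev_winv adj_inverse matrix_mul_assoc)
  qed
  have A0e: "A0 = ev h ** ev us ** adj (ev h)" unfolding per[symmetric] by (simp add: ev_append ev_winv matrix_mul_assoc)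
  have d1: "den A0 x0 = den (ev us) x1" "den A0 y0 = den (ev us) y1"
    using conj_fixed(2)[OF irr1(1) det_ev det_ev cx(1), of h] conj_fixed(2)[OF irr1(2) det_ev det_ev cy(1), of h]
    unfolding A0e h by blast+
  have "lam = exp L * (1 / lam)"
    using d1 fx(3) cx(2) cy(2) den_A0_x0 by (simp add: lam_def)
  then have "exp L = lam * lam" using lam_pos by (simp add: field_simps)
  then have "L = ln (lam * lam)" by (metis ln_exp)
  then show "L = L0" using lam_pos by (simp add: L0_def ln_mult)
  define v where "v = h @ g"
  have vx: "rm (ev v) x = x0" "rm (ev v) y = y0"
    using h form by (simp_all add: v_def ev_append rm_mult x1_def y1_def)
  have dv: "den (ev v) x \<noteq> 0" "den (ev v) y \<noteq> 0" using den_nz form by auto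
  define k' where "k' = k * den (ev v) y / den (ev v) x"
  have "k' * (y0 - x0) > 0" using gpt_sign[OF form(1,2) det_ev form(3), of v] by (simp add: k'_def vx)
  then have k': "k' > 0" using xy0 by (simp add: zero_less_mult_iff)
  have m1: "mob (ev v) (c t) = c0 (t + ln k')" for t
  proof -
    have "mob (ev v) (c t) = gpt x0 y0 (k * exp t * den (ev v) y / den (ev v) x)"
      unfolding form(4) using mob_gpt[OF dv] vx by simp
    also have "k * exp t * den (ev v) y / den (ev v) x = exp (t + ln k')"
      using k' by (simp add: exp_add k'_def algebra_simps)
    finally show ?thesis by (simp add: c0_def)
  qed
  have Imc: "Im (c t) > 0" for t using gl by (simp add: geodesic_line_def)
  have "c t = mob (ev (winv v)) (c0 (t + ln k'))" for t
    unfolding m1[symmetric] ev_winv using mob_adj[OF det_ev Imc] by simp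
  then show "\<exists>g t0. \<forall>t. c t = mob (ev g) (c0 (t + t0))" by blast
qed

end

section \<open>The relative twist of a slope\<close>

lemma ex_sbr: "exa (concat (map sbr ws)) = exa ws + exb ws" "exb (concat (map sbr ws)) = - exa ws"
proof -
  have "exa (concat (map sbr ws)) = exa ws + exb ws \<and> exb (concat (map sbr ws)) = - exa ws"
  proof (induction ws)
    case (Cons l ws) then show ?case by (cases l) auto
  qed simp
  then show "exa (concat (map sbr ws)) = exa ws + exb ws" "exb (concat (map sbr ws)) = - exa ws" by auto
qed

text \<open>Translating by two turns exponent sums \<open>(q, - p - q)\<close> into \<open>(p, q)\<close>.\<close>

lemma conj_Tm_m2: "\<exists>vs. Tm (-2) ** ev ws ** Tm 2 = ev vs \<and> exa vs = - (exa ws + exb ws) \<and> exb vs = exa ws"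
proof -
  let ?u = "concat (map sbl ws)" and ?v = "concat (map sbl (concat (map sbl ws)))"
  have 1: "ev ws ** Tm 1 = Tm 1 ** ev ?u" and 2: "ev ?u ** Tm 1 = Tm 1 ** ev ?v" by (rule ev_sbl)+
  have "Tm (-2) ** ev ws ** Tm 2 = Tm (-2) ** (ev ws ** Tm 1) ** Tm 1"
    by (simp add: Tm_mult matrix_mul_assoc[symmetric])
  also have "\<dots> = Tm (-1) ** (ev ?u ** Tm 1)" unfolding 1 by (simp add: Tm_mult matrix_mul_assoc)
  also have "\<dots> = ev ?v" unfolding 2 by (simp add: Tm_mult matrix_mul_assoc)
  finally show ?thesis by (intro exI[of _ ?v]) (simp only: ex_sbl, simp)
qed

lemma conj_Tm_2: "\<exists>vs. Tm 2 ** ev ws ** Tm (-2) = ev vs \<and> exa vs = exb ws \<and> exb vs = - (exa ws + exb ws)"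
proof -
  let ?u = "concat (map sbr ws)" and ?v = "concat (map sbr (concat (map sbr ws)))"
  have 1: "ev ws ** Tm (-1) = Tm (-1) ** ev ?u" and 2: "ev ?u ** Tm (-1) = Tm (-1) ** ev ?v" by (rule ev_sbr)+
  have "Tm 2 ** ev ws ** Tm (-2) = Tm 2 ** (ev ws ** Tm (-1)) ** Tm (-1)"
    by (simp add: Tm_mult matrix_mul_assoc[symmetric])
  also have "\<dots> = Tm 1 ** (ev ?u ** Tm (-1))" unfolding 1 by (simp add: Tm_mult matrix_mul_assoc)
  also have "\<dots> = ev ?v" unfolding 2 by (simp add: Tm_mult matrix_mul_assoc)
  finally show ?thesis by (intro exI[of _ ?v]) (simp only: ex_sbr, simp)
qed

lemma shift_period:
  assumes "\<And>t. c (t + L) = mob A (c t)" "det A = 1" "\<And>t. Im (c t) > 0" "Tm k ** A ** Tm (- k) = B"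
  shows "c (t + L) + of_int k = mob B (c t + of_int k)"
proof -
  have I: "Im (c t + of_int k) > 0" using assms(3)[of t] by simp
  have "mob B (c t + of_int k) = mob (Tm k) (mob A (mob (Tm (- k)) (c t + of_int k)))"
    unfolding assms(4)[symmetric] using I assms(2,3) by (simp add: mob_mult)
  then show ?thesis using assms(1) by simp
qed

context rot begin

lemma twist_value:
  assumes "simple_closed_geodesic c L" "has_homology c L (q, p)" "is_twist c L t"
  shows "t / L = tw0 / L0"
proof -
  have Imc: "Im (c t) > 0" for t using assms(1) by (simp add: simple_closed_geodesic_def geodesic_line_def)
  obtain ws where ws: "\<And>t. c (t + L) = mob (ev ws) (c t)" and h: "exa ws = q" "exb ws = - q - p"
    using assms(2) unfolding has_homology_iff hom_vec_def by auto
  obtain vs where vs: "Tm (-2) ** ev ws ** Tm 2 = ev vs" "exa vs = - (exa ws + exb ws)" "exb vs = exa ws"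
    using conj_Tm_m2 by blast
  define d where "d t = c t + of_int (-2)" for t
  have d: "d (t + L) = mob (ev vs) (d t)" for t
    unfolding d_def by (rule shift_period[of c L "ev ws" "-2" "ev vs", OF ws det_ev Imc]) (simp add: vs(1))
  have sd: "simple_closed_geodesic d L" unfolding d_def by (rule simple_closed_geodesic_shift[OF assms(1)])
  have td: "is_twist d L t" unfolding d_def by (rule is_twist_shift[OF assms(3) Imc])
  have ex: "exa vs = p" "exb vs = q" using vs h by simp_all
  have L: "L = L0" by (rule standard_geodesic(1)[OF sd d ex])
  obtain g t0 where "\<And>t. d t = mob (ev g) (c0 (t + t0))" using standard_geodesic(2)[OF sd d ex] by blast
  from twist_unique[OF td[unfolded L] this] show ?thesis by (simp add: L)
qed

text \<open>The rank \<open>- 1 + i p\<close> runs through all residues once.\<close>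

definition \<rho> :: "int \<Rightarrow> int" where "\<rho> i = (- 1 + i * p) mod n"
definition \<iota> :: "int \<Rightarrow> int" where "\<iota> r = (int jj * (r + 1)) mod n"

lemma jj_inverse: "(int jj * p) mod n = 1 mod n"
proof -
  have "n dvd (- 1 + int jj * p)" using jj by (rule mod_0_imp_dvd)
  then have "n dvd (int jj * p - 1)" by (simp add: add.commute)
  then show ?thesis by (simp only: mod_eq_dvd_iff)
qed

lemma \<iota>_\<rho>: assumes "i \<in> {0..<n}" shows "\<iota> (\<rho> i) = i"
proof -
    have "\<iota> (\<rho> i) = (int jj * ((- 1 + i * p) + 1)) mod n"
      unfolding \<iota>_def \<rho>_def by (metis mod_add_left_eq mod_mult_right_eq)
    also have "int jj * ((- 1 + i * p) + 1) = i * (int jj * p)" by simp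
    also have "\<dots> mod n = (i * 1) mod n" by (metis jj_inverse mod_mult_right_eq)
    finally show ?thesis using assms by simp
qed

lemma \<rho>_bij: "bij_betw \<rho> {0..<n} {0..<n}"
proof (rule bij_betw_byWitness[where f' = \<iota>])
  show "\<forall>i\<in>{0..<n}. \<iota> (\<rho> i) = i" using \<iota>_\<rho> by blast
  show "\<forall>r\<in>{0..<n}. \<rho> (\<iota> r) = r"
  proof
    fix r assume r: "r \<in> {0..<n}"
    have "\<rho> (\<iota> r) = (- 1 + int jj * (r + 1) * p) mod n"
      unfolding \<iota>_def \<rho>_def by (metis mod_add_right_eq mod_mult_left_eq)
    also have "- 1 + int jj * (r + 1) * p = - 1 + (r + 1) * (int jj * p)" by simp
    also have "\<dots> mod n = (- 1 + (r + 1) * 1) mod n" by (metis jj_inverse mod_mult_right_eq mod_add_right_eq)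
    finally show "\<rho> (\<iota> r) = r" using r by simp
  qed
qed (use n0 in \<open>auto simp: \<rho>_def \<iota>_def\<close>)

lemma count_W: "exa (W (- 1) (nat n)) = p" "exb (W (- 1) (nat n)) = q"
proof -
  have e: "exb (map f ks) = sum_list (map (\<lambda>i. eb (f i)) ks)" "exa (map f ks) = sum_list (map (\<lambda>i. ea (f i)) ks)" for f and ks :: "nat list"
    by (simp_all add: exa_def exb_def o_def)
  have s: "sum_list (map g [0..<nat n]) = (\<Sum>i\<in>{0..<n}. g (nat i))" for g :: "nat \<Rightarrow> int"
  proof -
    have "sum_list (map g [0..<nat n]) = (\<Sum>i\<in>{0..<nat n}. g i)" by (simp add: interv_sum_list_conv_sum_set_nat)
    also have "\<dots> = (\<Sum>i\<in>{0..<n}. g (nat i))"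
      by (rule sum.reindex_bij_witness[where i = nat and j = int]) auto
    finally show ?thesis .
  qed
  have l: "ltr (- 1 + int (nat i) * p) = (if \<rho> i < q then Lb else La)" if "i \<in> {0..<n}" for i
    using that by (simp add: ltr_def \<rho>_def)
  have qn: "q \<le> n" using p0 by (simp add: n_def)
  have "exb (W (- 1) (nat n)) = (\<Sum>i\<in>{0..<n}. of_bool (\<rho> i < q))"
    unfolding W_def e s by (intro sum.cong refl) (simp only: l, simp)
  also have "\<dots> = (\<Sum>r\<in>{0..<n}. of_bool (r < q))" by (rule sum.reindex_bij_betw[OF \<rho>_bij])
  also have "\<dots> = (\<Sum>r\<in>{0..<q}. 1)" by (rule sum.mono_neutral_cong_right) (use qn in auto)
  finally show "exb (W (- 1) (nat n)) = q" using q0 by simp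
  have "exa (W (- 1) (nat n)) = (\<Sum>i\<in>{0..<n}. of_bool (\<not> \<rho> i < q))"
    unfolding W_def e s by (intro sum.cong refl) (simp only: l, simp)
  also have "\<dots> = (\<Sum>r\<in>{0..<n}. of_bool (\<not> r < q))" by (rule sum.reindex_bij_betw[OF \<rho>_bij, of "\<lambda>r. of_bool (\<not> r < q)"])
  also have "\<dots> = (\<Sum>r\<in>{q..<n}. 1)" by (rule sum.mono_neutral_cong_right) (use q0 in auto)
  finally show "exa (W (- 1) (nat n)) = p" using p0 by (simp add: n_def)
qed

lemma twist_attained: "\<exists>c. simple_closed_geodesic c L0 \<and> has_homology c L0 (q, p) \<and> is_twist c L0 tw0"
proof -
  obtain vs where vs: "Tm 2 ** A0 ** Tm (-2) = ev vs" "exa vs = q" "exb vs = - (p + q)"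
    using conj_Tm_2[of "W (- 1) (nat n)"] count_W by (auto simp: A0_def M_def)
  have "c0 (t + L0) + of_int 2 = mob (ev vs) (c0 t + of_int 2)" for t
    by (rule shift_period[of c0 L0 A0 2 "ev vs", OF mob_A0_c0[symmetric] det_A0 Im_c0 vs(1)])
  moreover have "hom_vec vs = (q, p)" by (simp add: hom_vec_def vs)
  ultimately have "has_homology (\<lambda>t. c0 t + of_int 2) L0 (q, p)" unfolding has_homology_iff by blast
  then show ?thesis
    using simple_closed_geodesic_shift[OF c0_simple_closed, of 2] is_twist_shift[OF twist_exists Im_c0, of 2] by blast
qed

theorem relative_twist_eq:
  assumes "quotient_of r = (p, q)" shows "relative_twist r = tw0 / L0"
  unfolding relative_twist_def
proof (rule the_equality)
  obtain c where c: "simple_closed_geodesic c L0" "has_homology c L0 (q, p)" "is_twist c L0 tw0" using twist_attained by blast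
  show "\<exists>c L t p' q'. quotient_of r = (p', q') \<and> simple_closed_geodesic c L \<and> has_homology c L (q', p') \<and> is_twist c L t \<and> tw0 / L0 = t / L"
    proof (rule exI[of _ c], rule exI[of _ L0], rule exI[of _ tw0], rule exI[of _ p], rule exI[of _ q], intro conjI)
  qed (rule assms c refl)+
  fix x assume "\<exists>c L t p' q'. quotient_of r = (p', q') \<and> simple_closed_geodesic c L \<and> has_homology c L (q', p') \<and> is_twist c L t \<and> x = t / L"
  then obtain c L t p' q' where h: "quotient_of r = (p', q')" "simple_closed_geodesic c L" "has_homology c L (q', p')" "is_twist c L t" "x = t / L"
    by (elim exE conjE)
  have "p' = p" "q' = q" using h(1) assms by simp_all
  then show "x = tw0 / L0" using twist_value[OF h(2) _ h(4)] h(3,5) by simp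
qed

section \<open>Length and twist as sums over ranks\<close>

text \<open>The contribution to the length of the step of the rotation that arrives at rank \<open>r\<close>.\<close>

definition F :: "int \<Rightarrow> real" where "F r = 2 * ln (den (lm (ltr (r - p))) (yy r))"

lemma F_mod: "r mod n = r' mod n \<Longrightarrow> F r = F r'"
proof -
  assume m: "r mod n = r' mod n"
  have e: "(r - p) mod n = (r' - p) mod n" by (rule mod_diff_cong[OF m refl])
  show ?thesis unfolding F_def using arg_cong[OF ltr_mod[OF e], of lm] yy_mod[OF m] by (simp only:)
qed

lemma den_yy: "l = La \<or> l = Lb \<Longrightarrow> den (lm l) (yy r) = yy r + (if l = La then 1 else 2)"
  by (auto simp: den_def)

lemma F_cases:
  assumes "0 \<le> r" "r < n" shows "F r = 2 * ln (yy r + (if r < p then 1 else 2))"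
proof -
  have "ltr (r - p) = La \<longleftrightarrow> r < p"
  proof (cases "r < p")
    case True
    have "(r - p) mod n = (r - p + n) mod n" by simp
    also have "\<dots> = r + q" using True assms q0 by (simp add: n_def mod_pos_pos_trivial)
    finally show ?thesis using True assms by (simp add: ltr_La)
  next
    case False
    then have "(r - p) mod n = r - p" using assms p0 by (simp add: mod_pos_pos_trivial)
    then show ?thesis using False assms by (simp add: ltr_La n_def)
  qed
  then show ?thesis unfolding F_def using den_yy[OF ltr_cases] by simp
qed

lemma yy_range: "1/2 < yy r" "yy r < 2"
  using yy_bounds[of r] ltr_cases[of r] by auto

lemma F_mono: assumes "0 \<le> r" "r \<le> r'" "r' < n" shows "F r \<le> F r'"
proof -
  have "yy r \<le> yy r'" using yy_mono[of r r'] assms by (cases "r = r'") auto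
  then have "yy r + (if r < p then 1 else 2) \<le> yy r' + (if r' < p then 1 else 2)" using assms by auto
  moreover have "yy r + (if r < p then 1 else 2) > 0" using yy_range(1)[of r] by simp
  ultimately show ?thesis using F_cases[of r] F_cases[of r'] assms by simp
qed

lemma F_range: "2/3 \<le> F r" "F r \<le> 4"
proof -
  define s where "s = r mod n"
  have s: "0 \<le> s" "s < n" "F r = F s" using n0 by (auto simp: s_def intro: F_mod)
  define v where "v = yy s + (if s < p then 1 else 2)"
  have v: "3/2 < v" "v < 4" using yy_range[of s] by (auto simp: v_def)
  have F: "F r = 2 * ln v" using F_cases[OF s(1,2)] s(3) by (simp add: v_def)
  \<comment> \<open>These rough bounds on the logarithm suffice, as only a constant error matters.\<close>
  have "ln (1 / v) \<le> 1 / v - 1" using v by (intro ln_le_minus_one) simp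
  moreover have "1 / v < 2 / 3" using v by (simp add: field_simps)
  ultimately show "2/3 \<le> F r" using v F by (simp add: ln_div)
  have "ln v = 2 * ln (sqrt v)" using v by (simp add: ln_sqrt)
  moreover have "ln (sqrt v) \<le> sqrt v - 1" using v by (intro ln_le_minus_one) simp
  moreover have "sqrt v \<le> 2" using v real_sqrt_le_mono[of v 4] by simp
  ultimately show "F r \<le> 4" using F by simp
qed

text \<open>The cocycle rule for the denominators along the word.\<close>

lemma den_W: "2 * ln (den (ev (W r k)) (yy (r + int k * p))) = (\<Sum>i\<in>{1..k}. F (r + int i * p)) \<and> den (ev (W r k)) (yy (r + int k * p)) > 0"
proof (induction k arbitrary: r)
  case (Suc k)
  let ?y = "yy (r + int (Suc k) * p)"
  have e: "r + p + int k * p = r + int (Suc k) * p" by (simp add: algebra_simps)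
  have IH: "2 * ln (den (ev (W (r + p) k)) ?y) = (\<Sum>i\<in>{1..k}. F (r + p + int i * p))" "den (ev (W (r + p) k)) ?y > 0"
    using Suc[of "r + p"] unfolding e by auto
  have bk: "rm (ev (W (r + p) k)) ?y = yy (r + p)" using ev_W_step(1)[of "r + p" k] unfolding e .
  have d: "den (ev (W r (Suc k))) ?y = den (lm (ltr r)) (yy (r + p)) * den (ev (W (r + p) k)) ?y"
    unfolding W_Suc ev_Cons den_mult[OF yy_irr det_ev] bk ..
  have p1: "den (lm (ltr r)) (yy (r + p)) > 0" using den_yy[OF ltr_cases, of r "r + p"] yy_pos[of "r + p"] by simp
  have F1: "F (r + p) = 2 * ln (den (lm (ltr r)) (yy (r + p)))" by (simp add: F_def)
  have "2 * ln (den (ev (W r (Suc k))) ?y) = F (r + p) + (\<Sum>i\<in>{1..k}. F (r + p + int i * p))"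
    unfolding d F1 IH(1)[symmetric] using p1 IH(2) by (simp add: ln_mult)
  also have "(\<Sum>i\<in>{1..k}. F (r + p + int i * p)) = (\<Sum>i\<in>{Suc 1..Suc k}. F (r + int i * p))"
    unfolding sum.shift_bounds_cl_Suc_ivl by (intro sum.cong refl) (simp add: algebra_simps)
  also have "F (r + p) + \<dots> = (\<Sum>i\<in>{1..Suc k}. F (r + int i * p))"
    by (subst sum.atLeast_Suc_atMost[of 1 "Suc k"]) simp_all
  finally show ?case using d p1 IH(2) by simp
qed simp

lemma L0_sum: "L0 = (\<Sum>i\<in>{1..nat n}. F (- 1 + int i * p))"
proof -
  have "yy (- 1 + int (nat n) * p) = y0" unfolding y0_def
  proof (rule yy_mod)
    have "- 1 + int (nat n) * p = - 1 + p * n" using n0 by simp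
    then show "(- 1 + int (nat n) * p) mod n = (- 1) mod n" by (simp only: mod_mult_self1)
  qed
  then show ?thesis using den_W[of "- 1" "nat n"] by (simp add: L0_def lam_def A0_def M_def)
qed

lemma x0_range: "1 < - x0" "- x0 < 2"
proof -
  have "ltr 0 = Lb" using q0 by (simp add: ltr_Lb)
  then have b: "1/2 < yy 0" "yy 0 < 1" using yy_bounds(2)[of 0] by auto
  define w where "w = - x0"
  have w: "w > 0" "yy 0 = 1 / w" using xy0 by (simp_all add: w_def yy_0)
  have "1 < w" "w < 2" using b w(1) unfolding w(2) by (simp_all add: field_simps)
  then show "1 < - x0" "- x0 < 2" by (simp_all add: w_def)
qed

lemma D0_sum: "D0 = 2 * ln (- x0) + (\<Sum>i\<in>{1..jj}. F (- 1 + int i * p))"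
proof -
  have "yy (- 1 + int jj * p) = yy 0" by (rule yy_mod) (simp only: jj mod_0)
  then have "2 * ln dh = (\<Sum>i\<in>{1..jj}. F (- 1 + int i * p))" using den_W[of "- 1" jj] by (simp add: dh_def hh_def)
  moreover have "D0 = 2 * ln (- x0) + 2 * ln dh"
    unfolding D0_def using dh_pos x0_range by (subst ln_mult) auto
  ultimately show ?thesis by simp
qed

end

text \<open>Summation by parts, in the form of the inequality of Koksma: the error of a sum over evenly spaced points is at
  most the discrepancy \<open>e\<close> of the points times the variation of \<open>f\<close>.\<close>

lemma abel_bounds:
  fixes f e :: "nat \<Rightarrow> real"
  assumes "\<And>k. k < N \<Longrightarrow> f k \<le> f (Suc k)" "\<And>k. 0 \<le> e k" "\<And>k. e k \<le> K"
  shows "(\<Sum>k<Suc N. f k * (e (Suc k) - e k)) \<le> f N * e (Suc N) - f 0 * e 0"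
    "f N * e (Suc N) - f 0 * e 0 - K * (f N - f 0) \<le> (\<Sum>k<Suc N. f k * (e (Suc k) - e k))"
proof -
  have "(\<Sum>k<Suc N. f k * (e (Suc k) - e k)) \<le> f N * e (Suc N) - f 0 * e 0 \<and>
    f N * e (Suc N) - f 0 * e 0 - K * (f N - f 0) \<le> (\<Sum>k<Suc N. f k * (e (Suc k) - e k))"
    using assms(1)
  proof (induction N)
    case 0 show ?case by (simp add: algebra_simps)
  next
    case (Suc N)
    have IH: "(\<Sum>k<Suc N. f k * (e (Suc k) - e k)) \<le> f N * e (Suc N) - f 0 * e 0"
      "f N * e (Suc N) - f 0 * e 0 - K * (f N - f 0) \<le> (\<Sum>k<Suc N. f k * (e (Suc k) - e k))"
      using Suc by auto
    have d: "0 \<le> f (Suc N) - f N" using Suc.prems[of N] by simp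
    have "0 \<le> (f (Suc N) - f N) * e (Suc N)" using d assms(2) by (rule mult_nonneg_nonneg)
    moreover have "(f (Suc N) - f N) * e (Suc N) \<le> (f (Suc N) - f N) * K" using d assms(3) by (intro mult_left_mono)
    moreover have "(\<Sum>k<Suc (Suc N). f k * (e (Suc k) - e k)) = (\<Sum>k<Suc N. f k * (e (Suc k) - e k)) + f (Suc N) * (e (Suc (Suc N)) - e (Suc N))"
      by simp
    ultimately show ?case using IH by (simp add: algebra_simps del: sum.lessThan_Suc)
  qed
  then show "(\<Sum>k<Suc N. f k * (e (Suc k) - e k)) \<le> f N * e (Suc N) - f 0 * e 0"
    "f N * e (Suc N) - f 0 * e 0 - K * (f N - f 0) \<le> (\<Sum>k<Suc N. f k * (e (Suc k) - e k))" by auto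
qed

context rot begin

lemma sum_int_nat: "(\<Sum>r\<in>{0..<n}. g r) = (\<Sum>k<nat n. g (int k))" for g :: "int \<Rightarrow> real"
  by (rule sum.reindex_bij_witness[where i = int and j = nat]) auto

lemma F_\<rho>: "F (\<rho> i) = F (- 1 + i * p)" unfolding \<rho>_def by (rule F_mod) simp

lemma L0_ranks: "L0 = (\<Sum>r\<in>{0..<n}. F r)"
proof -
  define g where "g i = F (- 1 + int i * p)" for i :: nat
  have gn: "g (nat n) = g 0" unfolding g_def
  proof (rule F_mod)
    have "- 1 + int (nat n) * p = - 1 + int 0 * p + p * n" using n0 by simp
    then show "(- 1 + int (nat n) * p) mod n = (- 1 + int 0 * p) mod n" by (simp only: mod_mult_self1)
  qed
  have "L0 = (\<Sum>i<nat n. g (Suc i))" unfolding L0_sum g_def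
    by (rule sum.reindex_bij_witness[where i = Suc and j = "\<lambda>i. i - 1"]) auto
  also have "\<dots> = (\<Sum>i<nat n. g i)"
    using sum.lessThan_Suc_shift[of g "nat n"] sum.lessThan_Suc[of g "nat n"] gn by simp
  also have "\<dots> = (\<Sum>i\<in>{0..<n}. F (\<rho> i))" unfolding sum_int_nat F_\<rho> g_def ..
  also have "\<dots> = (\<Sum>r\<in>{0..<n}. F r)" by (rule sum.reindex_bij_betw[OF \<rho>_bij])
  finally show ?thesis .
qed

context
  assumes p1: "p > 0"
begin

lemma jj_bounds: "0 < jj" "int jj < n"
proof -
  have n2: "n \<ge> 2" using p1 q0 by (simp add: n_def)
  show "0 < jj"
  proof (rule ccontr)
    assume "\<not> 0 < jj"
    then have "(- 1) mod n = 0" using jj by simp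
    then have "n dvd - 1" by (rule mod_0_imp_dvd)
    then show False using n2 zdvd_imp_le[of n 1] by simp
  qed
  define k where "k = nat (int jj mod n)"
  have k: "int k = int jj mod n" using n0 by (simp add: k_def)
  have "(- 1 + int k * p) mod n = (- 1 + int jj * p) mod n"
    unfolding k by (metis mod_add_right_eq mod_mult_left_eq)
  then have "(- 1 + int k * p) mod n = 0" using jj by simp
  then have "jj \<le> k" unfolding jj_def by (rule Least_le)
  then show "int jj < n" using k n0 pos_mod_bound[of n "int jj"] by linarith
qed

lemma jj_unique: assumes "(j * p) mod n = 1 mod n" "0 < j" "j < n" shows "int jj = j"
proof -
  have "int jj mod n = (int jj * (j * p)) mod n" by (metis assms(1) mod_mult_right_eq mult.right_neutral)
  also have "int jj * (j * p) = j * (int jj * p)" by simp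
  also have "\<dots> mod n = j mod n" by (metis jj_inverse mod_mult_right_eq mult.right_neutral)
  finally show ?thesis using assms jj_bounds by simp
qed

definition ee :: "int \<Rightarrow> int" where "ee r = (- (int jj * r)) mod n"

text \<open>The ranks that are used up to the step \<open>jj\<close> are the multiples of \<open>n / jj\<close>, rounded down:
  the following is an increment of the ceiling of \<open>r * jj / n\<close>.\<close>

lemma ind_ee: "of_bool (1 \<le> \<iota> r \<and> \<iota> r \<le> int jj) * n = int jj + ee (r + 1) - ee r"
proof -
  have e: "0 \<le> ee r" "ee r < n" using n0 by (simp_all add: ee_def)
  have i: "\<iota> r = (int jj - ee r) mod n"
  proof -
    have "(int jj - ee r) mod n = (int jj - (- (int jj * r))) mod n" unfolding ee_def by (rule mod_diff_right_eq)
    then show ?thesis by (simp add: \<iota>_def algebra_simps)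
  qed
  have e1: "ee (r + 1) = (ee r - int jj) mod n"
  proof -
    have "(ee r - int jj) mod n = (- (int jj * r) - int jj) mod n" unfolding ee_def by (rule mod_diff_left_eq)
    moreover have "- (int jj * r) - int jj = - (int jj * (r + 1))" by (simp add: algebra_simps)
    ultimately show ?thesis by (simp only: ee_def)
  qed
  show ?thesis
  proof (cases "ee r < int jj")
    case True
    have 1: "\<iota> r = int jj - ee r" unfolding i using True e jj_bounds by (intro mod_pos_pos_trivial) auto
    have "(ee r - int jj) mod n = (ee r - int jj + n) mod n" by simp
    also have "\<dots> = ee r - int jj + n" using True e jj_bounds by (intro mod_pos_pos_trivial) auto
    finally show ?thesis using 1 e1 True e by simp
  next
    case False
    have 2: "ee (r + 1) = ee r - int jj" unfolding e1 using False e jj_bounds by (intro mod_pos_pos_trivial) auto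
    have "\<not> (1 \<le> \<iota> r \<and> \<iota> r \<le> int jj)"
    proof (cases "ee r = int jj")
      case True then show ?thesis unfolding i by simp
    next
      case ne: False
      have "(int jj - ee r) mod n = (int jj - ee r + n) mod n" by simp
      also have "\<dots> = int jj - ee r + n" using False ne e jj_bounds by (intro mod_pos_pos_trivial) auto
      finally show ?thesis using i e by simp
    qed
    then show ?thesis using 2 by simp
  qed
qed

definition S0 :: real where "S0 = (\<Sum>i\<in>{1..jj}. F (- 1 + int i * p))"

lemma S0_ranks: "S0 = (\<Sum>r\<in>{0..<n}. of_bool (1 \<le> \<iota> r \<and> \<iota> r \<le> int jj) * F r)"
proof -
  have "S0 = (\<Sum>i\<in>{1..int jj}. F (- 1 + i * p))" unfolding S0_def
    by (rule sum.reindex_bij_witness[where i = nat and j = int]) auto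
  also have "\<dots> = (\<Sum>i\<in>{0..<n}. of_bool (1 \<le> i \<and> i \<le> int jj) * F (- 1 + i * p))"
    by (rule sum.mono_neutral_cong_left) (use jj_bounds in auto)
  also have "\<dots> = (\<Sum>i\<in>{0..<n}. of_bool (1 \<le> \<iota> (\<rho> i) \<and> \<iota> (\<rho> i) \<le> int jj) * F (\<rho> i))"
    by (intro sum.cong refl) (simp only: \<iota>_\<rho> F_\<rho>)
  also have "\<dots> = (\<Sum>r\<in>{0..<n}. of_bool (1 \<le> \<iota> r \<and> \<iota> r \<le> int jj) * F r)" by (rule sum.reindex_bij_betw[OF \<rho>_bij])
  finally show ?thesis .
qed

lemma S0_bounds: "of_int n * S0 \<le> of_nat jj * L0" "of_nat jj * L0 - 4 * of_int n \<le> of_int n * S0"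
proof -
  define f e where "f k = F (int k)" and "e k = real_of_int (ee (int k))" for k :: nat
  obtain N where N: "nat n = Suc N" using n0 by (metis gr0_conv_Suc zero_less_nat_eq)
  have "of_int n * S0 = (\<Sum>r\<in>{0..<n}. F r * of_int (int jj + ee (r + 1) - ee r))"
    unfolding S0_ranks sum_distrib_left
    by (intro sum.cong refl) (simp only: ind_ee[symmetric], simp)
  also have "\<dots> = (\<Sum>k<nat n. f k * (of_nat jj + (e (Suc k) - e k)))"
    unfolding sum_int_nat f_def e_def by (intro sum.cong refl) (simp add: add.commute algebra_simps)
  also have "\<dots> = of_nat jj * L0 + (\<Sum>k<Suc N. f k * (e (Suc k) - e k))"
    unfolding distrib_left sum.distrib N L0_ranks sum_int_nat f_def by (simp only: sum_distrib_left mult.commute)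
  finally have S: "of_int n * S0 = of_nat jj * L0 + (\<Sum>k<Suc N. f k * (e (Suc k) - e k))" .
  have fm: "f k \<le> f (Suc k)" if "k < N" for k unfolding f_def using that N by (intro F_mono) linarith+
  have e0: "0 \<le> e k" "e k \<le> of_int n" for k using n0 by (simp_all add: e_def ee_def less_imp_le)
  have "int (Suc N) = n" using N n0 by simp
  then have ends: "e 0 = 0" "e (Suc N) = 0" by (simp_all only: e_def ee_def) simp_all
  note ab = abel_bounds[of N f e, OF fm e0]
  show "of_int n * S0 \<le> of_nat jj * L0" using ab(1) S ends by (simp del: sum.lessThan_Suc)
  have "f N - f 0 \<le> 4" using F_range(2)[of "int N"] F_range(1)[of "int 0"] by (simp add: f_def)
  then have "of_int n * (f N - f 0) \<le> of_int n * 4" using n0 by (intro mult_left_mono) auto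
  then show "of_nat jj * L0 - 4 * of_int n \<le> of_int n * S0" using ab(2) S ends by (simp del: sum.lessThan_Suc)
qed

lemma ln_x0: "0 < ln (- x0)" "ln (- x0) \<le> 1"
  using x0_range ln_le_minus_one[of "- x0"] by simp_all

lemma D0_S0: "D0 = 2 * ln (- x0) + S0" using D0_sum by (simp add: S0_def)

text \<open>The twist stays below the length since the last step, which arrives at the top rank, contributes more than
  the term \<open>2 ln (- x0)\<close>.\<close>

lemma D0_range: "0 < D0" "D0 < L0"
proof -
  have Fp: "F r > 0" for r using F_range(1)[of r] by simp
  have "S0 \<ge> 0" unfolding S0_def using Fp by (intro sum_nonneg) (simp add: less_imp_le)
  then show "0 < D0" using D0_S0 ln_x0 by simp
  have nn: "jj < nat n" using jj_bounds by simp
  have "(\<Sum>i\<in>insert (nat n) {1..jj}. F (- 1 + int i * p)) \<le> L0"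
    unfolding L0_sum using nn Fp by (intro sum_mono2) (auto simp: less_imp_le)
  then have 1: "F (- 1 + int (nat n) * p) + S0 \<le> L0" using nn by (simp add: S0_def)
  have "F (- 1 + int (nat n) * p) = F (n - 1)"
  proof (rule F_mod)
    have "- 1 + int (nat n) * p = (n - 1) + (p - 1) * n" using n0 by (simp add: algebra_simps)
    then show "(- 1 + int (nat n) * p) mod n = (n - 1) mod n" by (simp only: mod_mult_self1)
  qed
  also have "F (n - 1) = 2 * ln (yy (n - 1) + 2)" using F_cases[of "n - 1"] n0 q0 by (simp add: n_def)
  finally have 2: "F (- 1 + int (nat n) * p) = 2 * ln (yy (n - 1) + 2)" .
  have "ln (- x0) < ln (yy (n - 1) + 2)" using x0_range yy_range(1)[of "n - 1"] by simp
  then show "D0 < L0" using 1 2 D0_S0 by simp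
qed

lemma tw0_D0: "tw0 = D0"
proof -
  have "0 < D0 / L0" "D0 / L0 < 1" using D0_range by simp_all
  then have "\<lfloor>D0 / L0\<rfloor> = 0" by linarith
  then show ?thesis by (simp add: tw0_def)
qed

text \<open>The twist is, up to a bounded error, the part of the length that \<open>jj\<close> evenly distributed ranks
  of the \<open>n\<close> ranks contribute.\<close>

lemma twist_near: "\<bar>tw0 / L0 - of_nat jj / of_int n\<bar> \<le> 6 / of_int n"
proof -
  have np: "real_of_int n > 0" using n0 by simp
  have L: "L0 \<ge> 2/3 * of_int n"
  proof -
    have "(\<Sum>r\<in>{0..<n}. 2/3) \<le> L0" unfolding L0_ranks using F_range(1) by (intro sum_mono) simp
    then show ?thesis using n0 by simp
  qed
  then have Lp: "L0 > 0" using np by simp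
  have "of_int n * D0 = of_int n * (2 * ln (- x0)) + of_int n * S0" unfolding D0_S0 by (simp add: algebra_simps)
  moreover have "0 \<le> of_int n * (2 * ln (- x0))" "of_int n * (2 * ln (- x0)) \<le> of_int n * 2"
    using ln_x0 np by (simp_all add: mult_left_mono)
  ultimately have "\<bar>of_int n * D0 - of_nat jj * L0\<bar> \<le> 4 * of_int n" using S0_bounds by linarith
  moreover have "D0 / L0 - of_nat jj / of_int n = (of_int n * D0 - of_nat jj * L0) / (of_int n * L0)"
    using np Lp by (simp add: field_simps)
  ultimately have "\<bar>D0 / L0 - of_nat jj / of_int n\<bar> \<le> 4 * of_int n / (of_int n * L0)"
    using np Lp divide_right_mono[of "\<bar>of_int n * D0 - of_nat jj * L0\<bar>" "4 * of_int n" "of_int n * L0"]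
    by (simp only: abs_divide abs_of_pos[OF mult_pos_pos] less_imp_le[OF mult_pos_pos])
  also have "\<dots> = 4 / L0" using np by simp
  also have "\<dots> \<le> 4 / (2/3 * of_int n)" using L np by (intro divide_left_mono) auto
  also have "\<dots> = 6 / of_int n" by simp
  finally show ?thesis by (simp add: tw0_D0)
qed

end

end

section \<open>Density\<close>

lemma twist_range:
  assumes "0 \<le> r" "r \<le> 1" shows "0 \<le> relative_twist r \<and> relative_twist r \<le> 1"
proof -
  obtain p q where pq: "quotient_of r = (p, q)" by (cases "quotient_of r")
  have "q > 0" "coprime p q" using quotient_of_denom_pos[OF pq] quotient_of_coprime[OF pq] by auto
  moreover have "0 \<le> p"
  proof -
    have "r = of_int p / of_int q" using quotient_of_div[OF pq] .
    then show ?thesis using assms(1) \<open>q > 0\<close> by (simp add: zero_le_divide_iff)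
  qed
  ultimately interpret rot p q by unfold_locales auto
  have "relative_twist r = tw0 / L0" by (rule relative_twist_eq[OF pq])
  then show ?thesis using tw0_bounds L0_pos by (simp add: divide_le_eq)
qed

lemma twist_approx:
  assumes "0 < p" "0 < q" "j * p - s * (p + q) = 1" "0 < j" "j < p + q"
  shows "\<bar>relative_twist (Fract p q) - of_int j / of_int (p + q)\<bar> \<le> 6 / of_int (p + q)"
proof -
  have "(j - s) * p - s * q = 1" using assms(3) by (simp add: algebra_simps)
  then have cop: "coprime p q" by (metis coprime_iff_gcd_eq_1 dvd_diff dvd_mult gcd_dvd1 gcd_dvd2 gcd_ge_0_int is_unit_gcd dvd_refl)
  interpret rot p q by unfold_locales (use assms cop in auto)
  have "quotient_of (Fract p q) = (p, q)"
    using assms(2) cop by (simp add: quotient_of_Fract normalize_stable)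
  then have "relative_twist (Fract p q) = tw0 / L0" by (rule relative_twist_eq)
  moreover have "int jj = j"
  proof (rule jj_unique)
    have "j * p = 1 + s * n" using assms(3) by (simp add: n_def)
    then show "(j * p) mod n = 1 mod n" by (simp only: mod_mult_self1)
  qed (use assms in \<open>simp_all add: n_def\<close>)
  then have "real jj = of_int j" by (metis of_int_of_nat_eq)
  ultimately show ?thesis using twist_near[OF assms(1)] by (simp only: n_def)
qed

lemma linear_ratio: "c \<noteq> 0 \<Longrightarrow> (\<lambda>N. (a * real N + b) / (c * real N + d)) \<longlonglongrightarrow> a / c"
proof -
  assume c: "c \<noteq> 0"
  have i: "(\<lambda>N. 1 / real N) \<longlonglongrightarrow> 0" by (rule lim_1_over_n)
  have "(\<lambda>N. (a + b * (1 / real N)) / (c + d * (1 / real N))) \<longlonglongrightarrow> (a + b * 0) / (c + d * 0)"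
    by (intro tendsto_intros i) (use c in simp)
  then have l: "(\<lambda>N. (a + b * (1 / real N)) / (c + d * (1 / real N))) \<longlonglongrightarrow> a / c" by simp
  have "eventually (\<lambda>N. (a + b * (1 / real N)) / (c + d * (1 / real N)) = (a * real N + b) / (c * real N + d)) sequentially"
    using eventually_gt_at_top[of 0]
  proof eventually_elim
    case (elim N)
    have "(a + b * (1 / real N)) / (c + d * (1 / real N)) = ((a + b * (1 / real N)) * real N) / ((c + d * (1 / real N)) * real N)"
      using elim by simp
    also have "(a + b * (1 / real N)) * real N = a * real N + b" using elim by (simp add: distrib_right)
    also have "(c + d * (1 / real N)) * real N = c * real N + d" using elim by (simp add: distrib_right)
    finally show ?case .
  qed
  from Lim_transform_eventually[OF l this] show ?thesis .
qed

lemma eventually_linear_pos: "c > 0 \<Longrightarrow> eventually (\<lambda>N. 0 < c * int N + d) sequentially" for c d :: int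
proof -
  assume c: "c > 0"
  show ?thesis using eventually_gt_at_top[of "nat \<bar>d\<bar>"]
  proof eventually_elim
    case (elim N)
    have "1 * int N \<le> c * int N" using c by (intro mult_right_mono) auto
    then show ?case using elim by linarith
  qed
qed

definition twist_graph :: "(real \<times> real) set" where
  "twist_graph = {(of_rat r, relative_twist r) | r :: rat. 0 \<le> r \<and> r \<le> 1}"

text \<open>Take matrices of determinant 1, one with the first column \<open>(P, P + Q)\<close> and one with the last row
  \<open>(n2, j2)\<close>.  Their product with the translation by \<open>N\<close> in between is \<open>((p, s), (p + q, j))\<close> with entries
  linear in \<open>N\<close>, and the leading coefficients have the required quotients.\<close>

lemma rational_point_in_closure:
  fixes P Q j2 n2 :: int
  assumes 1: "0 < P" "P < Q" "coprime P Q" and 2: "0 < j2" "j2 < n2" "coprime j2 n2"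
  shows "(of_int P / of_int Q, of_int j2 / of_int n2) \<in> closure twist_graph"
proof -
  define n1 where "n1 = P + Q"
  have n1: "n1 > 0" and Q: "Q > 0" and n2: "n2 > 0" using 1 2 by (auto simp: n1_def)
  have "coprime P n1" using 1(3) unfolding n1_def coprime_iff_gcd_eq_1 gcd_add2 .
  then obtain v1 u where "v1 * P + u * n1 = 1" by (metis bezout_int coprime_imp_gcd_eq_1)
  then have b1: "P * v1 - (- u) * n1 = 1" by (simp add: algebra_simps)
  obtain a2 u' where "a2 * j2 + u' * n2 = 1" using 2(3) by (metis bezout_int coprime_imp_gcd_eq_1)
  then have b2: "a2 * j2 - (- u') * n2 = 1" by simp
  define u1 b2' where "u1 = - u" and "b2' = - u'"
  note b = b1[folded u1_def] b2[folded b2'_def]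
  define p where "p N = P * n2 * int N + (P * a2 + u1 * n2)" for N
  define q where "q N = Q * n2 * int N + (Q * a2 + (v1 - u1) * n2)" for N
  define j where "j N = n1 * j2 * int N + (n1 * b2' + v1 * j2)" for N
  define s where "s N = P * j2 * int N + (P * b2' + u1 * j2)" for N
  have pq: "p N + q N = n1 * n2 * int N + (n1 * a2 + v1 * n2)" for N by (simp add: p_def q_def n1_def algebra_simps)
  have det: "j N * p N - s N * (p N + q N) = 1" for N
  proof -
    have "j N * p N - s N * (p N + q N) = (P * v1 - u1 * n1) * (a2 * j2 - b2' * n2)"
      unfolding pq by (simp add: j_def p_def s_def algebra_simps)
    then show ?thesis by (simp only: b)
  qed
  have ev: "eventually (\<lambda>N. 0 < p N \<and> 0 < q N \<and> 0 < q N - p N \<and> 0 < j N \<and> 0 < p N + q N - j N) sequentially"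
  proof (intro eventually_conj)
    show "eventually (\<lambda>N. 0 < p N) sequentially" "eventually (\<lambda>N. 0 < q N) sequentially" "eventually (\<lambda>N. 0 < j N) sequentially"
      unfolding p_def q_def j_def using 1 2 Q n1 n2 by (intro eventually_linear_pos mult_pos_pos; simp)+
    have "q N - p N = (Q - P) * n2 * int N + ((Q - P) * a2 + (v1 - u1 - u1) * n2)" for N by (simp add: p_def q_def algebra_simps)
    then show "eventually (\<lambda>N. 0 < q N - p N) sequentially" using 1 n2 by (simp only:) (intro eventually_linear_pos mult_pos_pos; simp)
    have "p N + q N - j N = n1 * (n2 - j2) * int N + (n1 * (a2 - b2') + v1 * (n2 - j2))" for N
      unfolding pq by (simp add: j_def algebra_simps)
    then show "eventually (\<lambda>N. 0 < p N + q N - j N) sequentially" using n1 2 by (simp only:) (intro eventually_linear_pos mult_pos_pos; simp)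
  qed
  define r where "r N = Fract (p N) (q N)" for N
  have "(\<lambda>N. real_of_int (p N) / real_of_int (q N)) \<longlonglongrightarrow> real_of_int (P * n2) / real_of_int (Q * n2)"
    using linear_ratio[of "real_of_int (Q * n2)" "real_of_int (P * n2)" "real_of_int (P * a2 + u1 * n2)" "real_of_int (Q * a2 + (v1 - u1) * n2)"] Q n2
    by (simp add: p_def q_def)
  moreover have "real_of_int (P * n2) / real_of_int (Q * n2) = of_int P / of_int Q" using n2 by simp
  moreover have "eventually (\<lambda>N. real_of_int (p N) / real_of_int (q N) = of_rat (r N)) sequentially"
    using ev by eventually_elim (simp add: r_def of_rat_rat)
  ultimately have lx: "(\<lambda>N. of_rat (r N)) \<longlonglongrightarrow> real_of_int P / of_int Q" using Lim_transform_eventually by metis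
  have ln: "(\<lambda>N. 6 / real_of_int (p N + q N)) \<longlonglongrightarrow> 0"
    using linear_ratio[of "real_of_int (n1 * n2)" 0 6 "real_of_int (n1 * a2 + v1 * n2)"] n1 n2 by (simp add: pq)
  have lj: "(\<lambda>N. real_of_int (j N) / real_of_int (p N + q N)) \<longlonglongrightarrow> of_int j2 / of_int n2"
  proof -
    have "(\<lambda>N. real_of_int (j N) / real_of_int (p N + q N)) \<longlonglongrightarrow> real_of_int (n1 * j2) / real_of_int (n1 * n2)"
      using linear_ratio[of "real_of_int (n1 * n2)" "real_of_int (n1 * j2)" "real_of_int (n1 * b2' + v1 * j2)" "real_of_int (n1 * a2 + v1 * n2)"] n1 n2
      by (simp add: pq j_def)
    then show ?thesis using n1 by simp
  qed
  have "eventually (\<lambda>N. norm (relative_twist (r N) - of_int (j N) / of_int (p N + q N)) \<le> 6 / of_int (p N + q N)) sequentially"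
    using ev unfolding r_def by eventually_elim (simp only: real_norm_def, rule twist_approx[OF _ _ det], auto)
  from tendsto_add[OF Lim_null_comparison[OF this ln] lj]
  have ly: "(\<lambda>N. relative_twist (r N)) \<longlonglongrightarrow> of_int j2 / of_int n2" by simp
  have "eventually (\<lambda>N. (of_rat (r N), relative_twist (r N)) \<in> closure twist_graph) sequentially"
    using ev
  proof eventually_elim
    case (elim N)
    have "0 \<le> r N" "r N \<le> 1" using elim by (simp_all add: r_def zero_le_Fract_iff Fract_le_one_iff)
    then have "(of_rat (r N), relative_twist (r N)) \<in> twist_graph" unfolding twist_graph_def by blast
    then show ?case using closure_subset by blast
  qed
  from Lim_in_closed_set[OF closed_closure this trivial_limit_sequentially tendsto_Pair[OF lx ly]] show ?thesis .
qed

lemma closure_rationals: "{0..1} \<subseteq> closure ((of_rat :: rat \<Rightarrow> real) ` {0<..<1})"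
proof
  fix x :: real assume x: "x \<in> {0..1}"
  show "x \<in> closure ((of_rat :: rat \<Rightarrow> real) ` {0<..<1})"
    unfolding closure_approachable
  proof (intro allI impI)
    fix e :: real assume e: "e > 0"
    have "max 0 (x - e) < min 1 (x + e)" using x e by auto
    then obtain r where r: "max 0 (x - e) < of_rat r" "of_rat r < min 1 (x + e)" using of_rat_dense by blast
    then have "of_rat 0 < (of_rat r :: real)" "of_rat r < (of_rat 1 :: real)" by simp_all
    then have "r \<in> {0<..<1}" by (simp only: of_rat_less) simp
    moreover have "dist (of_rat r) x < e" using r by (simp add: dist_real_def abs_less_iff)
    ultimately show "\<exists>y\<in>of_rat ` {0<..<1}. dist y x < e" by blast
  qed
qed

theorem theorem1p1:
  shows "closure {(of_rat r :: real, relative_twist r) | r :: rat. 0 \<le> r \<and> r \<le> 1} = {0..1} \<times> {0..1}"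
proof
  have "twist_graph \<subseteq> {0..1} \<times> {0..1}" using twist_range by (auto simp: twist_graph_def)
  then have "closure twist_graph \<subseteq> {0..1} \<times> {0..1}" by (rule closure_minimal) (intro closed_Times closed_atLeastAtMost)
  then show "closure {(of_rat r :: real, relative_twist r) | r :: rat. 0 \<le> r \<and> r \<le> 1} \<subseteq> {0..1} \<times> {0..1}"
    unfolding twist_graph_def .
  let ?Q = "(of_rat :: rat \<Rightarrow> real) ` {0<..<1}"
  have "(of_rat r, of_rat t) \<in> closure twist_graph" if rt: "r \<in> {0<..<1}" "t \<in> {0<..<1}" for r t :: rat
  proof -
    have f: "\<exists>P Q. 0 < P \<and> P < Q \<and> coprime P Q \<and> (of_rat r :: real) = of_int P / of_int Q" if "r \<in> {0<..<1}" for r :: rat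
    proof -
      obtain P Q where pq: "quotient_of r = (P, Q)" by (cases "quotient_of r")
      have Q: "Q > 0" using quotient_of_denom_pos[OF pq] .
      have r: "r = of_int P / of_int Q" using quotient_of_div[OF pq] .
      have "0 < P" using that Q unfolding r by (simp add: zero_less_divide_iff)
      moreover have "P < Q" using that Q unfolding r by (simp add: divide_less_eq)
      moreover have "(of_rat r :: real) = of_int P / of_int Q" unfolding r by (simp add: of_rat_divide)
      ultimately show ?thesis using quotient_of_coprime[OF pq] by blast
    qed
    obtain P Q where 1: "0 < P" "P < Q" "coprime P Q" "(of_rat r :: real) = of_int P / of_int Q" using f[OF rt(1)] by blast
    obtain P' Q' where 2: "0 < P'" "P' < Q'" "coprime P' Q'" "(of_rat t :: real) = of_int P' / of_int Q'" using f[OF rt(2)] by blast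
    show ?thesis unfolding 1(4) 2(4) by (rule rational_point_in_closure[OF 1(1-3) 2(1-3)])
  qed
  then have "?Q \<times> ?Q \<subseteq> closure twist_graph" by auto
  then have "closure (?Q \<times> ?Q) \<subseteq> closure twist_graph" by (intro closure_minimal closed_closure)
  moreover have "{0..1} \<times> {0..1} \<subseteq> closure (?Q \<times> ?Q)" unfolding closure_Times by (intro Sigma_mono closure_rationals)
  ultimately show "{0..1} \<times> {0..1} \<subseteq> closure {(of_rat r :: real, relative_twist r) | r :: rat. 0 \<le> r \<and> r \<le> 1}"
    unfolding twist_graph_def[symmetric] by (rule subset_trans[rotated])
qed

end
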